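(* Let $\Gamma$ be a nontrivial finite subgroup of $\mathrm{SL}_2(\mathbb{C})$ and $n\geq 1$ an integer. The set $\mathcal{A}_{n,1,0}$ indexing the irreducible components of the $\Gamma$-fixed locus $\mathcal{H}_n^\Gamma$ of the Hilbert scheme of $n$ points in $\mathbb{C}^2$ and the set $\mathcal{A}_{n,0,1}$ indexing the irreducible components of the $\Gamma$-fixed locus of the $n$-th Calogero–Moser space are equal, and $$\mathcal{A}_{n,1,0}=\mathcal{A}_{n,0,1}=\{d\in\Delta_\Gamma^+ : |d|=n,\ \mathrm{wt}(d)\ge0\}.$$
   Context: **$\Gamma$-modules and root lattice.** $\mathrm{Irr}$ is the set of irreducible characters of $\Gamma$, $X_\chi$ an irreducible module with character $\chi$, $\chi_0$ the trivial character, $\chi_{\mathrm{std}}$ the character of the standard representation $\mathbb{C}^2$, $\delta_\chi=\dim X_\chi$. $\Delta_\Gamma=\bigoplus_{\chi\in\mathrm{Irr}}\mathbb{Z}\chi$ and $\Delta_\Gamma^+=\bigoplus_\chi\mathbb{Z}_{\ge0}\chi$; elements are written $d=(d_\chi)$. By the McKay correspondence $\Delta_\Gamma$ is identified with the root lattice $\mathcal{Q}$ of the affine Lie algebra attached to $\Gamma$ (with $\chi$ corresponding to the simple root $\alpha_\chi$, generalized Cartan matrix $a_{\chi,\xi}=2\langle\chi|\xi\rangle-\langle\chi\chi_{\mathrm{std}}|\xi\rangle$), $\Delta_\Gamma^+$ with the nonnegative integral combinations of simple roots, and $\delta=(\delta_\chi)$ with the null root. The size of $d$ is $|d|=\sum_\chi\delta_\chi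 d_\chi$. **Weight.** The affine Weyl group $W$, with generators $s_\chi$ ($\chi\in\mathrm{Irr}$), acts on $\Delta_\Gamma$ by $(s_\chi.d)_\xi=d_\xi$ for $\xi\ne\chi$ and $(s_\chi.d)_\chi=\sum_{\xi}\langle\chi\chi_{\mathrm{std}}|\xi\rangle d_\xi-d_\chi+\epsilon_\chi$, where $\epsilon_{\chi_0}=1$ and $\epsilon_\chi=0$ for $\chi\neq\chi_0$. For $d\in\Delta_\Gamma$, $\mathrm{wt}(d)$ is the unique integer $r$ such that $r\delta$ and $d$ lie in the same $W$-orbit for this action (existence and uniqueness hold). **Jordan quiver variety.** $\mathrm{GL}_n(\mathbb{C})$ acts on $M_n(\mathbb{C})^2\oplus\mathbb{C}^n\oplus\mathrm{Hom}(\mathbb{C}^n,\mathbb{C})$ by $g.(\alpha,\beta,v^1,v^2)=(g\alpha g^{-1},g\beta g^{-1},gv^1,v^2g^{-1})$; $\mu_\bullet(\alpha,\beta,v^1,v^2)=[\alpha,\beta]+v^1v^2$. For $(\theta,\lambda)\in\mathbb{Q}\times\mathbb{C}$, $\mu_\bullet^{-1}(\lambda)^{\theta\text{-}ss}$ is the locus in $\mu_\bullet^{-1}(\lambda\,\mathrm{id})$ of points semistable for the character $\det^\theta$ (all points if $\theta=0$; for $\theta=1$, those points at which some semi-invariant $f$ with $f(g.y)=\det(g)^mf(y)$, $m\ge1$, does not vanish), and $\mathcal{M}^{\bullet,\lambda}_\theta(n)$ is its quotient by $\mathrm{GL}_n(\mathbb{C})$. $\Gamma\subset\mathrm{GL}_2(\mathbb{C})$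 acts by $\begin{pmatrix}a&b\\c&d\end{pmatrix}.(\alpha,\beta,v^1,v^2)=(a\alpha+b\beta,c\alpha+d\beta,v^1,v^2)$. **Index sets.** For $d\in\Delta_\Gamma^+$ with $|d|=n$, let $\mathcal{C}_d$ be the set of group morphisms $\sigma:\Gamma\to\mathrm{GL}_n(\mathbb{C})$ with character $\sum_\chi d_\chi\chi$. Then $\mathcal{A}_{n,\theta,\lambda}$ is the set of $d\in\Delta_\Gamma^+$ with $|d|=n$ for which there exist $\sigma\in\mathcal{C}_d$ and $(\alpha,\beta,v^1,v^2)\in\mu_\bullet^{-1}(\lambda)^{\theta\text{-}ss}$ with $\gamma.(\alpha,\beta,v^1,v^2)=\sigma(\gamma^{-1}).(\alpha,\beta,v^1,v^2)$ for all $\gamma\in\Gamma$; the images in $\mathcal{M}^{\bullet,\lambda}_\theta(n)$ of all such points, for fixed $d$, form $\mathcal{M}_d$, and for $(\theta,\lambda)\ne(0,0)$ the $\mathcal{M}_d$, $d\in\mathcal{A}_{n,\theta,\lambda}$, are the irreducible components of $\mathcal{M}^{\bullet,\lambda}_\theta(n)^\Gamma$. **Hilbert scheme and Calogero–Moser space.** $\mathcal{H}_n=\{I\subset\mathbb{C}[x,y]\text{ ideal}:\dim\mathbb{C}[x,y]/I=n\}$ is $\mathrm{GL}_2(\mathbb{C})$-equivariantly isomorphic to $\mathcal{M}^{\bullet,0}_1(n)$, with $\mathcal{M}_d$ corresponding to $\{I\in\mathcal{H}_n^\Gamma:\mathbb{C}[x,y]/I\text{ has character }\sum_\chi d_\chi\chi\}$.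 The Calogero–Moser space $\{(X,Y)\in M_n(\mathbb{C})^2: XY-YX+I_n\text{ has rank }1\}/\!/\mathrm{GL}_n(\mathbb{C})$, with $\mathrm{GL}_2(\mathbb{C})$ acting by $g.(X,Y)=(aX+bY,cX+dY)$, is $\mathrm{GL}_2(\mathbb{C})$-equivariantly isomorphic to $\mathcal{M}^{\bullet,1}_0(n)$ (forgetting $v^1,v^2$). Via these isomorphisms the irreducible components of the two $\Gamma$-fixed loci are indexed by $\mathcal{A}_{n,1,0}$ and $\mathcal{A}_{n,0,1}$ respectively. *)

theory Defs
  imports
    "HOL-Algebra.Bij"
    "HOL-Algebra.Generated_Groups"
    "Jordan_Normal_Form.Determinant"
    "Jordan_Normal_Form.VS_Connect"
begin

section \<open>Matrix groups\<close>

definition GL :: "nat \<Rightarrow> complex mat monoid" where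
  "GL n = units_of (ring_mat TYPE(complex) n ())"

definition SL :: "nat \<Rightarrow> complex mat monoid" where
  "SL n = (GL n)\<lparr>carrier := {A \<in> carrier (GL n). det A = 1}\<rparr>"

definition mat_trace :: "complex mat \<Rightarrow> complex" where
  "mat_trace A = (\<Sum>i<dim_row A. A $$ (i, i))"


section \<open>Representations and characters of a subgroup of the plane linear group\<close>

text \<open>Throughout, \<open>\<Gamma>\<close> is the underlying set of a subgroup of \<open>GL 2\<close>. Characters are
  functions on \<open>\<Gamma>\<close>, made extensional so that equal characters are equal as HOL functions.\<close>

definition reps :: "complex mat set \<Rightarrow> nat \<Rightarrow> (complex mat \<Rightarrow> complex mat) set" where
  "reps \<Gamma> k = hom ((GL 2)\<lparr>carrier := \<Gamma>\<rparr>) (GL k)"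

definition irreducible_rep :: "complex mat set \<Rightarrow> nat \<Rightarrow> (complex mat \<Rightarrow> complex mat) \<Rightarrow> bool" where
  "irreducible_rep \<Gamma> k \<rho> \<longleftrightarrow>
     \<rho> \<in> reps \<Gamma> k \<and> k > 0 \<and>
     (\<forall>W. subspace class_ring W (module_vec TYPE(complex) k) \<and>
          (\<forall>g\<in>\<Gamma>. \<forall>v\<in>W. \<rho> g *\<^sub>v v \<in> W) \<longrightarrow>
          W = {0\<^sub>v k} \<or> W = carrier_vec k)"

definition character :: "complex mat set \<Rightarrow> (complex mat \<Rightarrow> complex mat) \<Rightarrow> complex mat \<Rightarrow> complex" where
  "character \<Gamma> \<rho> = (\<lambda>g\<in>\<Gamma>. mat_trace (\<rho> g))"

definition Irr :: "complex mat set \<Rightarrow> (complex mat \<Rightarrow> complex) set" where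
  "Irr \<Gamma> = {character \<Gamma> \<rho> | k \<rho>. irreducible_rep \<Gamma> k \<rho>}"

definition triv_char :: "complex mat set \<Rightarrow> complex mat \<Rightarrow> complex" where
  "triv_char \<Gamma> = (\<lambda>g\<in>\<Gamma>. 1)"

definition std_char :: "complex mat set \<Rightarrow> complex mat \<Rightarrow> complex" where
  "std_char \<Gamma> = character \<Gamma> (\<lambda>g. g)"

definition char_inner ::
  "complex mat set \<Rightarrow> (complex mat \<Rightarrow> complex) \<Rightarrow> (complex mat \<Rightarrow> complex) \<Rightarrow> complex" where
  "char_inner \<Gamma> \<phi> \<psi> = (\<Sum>g\<in>\<Gamma>. \<phi> g * cnj (\<psi> g)) / of_nat (card \<Gamma>)"

definition char_degree :: "complex mat set \<Rightarrow> (complex mat \<Rightarrow> complex) \<Rightarrow> nat" where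
  "char_degree \<Gamma> \<chi> = (THE k. \<exists>\<rho>. irreducible_rep \<Gamma> k \<rho> \<and> character \<Gamma> \<rho> = \<chi>)"

text \<open>The inner product of \<open>\<chi> \<chi>\<^sub>s\<^sub>t\<^sub>d\<close> with \<open>\<xi>\<close> is a complex number
  that happens to be an integer; the following is that integer.\<close>

definition mckay_mult ::
  "complex mat set \<Rightarrow> (complex mat \<Rightarrow> complex) \<Rightarrow> (complex mat \<Rightarrow> complex) \<Rightarrow> int" where
  "mckay_mult \<Gamma> \<chi> \<xi> =
     (THE m. of_int m = char_inner \<Gamma> (\<lambda>g\<in>\<Gamma>. \<chi> g * std_char \<Gamma> g) \<xi>)"


section \<open>The root lattice, the affine Weyl group and the weight\<close>

type_synonym lattice_elt = "(complex mat \<Rightarrow> complex) \<Rightarrow> int"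

definition root_lattice :: "complex mat set \<Rightarrow> lattice_elt set" where
  "root_lattice \<Gamma> = Irr \<Gamma> \<rightarrow>\<^sub>E UNIV"

definition root_lattice_pos :: "complex mat set \<Rightarrow> lattice_elt set" where
  "root_lattice_pos \<Gamma> = Irr \<Gamma> \<rightarrow>\<^sub>E {0..}"

definition lattice_size :: "complex mat set \<Rightarrow> lattice_elt \<Rightarrow> int" where
  "lattice_size \<Gamma> d = (\<Sum>\<chi>\<in>Irr \<Gamma>. int (char_degree \<Gamma> \<chi>) * d \<chi>)"

definition simple_reflection ::
  "complex mat set \<Rightarrow> (complex mat \<Rightarrow> complex) \<Rightarrow> lattice_elt \<Rightarrow> lattice_elt" where
  "simple_reflection \<Gamma> \<chi> = (\<lambda>d\<in>root_lattice \<Gamma>.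
     d(\<chi> := (\<Sum>\<xi>\<in>Irr \<Gamma>. mckay_mult \<Gamma> \<chi> \<xi> * d \<xi>) - d \<chi> + (if \<chi> = triv_char \<Gamma> then 1 else 0)))"

text \<open>The affine Weyl group is realised through its (affine, not linear) action on the root
  lattice, i.e. as the permutation group generated by the \<open>s\<^sub>\<chi>\<close>.\<close>

definition affine_weyl_group :: "complex mat set \<Rightarrow> (lattice_elt \<Rightarrow> lattice_elt) set" where
  "affine_weyl_group \<Gamma> = generate (BijGroup (root_lattice \<Gamma>)) (simple_reflection \<Gamma> ` Irr \<Gamma>)"

definition weyl_orbit :: "complex mat set \<Rightarrow> lattice_elt \<Rightarrow> lattice_elt set" where
  "weyl_orbit \<Gamma> d = (\<lambda>w. w d) ` affine_weyl_group \<Gamma>"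

definition null_root_multiple :: "complex mat set \<Rightarrow> int \<Rightarrow> lattice_elt" where
  "null_root_multiple \<Gamma> r = (\<lambda>\<chi>\<in>Irr \<Gamma>. r * int (char_degree \<Gamma> \<chi>))"

definition wt :: "complex mat set \<Rightarrow> lattice_elt \<Rightarrow> int" where
  "wt \<Gamma> d = (THE r. d \<in> weyl_orbit \<Gamma> (null_root_multiple \<Gamma> r))"


section \<open>Representations of the framed Jordan quiver\<close>

text \<open>A point is \<open>(\<alpha>, \<beta>, v\<^sup>1, v\<^sup>2)\<close>, with \<open>v\<^sup>1\<close> a column
  and \<open>v\<^sup>2\<close> a row, both as matrices.\<close>

type_synonym jordan_point = "complex mat \<times> complex mat \<times> complex mat \<times> complex mat"

definition jordan_space :: "nat \<Rightarrow> jordan_point set" where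
  "jordan_space n =
     carrier_mat n n \<times> carrier_mat n n \<times> carrier_mat n 1 \<times> carrier_mat 1 n"

fun moment_map :: "jordan_point \<Rightarrow> complex mat" where
  "moment_map (\<alpha>, \<beta>, v1, v2) = (\<alpha> * \<beta> - \<beta> * \<alpha>) + v1 * v2"

fun gl_act :: "nat \<Rightarrow> complex mat \<Rightarrow> jordan_point \<Rightarrow> jordan_point" where
  "gl_act n g (\<alpha>, \<beta>, v1, v2) =
     (g * \<alpha> * inv\<^bsub>GL n\<^esub> g, g * \<beta> * inv\<^bsub>GL n\<^esub> g, g * v1, v2 * inv\<^bsub>GL n\<^esub> g)"

fun plane_act :: "complex mat \<Rightarrow> jordan_point \<Rightarrow> jordan_point" where
  "plane_act g (\<alpha>, \<beta>, v1, v2) =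
     (g $$ (0, 0) \<cdot>\<^sub>m \<alpha> + g $$ (0, 1) \<cdot>\<^sub>m \<beta>,
      g $$ (1, 0) \<cdot>\<^sub>m \<alpha> + g $$ (1, 1) \<cdot>\<^sub>m \<beta>, v1, v2)"

inductive_set poly_functions :: "nat \<Rightarrow> (jordan_point \<Rightarrow> complex) set" for n :: nat where
  const: "(\<lambda>_. c) \<in> poly_functions n"
| coord_alpha: "\<lbrakk>i < n; j < n\<rbrakk> \<Longrightarrow> (\<lambda>(\<alpha>, \<beta>, v1, v2). \<alpha> $$ (i, j)) \<in> poly_functions n"
| coord_beta: "\<lbrakk>i < n; j < n\<rbrakk> \<Longrightarrow> (\<lambda>(\<alpha>, \<beta>, v1, v2). \<beta> $$ (i, j)) \<in> poly_functions n"
| coord_v1: "i < n \<Longrightarrow> (\<lambda>(\<alpha>, \<beta>, v1, v2). v1 $$ (i, 0)) \<in> poly_functions n"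
| coord_v2: "j < n \<Longrightarrow> (\<lambda>(\<alpha>, \<beta>, v1, v2). v2 $$ (0, j)) \<in> poly_functions n"
| add: "\<lbrakk>f \<in> poly_functions n; h \<in> poly_functions n\<rbrakk> \<Longrightarrow> (\<lambda>x. f x + h x) \<in> poly_functions n"
| mult: "\<lbrakk>f \<in> poly_functions n; h \<in> poly_functions n\<rbrakk> \<Longrightarrow> (\<lambda>x. f x * h x) \<in> poly_functions n"

definition semi_invariant :: "nat \<Rightarrow> int \<Rightarrow> (jordan_point \<Rightarrow> complex) \<Rightarrow> bool" where
  "semi_invariant n k f \<longleftrightarrow>
     f \<in> poly_functions n \<and>
     (\<forall>g\<in>carrier (GL n). \<forall>y\<in>jordan_space n. f (gl_act n g y) = (det g powi k) * f y)"

text \<open>Semi-invariants are taken on the whole vector space; since the general linear group is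
  linearly reductive, those on a fibre of the moment map are exactly the restrictions of these.
  For rational \<open>\<theta>\<close>, only those multiples \<open>m\<theta>\<close> that are integers give
  a character of the group. For \<open>\<theta> = 0\<close> the constants are semi-invariants, so that every point
  is semistable.\<close>

definition semistable :: "nat \<Rightarrow> rat \<Rightarrow> jordan_point \<Rightarrow> bool" where
  "semistable n \<theta> x \<longleftrightarrow>
     (\<exists>m k f. m \<ge> (1::nat) \<and> of_int k = of_nat m * \<theta> \<and> semi_invariant n k f \<and> f x \<noteq> 0)"

definition semistable_fibre :: "nat \<Rightarrow> rat \<Rightarrow> complex \<Rightarrow> jordan_point set" where
  "semistable_fibre n \<theta> lam =
     {x \<in> jordan_space n. moment_map x = lam \<cdot>\<^sub>m 1\<^sub>m n \<and> semistable n \<theta> x}"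


section \<open>The index sets\<close>

definition reps_of_type :: "complex mat set \<Rightarrow> nat \<Rightarrow> lattice_elt \<Rightarrow> (complex mat \<Rightarrow> complex mat) set" where
  "reps_of_type \<Gamma> n d =
     {\<sigma> \<in> reps \<Gamma> n. \<forall>g\<in>\<Gamma>. character \<Gamma> \<sigma> g = (\<Sum>\<chi>\<in>Irr \<Gamma>. of_int (d \<chi>) * \<chi> g)}"

definition index_set :: "complex mat set \<Rightarrow> nat \<Rightarrow> rat \<Rightarrow> complex \<Rightarrow> lattice_elt set" where
  "index_set \<Gamma> n \<theta> lam =
     {d \<in> root_lattice_pos \<Gamma>. lattice_size \<Gamma> d = int n \<and>
        (\<exists>\<sigma>\<in>reps_of_type \<Gamma> n d. \<exists>x\<in>semistable_fibre n \<theta> lam.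
           \<forall>g\<in>\<Gamma>. plane_act g x = gl_act n (\<sigma> (inv\<^bsub>GL 2\<^esub> g)) x)}"

end

theory Submission
  imports Defs "HOL-Library.Nat_Bijection" "Jordan_Normal_Form.Spectral_Radius" "HOL-Algebra.Multiplicative_Group"
begin

text \<open>
  For a parameter \<open>l\<close> on the irreducible characters, consider the equivariant solutions of
  \<open>\<alpha> \<beta> - \<beta> \<alpha> + v w = l\<close>, that is, representations of the deformed preprojective algebra of the framed
  McKay quiver. Reflection functors at a vertex \<open>\<chi>\<close> with \<open>l \<chi> \<noteq> 0\<close> exchange the solutions of type \<open>d\<close>
  for \<open>l\<close> with those of type \<open>s\<^sub>\<chi> d\<close> for the reflected parameter. The parameter of the identity lies on
  no root hyperplane, so these functors can be composed along a path in the Weyl group orbit from \<open>d\<close> to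
  the multiple \<open>r \<delta>\<close> with \<open>r = wt d\<close>. For \<open>r < 0\<close> nothing has type \<open>r \<delta>\<close>; for \<open>r \<ge> 0\<close> a union of
  \<open>r\<close> free orbits in the plane can be deformed to any parameter. This settles the Calogero-Moser side.

  At a stable point with moment map value 0 the differential of the moment map is onto, and the moment map
  is homogeneous of degree 2, so the value 1 is attained by a point of the same type. Conversely, filter a
  solution with value 1 by the length of words in \<open>\<alpha>\<close> and \<open>\<beta>\<close> applied to \<open>v\<close>. The filtration is exhaustive by a
  trace argument, and on the associated graded space \<open>\<alpha>\<close> and \<open>\<beta>\<close> commute and \<open>v\<close> is cyclic, which is a stable point
  with value 0 for the same representation of the group.
\<close>

section \<open>Finitely supported matrices\<close>

text \<open>The reflection at \<chi> rebuilds the \<chi>-part from its neighbours, so the McKay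
  graph must have no loops. A simple loop is excluded by the invariant symplectic form of the plane,
  a multiple one by degrees and orthogonality; the trivial group has a double loop. The pairing of
  the identity parameter with a root is the size of the root. It is nonzero because the form is even
  and semidefinite with nonpositive off-diagonal entries, so a vector of norm 2 has coordinates of
  one sign. Semidefiniteness comes from characters: the Cartan matrix is multiplication by 2 minus
  the standard character, which is positive off the unit. That the weight is defined needs two
  arguments. The norm of the level-one weight Lambda_0 - d is invariant and tells the multiples of
  \<delta> apart. At fixed norm the size is bounded below, and an element of least size in an orbit
  is dominant of level one; its only alternative to r\<delta> would come from a nontrivial linear
  character, which a determinant computation excludes.\<close>

text \<open>Matrices of all finite sizes live in one non-unital ring, so that representations, intertwiners
  and blocks need no dimension bookkeeping; the identities of the various sizes are idempotents.\<close>

definition fbounded :: "(nat \<Rightarrow> nat \<Rightarrow> complex) \<Rightarrow> nat \<Rightarrow> bool" where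
  "fbounded f N \<longleftrightarrow> (\<forall>i j. i \<ge> N \<or> j \<ge> N \<longrightarrow> f i j = 0)"

typedef fmat = "{f. \<exists>N. fbounded f N}" morphisms ent Abs_fmat
  by (rule exI[of _ "\<lambda>i j. 0"]) (auto simp: fbounded_def)

setup_lifting type_definition_fmat

definition bd :: "fmat \<Rightarrow> nat \<Rightarrow> bool" where "bd a N \<longleftrightarrow> fbounded (ent a) N"

lemma bd_ex: "\<exists>N. bd a N"
  using ent[of a] by (auto simp: bd_def)

lemma bd_mono: "bd a N \<Longrightarrow> N \<le> M \<Longrightarrow> bd a M"
  by (auto simp: bd_def fbounded_def)

lemma bdD: "bd a N \<Longrightarrow> i \<ge> N \<or> j \<ge> N \<Longrightarrow> ent a i j = 0"
  by (auto simp: bd_def fbounded_def)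

lemma bdI: "(\<And>i j. i \<ge> N \<or> j \<ge> N \<Longrightarrow> ent a i j = 0) \<Longrightarrow> bd a N"
  by (auto simp: bd_def fbounded_def)

lemma bd_ex2: "\<exists>N. bd a N \<and> bd b N"
proof -
  obtain N M where "bd a N" "bd b M" using bd_ex by blast
  then show ?thesis by (intro exI[of _ "max N M"]) (auto intro: bd_mono)
qed

lemma fmat_eqI: "(\<And>i j. ent a i j = ent b i j) \<Longrightarrow> a = b"
  by (metis ent_inject ext)

lemma ent_Abs: "fbounded f N \<Longrightarrow> ent (Abs_fmat f) = f"
  by (rule Abs_fmat_inverse) auto

text \<open>Summing over the support of row i needs no bound, so the product is a plain function of
  \<open>f\<close> and \<open>g\<close>; \<open>fmul_bounded\<close> then allows any bound of
  \<open>f\<close>.\<close>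

definition fmul :: "(nat \<Rightarrow> nat \<Rightarrow> complex) \<Rightarrow> (nat \<Rightarrow> nat \<Rightarrow> complex) \<Rightarrow> nat \<Rightarrow> nat \<Rightarrow> complex" where
  "fmul f g i k = (\<Sum>j\<in>{j. f i j \<noteq> 0}. f i j * g j k)"

lemma fmul_bounded: "fbounded f N \<Longrightarrow> fmul f g i k = (\<Sum>j<N. f i j * g j k)"
  unfolding fmul_def fbounded_def
  by (rule sum.mono_neutral_left) (auto, metis not_le)

lemma fbounded_mono: "fbounded f N \<Longrightarrow> N \<le> M \<Longrightarrow> fbounded f M"
  by (auto simp: fbounded_def)

instantiation fmat :: ring
begin

lift_definition zero_fmat :: fmat is "\<lambda>i j. 0" by (auto simp: fbounded_def)
lift_definition plus_fmat :: "fmat \<Rightarrow> fmat \<Rightarrow> fmat" is "\<lambda>f g i j. f i j + g i j"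
proof -
  fix f g assume "\<exists>N. fbounded f N" "\<exists>N. fbounded g N"
  then obtain N M where "fbounded f N" "fbounded g M" by auto
  then show "\<exists>N. fbounded (\<lambda>i j. f i j + g i j) N"
    by (intro exI[of _ "max N M"]) (auto simp: fbounded_def)
qed
lift_definition minus_fmat :: "fmat \<Rightarrow> fmat \<Rightarrow> fmat" is "\<lambda>f g i j. f i j - g i j"
proof -
  fix f g assume "\<exists>N. fbounded f N" "\<exists>N. fbounded g N"
  then obtain N M where "fbounded f N" "fbounded g M" by auto
  then show "\<exists>N. fbounded (\<lambda>i j. f i j - g i j) N"
    by (intro exI[of _ "max N M"]) (auto simp: fbounded_def)
qed
lift_definition uminus_fmat :: "fmat \<Rightarrow> fmat" is "\<lambda>f i j. - f i j"
  by (auto simp: fbounded_def)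
lift_definition times_fmat :: "fmat \<Rightarrow> fmat \<Rightarrow> fmat" is fmul
proof -
  fix f g assume "\<exists>N. fbounded f N" "\<exists>N. fbounded g N"
  then obtain N M where N: "fbounded f N" "fbounded g M" by auto
  have "fbounded (fmul f g) (max N M)"
    unfolding fmul_bounded[OF N(1), abs_def] using N by (auto simp: fbounded_def)
  then show "\<exists>N. fbounded (fmul f g) N" by blast
qed

instance
proof
  fix a b c :: fmat
  show "a * b * c = a * (b * c)"
  proof (transfer)
    fix f g h assume "\<exists>N. fbounded f N" "\<exists>N. fbounded g N" "\<exists>N. fbounded h N"
    then obtain A B where AB: "fbounded f A" "fbounded g B" by auto
    define M where "M = max A B"
    have f: "fbounded f M" and g: "fbounded g M"
      using AB fbounded_mono[of f A M] fbounded_mono[of g B M] by (auto simp: M_def)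
    have fg: "fbounded (fmul f g) M"
      unfolding fmul_bounded[OF f, abs_def] using f g by (auto simp: fbounded_def)
    have "fmul (fmul f g) h i k = fmul f (fmul g h) i k" for i k
    proof -
      have "fmul (fmul f g) h i k = (\<Sum>j<M. (\<Sum>l<M. f i l * g l j) * h j k)"
        unfolding fmul_bounded[OF fg] fmul_bounded[OF f] ..
      also have "\<dots> = (\<Sum>j<M. \<Sum>l<M. f i l * g l j * h j k)" by (simp add: sum_distrib_right)
      also have "\<dots> = (\<Sum>l<M. \<Sum>j<M. f i l * g l j * h j k)" by (rule sum.swap)
      also have "\<dots> = (\<Sum>l<M. f i l * (\<Sum>j<M. g l j * h j k))"
        by (simp add: sum_distrib_left mult.assoc)
      also have "\<dots> = fmul f (fmul g h) i k"
        unfolding fmul_bounded[OF g] fmul_bounded[OF f] ..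
      finally show ?thesis .
    qed
    then show "fmul (fmul f g) h = fmul f (fmul g h)" by (intro ext)
  qed
  show "a + b + c = a + (b + c)" by transfer (simp add: add.assoc)
  show "a + b = b + a" by transfer (simp add: add.commute)
  show "0 + a = a" by transfer simp
  show "- a + a = 0" by transfer simp
  show "a - b = a + - b" by transfer simp
  show "(a + b) * c = a * c + b * c"
  proof transfer
    fix f g h assume "\<exists>N. fbounded f N" "\<exists>N. fbounded g N" "\<exists>N. fbounded h N"
    then obtain A B where AB: "fbounded f A" "fbounded g B" by auto
    define M where "M = max A B"
    have f: "fbounded f M" and g: "fbounded g M"
      using AB fbounded_mono[of f A M] fbounded_mono[of g B M] by (auto simp: M_def)
    have fg: "fbounded (\<lambda>i j. f i j + g i j) M" using f g by (auto simp: fbounded_def)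
    show "fmul (\<lambda>i j. f i j + g i j) h = (\<lambda>i j. fmul f h i j + fmul g h i j)"
      by (intro ext) (simp only: fmul_bounded[OF f] fmul_bounded[OF g] fmul_bounded[OF fg] distrib_right sum.distrib)
  qed
  show "a * (b + c) = a * b + a * c"
    by transfer (intro ext, simp add: fmul_def distrib_left sum.distrib)
qed

end

lemma ent_zero[simp]: "ent 0 i j = 0" by transfer simp
lemma ent_add[simp]: "ent (a + b) i j = ent a i j + ent b i j" by transfer simp
lemma ent_diff[simp]: "ent (a - b) i j = ent a i j - ent b i j" by transfer simp
lemma ent_uminus[simp]: "ent (- a) i j = - ent a i j" by transfer simp
lemma ent_mult: "bd a N \<Longrightarrow> ent (a * b) i k = (\<Sum>j<N. ent a i j * ent b j k)"
  unfolding bd_def times_fmat.rep_eq by (rule fmul_bounded)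
lemma ent_mult': assumes "bd b N" shows "ent (a * b) i k = (\<Sum>j<N. ent a i j * ent b j k)"
proof -
  obtain M where M: "bd a M" using bd_ex by blast
  define K where "K = max M N"
  have K: "bd a K" using bd_mono[OF M] K_def by simp
  have "ent (a * b) i k = (\<Sum>j<K. ent a i j * ent b j k)" by (rule ent_mult[OF K])
  also have "\<dots> = (\<Sum>j<N. ent a i j * ent b j k)"
    by (rule sum.mono_neutral_right) (auto simp: K_def bdD[OF assms])
  finally show ?thesis .
qed

lemma ent_sum[simp]: "ent (sum f S) i j = (\<Sum>x\<in>S. ent (f x) i j)"
  by (induction S rule: infinite_finite_induct) auto

lemma bd_add: "bd a N \<Longrightarrow> bd b N \<Longrightarrow> bd (a + b) N" by (auto simp: bd_def fbounded_def)
lemma bd_diff: "bd a N \<Longrightarrow> bd b N \<Longrightarrow> bd (a - b) N" by (auto simp: bd_def fbounded_def)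
lemma bd_mult: "bd a N \<Longrightarrow> bd b N \<Longrightarrow> bd (a * b) N"
  by (auto simp: bd_def fbounded_def ent_mult[unfolded bd_def])

lift_definition sc :: "complex \<Rightarrow> fmat \<Rightarrow> fmat" (infixr "\<star>" 75) is "\<lambda>c f i j. c * f i j"
  unfolding fbounded_def by fastforce

lemma ent_sc[simp]: "ent (c \<star> a) i j = c * ent a i j" by transfer simp
lemma sc_add: "c \<star> (a + b) = c \<star> a + c \<star> b" by (rule fmat_eqI) (simp add: algebra_simps)
lemma sc_diff: "c \<star> (a - b) = c \<star> a - c \<star> b" by (rule fmat_eqI) (simp add: algebra_simps)
lemma sc_add_left: "(c + d) \<star> a = c \<star> a + d \<star> a" by (rule fmat_eqI) (simp add: algebra_simps)
lemma sc_diff_left: "(c - d) \<star> a = c \<star> a - d \<star> a" by (rule fmat_eqI) (simp add: algebra_simps)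
lemma sc_sc[simp]: "c \<star> d \<star> a = (c * d) \<star> a" by (rule fmat_eqI) simp
lemma sc_zero[simp]: "c \<star> 0 = 0" by (rule fmat_eqI) simp
lemma sc_zero_left[simp]: "0 \<star> a = 0" by (rule fmat_eqI) simp
lemma sc_one[simp]: "1 \<star> a = a" by (rule fmat_eqI) simp
lemma sc_uminus[simp]: "c \<star> (- a) = - (c \<star> a)" by (rule fmat_eqI) simp
lemma sc_minus_left[simp]: "(- c) \<star> a = - (c \<star> a)" by (rule fmat_eqI) simp
lemma sc_mult_left[simp]: "(c \<star> a) * b = c \<star> (a * b)"
proof (rule fmat_eqI)
  fix i j
  obtain N where "bd a N" using bd_ex by blast
  moreover from this have "bd (c \<star> a) N" by (auto simp: bd_def fbounded_def)
  ultimately show "ent ((c \<star> a) * b) i j = ent (c \<star> (a * b)) i j"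
    by (simp add: ent_mult sum_distrib_left mult.assoc)
qed
lemma sc_mult_right[simp]: "a * (c \<star> b) = c \<star> (a * b)"
proof (rule fmat_eqI)
  fix i j
  obtain N where "bd a N" using bd_ex by blast
  then show "ent (a * (c \<star> b)) i j = ent (c \<star> (a * b)) i j"
    by (simp add: ent_mult sum_distrib_left mult.left_commute)
qed
lemma sc_sum: "c \<star> sum f S = (\<Sum>x\<in>S. c \<star> f x)"
  by (rule fmat_eqI) (simp add: sum_distrib_left)
lemma sc_sum_left: "sum f S \<star> a = (\<Sum>x\<in>S. f x \<star> a)"
  by (rule fmat_eqI) (simp add: sum_distrib_right)
lemma bd_sc: "bd a N \<Longrightarrow> bd (c \<star> a) N" by (auto simp: bd_def fbounded_def)
lemma bd_sum: "(\<And>x. x \<in> S \<Longrightarrow> bd (f x) N) \<Longrightarrow> bd (sum f S) N"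
  by (auto simp: bd_def fbounded_def)

section \<open>The trace\<close>

definition tr :: "fmat \<Rightarrow> complex" where "tr a = (\<Sum>i\<in>{i. ent a i i \<noteq> 0}. ent a i i)"

lemma tr_bd: "bd a N \<Longrightarrow> tr a = (\<Sum>i<N. ent a i i)"
  unfolding tr_def bd_def fbounded_def
  by (rule sum.mono_neutral_left) (auto, metis not_le)

lemma tr_zero[simp]: "tr 0 = 0" by (simp add: tr_def)
lemma tr_add: "tr (a + b) = tr a + tr b"
proof -
  obtain N where "bd a N" "bd b N" using bd_ex2 by blast
  then show ?thesis using bd_add[of a N b] by (simp add: tr_bd sum.distrib)
qed
lemma tr_diff: "tr (a - b) = tr a - tr b"
proof -
  obtain N where "bd a N" "bd b N" using bd_ex2 by blast
  then show ?thesis using bd_diff[of a N b] by (simp add: tr_bd sum_subtractf)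
qed
lemma tr_sc[simp]: "tr (c \<star> a) = c * tr a"
proof -
  obtain N where "bd a N" using bd_ex by blast
  then show ?thesis using bd_sc[of a N c] by (simp add: tr_bd sum_distrib_left)
qed
lemma tr_sum: "tr (sum f S) = (\<Sum>x\<in>S. tr (f x))"
  by (induction S rule: infinite_finite_induct) (auto simp: tr_add)
lemma tr_comm: "tr (a * b) = tr (b * a)"
proof -
  obtain N where N: "bd a N" "bd b N" using bd_ex2 by blast
  have "tr (a * b) = (\<Sum>i<N. \<Sum>j<N. ent a i j * ent b j i)"
    using N bd_mult[of a N b] by (simp add: tr_bd ent_mult)
  also have "\<dots> = (\<Sum>j<N. \<Sum>i<N. ent b j i * ent a i j)"
    by (subst sum.swap) (simp add: mult.commute)
  also have "\<dots> = tr (b * a)"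
    using N bd_mult[of b N a] by (simp add: tr_bd ent_mult)
  finally show ?thesis .
qed

section \<open>Matrix units and the identities of finite size\<close>

lift_definition eu :: "nat \<Rightarrow> nat \<Rightarrow> fmat" is "\<lambda>p q i j. if i = p \<and> j = q then 1 else 0"
  subgoal for p q by (rule exI[of _ "Suc (max p q)"]) (auto simp: fbounded_def)
  done

lemma ent_eu: "ent (eu p q) i j = (if i = p \<and> j = q then 1 else 0)" by transfer simp
lemma bd_eu: "p < N \<Longrightarrow> q < N \<Longrightarrow> bd (eu p q) N" by (auto simp: bd_def fbounded_def ent_eu)
lemma bd_eu_ex: obtains N where "bd (eu p q) N" "p < N" "q < N"
  by (rule that[of "Suc (max p q)"]) (auto intro!: bd_eu)

lemma ent_eu_mult: "ent (eu p q * a) i j = (if i = p then ent a q j else 0)"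
proof -
  obtain N where N: "bd (eu p q) N" "p < N" "q < N" by (rule bd_eu_ex)
  have "ent (eu p q * a) i j = (\<Sum>k<N. (if k = q then (if i = p then ent a q j else 0) else 0))"
    unfolding ent_mult[OF N(1)] by (rule sum.cong) (auto simp: ent_eu)
  also have "\<dots> = (if i = p then ent a q j else 0)" using N by (simp add: sum.delta)
  finally show ?thesis .
qed
lemma ent_mult_eu: "ent (a * eu p q) i j = (if j = q then ent a i p else 0)"
proof -
  obtain N where N: "bd (eu p q) N" "p < N" "q < N" by (rule bd_eu_ex)
  have "ent (a * eu p q) i j = (\<Sum>k<N. (if k = p then (if j = q then ent a i p else 0) else 0))"
    unfolding ent_mult'[OF N(1)] by (rule sum.cong) (auto simp: ent_eu)
  also have "\<dots> = (if j = q then ent a i p else 0)" using N by (simp add: sum.delta)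
  finally show ?thesis .
qed
lemma eu_eu[simp]: "eu p q * eu r s = (if q = r then eu p s else 0)"
  by (rule fmat_eqI) (auto simp: ent_eu_mult ent_eu)
text \<open>Reads off an entry by multiplication, which lets scalars be extracted from products in
  the ring.\<close>

lemma eu_sandwich: "eu p i * a * eu j q = ent a i j \<star> eu p q"
  by (rule fmat_eqI) (auto simp: ent_mult_eu ent_eu_mult ent_eu)
lemma eu_sandwich': "eu p i * (a * eu j q) = ent a i j \<star> eu p q"
  using eu_sandwich by (simp add: mult.assoc)
lemma tr_eu[simp]: "tr (eu p q) = (if p = q then 1 else 0)"
proof -
  have "{i. ent (eu p q) i i \<noteq> 0} = (if p = q then {p} else {})" by (auto simp: ent_eu)
  then show ?thesis by (simp add: tr_def ent_eu)
qed

lemma fmat_expand: assumes "bd a N" shows "a = (\<Sum>i<N. \<Sum>j<N. ent a i j \<star> eu i j)"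
proof (rule fmat_eqI)
  fix p q
  have "ent (\<Sum>i<N. \<Sum>j<N. ent a i j \<star> eu i j) p q
      = (\<Sum>i<N. \<Sum>j<N. (if j = q then (if i = p then ent a p q else 0) else 0))"
    unfolding ent_sum ent_sc by (intro sum.cong refl) (simp add: ent_eu)
  also have "\<dots> = ent a p q" using bdD[OF assms, of p q]
    by (cases "q < N") (simp_all add: sum.delta not_less)
  finally show "ent a p q = ent (\<Sum>i<N. \<Sum>j<N. ent a i j \<star> eu i j) p q" by simp
qed

definition idm :: "nat \<Rightarrow> fmat" where "idm N = (\<Sum>i<N. eu i i)"

lemma ent_idm: "ent (idm N) i j = (if i = j \<and> i < N then 1 else 0)"
proof -
  have "ent (idm N) i j = (\<Sum>k<N. if k = i then (if i = j then 1 else 0) else 0)"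
    by (auto simp: idm_def ent_eu intro!: sum.cong)
  also have "\<dots> = (if i = j \<and> i < N then 1 else 0)" by (simp add: sum.delta)
  finally show ?thesis .
qed
lemma bd_idm: "bd (idm N) N" by (auto simp: bd_def fbounded_def ent_idm)
lemma ent_idm_mult: "ent (idm N * a) i j = (if i < N then ent a i j else 0)"
proof -
  have "ent (idm N * a) i j = (\<Sum>k<N. (if k = i then ent a i j else 0))"
    unfolding ent_mult[OF bd_idm] by (rule sum.cong) (auto simp: ent_idm)
  also have "\<dots> = (if i < N then ent a i j else 0)" by (simp add: sum.delta)
  finally show ?thesis .
qed
lemma ent_mult_idm: "ent (a * idm N) i j = (if j < N then ent a i j else 0)"
proof -
  have "ent (a * idm N) i j = (\<Sum>k<N. (if k = j then ent a i j else 0))"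
    unfolding ent_mult'[OF bd_idm] by (rule sum.cong) (auto simp: ent_idm)
  also have "\<dots> = (if j < N then ent a i j else 0)" by (simp add: sum.delta)
  finally show ?thesis .
qed
lemma idm_left: "bd a N \<Longrightarrow> idm N * a = a" by (rule fmat_eqI) (auto simp: ent_idm_mult bdD)
lemma idm_right: "bd a N \<Longrightarrow> a * idm N = a" by (rule fmat_eqI) (auto simp: ent_mult_idm bdD)
lemma bd_idm_iff: "bd a N \<longleftrightarrow> idm N * a = a \<and> a * idm N = a"
proof
  assume *: "idm N * a = a \<and> a * idm N = a"
  show "bd a N"
  proof (rule bdI)
    fix i j assume "i \<ge> N \<or> j \<ge> N"
    then show "ent a i j = 0"
      using ent_idm_mult[of N a i j] ent_mult_idm[of a N i j] * by (auto simp: not_less)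
  qed
qed (simp add: idm_left idm_right)
lemma idm_idem[simp]: "idm N * idm N = idm N" by (rule idm_left[OF bd_idm])
lemma tr_idm[simp]: "tr (idm N) = of_nat N" by (simp add: tr_bd[OF bd_idm] ent_idm)
lemma idm_0[simp]: "idm 0 = 0" by (simp add: idm_def)
lemma idm_Suc: "idm (Suc N) = idm N + eu N N" by (simp add: idm_def)
lemma idm_eu: "idm N * eu p q = (if p < N then eu p q else 0)"
  by (rule fmat_eqI) (auto simp: ent_idm_mult ent_eu)
lemma eu_idm: "eu p q * idm N = (if q < N then eu p q else 0)"
  by (rule fmat_eqI) (auto simp: ent_mult_idm ent_eu)

text \<open>The block index and the position inside the block are paired by \<^const>\<open>prod_encode\<close>.\<close>

lift_definition blk :: "nat \<Rightarrow> nat \<Rightarrow> fmat \<Rightarrow> fmat" is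
  "\<lambda>p q f x y. if fst (prod_decode x) = p \<and> fst (prod_decode y) = q
     then f (snd (prod_decode x)) (snd (prod_decode y)) else 0"
proof -
  fix p q f assume "\<exists>N. fbounded f N"
  then obtain N where N: "fbounded f N" by blast
  define S where "S = prod_encode ` ({p,q} \<times> {..<N})"
  have "finite S" by (simp add: S_def)
  then obtain K where K: "\<And>x. x \<in> S \<Longrightarrow> x < K" by (meson finite_nat_set_iff_bounded)
  have "fbounded (\<lambda>x y. if fst (prod_decode x) = p \<and> fst (prod_decode y) = q
     then f (snd (prod_decode x)) (snd (prod_decode y)) else 0) K"
    unfolding fbounded_def
  proof (intro allI impI)
    fix x y assume xy: "K \<le> x \<or> K \<le> y"
    have *: "z \<in> S" if "fst (prod_decode z) \<in> {p,q}" "snd (prod_decode z) < N" for z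
      unfolding S_def using that
      by (intro image_eqI[of _ _ "prod_decode z"]) (auto simp: mem_Times_iff)
    show "(if fst (prod_decode x) = p \<and> fst (prod_decode y) = q
     then f (snd (prod_decode x)) (snd (prod_decode y)) else 0) = 0"
    proof (rule ccontr)
      assume c: "\<not> ?thesis"
      then have p: "fst (prod_decode x) = p" "fst (prod_decode y) = q"
        and nz: "f (snd (prod_decode x)) (snd (prod_decode y)) \<noteq> 0" by (auto split: if_splits)
      have "snd (prod_decode x) < N" "snd (prod_decode y) < N"
        using nz N unfolding fbounded_def by (metis not_less)+
      then have "x < K" "y < K" using *[of x] *[of y] K p by auto
      then show False using xy by simp
    qed
  qed
  then show "\<exists>N. fbounded (\<lambda>x y. if fst (prod_decode x) = p \<and> fst (prod_decode y) = q
     then f (snd (prod_decode x)) (snd (prod_decode y)) else 0) N" by blast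
qed

lemma ent_blk: "ent (blk p q a) x y = (if fst (prod_decode x) = p \<and> fst (prod_decode y) = q
     then ent a (snd (prod_decode x)) (snd (prod_decode y)) else 0)"
  by transfer simp

lemma blk_add: "blk p q (a + b) = blk p q a + blk p q b" by (rule fmat_eqI) (auto simp: ent_blk)
lemma blk_diff: "blk p q (a - b) = blk p q a - blk p q b" by (rule fmat_eqI) (auto simp: ent_blk)
lemma blk_zero[simp]: "blk p q 0 = 0" by (rule fmat_eqI) (auto simp: ent_blk)
lemma blk_sc: "blk p q (c \<star> a) = c \<star> blk p q a" by (rule fmat_eqI) (auto simp: ent_blk)
lemma blk_sum: "blk p q (sum f S) = (\<Sum>x\<in>S. blk p q (f x))"
  by (rule fmat_eqI) (auto simp: ent_blk)
lemma blk_inj: "blk p q a = blk p q b \<Longrightarrow> a = b"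
proof (rule fmat_eqI)
  fix i j assume "blk p q a = blk p q b"
  then have "ent (blk p q a) (prod_encode (p,i)) (prod_encode (q,j)) = ent (blk p q b) (prod_encode (p,i)) (prod_encode (q,j))" by simp
  then show "ent a i j = ent b i j" by (simp add: ent_blk)
qed

text \<open>Only the indices of block \<open>q\<close> contribute. The two bounds are independent
  because \<open>h\<close> vanishes beyond either, so the bound of a block matrix need not be
  related to the bound of its content.\<close>

lemma sum_block: assumes "\<And>y. fst (prod_decode y) \<noteq> q \<Longrightarrow> h y = 0"
   and "\<And>i. i \<ge> N \<Longrightarrow> h (prod_encode (q, i)) = 0" and "\<And>y. y \<ge> K \<Longrightarrow> h y = 0"
  shows "(\<Sum>y<K. h y) = (\<Sum>i<N. h (prod_encode (q, i)) :: complex)"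
proof -
  have "(\<Sum>i<N. h (prod_encode (q, i))) = sum h ((\<lambda>i. prod_encode (q,i)) ` {..<N})"
    by (subst sum.reindex) (auto simp: inj_on_def)
  also have "\<dots> = sum h ({..<K} \<union> (\<lambda>i. prod_encode (q,i)) ` {..<N})"
  proof (rule sum.mono_neutral_left)
    show "\<forall>y\<in>({..<K} \<union> (\<lambda>i. prod_encode (q, i)) ` {..<N}) - (\<lambda>i. prod_encode (q, i)) ` {..<N}. h y = 0"
    proof
      fix y assume y: "y \<in> ({..<K} \<union> (\<lambda>i. prod_encode (q, i)) ` {..<N}) - (\<lambda>i. prod_encode (q, i)) ` {..<N}"
      obtain p i where "prod_decode y = (p, i)" by (cases "prod_decode y")
      then have yp: "y = prod_encode (p, i)" using prod_decode_inverse[of y] by simp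
      show "h y = 0"
      proof (cases "p = q")
        case True
        then have "\<not> i < N" using y yp by blast
        then show ?thesis using assms(2)[of i] yp True by simp
      next
        case False
        then show ?thesis using assms(1)[of y] yp by simp
      qed
    qed
  qed auto
  also have "\<dots> = (\<Sum>y<K. h y)"
    by (rule sum.mono_neutral_right) (auto simp: assms(3))
  finally show ?thesis by simp
qed

lemma blk_mult: "blk p q a * blk r s b = (if q = r then blk p s (a * b) else 0)"
proof (rule fmat_eqI)
  fix x z
  obtain N where N: "bd a N" using bd_ex by blast
  obtain K where K: "bd (blk p q a) K" using bd_ex by blast
  have "ent (blk p q a * blk r s b) x z = (\<Sum>y<K. ent (blk p q a) x y * ent (blk r s b) y z)"
    by (rule ent_mult[OF K])
  also have "\<dots> = (\<Sum>i<N. ent (blk p q a) x (prod_encode (q, i)) * ent (blk r s b) (prod_encode (q, i)) z)"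
    apply (rule sum_block[where h = "\<lambda>y. ent (blk p q a) x y * ent (blk r s b) y z" and q = q and N = N and K = K])
    subgoal by (simp add: ent_blk)
    subgoal by (simp add: ent_blk bdD[OF N])
    subgoal by (simp add: bdD[OF K])
    done
  also have "\<dots> = ent (if q = r then blk p s (a * b) else 0) x z"
    by (auto simp: ent_blk ent_mult[OF N])
  finally show "ent (blk p q a * blk r s b) x z = ent (if q = r then blk p s (a * b) else 0) x z" .
qed

lemma tr_blk: "tr (blk p q a) = (if p = q then tr a else 0)"
proof -
  obtain N where N: "bd a N" using bd_ex by blast
  obtain K where K: "bd (blk p q a) K" using bd_ex by blast
  have "tr (blk p q a) = (\<Sum>y<K. ent (blk p q a) y y)" by (rule tr_bd[OF K])
  also have "\<dots> = (\<Sum>i<N. ent (blk p q a) (prod_encode (q, i)) (prod_encode (q, i)))"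
    apply (rule sum_block[where h = "\<lambda>y. ent (blk p q a) y y" and q = q and N = N and K = K])
    subgoal by (simp add: ent_blk)
    subgoal by (simp add: ent_blk bdD[OF N])
    subgoal by (simp add: bdD[OF K])
    done
  also have "\<dots> = (if p = q then tr a else 0)"
    by (auto simp: ent_blk tr_bd[OF N])
  finally show ?thesis .
qed

lemma prod_decode_0: "prod_decode 0 = (0,0)"
  unfolding prod_decode_def by (subst prod_decode_aux.simps) simp

text \<open>The pair (0, 0) is encoded as 0, so embedding into block 0 preserves the index 0 at
  which \<open>v\<close> and \<open>w\<close> are anchored; the output of a reflection functor is
  thus framed like its input.\<close>

lemma eu00_blk: "blk 0 0 (eu 0 0) = eu 0 0"
proof (rule fmat_eqI)
  fix x y
  have *: "prod_decode x = (0,0) \<longleftrightarrow> x = 0" for x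
    using prod_decode_eq[of x 0] unfolding prod_decode_0 .
  show "ent (blk 0 0 (eu 0 0)) x y = ent (eu 0 0) x y"
    using *[of x] *[of y] by (cases "prod_decode x"; cases "prod_decode y") (auto simp: ent_blk ent_eu prod_decode_0)
qed

section \<open>Elimination, quasi-inverses and idempotents\<close>

definition nzrows :: "fmat \<Rightarrow> nat set" where "nzrows T = {k. \<exists>l. ent T k l \<noteq> 0}"

lemma finite_nzrows: "finite (nzrows T)"
proof -
  obtain N where "bd T N" using bd_ex by blast
  then have "nzrows T \<subseteq> {..<N}" unfolding nzrows_def bd_def fbounded_def
    by (auto intro: ccontr simp: not_less)
  then show ?thesis using finite_subset by blast
qed

lemma ent_mid: "ent (T * eu j i * T') k l = ent T k j * ent T' i l"
proof -
  obtain M where M: "bd (eu j i * T') M" using bd_ex by blast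
  define N where "N = max M (Suc j)"
  have N: "bd (eu j i * T') N" "j < N" using bd_mono[OF M] by (auto simp: N_def)
  have "ent (T * (eu j i * T')) k l = (\<Sum>p<N. if p = j then ent T k j * ent T' i l else 0)"
    unfolding ent_mult'[OF N(1)] by (rule sum.cong) (auto simp: ent_eu_mult)
  also have "\<dots> = ent T k j * ent T' i l" using N by (simp add: sum.delta)
  finally show ?thesis by (simp add: mult.assoc)
qed

text \<open>Rank reduction with pivot (i, j): row k of \<open>T - T * w * T\<close> is row k of
  \<open>T\<close> minus \<open>ent T k j / ent T i j\<close> times row i. Row i becomes zero and
  zero rows stay zero, so the number of nonzero rows can replace the rank as an induction
  measure.\<close>

lemma eliminate:
  assumes "ent T i j \<noteq> 0" and "w = (1 / ent T i j) \<star> eu j i"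
  shows "w * T * w = w" and "nzrows (T - T * w * T) \<subset> nzrows T"
proof -
  show "w * T * w = w" using assms by (simp add: eu_sandwich)
  have e: "ent (T - T * w * T) k l = ent T k l - ent T k j * ent T i l / ent T i j" for k l
    by (simp add: assms(2) ent_mid)
  have "i \<in> nzrows T" using assms(1) by (auto simp: nzrows_def)
  moreover have "i \<notin> nzrows (T - T * w * T)" using assms(1) by (simp add: nzrows_def e del: ent_diff)
  moreover have "nzrows (T - T * w * T) \<subseteq> nzrows T" by (auto simp: nzrows_def e simp del: ent_diff) (metis div_0 mult_zero_left)
  ultimately show "nzrows (T - T * w * T) \<subset> nzrows T" by blast
qed

lemma zero_or_entry: "T = 0 \<or> (\<exists>i j. ent T i j \<noteq> 0)"
  by (metis ent_zero fmat_eqI)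

text \<open>Von Neumann regularity. Averaged over a group it becomes Maschke's theorem, and it takes
  the place of kernels, images and complements.\<close>

lemma quasi_inverse: "\<exists>S. T * S * T = (T :: fmat)"
proof (induction "card (nzrows T)" arbitrary: T rule: less_induct)
  case less
  show ?case
  proof (cases "T = 0")
    case False
    then obtain i j where ij: "ent T i j \<noteq> 0" using zero_or_entry by blast
    define w where "w = (1 / ent T i j) \<star> eu j i"
    note el = eliminate[OF ij w_def]
    define T' where "T' = T - T * w * T"
    have "card (nzrows T') < card (nzrows T)"
      using el(2) finite_nzrows unfolding T'_def by (intro psubset_card_mono) auto
    then obtain S' where S': "T' * S' * T' = T'" using less by blast
    \<comment> \<open>This is \<open>w\<close> plus (1 - w T) S' (1 - T w), written out because the
      ring has no unit; the two factors turn \<open>T\<close> into \<open>T'\<close> on either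
      side.\<close>
    define S where "S = w + S' - w * T * S' - S' * T * w + w * T * S' * T * w"
    have "T * S * T = T * w * T + T' * S' * T'"
      unfolding S_def T'_def by (simp add: algebra_simps)
    also have "\<dots> = T" unfolding S' by (simp add: T'_def)
    finally show ?thesis by blast
  qed simp
qed

text \<open>An idempotent is peeled off one rank at a time; \<open>A\<close> and \<open>B\<close>
  identify its image with the coordinate space of size m. Hence traces of idempotents are natural
  numbers and vanish only for zero.\<close>

lemma idempotent_split:
  assumes "E * E = (E :: fmat)"
  shows "\<exists>m A B. A * B = E \<and> B * A = idm m \<and> A * idm m = A \<and> idm m * B = B"
  using assms
proof (induction "card (nzrows E)" arbitrary: E rule: less_induct)
  case less
  note EE = less(2)
  show ?case
  proof (cases "E = 0")
    case True
    then show ?thesis by (intro exI[of _ 0]) simp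
  next
    case False
    then obtain i j where ij: "ent E i j \<noteq> 0" using zero_or_entry by blast
    define c where "c = ent E i j"
    have c: "c \<noteq> 0" using ij by (simp add: c_def)
    define w where "w = (1 / c) \<star> eu j i"
    note el = eliminate[OF ij w_def[unfolded c_def]]
    define E' where "E' = E - E * w * E"
    have EE': "E * (E * X) = E * X" for X using EE by (metis mult.assoc)
    have wEw: "w * (E * (w * X)) = w * X" for X using el(1) by (metis mult.assoc)
    have "E' * E' = E'" unfolding E'_def
      by (simp add: algebra_simps EE EE' wEw)
    moreover have "card (nzrows E') < card (nzrows E)"
      using el(2) finite_nzrows unfolding E'_def by (intro psubset_card_mono) auto
    ultimately obtain m A B where AB: "A * B = E'" "B * A = idm m" "A * idm m = A" "idm m * B = B"
      using less(1) by blast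
    \<comment> \<open>\<open>x * y\<close> is the rank-one idempotent \<open>E * w * E\<close> split
      off from \<open>E\<close>. The column \<open>x\<close> and the row \<open>y\<close> use the
      fresh index m, and the factor 1/c makes \<open>y * x\<close> the matrix unit at m.\<close>
    define x where "x = (1 / c) \<star> (E * eu j m)"
    define y where "y = eu m i * E"
    have xy: "x * y = E * w * E"
      unfolding x_def y_def w_def by (simp add: mult.assoc[symmetric]) (simp add: mult.assoc)
    have yx: "y * x = eu m m"
    proof -
      have "eu m i * (E * eu j m) = c \<star> eu m m" by (simp add: c_def eu_sandwich')
      then show ?thesis using c unfolding x_def y_def by (simp add: mult.assoc EE')
    qed
    have E'x: "E' * x = 0"
    proof -
      have "E * (eu j i * (E * eu j m)) = c \<star> (E * eu j m)"
        by (simp add: c_def eu_sandwich')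
      then show ?thesis using c unfolding x_def E'_def w_def
        by (simp add: algebra_simps EE')
    qed
    have yE': "y * E' = 0"
    proof -
      have "eu m i * (E * (eu j i * E)) = c \<star> (eu m i * E)"
        using eu_sandwich'[of m i E j i] by (metis c_def mult.assoc sc_mult_left)
      then show ?thesis using c unfolding y_def E'_def w_def
        by (simp add: algebra_simps EE EE')
    qed
    have Bx: "B * x = 0"
    proof -
      have "B * x = idm m * B * x" by (simp add: AB)
      also have "\<dots> = B * (E' * x)" by (simp add: AB(2)[symmetric] AB(1)[symmetric] mult.assoc)
      finally show ?thesis using E'x by simp
    qed
    have yA: "y * A = 0"
    proof -
      have "y * A = y * (A * idm m)" by (simp add: AB)
      also have "\<dots> = (y * E') * A" by (simp add: AB(2)[symmetric] AB(1)[symmetric] mult.assoc)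
      finally show ?thesis using yE' by simp
    qed
    have Ay: "A * y = 0"
    proof -
      have "A * y = A * (idm m * eu m i) * E" unfolding y_def by (metis AB(3) mult.assoc)
      then show ?thesis by (simp add: idm_eu)
    qed
    have xB: "x * B = 0"
    proof -
      have "eu j m * B = eu j m * idm m * B" by (simp add: AB mult.assoc)
      then have "eu j m * B = 0" by (simp add: eu_idm)
      then show ?thesis unfolding x_def by (simp add: mult.assoc)
    qed
    have xi: "x * idm m = 0" unfolding x_def by (simp add: mult.assoc eu_idm)
    have iy: "idm m * y = 0" unfolding y_def by (simp add: mult.assoc[symmetric] idm_eu)
    have Ae: "A * eu m m = 0"
    proof -
      have "A * eu m m = A * (idm m * eu m m)" by (metis AB(3) mult.assoc)
      then show ?thesis by (simp add: idm_eu)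
    qed
    have eB: "eu m m * B = 0"
    proof -
      have "eu m m * B = eu m m * idm m * B" by (simp add: AB mult.assoc)
      then show ?thesis by (simp add: eu_idm)
    qed
    have "(A + x) * (B + y) = E"
      by (simp add: algebra_simps AB Ay xB xy E'_def)
    moreover have "(B + y) * (A + x) = idm (Suc m)"
      by (simp add: algebra_simps AB Bx yA yx idm_Suc)
    moreover have "(A + x) * idm (Suc m) = A + x"
      by (simp add: idm_Suc algebra_simps AB Ae xi) (simp add: x_def mult.assoc)
    moreover have "idm (Suc m) * (B + y) = B + y"
      by (simp add: idm_Suc algebra_simps AB eB iy) (simp add: y_def mult.assoc[symmetric])
    ultimately show ?thesis by blast
  qed
qed

lemma tr_idem: assumes "E * E = (E :: fmat)" shows "\<exists>m. tr E = of_nat m"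
  using idempotent_split[OF assms] by (metis tr_comm tr_idm)

lemma tr_idem_0: assumes "E * E = (E :: fmat)" and "tr E = 0" shows "E = 0"
proof -
  obtain m A B where AB: "A * B = E" "B * A = idm m" "A * idm m = A" "idm m * B = B"
    using idempotent_split[OF assms(1)] by blast
  have "of_nat m = (0 :: complex)" using assms(2) AB by (metis tr_comm tr_idm)
  then have "m = 0" by simp
  then have "A = 0" using AB(3) by simp
  then show ?thesis using AB by simp
qed

lemma tr_idem_le: assumes "E * E = (E :: fmat)" and "bd E N" shows "\<exists>m\<le>N. tr E = of_nat m"
proof -
  have "(idm N - E) * (idm N - E) = idm N - E"
    using assms by (simp add: algebra_simps idm_left idm_right)
  then obtain k m where km: "tr (idm N - E) = of_nat k" "tr E = of_nat m" using tr_idem assms by metis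
  then have "of_nat N = (of_nat (k + m) :: complex)" by (simp add: tr_diff algebra_simps)
  then have "N = k + m" by (simp only: of_nat_eq_iff)
  then show ?thesis using km by auto
qed


section \<open>Passing between the two kinds of matrices\<close>

lift_definition fm :: "complex mat \<Rightarrow> fmat" is
  "\<lambda>A i j. if i < dim_row A \<and> j < dim_col A then A $$ (i, j) else 0"
  subgoal for A by (rule exI[of _ "max (dim_row A) (dim_col A)"]) (auto simp: fbounded_def)
  done

lemma ent_fm: "ent (fm A) i j = (if i < dim_row A \<and> j < dim_col A then A $$ (i, j) else 0)"
  by transfer simp

definition mf :: "nat \<Rightarrow> nat \<Rightarrow> fmat \<Rightarrow> complex mat" where
  "mf n m a = mat n m (\<lambda>(i, j). ent a i j)"

lemma mf_carrier[simp]: "mf n m a \<in> carrier_mat n m" by (simp add: mf_def)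
lemma fm_mf: "fm (mf n m a) = idm n * a * idm m"
  by (rule fmat_eqI) (auto simp: ent_fm mf_def ent_mult_idm ent_idm_mult)
lemma mf_fm: "A \<in> carrier_mat n m \<Longrightarrow> mf n m (fm A) = A"
  by (rule eq_matI) (auto simp: ent_fm mf_def)
lemma fm_idm_left: "A \<in> carrier_mat n m \<Longrightarrow> idm n * fm A = fm A"
  by (rule fmat_eqI) (auto simp: ent_fm ent_idm_mult)
lemma fm_idm_right: "A \<in> carrier_mat n m \<Longrightarrow> fm A * idm m = fm A"
  by (rule fmat_eqI) (auto simp: ent_fm ent_mult_idm)
lemma fm_inj: "A \<in> carrier_mat n m \<Longrightarrow> B \<in> carrier_mat n m \<Longrightarrow> fm A = fm B \<Longrightarrow> A = B"
  by (metis mf_fm)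
lemma fm_add: "A \<in> carrier_mat n m \<Longrightarrow> B \<in> carrier_mat n m \<Longrightarrow> fm (A + B) = fm A + fm B"
  by (rule fmat_eqI) (auto simp: ent_fm)
lemma fm_minus: "A \<in> carrier_mat n m \<Longrightarrow> B \<in> carrier_mat n m \<Longrightarrow> fm (A - B) = fm A - fm B"
  by (rule fmat_eqI) (auto simp: ent_fm)
lemma fm_smult: "fm (c \<cdot>\<^sub>m A) = c \<star> fm A"
  by (rule fmat_eqI) (auto simp: ent_fm)
lemma fm_one: "fm (1\<^sub>m n) = idm n"
  by (rule fmat_eqI) (auto simp: ent_fm ent_idm)
lemma bd_fm: "A \<in> carrier_mat n n \<Longrightarrow> bd (fm A) n"
  by (auto simp: bd_def fbounded_def ent_fm)
lemma tr_fm: "A \<in> carrier_mat n n \<Longrightarrow> tr (fm A) = mat_trace A"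
  by (auto simp: tr_bd[OF bd_fm] mat_trace_def ent_fm intro!: sum.cong)
lemma fm_mult:
  assumes "A \<in> carrier_mat n k" "B \<in> carrier_mat k m"
  shows "fm (A * B) = fm A * fm B"
proof (rule fmat_eqI)
  fix i j
  obtain N where N: "bd (fm A) N" using bd_ex by blast
  define M where "M = max N k"
  have M: "bd (fm A) M" using N bd_mono M_def by simp
  have "ent (fm A * fm B) i j = (\<Sum>l<M. ent (fm A) i l * ent (fm B) l j)" by (rule ent_mult[OF M])
  also have "\<dots> = (\<Sum>l<k. ent (fm A) i l * ent (fm B) l j)"
    using assms by (intro sum.mono_neutral_right) (auto simp: M_def ent_fm)
  also have "\<dots> = ent (fm (A * B)) i j"
    using assms by (auto simp: ent_fm scalar_prod_def lessThan_atLeast0 intro!: sum.cong)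
  finally show "ent (fm (A * B)) i j = ent (fm A * fm B) i j" by simp
qed
lemma mf_mult:
  assumes "idm k * b = b"
  shows "mf n m (a * b) = mf n k a * mf k m b"
proof (rule fm_inj)
  show "mf n m (a * b) \<in> carrier_mat n m" by simp
  show "mf n k a * mf k m b \<in> carrier_mat n m" by (rule mult_carrier_mat[OF mf_carrier mf_carrier])
  show "fm (mf n m (a * b)) = fm (mf n k a * mf k m b)"
    unfolding fm_mult[OF mf_carrier mf_carrier] fm_mf
    by (metis (no_types, lifting) assms idm_idem mult.assoc)
qed

text \<open>Splitting \<open>E\<close> turns \<open>T\<close> into an m x m matrix with m > 0, whose
  spectrum is nonempty over the complex numbers; \<open>A\<close> carries the eigenvector back into
  the image of \<open>E\<close>.\<close>

lemma eigenvector_exists: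
  assumes "E * E = E" "E \<noteq> 0" "E * T = T" "T * E = T"
  shows "\<exists>c x. x \<noteq> 0 \<and> E * x = x \<and> T * x = c \<star> x"
proof -
  obtain m A B where AB: "A * B = E" "B * A = idm m" "A * idm m = A" "idm m * B = B"
    using idempotent_split[OF assms(1)] by blast
  have m: "m > 0"
  proof (rule ccontr)
    assume "\<not> m > 0"
    then have "A = 0" using AB(3) by simp
    then show False using AB assms by simp
  qed
  define M where "M = mf m m (B * T * A)"
  have M: "M \<in> carrier_mat m m" by (simp add: M_def)
  have fM: "fm M = B * T * A"
    unfolding M_def fm_mf using AB(3,4) by (metis mult.assoc)
  have "spectrum M \<noteq> {}" by (rule spectrum_non_empty[OF M m])
  then obtain c where "eigenvalue M c" unfolding spectrum_def by blast
  then obtain v where v: "v \<in> carrier_vec m" "v \<noteq> 0\<^sub>v m" "M *\<^sub>v v = c \<cdot>\<^sub>v v"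
    using M by (auto simp: eigenvalue_def eigenvector_def)
  define V where "V = mat m 1 (\<lambda>(i, j). v $ i)"
  have V: "V \<in> carrier_mat m 1" by (simp add: V_def)
  have "M * V = c \<cdot>\<^sub>m V"
  proof (rule eq_matI)
    fix i j assume ij: "i < dim_row (c \<cdot>\<^sub>m V)" "j < dim_col (c \<cdot>\<^sub>m V)"
    have cv: "col V j = v" using ij v by (intro eq_vecI) (auto simp: V_def)
    have "(M * V) $$ (i, j) = row M i \<bullet> v" using ij M V cv by (auto simp: V_def)
    also have "\<dots> = (M *\<^sub>v v) $ i" using ij M V by (auto simp: V_def)
    finally show "(M * V) $$ (i, j) = (c \<cdot>\<^sub>m V) $$ (i, j)" using ij v by (auto simp: V_def)
  qed (use M V in auto)
  then have MV: "fm M * fm V = c \<star> fm V" using fm_mult[OF M V] by (simp add: fm_smult)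
  have V0: "fm V \<noteq> 0"
  proof
    assume z: "fm V = 0"
    have "v = 0\<^sub>v m"
    proof (rule eq_vecI)
      fix i assume i: "i < dim_vec (0\<^sub>v m :: complex vec)"
      then have "ent (fm V) i 0 = v $ i" by (simp add: ent_fm V_def)
      then show "v $ i = 0\<^sub>v m $ i" using z i by simp
    qed (use v in auto)
    then show False using v by simp
  qed
  have BAV: "B * (A * fm V) = fm V"
    using fm_idm_left[OF V] AB(2) by (simp add: mult.assoc[symmetric])
  show ?thesis
  proof (intro exI conjI)
    show "A * fm V \<noteq> 0" using V0 BAV by fastforce
    show "E * (A * fm V) = A * fm V" using BAV AB(1) by (metis mult.assoc)
    have "T * (A * fm V) = A * (fm M * fm V)"
      unfolding fM using assms(3) AB(1) by (metis mult.assoc)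
    then show "T * (A * fm V) = c \<star> (A * fm V)" using MV by simp
  qed
qed


section \<open>Two facts about finite systems of equations\<close>

text \<open>Surjectivity by duality: a subspace of a finite-dimensional space that no nonzero
  functional annihilates is everything. Coordinates are removed one at a time by subtracting
  multiples of a member \<open>s0\<close> with \<open>s0 j = 1\<close>.\<close>

lemma functionals_separate:
  fixes S :: "('j \<Rightarrow> complex) set"
  assumes "finite J" "S \<noteq> {}"
    and "\<And>s t. s \<in> S \<Longrightarrow> t \<in> S \<Longrightarrow> (\<lambda>j. s j + t j) \<in> S"
    and "\<And>c s. s \<in> S \<Longrightarrow> (\<lambda>j. c * s j) \<in> S"
    and "\<And>z. (\<And>s. s \<in> S \<Longrightarrow> (\<Sum>j\<in>J. z j * s j) = 0) \<Longrightarrow> (\<forall>j\<in>J. z j = 0)"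
  shows "\<exists>s\<in>S. \<forall>j\<in>J. s j = t j"
  using assms
proof (induction J arbitrary: S t rule: finite_induct)
  case empty
  then show ?case by auto
next
  case (insert j J)
  note sub = insert.prems(1) and add = insert.prems(2) and scale = insert.prems(3) and sep = insert.prems(4)
  have "\<exists>s\<in>S. s j \<noteq> 0"
  proof (rule ccontr)
    assume "\<not> (\<exists>s\<in>S. s j \<noteq> 0)"
    then have "\<forall>i\<in>insert j J. (if i = j then 1 else 0 :: complex) = 0"
      by (intro sep) (auto simp: if_distrib[of "\<lambda>x. x * _"] insert.hyps sum.delta cong: if_cong)
    then show False by simp
  qed
  then obtain s1 where s1: "s1 \<in> S" "s1 j \<noteq> 0" by blast
  define s0 where "s0 = (\<lambda>i. (1 / s1 j) * s1 i)"
  have s0: "s0 \<in> S" "s0 j = 1" using scale[OF s1(1), of "1 / s1 j"] s1 by (auto simp: s0_def)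
  define S' where "S' = {s \<in> S. s j = 0}"
  have proj: "(\<lambda>i. s i + (- s j) * s0 i) \<in> S'" if "s \<in> S" for s
    using add[OF that scale[OF s0(1), of "- s j"]] s0(2) by (auto simp: S'_def)
  have "\<exists>s\<in>S'. \<forall>i\<in>J. s i = t i - t j * s0 i"
  proof (rule insert.IH)
    show "S' \<noteq> {}" using proj s0(1) by blast
    fix z assume z: "\<And>s. s \<in> S' \<Longrightarrow> (\<Sum>i\<in>J. z i * s i) = 0"
    define c where "c = (\<Sum>i\<in>J. z i * s0 i)"
    \<comment> \<open>A functional killing \<open>S'\<close> extends to one killing
      \<open>S\<close>: the coefficient at \<open>j\<close> is chosen so that it also vanishes on
      \<open>s0\<close>.\<close>
    have "\<forall>i\<in>insert j J. (if i = j then - c else z i) = 0"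
    proof (rule sep)
      fix s assume s: "s \<in> S"
      have "0 = (\<Sum>i\<in>J. z i * (s i + (- s j) * s0 i))" using z[OF proj[OF s]] by simp
      also have "\<dots> = (\<Sum>i\<in>J. z i * s i) - s j * c"
        by (simp add: c_def algebra_simps sum_subtractf sum_distrib_left)
      finally have "(\<Sum>i\<in>J. z i * s i) = s j * c" by simp
      moreover have "(\<Sum>i\<in>J. (if i = j then - c else z i) * s i) = (\<Sum>i\<in>J. z i * s i)"
        using insert.hyps by (intro sum.cong) auto
      ultimately show "(\<Sum>i\<in>insert j J. (if i = j then - c else z i) * s i) = 0"
        using insert.hyps by simp
    qed
    then show "\<forall>i\<in>J. z i = 0" using insert.hyps by (metis insertCI)
  qed (auto simp: S'_def intro: add scale)
  then obtain s where s: "s \<in> S" "s j = 0" "\<forall>i\<in>J. s i = t i - t j * s0 i" by (auto simp: S'_def)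
  have "(\<lambda>i. s i + t j * s0 i) \<in> S" by (intro add scale s s0)
  then show ?case using s s0(2) by (intro bexI[of _ "\<lambda>i. s i + t j * s0 i"]) auto
qed

text \<open>A small constant term makes the right-hand side a contraction of a small ball, and the
  iterates of 0 converge. This stands in for the inverse function theorem in
  \<open>deform\<close>.\<close>

lemma quadratic_solution:
  fixes B :: "'i \<Rightarrow> 'i \<Rightarrow> 'i \<Rightarrow> complex" and a :: "'i \<Rightarrow> complex"
  assumes fin: "finite I"
  shows "\<exists>e h. (e::real) > 0 \<and> (\<forall>i\<in>I. h i = of_real e * a i + (\<Sum>j\<in>I. \<Sum>k\<in>I. B i j k * h j * h k))"
proof -
  define K where "K = 1 + (\<Sum>i\<in>I. norm (a i)) + (\<Sum>i\<in>I. \<Sum>j\<in>I. \<Sum>k\<in>I. norm (B i j k))"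
  have K1: "K \<ge> 1" unfolding K_def by (simp add: sum_nonneg)
  have Ka: "norm (a i) \<le> K" if "i \<in> I" for i
  proof -
    have "norm (a i) \<le> (\<Sum>i\<in>I. norm (a i))" by (rule member_le_sum) (use that fin in auto)
    moreover have "0 \<le> (\<Sum>i\<in>I. \<Sum>j\<in>I. \<Sum>k\<in>I. norm (B i j k))" by (intro sum_nonneg) auto
    ultimately show ?thesis unfolding K_def by linarith
  qed
  have KB: "(\<Sum>j\<in>I. \<Sum>k\<in>I. norm (B i j k)) \<le> K" if "i \<in> I" for i
  proof -
    have "(\<Sum>j\<in>I. \<Sum>k\<in>I. norm (B i j k)) \<le> (\<Sum>i\<in>I. \<Sum>j\<in>I. \<Sum>k\<in>I. norm (B i j k))"
      by (rule member_le_sum[of i I "\<lambda>i. (\<Sum>j\<in>I. \<Sum>k\<in>I. norm (B i j k))"])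
        (use that fin in \<open>auto intro!: sum_nonneg\<close>)
    moreover have "0 \<le> (\<Sum>i\<in>I. norm (a i))" by (intro sum_nonneg) auto
    ultimately show ?thesis unfolding K_def by linarith
  qed
  \<comment> \<open>With K r = 1/4 and e K = r/2 the constant term is at most r/2 and the quadratic
    term at most r/4, so the ball of radius r is mapped into itself; the Lipschitz constant 2 K r is
    1/2.\<close>
  define r where "r = 1 / (4 * K)"
  define e where "e = r / (2 * K)"
  have r: "r > 0" "K * r = 1/4" using K1 by (auto simp: r_def)
  have e: "e > 0" "e * K = r / 2" using K1 r by (auto simp: e_def)
  define F where "F h i = of_real e * a i + (\<Sum>j\<in>I. \<Sum>k\<in>I. B i j k * h j * h k)" for h :: "'i \<Rightarrow> complex" and i
  have sumB: "norm (\<Sum>j\<in>I. \<Sum>k\<in>I. B i j k * u j k) \<le> K * D"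
    if "i \<in> I" "\<And>j k. j \<in> I \<Longrightarrow> k \<in> I \<Longrightarrow> norm (u j k) \<le> D" "D \<ge> 0" for i u D
  proof -
    have "norm (\<Sum>j\<in>I. \<Sum>k\<in>I. B i j k * u j k) \<le> (\<Sum>j\<in>I. norm (\<Sum>k\<in>I. B i j k * u j k))" by (rule norm_sum)
    also have "\<dots> \<le> (\<Sum>j\<in>I. \<Sum>k\<in>I. norm (B i j k * u j k))" by (intro sum_mono norm_sum)
    also have "\<dots> \<le> (\<Sum>j\<in>I. \<Sum>k\<in>I. norm (B i j k) * D)"
      by (intro sum_mono) (auto simp: norm_mult intro!: mult_left_mono that)
    also have "\<dots> = (\<Sum>j\<in>I. \<Sum>k\<in>I. norm (B i j k)) * D" by (simp add: sum_distrib_right)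
    also have "\<dots> \<le> K * D" by (intro mult_right_mono KB that)
    finally show ?thesis .
  qed
  have Fb: "norm (F h i) \<le> r" if "i \<in> I" "\<And>j. j \<in> I \<Longrightarrow> norm (h j) \<le> r" for h i
  proof -
    have "norm (\<Sum>j\<in>I. \<Sum>k\<in>I. B i j k * (h j * h k)) \<le> K * (r * r)"
      using r by (intro sumB that) (auto simp: norm_mult intro!: mult_mono that)
    moreover have "norm (of_real e * a i) \<le> r / 2"
    proof -
      have "e * norm (a i) \<le> e * K" by (rule mult_left_mono) (use Ka[OF that(1)] e in auto)
      then show ?thesis unfolding norm_mult using e by simp
    qed
    moreover have "K * (r * r) = r / 4" using r by (simp add: mult.assoc[symmetric])
    ultimately show ?thesis unfolding F_def
      using norm_triangle_ineq[of "of_real e * a i" "\<Sum>j\<in>I. \<Sum>k\<in>I. B i j k * (h j * h k)"] r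
      by (simp add: mult.assoc)
  qed
  have Fd: "norm (F h i - F h' i) \<le> D / 2"
    if "i \<in> I" "\<And>j. j \<in> I \<Longrightarrow> norm (h j) \<le> r" "\<And>j. j \<in> I \<Longrightarrow> norm (h' j) \<le> r"
      "\<And>j. j \<in> I \<Longrightarrow> norm (h j - h' j) \<le> D" "D \<ge> 0" for h h' i D
  proof -
    have "F h i - F h' i = (\<Sum>j\<in>I. \<Sum>k\<in>I. B i j k * (h j * (h k - h' k) + h' k * (h j - h' j)))"
      unfolding F_def by (simp add: sum_subtractf[symmetric] algebra_simps)
    moreover have "norm (\<Sum>j\<in>I. \<Sum>k\<in>I. B i j k * (h j * (h k - h' k) + h' k * (h j - h' j))) \<le> K * (2 * r * D)"
    proof (rule sumB)
      fix j k assume jk: "j \<in> I" "k \<in> I"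
      have "norm (h j * (h k - h' k)) \<le> r * D" "norm (h' k * (h j - h' j)) \<le> r * D"
        using jk r by (auto simp: norm_mult intro!: mult_mono that)
      then show "norm (h j * (h k - h' k) + h' k * (h j - h' j)) \<le> 2 * r * D"
        using norm_triangle_ineq[of "h j * (h k - h' k)" "h' k * (h j - h' j)"] by linarith
    qed (use that r in auto)
    moreover have "K * (2 * r * D) = D / 2" using r by (simp add: mult.assoc[symmetric])
    ultimately show ?thesis by simp
  qed
  define H where "H n = (F ^^ n) (\<lambda>i. 0)" for n
  have H0: "H 0 = (\<lambda>i. 0)" and HS: "H (Suc n) = F (H n)" for n by (auto simp: H_def)
  have Hb: "norm (H n i) \<le> r" if "i \<in> I" for n i
    using that
  proof (induction n arbitrary: i)
    case 0
    then show ?case using r by (simp add: H0)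
  next
    case (Suc n)
    show ?case unfolding HS by (rule Fb) (use Suc in auto)
  qed
  have Hd: "norm (H (Suc n) i - H n i) \<le> r * (1/2)^n" if "i \<in> I" for n i
    using that
  proof (induction n arbitrary: i)
    case 0
    then show ?case using Hb[of i 1] by (simp add: H0)
  next
    case (Suc n)
    have "norm (F (H (Suc n)) i - F (H n) i) \<le> r * (1/2)^n / 2"
      by (rule Fd) (use Suc Hb r in auto)
    then show ?case by (simp add: HS)
  qed
  have "convergent (\<lambda>n. H n i)" if "i \<in> I" for i
  proof -
    have "summable (\<lambda>n. H (Suc n) i - H n i)"
      by (rule summable_comparison_test[of _ "\<lambda>n. r * (1/2)^n"])
        (use Hd[OF that] in \<open>auto intro!: summable_mult summable_geometric\<close>)
    then have "convergent (\<lambda>n. \<Sum>k<n. H (Suc k) i - H k i)" by (simp add: summable_iff_convergent)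
    then show ?thesis by (simp add: sum_lessThan_telescope[of "\<lambda>n. H n i"] H0)
  qed
  then obtain L where L: "\<And>i. i \<in> I \<Longrightarrow> (\<lambda>n. H n i) \<longlonglongrightarrow> L i"
    unfolding convergent_def by metis
  have "L i = F L i" if "i \<in> I" for i
  proof (rule LIMSEQ_unique)
    show "(\<lambda>n. H (Suc n) i) \<longlonglongrightarrow> L i" using L[OF that] by (rule LIMSEQ_Suc)
    show "(\<lambda>n. H (Suc n) i) \<longlonglongrightarrow> F L i"
      unfolding HS F_def by (intro tendsto_intros L)
  qed
  then show ?thesis using e by (auto simp: F_def)
qed

section \<open>Representations of finite groups\<close>

locale fin_group = group G for G (structure) +
  assumes fin: "finite (carrier G)"
begin

abbreviation M where "M \<equiv> card (carrier G)"

lemma M_pos: "M > 0" using fin by (auto simp: card_gt_0_iff)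
lemma M_nz[simp]: "M \<noteq> 0" "of_nat M \<noteq> (0::complex)" using M_pos by simp_all

lemma sum_lshift: "h \<in> carrier G \<Longrightarrow> (\<Sum>g\<in>carrier G. F (h \<otimes> g)) = (\<Sum>g\<in>carrier G. F g)"
  by (rule sum.reindex_bij_witness[of _ "\<lambda>g. inv h \<otimes> g" "\<lambda>g. h \<otimes> g"])
    (auto simp: m_assoc[symmetric])
lemma sum_rshift: "h \<in> carrier G \<Longrightarrow> (\<Sum>g\<in>carrier G. F (g \<otimes> h)) = (\<Sum>g\<in>carrier G. F g)"
  by (rule sum.reindex_bij_witness[of _ "\<lambda>g. g \<otimes> inv h" "\<lambda>g. g \<otimes> h"])
    (auto simp: m_assoc)
lemma sum_inv: "(\<Sum>g\<in>carrier G. F (inv g)) = (\<Sum>g\<in>carrier G. F g)"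
  by (rule sum.reindex_bij_witness[of _ "\<lambda>g. inv g" "\<lambda>g. inv g"]) auto

text \<open>The unit is sent to an idempotent, not to a fixed identity matrix, and the image of that
  idempotent is the representation space. Summands, blocks and compressions are then representations
  in the same ring.\<close>

definition rep :: "('a \<Rightarrow> fmat) \<Rightarrow> bool" where
  "rep \<sigma> \<longleftrightarrow> (\<forall>x\<in>carrier G. \<forall>y\<in>carrier G. \<sigma> (x \<otimes> y) = \<sigma> x * \<sigma> y)"

text \<open>The first two equations make \<open>T\<close> vanish off the source space and land in
  the target space, so that equivariant maps and matrices correspond one to one.\<close>

definition intw :: "('a \<Rightarrow> fmat) \<Rightarrow> ('a \<Rightarrow> fmat) \<Rightarrow> fmat \<Rightarrow> bool" where
  "intw \<sigma> \<tau> T \<longleftrightarrow> T * \<sigma> \<one> = T \<and> \<tau> \<one> * T = T \<and> (\<forall>g\<in>carrier G. \<tau> g * T = T * \<sigma> g)"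

definition avg :: "('a \<Rightarrow> fmat) \<Rightarrow> ('a \<Rightarrow> fmat) \<Rightarrow> fmat \<Rightarrow> fmat" where
  "avg \<tau> \<sigma> T = (1 / of_nat M) \<star> (\<Sum>g\<in>carrier G. \<tau> g * T * \<sigma> (inv g))"

section \<open>Equivariant maps and averaging\<close>

lemma rep_mult: "rep \<sigma> \<Longrightarrow> x \<in> carrier G \<Longrightarrow> y \<in> carrier G \<Longrightarrow> \<sigma> x * \<sigma> y = \<sigma> (x \<otimes> y)"
  by (simp add: rep_def)
lemma rep_one: "rep \<sigma> \<Longrightarrow> x \<in> carrier G \<Longrightarrow> \<sigma> \<one> * \<sigma> x = \<sigma> x"
  "rep \<sigma> \<Longrightarrow> x \<in> carrier G \<Longrightarrow> \<sigma> x * \<sigma> \<one> = \<sigma> x"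
  by (simp_all add: rep_mult)
lemma rep_inv: "rep \<sigma> \<Longrightarrow> x \<in> carrier G \<Longrightarrow> \<sigma> (inv x) * \<sigma> x = \<sigma> \<one>"
  "rep \<sigma> \<Longrightarrow> x \<in> carrier G \<Longrightarrow> \<sigma> x * \<sigma> (inv x) = \<sigma> \<one>"
  by (simp_all add: rep_mult)
lemma rep_idem: "rep \<sigma> \<Longrightarrow> \<sigma> \<one> * \<sigma> \<one> = \<sigma> \<one>" by (simp add: rep_mult)

lemma intw_comm: "intw \<sigma> \<tau> T \<Longrightarrow> g \<in> carrier G \<Longrightarrow> \<tau> g * T = T * \<sigma> g"
  by (simp add: intw_def)

lemma avg_intw: assumes "rep \<sigma>" "rep \<tau>" shows "intw \<sigma> \<tau> (avg \<tau> \<sigma> T)"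
  unfolding intw_def
proof (intro conjI ballI)
  have *: "\<tau> g * T * \<sigma> (inv g) * \<sigma> \<one> = \<tau> g * T * \<sigma> (inv g)"
    "\<tau> \<one> * (\<tau> g * T * \<sigma> (inv g)) = \<tau> g * T * \<sigma> (inv g)" if "g \<in> carrier G" for g
    using that assms by (simp add: mult.assoc rep_one, metis mult.assoc rep_one(1))
  show "avg \<tau> \<sigma> T * \<sigma> \<one> = avg \<tau> \<sigma> T" by (simp add: avg_def sum_distrib_right * cong: sum.cong)
  show "\<tau> \<one> * avg \<tau> \<sigma> T = avg \<tau> \<sigma> T" by (simp add: avg_def sum_distrib_left * cong: sum.cong)
  fix h assume h: "h \<in> carrier G"
  have "(\<Sum>g\<in>carrier G. \<tau> h * (\<tau> g * T * \<sigma> (inv g)))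
      = (\<Sum>g\<in>carrier G. \<tau> (h \<otimes> g) * T * \<sigma> (inv (h \<otimes> g)) * \<sigma> h)"
  proof (rule sum.cong)
    fix g assume g: "g \<in> carrier G"
    have "\<sigma> (inv (h \<otimes> g)) * \<sigma> h = \<sigma> (inv g)"
      using g h assms by (simp add: rep_mult inv_mult_group m_assoc)
    then show "\<tau> h * (\<tau> g * T * \<sigma> (inv g)) = \<tau> (h \<otimes> g) * T * \<sigma> (inv (h \<otimes> g)) * \<sigma> h"
      using g h assms by (simp add: rep_mult[symmetric] mult.assoc)
  qed simp
  also have "\<dots> = (\<Sum>g\<in>carrier G. \<tau> g * T * \<sigma> (inv g) * \<sigma> h)"
    by (rule sum_lshift[OF h, of "\<lambda>g. \<tau> g * T * \<sigma> (inv g) * \<sigma> h"])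
  finally show "\<tau> h * avg \<tau> \<sigma> T = avg \<tau> \<sigma> T * \<sigma> h"
    by (simp add: avg_def sum_distrib_left sum_distrib_right)
qed

lemma sum_const_sc: "(\<Sum>g\<in>carrier G. T) = of_nat M \<star> T"
  by (rule fmat_eqI) simp

text \<open>Every conjugate of a quasi-inverse of an equivariant \<open>T\<close> by a group element
  is again one, hence so is the average. This is Maschke's theorem: \<open>T * S\<close> and
  \<open>S * T\<close> are equivariant idempotents.\<close>

lemma quasi_intw: assumes "rep \<sigma>" "rep \<tau>" "intw \<sigma> \<tau> T"
  shows "\<exists>S. intw \<tau> \<sigma> S \<and> T * S * T = T"
proof -
  obtain S where S: "T * S * T = T" using quasi_inverse by blast
  have "T * (\<sigma> g * S * \<tau> (inv g)) * T = T" if g: "g \<in> carrier G" for g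
  proof -
    have "T * (\<sigma> g * S * \<tau> (inv g)) * T = (T * \<sigma> g) * S * (\<tau> (inv g) * T)" by (simp add: mult.assoc)
    also have "\<dots> = \<tau> g * (T * S * T) * \<sigma> (inv g)"
      unfolding intw_comm[OF assms(3) g, symmetric] intw_comm[OF assms(3) inv_closed[OF g]] by (simp add: mult.assoc)
    also have "\<dots> = T * (\<sigma> g * \<sigma> (inv g))"
      unfolding S intw_comm[OF assms(3) g] by (simp add: mult.assoc)
    also have "\<dots> = T" using assms g by (simp add: rep_inv intw_def)
    finally show ?thesis .
  qed
  then have "T * avg \<sigma> \<tau> S * T = T"
    by (simp add: avg_def sum_distrib_left sum_distrib_right sum_const_sc cong: sum.cong)
  then show ?thesis using avg_intw[OF assms(2,1)] by blast
qed

lemma intw_mult: "intw \<sigma> \<tau> T \<Longrightarrow> intw \<tau> \<rho> S \<Longrightarrow> intw \<sigma> \<rho> (S * T)"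
  unfolding intw_def by (metis mult.assoc)
lemma intw_add: "intw \<sigma> \<tau> T \<Longrightarrow> intw \<sigma> \<tau> S \<Longrightarrow> intw \<sigma> \<tau> (S + T)"
  unfolding intw_def by (simp add: algebra_simps)
lemma intw_diff: "intw \<sigma> \<tau> T \<Longrightarrow> intw \<sigma> \<tau> S \<Longrightarrow> intw \<sigma> \<tau> (S - T)"
  unfolding intw_def by (simp add: algebra_simps)
lemma intw_sc: "intw \<sigma> \<tau> T \<Longrightarrow> intw \<sigma> \<tau> (c \<star> T)"
  unfolding intw_def by simp
lemma intw_one: "rep \<sigma> \<Longrightarrow> intw \<sigma> \<sigma> (\<sigma> \<one>)"
  unfolding intw_def by (simp add: rep_mult)
lemma intw_zero: "intw \<sigma> \<tau> 0" by (simp add: intw_def)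
lemma intw_sum: "(\<And>x. x \<in> A \<Longrightarrow> intw \<sigma> \<tau> (f x)) \<Longrightarrow> intw \<sigma> \<tau> (sum f A)"
  by (induction A rule: infinite_finite_induct) (auto simp: intw_zero intro!: intw_add)

text \<open>Absence of proper equivariant idempotents means indecomposability, which averaging makes
  equivalent to having no proper invariant subspace; in this form it involves ring elements
  only.\<close>

definition irr :: "('a \<Rightarrow> fmat) \<Rightarrow> bool" where
  "irr \<sigma> \<longleftrightarrow> rep \<sigma> \<and> \<sigma> \<one> \<noteq> 0 \<and> (\<forall>E. intw \<sigma> \<sigma> E \<and> E * E = E \<longrightarrow> E = 0 \<or> E = \<sigma> \<one>)"

section \<open>Characters, Schur's lemma and orthogonality\<close>

definition chr :: "('a \<Rightarrow> fmat) \<Rightarrow> 'a \<Rightarrow> complex" where "chr \<sigma> g = tr (\<sigma> g)"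
text \<open>The inverse in place of complex conjugation keeps the pairing bilinear and the proofs
  algebraic; \<open>inner_cnj\<close> reconciles it with the hermitian product.\<close>

definition inner :: "('a \<Rightarrow> complex) \<Rightarrow> ('a \<Rightarrow> complex) \<Rightarrow> complex" where
  "inner \<phi> \<psi> = (\<Sum>g\<in>carrier G. \<phi> g * \<psi> (inv g)) / of_nat M"

text \<open>For a quasi-inverse \<open>S\<close> the products \<open>S * T\<close> and
  \<open>T * S\<close> are nonzero equivariant idempotents, so irreducibility leaves only the
  units.\<close>

lemma schur_iso:
  assumes "irr \<sigma>" "irr \<tau>" "intw \<sigma> \<tau> T" "T \<noteq> 0"
  shows "\<exists>S. intw \<tau> \<sigma> S \<and> S * T = \<sigma> \<one> \<and> T * S = \<tau> \<one>"
proof -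
  have r: "rep \<sigma>" "rep \<tau>" using assms by (auto simp: irr_def)
  obtain S where S: "intw \<tau> \<sigma> S" "T * S * T = T" using quasi_intw[OF r assms(3)] by blast
  have "(S * T) * (S * T) = S * T" "(T * S) * (T * S) = T * S" using S by (metis mult.assoc)+
  moreover have "S * T \<noteq> 0" "T * S \<noteq> 0"
    using S(2) assms(4) by (metis mult.assoc mult_zero_right, metis mult_zero_left)
  ultimately show ?thesis using assms(1,2) S(1) intw_mult[OF assms(3) S(1)] intw_mult[OF S(1) assms(3)]
    by (intro exI[of _ S]) (auto simp: irr_def)
qed

lemma schur_chr:
  assumes "irr \<sigma>" "irr \<tau>" "intw \<sigma> \<tau> T" "T \<noteq> 0" "g \<in> carrier G"
  shows "chr \<sigma> g = chr \<tau> g"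
proof -
  obtain S where S: "S * T = \<sigma> \<one>" "T * S = \<tau> \<one>" using schur_iso[OF assms(1-4)] by blast
  have r: "rep \<sigma>" "rep \<tau>" using assms by (auto simp: irr_def)
  have "\<tau> g = \<tau> g * (T * S)" using S r assms(5) by (simp add: rep_one)
  also have "\<dots> = T * \<sigma> g * S" using intw_comm[OF assms(3,5)] by (simp add: mult.assoc[symmetric])
  finally have "tr (\<tau> g) = tr (T * (\<sigma> g * S))" by (simp add: mult.assoc)
  also have "\<dots> = tr (\<sigma> g * (S * T))" by (simp add: tr_comm[of T] mult.assoc)
  also have "\<dots> = tr (\<sigma> g)" using S r assms(5) by (simp add: rep_one)
  finally show ?thesis by (simp add: chr_def)
qed

lemma schur_scalar:
  assumes "irr \<sigma>" "intw \<sigma> \<sigma> T"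
  shows "\<exists>c. T = c \<star> \<sigma> \<one>"
proof -
  have r: "rep \<sigma>" "\<sigma> \<one> \<noteq> 0" using assms by (auto simp: irr_def)
  obtain c x where cx: "x \<noteq> 0" "\<sigma> \<one> * x = x" "T * x = c \<star> x"
    using eigenvector_exists[OF rep_idem[OF r(1)] r(2), of T] assms(2) by (auto simp: intw_def)
  have "T - c \<star> \<sigma> \<one> = 0"
  proof (rule ccontr)
    assume "T - c \<star> \<sigma> \<one> \<noteq> 0"
    then obtain S where "S * (T - c \<star> \<sigma> \<one>) = \<sigma> \<one>"
      using schur_iso[OF assms(1,1) intw_diff[OF intw_sc[OF intw_one[OF r(1)]] assms(2)]] by blast
    then have "x = S * ((T - c \<star> \<sigma> \<one>) * x)" using cx by (metis mult.assoc)
    also have "\<dots> = 0" using cx by (simp add: algebra_simps)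
    finally show False using cx by simp
  qed
  then show ?thesis by auto
qed

text \<open>The (i, j) entry of the average of \<open>eu i j\<close> is a mean of products of
  diagonal entries, so summing over i and j gives products of traces. Schur's lemma for averages
  thereby computes inner products of characters.\<close>

lemma inner_as_avg:
  assumes "\<And>g. g \<in> carrier G \<Longrightarrow> bd (\<sigma> g) N" "\<And>g. g \<in> carrier G \<Longrightarrow> bd (\<tau> g) N"
  shows "inner (chr \<sigma>) (chr \<tau>) = (\<Sum>i<N. \<Sum>j<N. ent (avg \<sigma> \<tau> (eu i j)) i j)"
proof -
  have "(\<Sum>i<N. \<Sum>j<N. ent (avg \<sigma> \<tau> (eu i j)) i j)
     = (\<Sum>i<N. \<Sum>j<N. (\<Sum>g\<in>carrier G. ent (\<sigma> g) i i * ent (\<tau> (inv g)) j j) / of_nat M)"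
    by (simp add: avg_def ent_mid)
  also have "\<dots> = (\<Sum>i<N. \<Sum>j<N. (\<Sum>g\<in>carrier G. ent (\<sigma> g) i i * ent (\<tau> (inv g)) j j)) / of_nat M"
    by (simp add: sum_divide_distrib)
  also have "(\<Sum>i<N. \<Sum>j<N. (\<Sum>g\<in>carrier G. ent (\<sigma> g) i i * ent (\<tau> (inv g)) j j))
     = (\<Sum>i<N. \<Sum>g\<in>carrier G. \<Sum>j<N. ent (\<sigma> g) i i * ent (\<tau> (inv g)) j j)"
    by (intro sum.cong refl sum.swap)
  also have "\<dots> = (\<Sum>g\<in>carrier G. \<Sum>i<N. \<Sum>j<N. ent (\<sigma> g) i i * ent (\<tau> (inv g)) j j)"
    by (rule sum.swap)
  also have "\<dots> = (\<Sum>g\<in>carrier G. chr \<sigma> g * chr \<tau> (inv g))"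
    using assms by (intro sum.cong refl) (simp add: chr_def tr_bd[OF assms(1)] tr_bd[OF assms(2)] sum_product)
  finally show ?thesis by (simp add: inner_def)
qed

lemma rep_bd: "\<exists>N. (\<forall>g\<in>carrier G. bd (\<sigma> g) N)"
proof -
  have "\<forall>g. \<exists>N. bd (\<sigma> g) N" using bd_ex by blast
  then obtain B where B: "\<And>g. bd (\<sigma> g) (B g)" by metis
  have "bd (\<sigma> g) (Max (B ` carrier G))" if "g \<in> carrier G" for g
    by (rule bd_mono[OF B]) (use fin that in auto)
  then show ?thesis by blast
qed

lemma tr_avg: assumes "rep \<sigma>" shows "tr (avg \<sigma> \<sigma> T) = tr (T * \<sigma> \<one>)"
proof -
  have "tr (\<sigma> g * T * \<sigma> (inv g)) = tr (T * \<sigma> \<one>)" if "g \<in> carrier G" for g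
    using that assms by (simp add: tr_comm[of "\<sigma> g"] mult.assoc rep_inv)
  then show ?thesis by (simp add: avg_def tr_sum cong: sum.cong)
qed

lemma tr_one_nz: assumes "irr \<sigma>" shows "tr (\<sigma> \<one>) \<noteq> 0"
  using tr_idem_0[OF rep_idem] assms by (auto simp: irr_def)

lemma inner_cong: "(\<And>g. g \<in> carrier G \<Longrightarrow> \<phi> g = \<phi>' g) \<Longrightarrow> (\<And>g. g \<in> carrier G \<Longrightarrow> \<psi> g = \<psi>' g)
   \<Longrightarrow> inner \<phi> \<psi> = inner \<phi>' \<psi>'"
  unfolding inner_def by (intro arg_cong2[of _ _ _ _ "(/)"] sum.cong) auto

lemma orthogonality:
  assumes "irr \<sigma>" "irr \<tau>"
  shows "inner (chr \<sigma>) (chr \<tau>) = (if \<forall>g\<in>carrier G. chr \<sigma> g = chr \<tau> g then 1 else 0)"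
proof (cases "\<forall>g\<in>carrier G. chr \<sigma> g = chr \<tau> g")
  case False
  have r: "rep \<sigma>" "rep \<tau>" using assms by (auto simp: irr_def)
  have "avg \<sigma> \<tau> T = 0" for T
    using schur_chr[OF assms(2,1) avg_intw[OF r(2,1)]] False by (metis)
  moreover obtain N N' where "\<forall>g\<in>carrier G. bd (\<sigma> g) N" "\<forall>g\<in>carrier G. bd (\<tau> g) N'" using rep_bd by metis
  then have "\<And>g. g \<in> carrier G \<Longrightarrow> bd (\<sigma> g) (max N N')" "\<And>g. g \<in> carrier G \<Longrightarrow> bd (\<tau> g) (max N N')"
    using bd_mono by (meson max.cobounded1 max.cobounded2)+
  ultimately show ?thesis using False inner_as_avg[of \<sigma> "max N N'" \<tau>] by simp
next
  case True
  have r: "rep \<sigma>" using assms by (auto simp: irr_def)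
  have t: "tr (\<sigma> \<one>) \<noteq> 0" using tr_one_nz[OF assms(1)] .
  obtain N where N: "\<And>g. g \<in> carrier G \<Longrightarrow> bd (\<sigma> g) N" using rep_bd by metis
  have N1: "bd (\<sigma> \<one>) N" using N by simp
  \<comment> \<open>By Schur's lemma the average is a scalar multiple of the unit; comparing traces
    determines the scalar.\<close>
  have a: "avg \<sigma> \<sigma> (eu i j) = (ent (\<sigma> \<one>) j i / tr (\<sigma> \<one>)) \<star> \<sigma> \<one>" for i j
  proof -
    obtain c where c: "avg \<sigma> \<sigma> (eu i j) = c \<star> \<sigma> \<one>" using schur_scalar[OF assms(1) avg_intw[OF r r]] by blast
    have "bd (eu i j * \<sigma> \<one>) (max N (Suc (max i j)))"
      by (rule bd_mult) (auto intro: bd_eu bd_mono[OF N1])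
    then have "tr (eu i j * \<sigma> \<one>) = (\<Sum>k<max N (Suc (max i j)). if k = i then ent (\<sigma> \<one>) j i else 0)"
      by (simp only: tr_bd ent_eu_mult) (intro sum.cong, auto)
    also have "\<dots> = ent (\<sigma> \<one>) j i" by (subst sum.delta) auto
    finally have "c * tr (\<sigma> \<one>) = ent (\<sigma> \<one>) j i" using tr_avg[OF r, of "eu i j"] c by simp
    then have "c = ent (\<sigma> \<one>) j i / tr (\<sigma> \<one>)" using t by (simp add: field_simps)
    then show ?thesis using c by simp
  qed
  have "inner (chr \<sigma>) (chr \<tau>) = inner (chr \<sigma>) (chr \<sigma>)"
    using True by (intro inner_cong) auto
  also have "\<dots> = (\<Sum>i<N. \<Sum>j<N. ent (\<sigma> \<one>) i j * ent (\<sigma> \<one>) j i) / tr (\<sigma> \<one>)"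
    by (subst inner_as_avg[OF N N]) (simp_all add: a sum_divide_distrib mult.commute)
  also have "(\<Sum>i<N. \<Sum>j<N. ent (\<sigma> \<one>) i j * ent (\<sigma> \<one>) j i) = tr (\<sigma> \<one> * \<sigma> \<one>)"
    using N1 by (simp add: tr_bd[OF bd_mult[OF N1 N1]] ent_mult)
  finally show ?thesis using True t r by (simp add: rep_idem)
qed

lemma rep_part: assumes "rep \<sigma>" "intw \<sigma> \<sigma> E" "E * E = E"
  shows "rep (\<lambda>g. E * \<sigma> g)" "rep (\<lambda>g. \<sigma> g - E * \<sigma> g)"
proof -
  have *: "\<sigma> x * (E * Y) = E * (\<sigma> x * Y)" if "x \<in> carrier G" for x Y
    using intw_comm[OF assms(2) that] by (metis mult.assoc)
  have EE: "E * (E * Y) = E * Y" for Y using assms(3) by (metis mult.assoc)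
  show "rep (\<lambda>g. E * \<sigma> g)" using assms(1) by (simp add: rep_def * EE mult.assoc)
  show "rep (\<lambda>g. \<sigma> g - E * \<sigma> g)" using assms(1)
    by (simp add: rep_def algebra_simps * EE)
qed

text \<open>Complete reducibility as an induction on the trace of the unit: a property that passes
  from the two parts cut out by an equivariant idempotent to the whole need only be checked on zero
  and on irreducibles.\<close>

lemma rep_induct[consumes 1, case_names zero irr split]:
  assumes "rep \<sigma>"
    and zero: "\<And>\<sigma>. rep \<sigma> \<Longrightarrow> \<sigma> \<one> = 0 \<Longrightarrow> P \<sigma>"
    and irr: "\<And>\<sigma>. irr \<sigma> \<Longrightarrow> P \<sigma>"
    and split: "\<And>\<sigma> E. rep \<sigma> \<Longrightarrow> intw \<sigma> \<sigma> E \<Longrightarrow> E * E = E \<Longrightarrow> P (\<lambda>g. E * \<sigma> g)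
        \<Longrightarrow> P (\<lambda>g. \<sigma> g - E * \<sigma> g) \<Longrightarrow> P \<sigma>"
  shows "P \<sigma>"
proof -
  obtain m where "tr (\<sigma> \<one>) = of_nat m" using tr_idem[OF rep_idem[OF assms(1)]] by blast
  then show ?thesis using assms(1)
  proof (induction m arbitrary: \<sigma> rule: less_induct)
    case (less m)
    show ?case
    proof (cases "\<sigma> \<one> = 0 \<or> irr \<sigma>")
      case True
      then show ?thesis using zero irr less by blast
    next
      case False
      then obtain E where E: "intw \<sigma> \<sigma> E" "E * E = E" "E \<noteq> 0" "E \<noteq> \<sigma> \<one>"
        using less by (auto simp: irr_def)
      note rp = rep_part[OF less.prems(2) E(1,2)]
      have E1: "E * \<sigma> \<one> = E" using E by (simp add: intw_def)
      obtain a where a: "tr E = of_nat a" using tr_idem[OF E(2)] by blast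
      have F: "(\<sigma> \<one> - E) * (\<sigma> \<one> - E) = \<sigma> \<one> - E" using rep_idem[OF rp(2)] by (simp add: E1)
      obtain b where b: "tr (\<sigma> \<one> - E) = of_nat b" using tr_idem[OF F] by blast
      have "of_nat (a + b) = (of_nat m :: complex)" using a b less.prems by (simp add: tr_diff algebra_simps)
      then have "a + b = m" by (simp only: of_nat_eq_iff)
      moreover have "a \<noteq> 0" using tr_idem_0[OF E(2)] E a by auto
      moreover have "b \<noteq> 0" using tr_idem_0[OF F] E b by auto
      ultimately have "a < m" "b < m" by auto
      then have "P (\<lambda>g. E * \<sigma> g)" "P (\<lambda>g. \<sigma> g - E * \<sigma> g)"
        using less.IH[of a "\<lambda>g. E * \<sigma> g"] less.IH[of b "\<lambda>g. \<sigma> g - E * \<sigma> g"] rp a b by (auto simp: E1)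
      then show ?thesis using split[OF less.prems(2) E(1,2)] by blast
    qed
  qed
qed

section \<open>Irreducible characters and isotypic projectors\<close>

definition IrrC :: "('a \<Rightarrow> complex) set" where
  "IrrC = {\<phi>. \<exists>\<sigma>. irr \<sigma> \<and> \<phi> = restrict (chr \<sigma>) (carrier G)}"

definition zf :: "('a \<Rightarrow> complex) \<Rightarrow> ('a \<Rightarrow> fmat) \<Rightarrow> fmat" where
  "zf f \<sigma> = (\<Sum>g\<in>carrier G. f g \<star> \<sigma> g)"

definition class_fun :: "('a \<Rightarrow> complex) \<Rightarrow> bool" where
  "class_fun f \<longleftrightarrow> (\<forall>g\<in>carrier G. \<forall>h\<in>carrier G. f (g \<otimes> h) = f (h \<otimes> g))"

text \<open>The central idempotent of the group algebra attached to the character; on a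
  representation it projects onto the isotypic component. Being given by a group algebra element, it
  is carried along by all equivariant maps.\<close>

definition iso :: "('a \<Rightarrow> complex) \<Rightarrow> ('a \<Rightarrow> fmat) \<Rightarrow> fmat" where
  "iso \<phi> \<sigma> = zf (\<lambda>g. \<phi> \<one> / of_nat M * \<phi> (inv g)) \<sigma>"

lemma zf_intw: assumes "class_fun f" "rep \<sigma>" shows "intw \<sigma> \<sigma> (zf f \<sigma>)"
  unfolding intw_def
proof (intro conjI ballI)
  show "zf f \<sigma> * \<sigma> \<one> = zf f \<sigma>" "\<sigma> \<one> * zf f \<sigma> = zf f \<sigma>"
    using assms(2) by (simp_all add: zf_def sum_distrib_left sum_distrib_right rep_one cong: sum.cong)
  fix h assume h: "h \<in> carrier G"
  have "\<sigma> h * zf f \<sigma> = (\<Sum>g\<in>carrier G. f (inv h \<otimes> (h \<otimes> g)) \<star> \<sigma> (h \<otimes> g))"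
    using h assms(2) by (simp add: zf_def sum_distrib_left rep_mult m_assoc[symmetric] cong: sum.cong)
  also have "\<dots> = (\<Sum>g\<in>carrier G. f (inv h \<otimes> g) \<star> \<sigma> g)"
    by (rule sum_lshift[OF h, of "\<lambda>g. f (inv h \<otimes> g) \<star> \<sigma> g"])
  also have "\<dots> = (\<Sum>g\<in>carrier G. f (g \<otimes> inv h) \<star> \<sigma> g)"
    using assms(1) h by (intro sum.cong refl) (simp add: class_fun_def)
  also have "\<dots> = (\<Sum>g\<in>carrier G. f (g \<otimes> h \<otimes> inv h) \<star> \<sigma> (g \<otimes> h))"
    by (rule sum_rshift[OF h, of "\<lambda>g. f (g \<otimes> inv h) \<star> \<sigma> g", symmetric])
  also have "\<dots> = zf f \<sigma> * \<sigma> h"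
    using h assms(2) by (simp add: zf_def sum_distrib_right rep_mult m_assoc cong: sum.cong)
  finally show "\<sigma> h * zf f \<sigma> = zf f \<sigma> * \<sigma> h" .
qed

lemma IrrC_E: assumes "\<phi> \<in> IrrC"
  obtains \<rho> where "irr \<rho>" "\<And>g. g \<in> carrier G \<Longrightarrow> \<phi> g = chr \<rho> g" "\<phi> = restrict (chr \<rho>) (carrier G)"
  using assms unfolding IrrC_def by auto

lemma IrrC_eqI: assumes "\<phi> \<in> IrrC" "\<psi> \<in> IrrC" "\<And>g. g \<in> carrier G \<Longrightarrow> \<phi> g = \<psi> g" shows "\<phi> = \<psi>"
proof -
  have "\<phi> \<in> extensional (carrier G)" "\<psi> \<in> extensional (carrier G)" using assms unfolding IrrC_def by auto
  then show ?thesis using assms(3) extensionalityI by blast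
qed

lemma IrrC_orth: assumes "\<phi> \<in> IrrC" "\<psi> \<in> IrrC" shows "inner \<phi> \<psi> = (if \<phi> = \<psi> then 1 else 0)"
proof -
  obtain \<rho> where r: "irr \<rho>" "\<And>g. g \<in> carrier G \<Longrightarrow> \<phi> g = chr \<rho> g" using IrrC_E[OF assms(1)] by metis
  obtain \<rho>' where r': "irr \<rho>'" "\<And>g. g \<in> carrier G \<Longrightarrow> \<psi> g = chr \<rho>' g" using IrrC_E[OF assms(2)] by metis
  have "inner \<phi> \<psi> = inner (chr \<rho>) (chr \<rho>')" using r r' by (intro inner_cong)
  also have "\<dots> = (if \<phi> = \<psi> then 1 else 0)"
    unfolding orthogonality[OF r(1) r'(1)] using r(2) r'(2) IrrC_eqI[OF assms] by metis
  finally show ?thesis .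
qed

lemma chr_class: "rep \<sigma> \<Longrightarrow> class_fun (chr \<sigma>)"
  by (simp add: class_fun_def chr_def rep_mult[symmetric] tr_comm)
lemma IrrC_class: assumes "\<phi> \<in> IrrC" shows "class_fun \<phi>"
proof -
  obtain \<rho> where r: "irr \<rho>" "\<And>g. g \<in> carrier G \<Longrightarrow> \<phi> g = chr \<rho> g" using IrrC_E[OF assms(1)] by metis
  then show ?thesis using chr_class[of \<rho>] by (simp add: class_fun_def irr_def)
qed
lemma class_inv: "class_fun f \<Longrightarrow> class_fun (\<lambda>g. f (inv g))"
  by (simp add: class_fun_def inv_mult_group)
lemma class_scale: "class_fun f \<Longrightarrow> class_fun (\<lambda>g. c * f g)"
  by (simp add: class_fun_def)
lemma class_mult: "class_fun f \<Longrightarrow> class_fun f' \<Longrightarrow> class_fun (\<lambda>g. f g * f' g)"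
  by (simp add: class_fun_def)

lemma IrrC_one_nz: assumes "\<phi> \<in> IrrC" shows "\<phi> \<one> \<noteq> 0"
  using IrrC_E[OF assms] tr_one_nz by (metis chr_def one_closed)

lemma iso_intw: "\<phi> \<in> IrrC \<Longrightarrow> rep \<sigma> \<Longrightarrow> intw \<sigma> \<sigma> (iso \<phi> \<sigma>)"
  unfolding iso_def by (intro zf_intw class_scale class_inv IrrC_class)

lemma zf_irr: assumes "class_fun f" "irr \<sigma>"
  shows "zf f \<sigma> = ((\<Sum>g\<in>carrier G. f g * chr \<sigma> g) / tr (\<sigma> \<one>)) \<star> \<sigma> \<one>"
proof -
  have r: "rep \<sigma>" using assms by (auto simp: irr_def)
  obtain c where c: "zf f \<sigma> = c \<star> \<sigma> \<one>" using schur_scalar[OF assms(2) zf_intw[OF assms(1) r]] by blast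
  have "(\<Sum>g\<in>carrier G. f g * chr \<sigma> g) = tr (zf f \<sigma>)"
    by (simp add: zf_def tr_sum chr_def)
  then have "(\<Sum>g\<in>carrier G. f g * chr \<sigma> g) = c * tr (\<sigma> \<one>)" by (simp add: c)
  then show ?thesis using c tr_one_nz[OF assms(2)] by simp
qed

lemma inner_comm: "inner \<phi> \<psi> = inner \<psi> \<phi>"
proof -
  have "(\<Sum>g\<in>carrier G. \<phi> g * \<psi> (inv g)) = (\<Sum>g\<in>carrier G. \<phi> (inv g) * \<psi> (inv (inv g)))"
    by (rule sum_inv[symmetric, of "\<lambda>g. \<phi> g * \<psi> (inv g)"])
  then show ?thesis by (simp add: inner_def mult.commute cong: sum.cong)
qed

lemma iso_irr: assumes "\<phi> \<in> IrrC" "irr \<sigma>"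
  shows "iso \<phi> \<sigma> = (if \<forall>g\<in>carrier G. \<phi> g = chr \<sigma> g then \<sigma> \<one> else 0)"
proof -
  obtain \<rho> where r: "irr \<rho>" "\<And>g. g \<in> carrier G \<Longrightarrow> \<phi> g = chr \<rho> g" using IrrC_E[OF assms(1)] by metis
  have "(\<Sum>g\<in>carrier G. \<phi> \<one> / of_nat M * \<phi> (inv g) * chr \<sigma> g) = \<phi> \<one> * inner (chr \<sigma>) \<phi>"
    by (simp add: inner_def sum_distrib_left sum_divide_distrib mult_ac)
  also have "inner (chr \<sigma>) \<phi> = inner (chr \<rho>) (chr \<sigma>)"
    unfolding inner_comm[of "chr \<sigma>"] using r by (intro inner_cong) auto
  finally have "(\<Sum>g\<in>carrier G. \<phi> \<one> / of_nat M * \<phi> (inv g) * chr \<sigma> g)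
      = (if \<forall>g\<in>carrier G. \<phi> g = chr \<sigma> g then \<phi> \<one> else 0)"
    using r by (simp add: orthogonality[OF r(1) assms(2)])
  then have z: "iso \<phi> \<sigma> = ((if \<forall>g\<in>carrier G. \<phi> g = chr \<sigma> g then \<phi> \<one> else 0) / tr (\<sigma> \<one>)) \<star> \<sigma> \<one>"
    unfolding iso_def
    by (subst zf_irr[OF class_scale[OF class_inv[OF IrrC_class[OF assms(1)]]] assms(2)]) simp
  have "\<forall>g\<in>carrier G. \<phi> g = chr \<sigma> g \<Longrightarrow> \<phi> \<one> = tr (\<sigma> \<one>)" by (simp add: chr_def)
  then show ?thesis using z tr_one_nz[OF assms(2)] by (cases "\<forall>g\<in>carrier G. \<phi> g = chr \<sigma> g") auto
qed

lemma zf_zero: "rep \<sigma> \<Longrightarrow> \<sigma> \<one> = 0 \<Longrightarrow> zf f \<sigma> = 0"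
  unfolding zf_def by (intro sum.neutral) (metis rep_one(1) mult_zero_left sc_zero)

lemma zf_left: "zf f (\<lambda>g. E * \<sigma> g) = E * zf f \<sigma>"
  by (simp add: zf_def sum_distrib_left)
lemma zf_diff: "zf f (\<lambda>g. \<sigma> g - \<tau> g) = zf f \<sigma> - zf f \<tau>"
  by (simp add: zf_def sc_diff sum_subtractf)
lemma iso_left: "iso \<phi> (\<lambda>g. E * \<sigma> g) = E * iso \<phi> \<sigma>"
  by (simp add: iso_def zf_left)
lemma iso_diff: "iso \<phi> (\<lambda>g. \<sigma> g - \<tau> g) = iso \<phi> \<sigma> - iso \<phi> \<tau>"
  by (simp add: iso_def zf_diff)

lemma E_zf: assumes "intw \<sigma> \<sigma> E" shows "E * zf f \<sigma> = zf f \<sigma> * E"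
  unfolding zf_def using intw_comm[OF assms] by (simp add: sum_distrib_left sum_distrib_right cong: sum.cong)

lemma iso_mult:
  assumes "\<phi> \<in> IrrC" "\<psi> \<in> IrrC" "rep \<sigma>"
  shows "iso \<phi> \<sigma> * iso \<psi> \<sigma> = (if \<phi> = \<psi> then iso \<phi> \<sigma> else 0)"
  using assms(3)
proof (induction rule: rep_induct)
  case (zero \<sigma>)
  then show ?case by (simp add: iso_def zf_zero)
next
  case (irr \<sigma>)
  then show ?case using rep_idem[of \<sigma>] IrrC_eqI[OF assms(1,2)]
    by (auto simp: iso_irr[OF assms(1)] iso_irr[OF assms(2)] irr_def)
next
  case (split \<sigma> E)
  have c: "E * iso \<xi> \<sigma> = iso \<xi> \<sigma> * E" for \<xi> using E_zf[OF split(2)] by (simp add: iso_def)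
  have EE: "E * (E * X) = E * X" for X using split(3) by (metis mult.assoc)
  have c': "iso \<xi> \<sigma> * (E * X) = E * (iso \<xi> \<sigma> * X)" for X \<xi> using c by (metis mult.assoc)
  show ?case
  proof (cases "\<phi> = \<psi>")
    case True
    then show ?thesis using split(4,5)
      by (simp add: iso_left iso_diff algebra_simps c' EE)
  next
    case False
    then show ?thesis using split(4,5)
      by (simp add: iso_left iso_diff algebra_simps c' EE)
  qed
qed

lemma iso_tr: assumes "\<phi> \<in> IrrC" "rep \<sigma>" "g \<in> carrier G"
  shows "tr (iso \<phi> \<sigma> * \<sigma> g) = inner (chr \<sigma>) \<phi> * \<phi> g"
  using assms(2)
proof (induction rule: rep_induct)
  case (zero \<sigma>)
  have "chr \<sigma> h = 0" if "h \<in> carrier G" for h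
    using rep_one(1)[OF zero(1) that] zero(2) by (simp add: chr_def)
  then show ?case using zero by (simp add: iso_def zf_zero inner_def)
next
  case (irr \<sigma>)
  have r: "rep \<sigma>" using irr by (simp add: irr_def)
  have "inner (chr \<sigma>) \<phi> = (if \<forall>g\<in>carrier G. \<phi> g = chr \<sigma> g then 1 else 0)"
  proof -
    obtain \<rho> where \<rho>: "irr \<rho>" "\<And>g. g \<in> carrier G \<Longrightarrow> \<phi> g = chr \<rho> g" using IrrC_E[OF assms(1)] by metis
    have "inner (chr \<sigma>) \<phi> = inner (chr \<sigma>) (chr \<rho>)" using \<rho> by (intro inner_cong) auto
    then show ?thesis using orthogonality[OF irr \<rho>(1)] \<rho>(2) by auto
  qed
  moreover have "\<forall>g\<in>carrier G. \<phi> g = chr \<sigma> g \<Longrightarrow> tr (\<sigma> g) = \<phi> g" using assms(3) by (simp add: chr_def)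
  ultimately show ?case using iso_irr[OF assms(1) irr] assms(3) r by (simp add: rep_one)
next
  case (split \<sigma> E)
  have c: "E * iso \<xi> \<sigma> = iso \<xi> \<sigma> * E" for \<xi> using E_zf[OF split(2)] by (simp add: iso_def)
  have EE: "E * (E * X) = E * X" for X using split(3) by (metis mult.assoc)
  have c': "iso \<xi> \<sigma> * (E * X) = E * (iso \<xi> \<sigma> * X)" for X \<xi> using c by (metis mult.assoc)
  have "inner (chr (\<lambda>g. \<sigma> g - E * \<sigma> g)) \<phi> = inner (chr \<sigma>) \<phi> - inner (chr (\<lambda>g. E * \<sigma> g)) \<phi>"
    by (simp add: inner_def chr_def tr_diff sum_subtractf algebra_simps diff_divide_distrib)
  then have "inner (chr \<sigma>) \<phi> * \<phi> g = inner (chr (\<lambda>g. \<sigma> g - E * \<sigma> g)) \<phi> * \<phi> g + inner (chr (\<lambda>g. E * \<sigma> g)) \<phi> * \<phi> g"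
    by (simp add: left_diff_distrib)
  also have "\<dots> = tr (iso \<phi> \<sigma> * \<sigma> g)"
    unfolding split(4,5)[symmetric]
    by (simp add: iso_left iso_diff algebra_simps c' EE tr_diff tr_add)
  finally show ?case by simp
qed

lemma inner_nat: assumes "\<phi> \<in> IrrC" "rep \<sigma>" shows "\<exists>m. inner (chr \<sigma>) \<phi> = of_nat m"
  using assms(2)
proof (induction rule: rep_induct)
  case (zero \<sigma>)
  have "chr \<sigma> h = 0" if "h \<in> carrier G" for h
    using rep_one(1)[OF zero(1) that] zero(2) by (simp add: chr_def)
  then show ?case by (intro exI[of _ 0]) (simp add: inner_def)
next
  case (irr \<sigma>)
  obtain \<rho> where \<rho>: "irr \<rho>" "\<And>g. g \<in> carrier G \<Longrightarrow> \<phi> g = chr \<rho> g" using IrrC_E[OF assms(1)] by metis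
  have "inner (chr \<sigma>) \<phi> = inner (chr \<sigma>) (chr \<rho>)" using \<rho> by (intro inner_cong) auto
  then show ?case using orthogonality[OF irr \<rho>(1)] by (metis of_nat_0 of_nat_1)
next
  case (split \<sigma> E)
  have "inner (chr \<sigma>) \<phi> = inner (chr (\<lambda>g. \<sigma> g - E * \<sigma> g)) \<phi> + inner (chr (\<lambda>g. E * \<sigma> g)) \<phi>"
    by (simp add: inner_def chr_def tr_diff sum_subtractf algebra_simps diff_divide_distrib)
  then show ?case using split(4,5) by (metis of_nat_add)
qed

text \<open>Applied to the regular representation, in which every irreducible character occurs, this
  yields \<open>finite_IrrC\<close>.\<close>

lemma finite_support: assumes "rep \<sigma>" shows "finite {\<phi> \<in> IrrC. inner (chr \<sigma>) \<phi> \<noteq> 0}"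
  using assms
proof (induction rule: rep_induct)
  case (zero \<sigma>)
  have "chr \<sigma> h = 0" if "h \<in> carrier G" for h
    using rep_one(1)[OF zero(1) that] zero(2) by (simp add: chr_def)
  then show ?case by (simp add: inner_def)
next
  case (irr \<sigma>)
  let ?\<chi> = "restrict (chr \<sigma>) (carrier G)"
  have i: "?\<chi> \<in> IrrC" using irr by (auto simp: IrrC_def)
  have "\<phi> = ?\<chi>" if "\<phi> \<in> IrrC" "inner (chr \<sigma>) \<phi> \<noteq> 0" for \<phi>
  proof -
    have "inner (chr \<sigma>) \<phi> = inner ?\<chi> \<phi>" by (intro inner_cong) auto
    then show ?thesis using IrrC_orth[OF i that(1)] that(2) by (auto split: if_splits)
  qed
  then have "{\<phi> \<in> IrrC. inner (chr \<sigma>) \<phi> \<noteq> 0} \<subseteq> {?\<chi>}" by blast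
  then show ?case using finite_subset by blast
next
  case (split \<sigma> E)
  have "inner (chr \<sigma>) \<phi> = inner (chr (\<lambda>g. \<sigma> g - E * \<sigma> g)) \<phi> + inner (chr (\<lambda>g. E * \<sigma> g)) \<phi>" for \<phi>
    by (simp add: inner_def chr_def tr_diff sum_subtractf algebra_simps diff_divide_distrib)
  then have "{\<phi> \<in> IrrC. inner (chr \<sigma>) \<phi> \<noteq> 0} \<subseteq> {\<phi> \<in> IrrC. inner (chr (\<lambda>g. E * \<sigma> g)) \<phi> \<noteq> 0}
     \<union> {\<phi> \<in> IrrC. inner (chr (\<lambda>g. \<sigma> g - E * \<sigma> g)) \<phi> \<noteq> 0}" by auto
  then show ?case using finite_subset split(4,5) by blast
qed

section \<open>Free modules over the group algebra\<close>

definition free_enc :: "nat \<Rightarrow> nat \<times> 'a \<Rightarrow> nat" where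
  "free_enc r = (SOME e. bij_betw e ({..<r} \<times> carrier G) {..<r * M})"

lemma free_enc: "bij_betw (free_enc r) ({..<r} \<times> carrier G) {..<r * M}"
proof -
  have "\<exists>e. bij_betw e ({..<r} \<times> carrier G) {..<r * M}"
    using fin by (intro finite_same_card_bij) (auto simp: card_cartesian_product)
  then show ?thesis unfolding free_enc_def by (rule someI_ex)
qed

lemma free_enc_inj: "x \<in> {..<r} \<times> carrier G \<Longrightarrow> y \<in> {..<r} \<times> carrier G \<Longrightarrow> free_enc r x = free_enc r y \<longleftrightarrow> x = y"
  using free_enc[of r] by (auto simp: bij_betw_def inj_on_def)
lemma free_enc_less: "x \<in> {..<r} \<times> carrier G \<Longrightarrow> free_enc r x < r * M"
  using free_enc[of r] by (auto simp: bij_betw_def)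

text \<open>r copies of the regular representation, realised as the functions on r free orbits. It
  bounds the number of irreducible characters and carries the starting points in
  \<open>CM_nul\<close>.\<close>

definition free_rep :: "nat \<Rightarrow> 'a \<Rightarrow> fmat" where
  "free_rep r g = (\<Sum>x\<in>{..<r} \<times> carrier G. eu (free_enc r (fst x, g \<otimes> snd x)) (free_enc r x))"

lemma free_rep_eu: assumes "g \<in> carrier G" "x \<in> {..<r} \<times> carrier G"
  shows "free_rep r g * eu (free_enc r x) j = eu (free_enc r (fst x, g \<otimes> snd x)) j"
proof -
  have "free_rep r g * eu (free_enc r x) j = (\<Sum>y\<in>{..<r} \<times> carrier G. if y = x then eu (free_enc r (fst x, g \<otimes> snd x)) j else 0)"
    unfolding free_rep_def sum_distrib_right using assms(2) by (intro sum.cong) (auto simp: free_enc_inj)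
  then show ?thesis using assms fin by (simp add: sum.delta)
qed

lemma free_rep_rep: "rep (free_rep r)"
  unfolding rep_def
proof (intro ballI)
  fix g h assume gh: "g \<in> carrier G" "h \<in> carrier G"
  have "free_rep r g * free_rep r h = (\<Sum>x\<in>{..<r} \<times> carrier G. free_rep r g * eu (free_enc r (fst x, h \<otimes> snd x)) (free_enc r x))"
    unfolding free_rep_def[of r h] by (simp add: sum_distrib_left)
  also have "\<dots> = free_rep r (g \<otimes> h)"
    unfolding free_rep_def[of r "g \<otimes> h"]
  proof (intro sum.cong refl)
    fix x assume x: "x \<in> {..<r} \<times> carrier G"
    then have "(fst x, h \<otimes> snd x) \<in> {..<r} \<times> carrier G" using gh by auto
    from free_rep_eu[OF gh(1) this] show "free_rep r g * eu (free_enc r (fst x, h \<otimes> snd x)) (free_enc r x)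
       = eu (free_enc r (fst x, g \<otimes> h \<otimes> snd x)) (free_enc r x)"
      using x gh by (auto simp: m_assoc)
  qed
  finally show "free_rep r (g \<otimes> h) = free_rep r g * free_rep r h" by simp
qed

lemma free_rep_one: "free_rep r \<one> = idm (r * M)"
proof -
  have "free_rep r \<one> = (\<Sum>x\<in>{..<r} \<times> carrier G. eu (free_enc r x) (free_enc r x))"
    unfolding free_rep_def by (intro sum.cong refl) auto
  also have "\<dots> = (\<Sum>i<r * M. eu i i)"
    by (rule sum.reindex_bij_betw[OF free_enc])
  finally show ?thesis by (simp add: idm_def)
qed

lemma free_rep_chr: assumes "g \<in> carrier G" shows "chr (free_rep r) g = (if g = \<one> then of_nat (r * M) else 0)"
proof (cases "g = \<one>")
  case True
  then show ?thesis by (simp add: chr_def free_rep_one)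
next
  case False
  have "free_enc r (fst x, g \<otimes> snd x) \<noteq> free_enc r x" if "x \<in> {..<r} \<times> carrier G" for x
    using that assms False free_enc_inj[of "(fst x, g \<otimes> snd x)" r x] r_cancel_one[of "snd x" g]
    by (auto simp: mem_Times_iff prod_eq_iff)
  then show ?thesis using False by (simp add: chr_def free_rep_def tr_sum cong: sum.cong)
qed

lemma inner_free: "inner (chr (free_rep r)) \<phi> = of_nat r * \<phi> \<one>"
proof -
  have "(\<Sum>g\<in>carrier G. chr (free_rep r) g * \<phi> (inv g)) = (\<Sum>g\<in>carrier G. if g = \<one> then of_nat (r * M) * \<phi> \<one> else 0)"
    by (intro sum.cong) (auto simp: free_rep_chr)
  also have "\<dots> = of_nat (r * M) * \<phi> \<one>" using fin by (simp add: sum.delta)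
  finally show ?thesis by (simp add: inner_def)
qed

lemma finite_IrrC: "finite IrrC"
proof -
  have "{\<phi> \<in> IrrC. inner (chr (free_rep 1)) \<phi> \<noteq> 0} = IrrC"
    using IrrC_one_nz by (auto simp: inner_free)
  then show ?thesis using finite_support[OF free_rep_rep[of 1]] by (simp only:)
qed

text \<open>A central group algebra element acts on each isotypic part by the scalar that Schur's
  lemma gives on irreducibles.\<close>

lemma zf_expand:
  assumes "class_fun f" "rep \<sigma>"
  shows "zf f \<sigma> = (\<Sum>\<phi>\<in>IrrC. ((\<Sum>g\<in>carrier G. f g * \<phi> g) / \<phi> \<one>) \<star> iso \<phi> \<sigma>)"
  using assms(2)
proof (induction rule: rep_induct)
  case (zero \<sigma>)
  then show ?case by (simp add: iso_def zf_zero)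
next
  case (irr \<sigma>)
  let ?\<chi> = "restrict (chr \<sigma>) (carrier G)"
  have i: "?\<chi> \<in> IrrC" using irr by (auto simp: IrrC_def)
  have eq: "(\<forall>g\<in>carrier G. \<phi> g = chr \<sigma> g) \<longleftrightarrow> \<phi> = ?\<chi>" if "\<phi> \<in> IrrC" for \<phi>
    using IrrC_eqI[OF that i] by auto
  have "(\<Sum>\<phi>\<in>IrrC. ((\<Sum>g\<in>carrier G. f g * \<phi> g) / \<phi> \<one>) \<star> iso \<phi> \<sigma>)
     = (\<Sum>\<phi>\<in>IrrC. if \<phi> = ?\<chi> then ((\<Sum>g\<in>carrier G. f g * ?\<chi> g) / ?\<chi> \<one>) \<star> \<sigma> \<one> else 0)"
  proof (intro sum.cong refl)
    fix \<phi> assume p: "\<phi> \<in> IrrC"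
    show "((\<Sum>g\<in>carrier G. f g * \<phi> g) / \<phi> \<one>) \<star> iso \<phi> \<sigma> = (if \<phi> = ?\<chi> then ((\<Sum>g\<in>carrier G. f g * ?\<chi> g) / ?\<chi> \<one>) \<star> \<sigma> \<one> else 0)"
      using iso_irr[OF p irr] eq[OF p] by simp
  qed
  also have "\<dots> = ((\<Sum>g\<in>carrier G. f g * ?\<chi> g) / ?\<chi> \<one>) \<star> \<sigma> \<one>" using i finite_IrrC by (simp add: sum.delta)
  also have "\<dots> = zf f \<sigma>" unfolding zf_irr[OF assms(1) irr] by (simp add: chr_def cong: sum.cong)
  finally show ?case by simp
next
  case (split \<sigma> E)
  from split(4) have 1: "E * zf f \<sigma> = E * (\<Sum>\<phi>\<in>IrrC. ((\<Sum>g\<in>carrier G. f g * \<phi> g) / \<phi> \<one>) \<star> iso \<phi> \<sigma>)"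
    by (simp add: zf_left iso_left sum_distrib_left)
  from split(5) have 2: "zf f \<sigma> - E * zf f \<sigma> = (\<Sum>\<phi>\<in>IrrC. ((\<Sum>g\<in>carrier G. f g * \<phi> g) / \<phi> \<one>) \<star> iso \<phi> \<sigma>)
     - E * (\<Sum>\<phi>\<in>IrrC. ((\<Sum>g\<in>carrier G. f g * \<phi> g) / \<phi> \<one>) \<star> iso \<phi> \<sigma>)"
    by (simp add: zf_left iso_left iso_diff zf_diff sum_distrib_left sum_subtractf sc_diff)
  from 1 2 show ?case by simp
qed

text \<open>The delta function at the unit is a class function that acts as the unit, and its
  coefficient on every isotypic part is 1.\<close>

lemma iso_sum: assumes "rep \<sigma>" shows "(\<Sum>\<phi>\<in>IrrC. iso \<phi> \<sigma>) = \<sigma> \<one>"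
proof -
  have cf: "class_fun (\<lambda>g. if g = \<one> then 1 else 0)"
    unfolding class_fun_def by (intro ballI) (metis inv_comm)
  have d: "(\<Sum>g\<in>carrier G. (if g = \<one> then 1 else 0) * \<phi> g) = \<phi> \<one>" for \<phi> :: "'a \<Rightarrow> complex"
    using fin by (simp add: if_distrib[of "\<lambda>x. x * _"] sum.delta cong: if_cong)
  have "zf (\<lambda>g. if g = \<one> then 1 else 0) \<sigma> = (\<Sum>g\<in>carrier G. if g = \<one> then \<sigma> \<one> else 0)"
    unfolding zf_def by (intro sum.cong) auto
  also have "\<dots> = \<sigma> \<one>" using fin by (simp add: sum.delta)
  finally have "\<sigma> \<one> = (\<Sum>\<phi>\<in>IrrC. (\<phi> \<one> / \<phi> \<one>) \<star> iso \<phi> \<sigma>)"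
    using zf_expand[OF cf assms] by (simp only: d)
  also have "\<dots> = (\<Sum>\<phi>\<in>IrrC. iso \<phi> \<sigma>)" using IrrC_one_nz by (intro sum.cong) auto
  finally show ?thesis by simp
qed

lemma chr_expand: assumes "rep \<sigma>" "g \<in> carrier G"
  shows "chr \<sigma> g = (\<Sum>\<phi>\<in>IrrC. inner (chr \<sigma>) \<phi> * \<phi> g)"
proof -
  have "chr \<sigma> g = tr ((\<Sum>\<phi>\<in>IrrC. iso \<phi> \<sigma>) * \<sigma> g)" using assms by (simp add: iso_sum rep_one chr_def)
  also have "\<dots> = (\<Sum>\<phi>\<in>IrrC. tr (iso \<phi> \<sigma> * \<sigma> g))" by (simp add: sum_distrib_right tr_sum)
  finally show ?thesis using assms by (simp add: iso_tr cong: sum.cong)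
qed

end

section \<open>Finite groups of unimodular plane matrices\<close>

context fin_group
begin

section \<open>Eigenvalues of group elements\<close>

definition zet :: complex where "zet = cis (2 * pi / M)"

lemma zet_pow: "zet ^ k = cis (2 * pi * k / M)"
  by (simp add: zet_def DeMoivre mult_ac)
lemma zet_M: "zet ^ M = 1" by (simp add: zet_pow cis_2pi)
lemma cnj_zet: "cnj zet * zet = 1" "zet * cnj zet = 1"
  by (simp_all add: zet_def cis_cnj cis_mult)
lemma cnj_zet_pow: "cnj zet ^ k * zet ^ k = 1" "zet ^ k * cnj zet ^ k = 1"
  by (simp_all add: power_mult_distrib[symmetric] cnj_zet)
lemma cnj_zet_M: "cnj zet ^ M = 1" using zet_M by (metis complex_cnj_one complex_cnj_power)

lemma zet_eq_1: assumes "zet ^ k = 1" shows "M dvd k"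
proof -
  have "cis (2 * pi * k / M) = 1" using assms by (simp add: zet_pow)
  then have "cos (2 * pi * k / M) = 1" by (metis cis.sel(1) one_complex.sel(1))
  then obtain x :: int where "2 * pi * k / M = real_of_int x * 2 * pi" using cos_one_2pi_int by blast
  then have "real k = x * real M" using M_pos by (simp add: field_simps)
  then have "of_int (int k) = (of_int (x * int M) :: real)" by simp
  then have "int k = x * int M" by (simp only: of_int_eq_iff)
  then have "int M dvd int k" by simp
  then show ?thesis by presburger
qed

lemma root_sum: assumes "w ^ M = 1" shows "(\<Sum>i<M. w ^ i) = (if w = 1 then of_nat M else (0::complex))"
  using assms by (simp add: geometric_sum)

text \<open>The projector onto the eigenspace of \<open>\<sigma> g\<close> for
  \<open>zet ^ j\<close>, by Fourier inversion on the powers of g. A root of unity of order the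
  group order serves all elements at once.\<close>

definition cp :: "('a \<Rightarrow> fmat) \<Rightarrow> 'a \<Rightarrow> nat \<Rightarrow> fmat" where
  "cp \<sigma> g j = (1 / of_nat M) \<star> (\<Sum>i<M. cnj zet ^ (i * j) \<star> \<sigma> (g [^] i))"

lemma pow_M: "g \<in> carrier G \<Longrightarrow> g [^] M = \<one>"
  using pow_eq_id[of g "M"] ord_dvd_group_order[of g] by (simp add: Coset.order_def)

lemma sum_cyclic_shift: assumes "f M = f (0::nat)" shows "(\<Sum>i<M. f (Suc i)) = (\<Sum>i<M. f i :: fmat)"
proof -
  have "f 0 + (\<Sum>i<M. f (Suc i)) = sum f {..<Suc M}" by (rule sum.lessThan_Suc_shift[symmetric])
  also have "\<dots> = (\<Sum>i<M. f i) + f M" by (rule sum.lessThan_Suc)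
  finally have "f 0 + (\<Sum>i<M. f (Suc i)) = (\<Sum>i<M. f i) + f M" .
  then show ?thesis using assms by simp
qed

lemma cp_shift: assumes "rep \<sigma>" "g \<in> carrier G"
  shows "\<sigma> g * cp \<sigma> g j = zet ^ j \<star> cp \<sigma> g j"
proof -
  define f where "f i = cnj zet ^ (i * j) \<star> \<sigma> (g [^] i)" for i :: nat
  have f: "\<sigma> g * f i = zet ^ j \<star> f (Suc i)" for i
  proof -
    have "\<sigma> g * \<sigma> (g [^] i) = \<sigma> (g [^] Suc i)" using assms by (metis nat_pow_Suc2 nat_pow_closed rep_mult)
    moreover have "zet ^ j * cnj zet ^ (Suc i * j) = cnj zet ^ (i * j)"
      by (simp add: power_add mult.assoc[symmetric] cnj_zet_pow)
    ultimately show ?thesis by (simp add: f_def)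
  qed
  have "f M = f 0" using assms by (simp add: f_def pow_M power_mult cnj_zet_M)
  then have "\<sigma> g * (\<Sum>i<M. f i) = zet ^ j \<star> (\<Sum>i<M. f i)"
    by (simp add: sum_distrib_left f sc_sum[symmetric] sum_cyclic_shift)
  then show ?thesis by (simp add: cp_def f_def mult.commute)
qed

lemma cp_one: assumes "rep \<sigma>" "g \<in> carrier G"
  shows "\<sigma> \<one> * cp \<sigma> g j = cp \<sigma> g j"
  using assms by (simp add: cp_def sum_distrib_left rep_one)

lemma cp_pow: assumes "rep \<sigma>" "g \<in> carrier G"
  shows "\<sigma> (g [^] (i::nat)) * cp \<sigma> g j = zet ^ (i * j) \<star> cp \<sigma> g j"
proof (induction i)
  case 0
  then show ?case using cp_one[OF assms] by simp
next
  case (Suc i)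
  have "\<sigma> (g [^] Suc i) = \<sigma> (g [^] i) * \<sigma> g" using assms by (simp add: rep_mult)
  then show ?case using Suc cp_shift[OF assms] by (simp add: mult.assoc power_add mult.commute)
qed

lemma cp_idem: assumes "rep \<sigma>" "g \<in> carrier G"
  shows "cp \<sigma> g j * cp \<sigma> g j = cp \<sigma> g j"
proof -
  have "cp \<sigma> g j * cp \<sigma> g j = (1 / of_nat M) \<star> (\<Sum>i<M. cnj zet ^ (i * j) \<star> (\<sigma> (g [^] i) * cp \<sigma> g j))"
    by (subst (1) cp_def) (simp add: sum_distrib_right)
  also have "\<dots> = (1 / of_nat M) \<star> (\<Sum>i<M. cp \<sigma> g j)"
    by (simp add: cp_pow[OF assms] cnj_zet_pow)
  also have "\<dots> = cp \<sigma> g j" by (rule fmat_eqI) simp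
  finally show ?thesis .
qed

lemma cp_sum: assumes "rep \<sigma>" "g \<in> carrier G"
  shows "(\<Sum>j<M. cp \<sigma> g j) = \<sigma> \<one>"
proof -
  have r: "(\<Sum>j<M. cnj zet ^ (i * j)) = (if i = 0 then of_nat M else 0)" if i: "i < M" for i
  proof -
    have w: "(cnj zet ^ i) ^ M = 1" by (metis cnj_zet_M mult.commute power_mult power_one)
    have "cnj zet ^ i = 1 \<longleftrightarrow> i = 0"
    proof
      assume "cnj zet ^ i = 1"
      then have "zet ^ i = 1" using cnj_zet_pow(1)[of i] by simp
      then show "i = 0" using zet_eq_1 i by (meson dvd_imp_le leD neq0_conv)
    qed simp
    then show ?thesis using root_sum[OF w] by (simp add: power_mult)
  qed
  have "(\<Sum>j<M. cp \<sigma> g j) = (1 / of_nat M) \<star> (\<Sum>i<M. (\<Sum>j<M. cnj zet ^ (i * j)) \<star> \<sigma> (g [^] i))"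
    unfolding cp_def sc_sum[symmetric] sc_sum_left by (subst sum.swap) simp
  also have "\<dots> = (1 / of_nat M) \<star> (\<Sum>i<M. if i = 0 then of_nat M \<star> \<sigma> \<one> else 0)"
    by (intro arg_cong[of _ _ "\<lambda>x. _ \<star> x"] sum.cong refl) (auto simp: r)
  also have "\<dots> = \<sigma> \<one>" using M_pos by (simp add: sum.delta)
  finally show ?thesis .
qed

lemma cp_expand: assumes "rep \<sigma>" "g \<in> carrier G"
  shows "\<sigma> (g [^] (i::nat)) = (\<Sum>j<M. zet ^ (i * j) \<star> cp \<sigma> g j)"
proof -
  have "\<sigma> (g [^] i) = \<sigma> (g [^] i) * (\<Sum>j<M. cp \<sigma> g j)" using assms by (simp add: cp_sum rep_one)
  also have "\<dots> = (\<Sum>j<M. zet ^ (i * j) \<star> cp \<sigma> g j)" by (simp add: sum_distrib_left cp_pow[OF assms])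
  finally show ?thesis .
qed

definition cn :: "('a \<Rightarrow> fmat) \<Rightarrow> 'a \<Rightarrow> nat \<Rightarrow> nat" where
  "cn \<sigma> g j = (SOME m. tr (cp \<sigma> g j) = of_nat m)"
lemma cn: assumes "rep \<sigma>" "g \<in> carrier G" shows "tr (cp \<sigma> g j) = of_nat (cn \<sigma> g j)"
  unfolding cn_def by (rule someI_ex) (rule tr_idem[OF cp_idem[OF assms]])

lemma chr_pow: assumes "rep \<sigma>" "g \<in> carrier G"
  shows "chr \<sigma> (g [^] (i::nat)) = (\<Sum>j<M. zet ^ (i * j) * of_nat (cn \<sigma> g j))"
  unfolding chr_def cp_expand[OF assms] by (simp add: tr_sum cn[OF assms])

lemma chr_inv: assumes "rep \<sigma>" "g \<in> carrier G" shows "chr \<sigma> (inv g) = cnj (chr \<sigma> g)"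
proof -
  have "g [^] (M - 1) \<otimes> g = \<one>" using pow_M[OF assms(2)] M_pos
    by (metis Suc_diff_1 nat_pow_Suc)
  then have i: "inv g = g [^] (M - 1)" using assms by (metis inv_equality nat_pow_closed)
  have "zet ^ (M - 1) * zet = 1" using zet_M M_pos by (metis Suc_diff_1 power_Suc2)
  then have "zet ^ (M - 1) = cnj zet" using cnj_zet by (metis mult.assoc mult.right_neutral mult_1)
  then have "zet ^ ((M - 1) * j) = cnj (zet ^ j)" for j by (simp add: power_mult)
  then show ?thesis unfolding i chr_pow[OF assms] using chr_pow[OF assms, of 1] assms by simp
qed

lemma IrrC_inv: assumes "\<phi> \<in> IrrC" "g \<in> carrier G" shows "\<phi> (inv g) = cnj (\<phi> g)"
proof -
  obtain \<rho> where r: "irr \<rho>" "\<And>g. g \<in> carrier G \<Longrightarrow> \<phi> g = chr \<rho> g" using IrrC_E[OF assms(1)] by metis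
  then show ?thesis using assms chr_inv[of \<rho> g] by (simp add: irr_def)
qed

lemma inner_cnj: assumes "\<psi> \<in> IrrC"
  shows "inner \<phi> \<psi> = (\<Sum>g\<in>carrier G. \<phi> g * cnj (\<psi> g)) / of_nat M"
  using assms by (simp add: inner_def IrrC_inv cong: sum.cong)

text \<open>The eigenvalues are roots of unity, so their sum can equal their number only if each of
  them is 1. For the plane this says that the standard character is 2 only at the unit.\<close>

lemma chr_eq_degree: assumes "rep \<sigma>" "g \<in> carrier G" "chr \<sigma> g = chr \<sigma> \<one>" shows "\<sigma> g = \<sigma> \<one>"
proof -
  have g1: "chr \<sigma> g = (\<Sum>j<M. zet ^ j * of_nat (cn \<sigma> g j))" using chr_pow[OF assms(1,2), of 1] assms(2) by simp
  have g0: "chr \<sigma> \<one> = (\<Sum>j<M. of_nat (cn \<sigma> g j))" using chr_pow[OF assms(1,2), of 0] by simp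
  have "(\<Sum>j<M. (1 - Re (zet ^ j)) * real (cn \<sigma> g j)) = 0"
    using arg_cong[OF assms(3)[unfolded g1 g0], of Re] by (simp add: algebra_simps sum_subtractf)
  moreover have nn: "(1 - Re (zet ^ j)) * real (cn \<sigma> g j) \<ge> 0" for j
    by (simp add: zet_pow)
  ultimately have z: "(1 - Re (zet ^ j)) * real (cn \<sigma> g j) = 0" if "j < M" for j
    using that by (subst (asm) sum_nonneg_eq_0_iff) auto
  have p: "zet ^ j \<star> cp \<sigma> g j = cp \<sigma> g j" if j: "j < M" for j
  proof (cases "Re (zet ^ j) = 1")
    case True
    then have "zet ^ j = 1" unfolding zet_pow
      by (auto simp: complex_eq_iff) (metis cos_one_sin_zero)
    then show ?thesis by simp
  next
    case False
    then have t: "tr (cp \<sigma> g j) = 0" using z[OF j] cn[OF assms(1,2)] by simp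
    show ?thesis using tr_idem_0[OF cp_idem[OF assms(1,2)] t] by simp
  qed
  have "\<sigma> g = (\<Sum>j<M. zet ^ j \<star> cp \<sigma> g j)" using cp_expand[OF assms(1,2), of 1] assms(2) by simp
  also have "\<dots> = (\<Sum>j<M. cp \<sigma> g j)" using p by (intro sum.cong) auto
  finally show ?thesis using cp_sum[OF assms(1,2)] by simp
qed

end

definition ublk :: "nat \<Rightarrow> nat \<Rightarrow> fmat \<Rightarrow> fmat" where
  "ublk p q X = Abs_fmat (\<lambda>i j. ent X (prod_encode (p, i)) (prod_encode (q, j)))"

lemma ent_ublk: "ent (ublk p q X) i j = ent X (prod_encode (p, i)) (prod_encode (q, j))"
proof -
  obtain N where N: "bd X N" using bd_ex by blast
  have "fbounded (\<lambda>i j. ent X (prod_encode (p, i)) (prod_encode (q, j))) N"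
    unfolding fbounded_def using bdD[OF N] le_prod_encode_2 order_trans by blast
  then show ?thesis unfolding ublk_def by (simp add: ent_Abs)
qed

lemma blk_eu: "blk p q (eu i j) = eu (prod_encode (p, i)) (prod_encode (q, j))"
proof (rule fmat_eqI)
  fix x y
  obtain a b where x: "x = prod_encode (a, b)" by (metis prod_decode_inverse surj_pair)
  obtain c d where y: "y = prod_encode (c, d)" by (metis prod_decode_inverse surj_pair)
  show "ent (blk p q (eu i j)) x y = ent (eu (prod_encode (p, i)) (prod_encode (q, j))) x y"
    unfolding x y by (auto simp: ent_blk ent_eu)
qed

text \<open>Recovers the components of an equivariant map between representations that are put
  together from blocks.\<close>

lemma blk_ublk: "blk p p e * X * blk q q f = blk p q (e * ublk p q X * f)"
proof -
  obtain N where N: "bd e N" "bd f N" using bd_ex2 by blast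
  have s: "blk p p (eu i j) * X * blk q q (eu k l) = blk p q (eu i j * ublk p q X * eu k l)" for i j k l
    by (simp add: blk_eu eu_sandwich ent_ublk blk_sc)
  have "blk p p (\<Sum>i<N. \<Sum>j<N. ent e i j \<star> eu i j) * X * blk q q (\<Sum>i<N. \<Sum>j<N. ent f i j \<star> eu i j)
    = blk p q ((\<Sum>i<N. \<Sum>j<N. ent e i j \<star> eu i j) * ublk p q X * (\<Sum>i<N. \<Sum>j<N. ent f i j \<star> eu i j))"
    by (simp add: blk_sum blk_sc sum_distrib_left sum_distrib_right s)
  then show ?thesis using fmat_expand[OF N(1)] fmat_expand[OF N(2)] by simp
qed

text \<open>The embedding into the unimodular group is recorded by its four entries, since
  equivariance of a pair of matrices mixes the two with scalar coefficients.\<close>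

locale sl2_group = fin_group G for G (structure) +
  fixes ga gb gc gd :: "'a \<Rightarrow> complex"
  assumes m: "x \<in> carrier G \<Longrightarrow> y \<in> carrier G \<Longrightarrow> ga (x \<otimes> y) = ga x * ga y + gb x * gc y"
    "x \<in> carrier G \<Longrightarrow> y \<in> carrier G \<Longrightarrow> gb (x \<otimes> y) = ga x * gb y + gb x * gd y"
    "x \<in> carrier G \<Longrightarrow> y \<in> carrier G \<Longrightarrow> gc (x \<otimes> y) = gc x * ga y + gd x * gc y"
    "x \<in> carrier G \<Longrightarrow> y \<in> carrier G \<Longrightarrow> gd (x \<otimes> y) = gc x * gb y + gd x * gd y"
    and det1: "x \<in> carrier G \<Longrightarrow> ga x * gd x - gb x * gc x = 1"
    and one: "ga \<one> = 1" "gb \<one> = 0" "gc \<one> = 0" "gd \<one> = 1"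
    and faithful: "x \<in> carrier G \<Longrightarrow> ga x = 1 \<Longrightarrow> gb x = 0 \<Longrightarrow> gc x = 0 \<Longrightarrow> gd x = 1 \<Longrightarrow> x = \<one>"
    and nontriv: "carrier G \<noteq> {\<one>}"
begin

lemma inv_entries: assumes x: "x \<in> carrier G"
  shows "ga (inv x) = gd x" "gb (inv x) = - gb x" "gc (inv x) = - gc x" "gd (inv x) = ga x"
proof -
  have e: "ga (inv x) * ga x + gb (inv x) * gc x = 1" "ga (inv x) * gb x + gb (inv x) * gd x = 0"
    "gc (inv x) * ga x + gd (inv x) * gc x = 0" "gc (inv x) * gb x + gd (inv x) * gd x = 1"
    using m[of "inv x" x] x one by simp_all
  note d = det1[OF x]
  have "ga (inv x) = ga (inv x) * (ga x * gd x - gb x * gc x)" using d by simp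
  also have "\<dots> = (ga (inv x) * ga x + gb (inv x) * gc x) * gd x - (ga (inv x) * gb x + gb (inv x) * gd x) * gc x"
    by (simp add: algebra_simps)
  finally show "ga (inv x) = gd x" using e by simp
  have "gb (inv x) = gb (inv x) * (ga x * gd x - gb x * gc x)" using d by simp
  also have "\<dots> = (ga (inv x) * gb x + gb (inv x) * gd x) * ga x - (ga (inv x) * ga x + gb (inv x) * gc x) * gb x"
    by (simp add: algebra_simps)
  finally show "gb (inv x) = - gb x" using e by simp
  have "gc (inv x) = gc (inv x) * (ga x * gd x - gb x * gc x)" using d by simp
  also have "\<dots> = (gc (inv x) * ga x + gd (inv x) * gc x) * gd x - (gc (inv x) * gb x + gd (inv x) * gd x) * gc x"
    by (simp add: algebra_simps)
  finally show "gc (inv x) = - gc x" using e by simp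
  have "gd (inv x) = gd (inv x) * (ga x * gd x - gb x * gc x)" using d by simp
  also have "\<dots> = (gc (inv x) * gb x + gd (inv x) * gd x) * ga x - (gc (inv x) * ga x + gd (inv x) * gc x) * gb x"
    by (simp add: algebra_simps)
  finally show "gd (inv x) = ga x" using e by simp
qed

section \<open>The standard character\<close>

definition st :: "'a \<Rightarrow> complex" where "st g = ga g + gd g"

definition stdr :: "'a \<Rightarrow> fmat" where
  "stdr g = ga g \<star> eu 0 0 + gb g \<star> eu 0 1 + gc g \<star> eu 1 0 + gd g \<star> eu 1 1"

lemma stdr_rep: "rep stdr"
  unfolding rep_def stdr_def by (auto simp: algebra_simps m sc_add_left sc_add)
lemma chr_stdr: "chr stdr g = st g"
  by (simp add: chr_def stdr_def st_def tr_add)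
lemma stdr_eq: "ga g = ent (stdr g) 0 0" "gb g = ent (stdr g) 0 1" "gc g = ent (stdr g) 1 0" "gd g = ent (stdr g) 1 1"
  by (simp_all add: stdr_def ent_eu)

lemma st_one: "st \<one> = 2" by (simp add: st_def one)
lemma st_inv: "g \<in> carrier G \<Longrightarrow> st (inv g) = st g" by (simp add: st_def inv_entries)
lemma st_class: "class_fun st" by (simp add: class_fun_def st_def m algebra_simps)
lemma st_cnj: "g \<in> carrier G \<Longrightarrow> cnj (st g) = st g"
  using chr_inv[OF stdr_rep] st_inv by (simp add: chr_stdr)

lemma st_2: assumes "g \<in> carrier G" "st g = 2" shows "g = \<one>"
proof -
  have e: "stdr g = stdr \<one>" using chr_eq_degree[OF stdr_rep assms(1)] assms by (simp add: chr_stdr st_one)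
  show ?thesis by (rule faithful[OF assms(1)]) (simp_all only: stdr_eq e, simp_all only: stdr_eq[symmetric] one)
qed

text \<open>Multiplicities of total 2 become two eigenvalue exponents, possibly equal, which can
  then be handled separately.\<close>

lemma two_points:
  fixes n :: "nat \<Rightarrow> nat"
  assumes "(\<Sum>j<K. n j) = 2"
  shows "\<exists>a b. a < K \<and> b < K \<and> (\<forall>f :: nat \<Rightarrow> complex. (\<Sum>j<K. f j * of_nat (n j)) = f a + f b)"
proof -
  have one: "\<exists>a<K. n a > 0 \<and> (\<Sum>j<K. (n(a := n a - 1)) j) = s" if "(\<Sum>j<K. n j) = Suc s" for n :: "nat \<Rightarrow> nat" and s
  proof -
    have "\<exists>a\<in>{..<K}. n a \<noteq> 0"
    proof (rule ccontr)
      assume "\<not> (\<exists>a\<in>{..<K}. n a \<noteq> 0)"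
      then have "(\<Sum>j<K. n j) = 0" by (intro sum.neutral) blast
      then show False using that by simp
    qed
    then obtain a where a: "a < K" "n a > 0" by blast
    have "(\<Sum>j<K. n j) = n a + (\<Sum>j\<in>{..<K} - {a}. n j)" by (rule sum.remove) (use a in auto)
    moreover have "(\<Sum>j<K. (n(a := n a - 1)) j) = (n a - 1) + (\<Sum>j\<in>{..<K} - {a}. (n(a := n a - 1)) j)"
      by (subst sum.remove[of _ a]) (use a in auto)
    moreover have "(\<Sum>j\<in>{..<K} - {a}. (n(a := n a - 1)) j) = (\<Sum>j\<in>{..<K} - {a}. n j)"
      by (intro sum.cong) auto
    ultimately have "(\<Sum>j<K. (n(a := n a - 1)) j) = s" using a that by simp
    then show ?thesis using a by blast
  qed
  have f: "(\<Sum>j<K. f j * of_nat (n j)) = f a + (\<Sum>j<K. f j * of_nat ((n(a := n a - 1)) j))"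
    if "a < K" "n a > 0" for n :: "nat \<Rightarrow> nat" and a and f :: "nat \<Rightarrow> complex"
  proof -
    have "(\<Sum>j<K. f j * of_nat ((n(a := n a - 1)) j)) = (\<Sum>j<K. f j * of_nat (n j) - (if j = a then f a else 0))"
      using that by (intro sum.cong) (auto simp: of_nat_diff algebra_simps)
    then show ?thesis using that by (simp add: sum_subtractf sum.delta)
  qed
  obtain a where a: "a < K" "n a > 0" "(\<Sum>j<K. (n(a := n a - 1)) j) = 1" using one[of n 1] assms by auto
  obtain b where b: "b < K" "(n(a := n a - 1)) b > 0"
    "(\<Sum>j<K. ((n(a := n a - 1))(b := (n(a := n a - 1)) b - 1)) j) = 0" using one[of "n(a := n a - 1)" 0] a by auto
  have z: "((n(a := n a - 1))(b := (n(a := n a - 1)) b - 1)) j = 0" if "j < K" for j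
    using b(3) that by (subst (asm) sum_eq_0_iff) auto
  have "(\<Sum>j<K. f j * of_nat (n j)) = f a + f b" for f :: "nat \<Rightarrow> complex"
    using f[where n = n and a = a and f = f, OF a(1,2)] f[where n = "n(a := n a - 1)" and a = b and f = f, OF b(1,2)] z by simp
  then show ?thesis using a b by blast
qed

lemma st_pow: assumes g: "g \<in> carrier G"
  shows "\<exists>a. \<forall>i. st (g [^] (i::nat)) = zet ^ (i * a) + cnj zet ^ (i * a)"
proof -
  have "of_nat (\<Sum>j<M. cn stdr g j) = (of_nat 2 :: complex)"
    using chr_pow[OF stdr_rep g, of 0] by (simp add: chr_stdr st_one)
  then have "(\<Sum>j<M. cn stdr g j) = 2" by (simp only: of_nat_eq_iff)
  then obtain a b where ab: "\<And>f :: nat \<Rightarrow> complex. (\<Sum>j<M. f j * of_nat (cn stdr g j)) = f a + f b"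
    using two_points by metis
  have s: "st (g [^] i) = zet ^ (i * a) + zet ^ (i * b)" for i :: nat
    using chr_pow[OF stdr_rep g, of i] by (simp add: chr_stdr ab)
  have g2: "g [^] (2::nat) = g \<otimes> g" using g by (simp add: numeral_2_eq_2)
  \<comment> \<open>Newton's identity in size 2: the square of the trace minus the trace of the
    square is twice the determinant. Hence the two eigenvalues are inverse to each other.\<close>
  have "st g * st g - st (g \<otimes> g) = 2 * (ga g * gd g - gb g * gc g)"
    using g by (simp add: st_def m algebra_simps)
  then have "st g * st g - st (g \<otimes> g) = 2" using det1[OF g] by simp
  moreover have "st g = zet ^ a + zet ^ b" using s[of 1] g by simp
  moreover have "st (g \<otimes> g) = zet ^ a * zet ^ a + zet ^ b * zet ^ b"
    using s[of 2] g2 by (simp add: mult_2 power_add)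
  ultimately have "zet ^ a * zet ^ b = 1" by (simp add: algebra_simps)
  then have "zet ^ b = cnj zet ^ a" using cnj_zet_pow(1)[of a] by (metis mult.assoc mult.right_neutral mult_1)
  then have "zet ^ (i * b) = cnj zet ^ (i * a)" for i by (metis mult.commute power_mult)
  then show ?thesis using s by auto
qed

lemma st_real_le: assumes g: "g \<in> carrier G" shows "Im (st g) = 0" "Re (st g) \<le> 2" "g \<noteq> \<one> \<Longrightarrow> Re (st g) < 2"
proof -
  show im: "Im (st g) = 0" using st_cnj[OF g] by (metis Im_complex_of_real complex_cnj_cancel_iff Reals_cnj_iff complex_is_Real_iff)
  obtain a where a: "\<And>i. st (g [^] (i::nat)) = zet ^ (i * a) + cnj zet ^ (i * a)" using st_pow[OF g] by blast
  have "st g = zet ^ a + cnj (zet ^ a)" using a[of 1] g by simp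
  moreover have "Re (zet ^ a) \<le> 1" by (simp add: zet_pow)
  ultimately show le: "Re (st g) \<le> 2" by (simp del: complex_cnj_power)
  show "Re (st g) < 2" if "g \<noteq> \<one>"
  proof (rule ccontr)
    assume "\<not> Re (st g) < 2"
    then have "st g = 2" using le im by (simp add: complex_eq_iff)
    then show False using st_2[OF g] that by simp
  qed
qed

text \<open>The tensor product with the dual of the standard representation, in blocks 1 and 2; since
  the determinant is 1 the character is that of the tensor product with the standard one.\<close>

definition tens :: "('a \<Rightarrow> fmat) \<Rightarrow> 'a \<Rightarrow> fmat" where
  "tens \<sigma> g = gd g \<star> blk 1 1 (\<sigma> g) - gc g \<star> blk 1 2 (\<sigma> g) - gb g \<star> blk 2 1 (\<sigma> g) + ga g \<star> blk 2 2 (\<sigma> g)"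

lemma tens_rep: "rep \<sigma> \<Longrightarrow> rep (tens \<sigma>)"
  unfolding rep_def tens_def by (auto simp: algebra_simps blk_mult m sc_add_left sc_add sc_diff)
lemma chr_tens: "chr (tens \<sigma>) g = chr \<sigma> g * st g"
  by (simp add: chr_def tens_def tr_add tr_diff tr_blk st_def algebra_simps)
lemma tens_one: "tens \<sigma> \<one> = blk 1 1 (\<sigma> \<one>) + blk 2 2 (\<sigma> \<one>)"
  by (simp add: tens_def one)

section \<open>The McKay graph\<close>

definition mm :: "('a \<Rightarrow> complex) \<Rightarrow> ('a \<Rightarrow> complex) \<Rightarrow> complex" where
  "mm \<phi> \<psi> = inner (\<lambda>g. \<phi> g * st g) \<psi>"

lemma mm_nat: assumes "\<phi> \<in> IrrC" "\<psi> \<in> IrrC" shows "\<exists>k. mm \<phi> \<psi> = of_nat k"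
proof -
  obtain \<rho> where r: "irr \<rho>" "\<And>g. g \<in> carrier G \<Longrightarrow> \<phi> g = chr \<rho> g" using IrrC_E[OF assms(1)] by metis
  then have "mm \<phi> \<psi> = inner (chr (tens \<rho>)) \<psi>" unfolding mm_def by (intro inner_cong) (simp_all add: chr_tens)
  then show ?thesis using inner_nat[OF assms(2) tens_rep] r by (simp add: irr_def)
qed

lemma mm_sym: "mm \<phi> \<psi> = mm \<psi> \<phi>"
proof -
  have "mm \<phi> \<psi> = (\<Sum>g\<in>carrier G. \<phi> (inv g) * st (inv g) * \<psi> (inv (inv g))) / of_nat M"
    unfolding mm_def inner_def by (subst sum_inv[of "\<lambda>g. \<phi> g * st g * \<psi> (inv g)"]) simp
  also have "\<dots> = mm \<psi> \<phi>" unfolding mm_def inner_def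
    by (intro arg_cong2[of _ _ _ _ "(/)"] sum.cong) (auto simp: st_inv)
  finally show ?thesis .
qed

lemma mm_expand: assumes "\<phi> \<in> IrrC" "g \<in> carrier G" shows "\<phi> g * st g = (\<Sum>\<psi>\<in>IrrC. mm \<phi> \<psi> * \<psi> g)"
proof -
  obtain \<rho> where r: "irr \<rho>" "\<And>g. g \<in> carrier G \<Longrightarrow> \<phi> g = chr \<rho> g" using IrrC_E[OF assms(1)] by metis
  then have "mm \<phi> \<psi> = inner (chr (tens \<rho>)) \<psi>" for \<psi> unfolding mm_def by (intro inner_cong) (simp_all add: chr_tens)
  then show ?thesis using chr_expand[OF tens_rep assms(2), of \<rho>] r assms(2) by (simp add: irr_def chr_tens)
qed

lemma IrrC_deg: assumes "\<phi> \<in> IrrC" shows "\<exists>k>0. \<phi> \<one> = of_nat k"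
proof -
  obtain \<rho> where r: "irr \<rho>" "\<And>g. g \<in> carrier G \<Longrightarrow> \<phi> g = chr \<rho> g" using IrrC_E[OF assms(1)] by metis
  obtain k where k: "\<phi> \<one> = of_nat k" using tr_idem[OF rep_idem, of \<rho>] r by (auto simp: chr_def irr_def)
  then show ?thesis using IrrC_one_nz[OF assms] by (intro exI[of _ k]) auto
qed

definition triv :: "'a \<Rightarrow> complex" where "triv = restrict (\<lambda>g. 1) (carrier G)"

lemma triv_irr: "irr (\<lambda>g. eu 0 0)"
  unfolding irr_def
proof (intro conjI allI impI)
  show "rep (\<lambda>g. eu 0 0)" by (simp add: rep_def)
  show "eu 0 0 \<noteq> 0" using tr_eu[of 0 0] by (metis tr_zero zero_neq_one)
  fix E assume E: "intw (\<lambda>g. eu 0 0) (\<lambda>g. eu 0 0) E \<and> E * E = E"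
  then have "E = eu 0 0 * E * eu 0 0" by (simp add: intw_def mult.assoc)
  then have e: "E = ent E 0 0 \<star> eu 0 0" by (simp only: eu_sandwich)
  then have "(ent E 0 0 * ent E 0 0) \<star> eu 0 0 = ent E 0 0 \<star> eu 0 0" using E
    by (metis eu_eu sc_mult_left sc_mult_right sc_sc)
  then have "ent E 0 0 * ent E 0 0 = ent E 0 0" by (metis ent_eu ent_sc mult.right_neutral)
  then have "ent E 0 0 = 0 \<or> ent E 0 0 = 1" by auto
  then show "E = 0 \<or> E = eu 0 0" using e by (metis sc_one sc_zero_left)
qed

lemma triv_IrrC: "triv \<in> IrrC"
  unfolding IrrC_def triv_def using triv_irr by (auto intro!: exI[of _ "\<lambda>g. eu 0 0"] simp: chr_def)

lemma mm_row_sum: assumes "\<phi> \<in> IrrC" shows "(\<Sum>\<psi>\<in>IrrC. mm \<phi> \<psi> * \<psi> \<one>) = 2 * \<phi> \<one>"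
  using mm_expand[OF assms one_closed] by (simp add: st_one mult.commute)

text \<open>The invariant symplectic form identifies the plane with its dual: an equivariant map
  into the tensor product with components \<open>A1\<close>, \<open>A2\<close> transposes to an
  equivariant map out of it with components \<open>A2\<close>, \<open>- A1\<close>.\<close>

lemma intw_pair:
  assumes T: "intw (\<lambda>g. blk 0 0 (\<rho> g)) (tens \<rho>) (blk 1 0 A1 + blk 2 0 A2)" and r: "rep \<rho>"
  shows "intw (tens \<rho>) (\<lambda>g. blk 0 0 (\<rho> g)) (blk 0 1 A2 - blk 0 2 A1)"
proof -
  have ex: "A = A' \<and> B = B'" if "blk 1 0 A + blk 2 0 B = blk 1 0 A' + blk 2 0 B'" for A B A' B'
  proof -
    have "ublk 1 0 (blk 1 0 A + blk 2 0 B) = A" "ublk 2 0 (blk 1 0 A + blk 2 0 B) = B" for A B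
      by (rule fmat_eqI, simp add: ent_ublk ent_blk)+
    then show ?thesis using that by metis
  qed
  have rA: "A1 * \<rho> \<one> = A1 \<and> A2 * \<rho> \<one> = A2"
    using T by (intro ex) (simp add: intw_def algebra_simps blk_mult)
  have lA: "\<rho> \<one> * A1 = A1 \<and> \<rho> \<one> * A2 = A2"
    using T by (intro ex) (simp add: intw_def algebra_simps blk_mult tens_one)
  have e: "gd g \<star> (\<rho> g * A1) - gc g \<star> (\<rho> g * A2) = A1 * \<rho> g \<and> ga g \<star> (\<rho> g * A2) - gb g \<star> (\<rho> g * A1) = A2 * \<rho> g"
    if g: "g \<in> carrier G" for g
    using intw_comm[OF T g] by (intro ex) (simp add: tens_def algebra_simps blk_mult blk_diff blk_sc)
  have e1: "\<rho> g * A1 = ga g \<star> (A1 * \<rho> g) + gc g \<star> (A2 * \<rho> g)"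
   and e2: "\<rho> g * A2 = gb g \<star> (A1 * \<rho> g) + gd g \<star> (A2 * \<rho> g)" if g: "g \<in> carrier G" for g
  proof -
    let ?x = "\<rho> g * A1" and ?y = "\<rho> g * A2"
    have "ga g \<star> (A1 * \<rho> g) + gc g \<star> (A2 * \<rho> g) = (ga g * gd g - gb g * gc g) \<star> ?x"
      unfolding conjunct1[OF e[OF g], symmetric] conjunct2[OF e[OF g], symmetric]
      by (simp add: sc_diff sc_diff_left algebra_simps)
    then show "?x = ga g \<star> (A1 * \<rho> g) + gc g \<star> (A2 * \<rho> g)" using det1[OF g] by simp
    have "gb g \<star> (A1 * \<rho> g) + gd g \<star> (A2 * \<rho> g) = (ga g * gd g - gb g * gc g) \<star> ?y"
      unfolding conjunct1[OF e[OF g], symmetric] conjunct2[OF e[OF g], symmetric]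
      by (simp add: sc_diff sc_diff_left algebra_simps)
    then show "?y = gb g \<star> (A1 * \<rho> g) + gd g \<star> (A2 * \<rho> g)" using det1[OF g] by simp
  qed
  show ?thesis unfolding intw_def
  proof (intro conjI ballI)
    show "(blk 0 1 A2 - blk 0 2 A1) * tens \<rho> \<one> = blk 0 1 A2 - blk 0 2 A1"
      using rA by (simp add: tens_one algebra_simps blk_mult)
    show "blk 0 0 (\<rho> \<one>) * (blk 0 1 A2 - blk 0 2 A1) = blk 0 1 A2 - blk 0 2 A1"
      using lA by (simp add: algebra_simps blk_mult)
    fix g assume g: "g \<in> carrier G"
    show "blk 0 0 (\<rho> g) * (blk 0 1 A2 - blk 0 2 A1) = (blk 0 1 A2 - blk 0 2 A1) * tens \<rho> g"
      by (simp add: tens_def algebra_simps blk_mult e1[OF g] e2[OF g] blk_add blk_sc)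
  qed
qed

text \<open>Let \<open>T\<close> map \<rho> into its tensor product with the plane and let
  \<open>Tv\<close> be the symplectic transpose. Then \<open>Tv * T\<close> is a commutator, so its
  trace is 0, and Schur's lemma makes it vanish. With multiplicity one, \<open>T\<close> fills the
  whole \<rho>-part, so \<open>Tv\<close> would vanish altogether; but up to sign it has the same
  components as \<open>T\<close>.\<close>

lemma mm_ne_1: assumes "\<phi> \<in> IrrC" shows "mm \<phi> \<phi> \<noteq> 1"
proof
  assume m1: "mm \<phi> \<phi> = 1"
  obtain \<rho> where r: "irr \<rho>" "\<And>g. g \<in> carrier G \<Longrightarrow> \<phi> g = chr \<rho> g" using IrrC_E[OF assms(1)] by metis
  have rr: "rep \<rho>" using r by (simp add: irr_def)
  define \<rho>0 where "\<rho>0 = (\<lambda>g. blk 0 0 (\<rho> g))"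
  have c0: "chr \<rho>0 g = chr \<rho> g" for g by (simp add: chr_def \<rho>0_def tr_blk)
  have r0: "rep \<rho>0" using rr by (simp add: rep_def \<rho>0_def blk_mult)
  have tr: "rep (tens \<rho>)" by (rule tens_rep[OF rr])
  have m: "inner (chr (tens \<rho>)) \<phi> = 1" "inner (chr (tens \<rho>)) (chr \<rho>0) = 1"
    using m1 r(2) unfolding mm_def by (auto simp: chr_tens c0 intro!: inner_cong elim!: trans[rotated])
  obtain N N' where "\<forall>g\<in>carrier G. bd (tens \<rho> g) N" "\<forall>g\<in>carrier G. bd (\<rho>0 g) N'" using rep_bd by metis
  then have "\<And>g. g \<in> carrier G \<Longrightarrow> bd (tens \<rho> g) (max N N')" "\<And>g. g \<in> carrier G \<Longrightarrow> bd (\<rho>0 g) (max N N')"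
    using bd_mono by (meson max.cobounded1 max.cobounded2)+
  then have "(\<Sum>i<max N N'. \<Sum>j<max N N'. ent (avg (tens \<rho>) \<rho>0 (eu i j)) i j) = 1"
    using inner_as_avg[of "tens \<rho>" "max N N'" \<rho>0] m by simp
  then have "\<exists>i j. avg (tens \<rho>) \<rho>0 (eu i j) \<noteq> 0" by (auto intro: ccontr)
  then obtain T where T: "intw \<rho>0 (tens \<rho>) T" "T \<noteq> 0" using avg_intw[OF r0 tr] by blast
  define A1 where "A1 = \<rho> \<one> * ublk 1 0 T * \<rho> \<one>"
  define A2 where "A2 = \<rho> \<one> * ublk 2 0 T * \<rho> \<one>"
  have "T = tens \<rho> \<one> * T * \<rho>0 \<one>" using T by (simp add: intw_def mult.assoc)
  then have TA: "T = blk 1 0 A1 + blk 2 0 A2"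
    by (simp add: tens_one \<rho>0_def distrib_right blk_ublk A1_def A2_def)
  define Tv where "Tv = blk 0 1 A2 - blk 0 2 A1"
  have Tv: "intw (tens \<rho>) \<rho>0 Tv"
    using intw_pair[OF _ rr, of A1 A2] T(1) unfolding TA Tv_def \<rho>0_def by blast
  have i0: "irr \<rho>0"
    unfolding irr_def
  proof (intro conjI allI impI)
    show "rep \<rho>0" by (rule r0)
    show "\<rho>0 \<one> \<noteq> 0" using r(1) unfolding \<rho>0_def irr_def by (metis blk_inj blk_zero)
    fix E assume E: "intw \<rho>0 \<rho>0 E \<and> E * E = E"
    then have "E = \<rho>0 \<one> * E * \<rho>0 \<one>" by (simp add: intw_def mult.assoc)
    then obtain F where F: "E = blk 0 0 F" unfolding \<rho>0_def by (auto simp: blk_ublk)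
    have "intw \<rho> \<rho> F" "F * F = F"
      using E unfolding F \<rho>0_def intw_def by (auto simp: blk_mult dest: blk_inj)
    then show "E = 0 \<or> E = \<rho>0 \<one>" using r(1) unfolding irr_def F \<rho>0_def by auto
  qed
  have "Tv * T = blk 0 0 (A2 * A1 - A1 * A2)"
    by (simp add: Tv_def TA algebra_simps blk_mult blk_diff)
  moreover obtain c where c: "Tv * T = c \<star> \<rho>0 \<one>"
    using schur_scalar[OF i0 intw_mult[OF T(1) Tv]] by blast
  ultimately have "c * tr (\<rho>0 \<one>) = tr (A2 * A1) - tr (A1 * A2)"
    by (metis tr_blk tr_diff tr_sc)
  then have "c = 0" using tr_one_nz[OF i0] by (simp add: tr_comm)
  then have TvT: "Tv * T = 0" using c by simp
  obtain S where S: "intw (tens \<rho>) \<rho>0 S" "T * S * T = T" using quasi_intw[OF r0 tr T(1)] by blast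
  define P where "P = iso \<phi> (tens \<rho>)"
  have iP: "iso \<phi> \<rho>0 = \<rho>0 \<one>" using iso_irr[OF assms i0] r(2) by (simp add: c0)
  have move: "X * iso \<phi> \<alpha> = iso \<phi> \<beta> * X" if "intw \<alpha> \<beta> X" for X \<alpha> \<beta>
    unfolding iso_def zf_def using intw_comm[OF that]
    by (simp add: sum_distrib_left sum_distrib_right cong: sum.cong)
  have PT: "P * T = T" using move[OF T(1)] T(1) by (simp add: P_def iP intw_def)
  have SP: "S * P = S" using move[OF S(1)] S(1) by (simp add: P_def iP intw_def)
  have TvP: "Tv * P = Tv" using move[OF Tv] Tv by (simp add: P_def iP intw_def)
  have PP: "P * P = P" using iso_mult[OF assms assms tr] by (simp add: P_def)
  have TSTS: "T * S * (T * S) = T * S" using S(2) by (metis mult.assoc)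
  \<comment> \<open>The \<rho>-part \<open>P\<close> and the image of \<open>T\<close> have equal
    dimension, so this idempotent has trace 0 and \<open>P = T * S\<close>.\<close>
  have "(P - T * S) * (P - T * S) = P - T * S"
    using PP PT SP TSTS by (simp add: algebra_simps) (simp add: mult.assoc[symmetric] PT)
  moreover have "tr (P - T * S) = 0"
  proof -
    have "S * T = \<rho>0 \<one>"
    proof -
      have "(S * T) * (S * T) = S * T" using S(2) by (metis mult.assoc)
      moreover have "S * T \<noteq> 0" using S(2) T(2) by (metis mult.assoc mult_zero_right)
      ultimately show ?thesis using i0 intw_mult[OF T(1) S(1)] by (auto simp: irr_def)
    qed
    then have "tr (T * S) = chr \<rho> \<one>" using c0[of \<one>] by (simp add: tr_comm[of T] chr_def)
    moreover have "P * tens \<rho> \<one> = P" using iso_intw[OF assms tr] by (simp add: P_def intw_def)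
    then have "tr P = \<phi> \<one>" using iso_tr[OF assms tr one_closed] m(1) by (simp add: P_def)
    ultimately show ?thesis using r(2) by (simp add: tr_diff)
  qed
  ultimately have "P = T * S" using tr_idem_0 by (metis eq_iff_diff_eq_0)
  then have "Tv = 0" using TvP TvT by (metis mult.assoc mult_zero_left)
  then have "ublk 0 1 Tv = 0" "ublk 0 2 Tv = 0" by (auto intro!: fmat_eqI simp: ent_ublk)
  moreover have "ublk 0 1 Tv = A2" "ublk 0 2 Tv = - A1" unfolding Tv_def
    by (rule fmat_eqI, simp add: ent_ublk ent_blk)+
  ultimately show False using T(2) TA by simp
qed

text \<open>Multiplicity at least 2 exhausts the row sum 2 dg \<phi>, so it is 2 and \<phi> has no
  other neighbour. Then \<phi> times the standard character is 2 \<phi>, so \<phi> vanishes off the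
  unit and has a nonzero inner product with the trivial character. Hence it is the trivial
  character, which does not vanish at the other elements of a nontrivial group.\<close>

lemma mm_no_loop: assumes "\<phi> \<in> IrrC" shows "mm \<phi> \<phi> = 0"
proof (rule ccontr)
  assume nz: "mm \<phi> \<phi> \<noteq> 0"
  obtain dg where dg: "\<And>\<psi>. \<psi> \<in> IrrC \<Longrightarrow> dg \<psi> > 0 \<and> \<psi> \<one> = of_nat (dg \<psi>)" using IrrC_deg by metis
  obtain mn where mn: "\<And>\<psi>. \<psi> \<in> IrrC \<Longrightarrow> mm \<phi> \<psi> = of_nat (mn \<psi>)" using mm_nat[OF assms] by metis
  have "of_nat (\<Sum>\<psi>\<in>IrrC. mn \<psi> * dg \<psi>) = (of_nat (2 * dg \<phi>) :: complex)"
    using mm_row_sum[OF assms] dg mn assms by (simp cong: sum.cong)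
  then have s: "(\<Sum>\<psi>\<in>IrrC. mn \<psi> * dg \<psi>) = 2 * dg \<phi>" by (simp only: of_nat_eq_iff)
  have "mn \<phi> \<noteq> 0" "mn \<phi> \<noteq> 1" using nz mm_ne_1[OF assms] mn[OF assms] by auto
  then have "mn \<phi> \<ge> 2" by linarith
  then have ge: "mn \<phi> * dg \<phi> \<ge> 2 * dg \<phi>" by simp
  have "(\<Sum>\<psi>\<in>IrrC. mn \<psi> * dg \<psi>) = mn \<phi> * dg \<phi> + (\<Sum>\<psi>\<in>IrrC - {\<phi>}. mn \<psi> * dg \<psi>)"
    by (rule sum.remove[OF finite_IrrC assms])
  then have "(\<Sum>\<psi>\<in>IrrC - {\<phi>}. mn \<psi> * dg \<psi>) = 0" and e2: "mn \<phi> * dg \<phi> = 2 * dg \<phi>" using s ge by linarith+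
  then have "mn \<psi> * dg \<psi> = 0" if "\<psi> \<in> IrrC" "\<psi> \<noteq> \<phi>" for \<psi>
    using that finite_IrrC by (subst (asm) sum_eq_0_iff) auto
  then have z: "mm \<phi> \<psi> = 0" if "\<psi> \<in> IrrC" "\<psi> \<noteq> \<phi>" for \<psi> using that dg mn by force
  have two: "mm \<phi> \<phi> = 2" using e2 dg[OF assms] mn[OF assms] by simp
  have v: "\<phi> g = 0" if g: "g \<in> carrier G" "g \<noteq> \<one>" for g
  proof -
    have "\<phi> g * st g = (\<Sum>\<psi>\<in>IrrC. if \<psi> = \<phi> then 2 * \<phi> g else 0)"
      unfolding mm_expand[OF assms g(1)] using z two by (intro sum.cong) auto
    then have "\<phi> g * (st g - 2) = 0" using assms finite_IrrC by (simp add: sum.delta algebra_simps)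
    then show ?thesis using st_2[OF g(1)] g(2) by auto
  qed
  have "inner \<phi> triv = (\<Sum>g\<in>carrier G. if g = \<one> then \<phi> \<one> else 0) / of_nat M"
    unfolding inner_def triv_def using v by (intro arg_cong2[of _ _ _ _ "(/)"] sum.cong) auto
  also have "\<dots> = \<phi> \<one> / of_nat M" using fin by (simp add: sum.delta)
  finally have "inner \<phi> triv \<noteq> 0" using IrrC_one_nz[OF assms] by simp
  then have "\<phi> = triv" using IrrC_orth[OF assms triv_IrrC] by (auto split: if_splits)
  moreover obtain g where "g \<in> carrier G" "g \<noteq> \<one>" using nontriv by blast
  ultimately show False using v by (auto simp: triv_def)
qed

end

section \<open>The root lattice and its affine reflections\<close>

context sl2_group
begin

definition dg :: "('a \<Rightarrow> complex) \<Rightarrow> nat" where "dg \<phi> = (SOME k. \<phi> \<one> = of_nat k)"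
definition mi :: "('a \<Rightarrow> complex) \<Rightarrow> ('a \<Rightarrow> complex) \<Rightarrow> int" where "mi \<phi> \<psi> = (SOME k. mm \<phi> \<psi> = of_int k \<and> k \<ge> 0)"

lemma dg: assumes "\<phi> \<in> IrrC" shows "\<phi> \<one> = of_nat (dg \<phi>)" "dg \<phi> > 0"
proof -
  show 1: "\<phi> \<one> = of_nat (dg \<phi>)" unfolding dg_def by (rule someI_ex) (use IrrC_deg[OF assms] in blast)
  show "dg \<phi> > 0" using 1 IrrC_one_nz[OF assms] by (intro Nat.gr0I) auto
qed
lemma mi: assumes "\<phi> \<in> IrrC" "\<psi> \<in> IrrC" shows "of_int (mi \<phi> \<psi>) = mm \<phi> \<psi>" "mi \<phi> \<psi> \<ge> 0"
proof -
  obtain k where "mm \<phi> \<psi> = of_nat k" using mm_nat[OF assms] by blast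
  then have "mm \<phi> \<psi> = of_int (int k) \<and> int k \<ge> 0" by simp
  then have "mm \<phi> \<psi> = of_int (mi \<phi> \<psi>) \<and> mi \<phi> \<psi> \<ge> 0" unfolding mi_def by (rule someI)
  then show "of_int (mi \<phi> \<psi>) = mm \<phi> \<psi>" "mi \<phi> \<psi> \<ge> 0" by auto
qed
lemma mi_sym: "mi \<phi> \<psi> = mi \<psi> \<phi>" by (simp add: mi_def mm_sym[of \<phi>])
lemma mi_diag: assumes "\<phi> \<in> IrrC" shows "mi \<phi> \<phi> = 0"
  using mi(1)[OF assms assms] mm_no_loop[OF assms] by simp
lemma mi_row: assumes "\<phi> \<in> IrrC" shows "(\<Sum>\<psi>\<in>IrrC. mi \<phi> \<psi> * int (dg \<psi>)) = 2 * int (dg \<phi>)"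
proof -
  have "of_int (\<Sum>\<psi>\<in>IrrC. mi \<phi> \<psi> * int (dg \<psi>)) = (\<Sum>\<psi>\<in>IrrC. mm \<phi> \<psi> * \<psi> \<one>)"
    using assms by (simp add: mi dg cong: sum.cong)
  also have "\<dots> = of_int (2 * int (dg \<phi>))" using mm_row_sum[OF assms] assms by (simp add: dg)
  finally show ?thesis by (simp only: of_int_eq_iff)
qed
lemma dg_triv: "dg triv = 1" using dg(1)[OF triv_IrrC] by (simp add: triv_def)

section \<open>The affine Cartan matrix and its quadratic form\<close>

definition ca :: "('a \<Rightarrow> complex) \<Rightarrow> ('a \<Rightarrow> complex) \<Rightarrow> int" where
  "ca \<phi> \<psi> = (if \<phi> = \<psi> then 2 else 0) - mi \<phi> \<psi>"
definition Bv :: "('a \<Rightarrow> complex) \<Rightarrow> (('a \<Rightarrow> complex) \<Rightarrow> int) \<Rightarrow> int" where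
  "Bv \<phi> d = (\<Sum>\<psi>\<in>IrrC. ca \<phi> \<psi> * d \<psi>)"
definition Bf :: "(('a \<Rightarrow> complex) \<Rightarrow> int) \<Rightarrow> (('a \<Rightarrow> complex) \<Rightarrow> int) \<Rightarrow> int" where
  "Bf d e = (\<Sum>\<phi>\<in>IrrC. d \<phi> * Bv \<phi> e)"
definition ch :: "(('a \<Rightarrow> complex) \<Rightarrow> int) \<Rightarrow> 'a \<Rightarrow> complex" where
  "ch d g = (\<Sum>\<phi>\<in>IrrC. of_int (d \<phi>) * \<phi> g)"
definition sz :: "(('a \<Rightarrow> complex) \<Rightarrow> int) \<Rightarrow> int" where
  "sz d = (\<Sum>\<phi>\<in>IrrC. int (dg \<phi>) * d \<phi>)"
definition eps :: "('a \<Rightarrow> complex) \<Rightarrow> int" where "eps \<phi> = (if \<phi> = triv then 1 else 0)"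
text \<open>The pairing of the level-one weight Lambda_0 - d with the simple coroot at \<phi>. The
  affine action on d is the linear action on Lambda_0 - d, so this is also the change of the
  coordinate under the reflection.\<close>

definition cf :: "('a \<Rightarrow> complex) \<Rightarrow> (('a \<Rightarrow> complex) \<Rightarrow> int) \<Rightarrow> int" where "cf \<phi> d = eps \<phi> - Bv \<phi> d"
definition refl :: "('a \<Rightarrow> complex) \<Rightarrow> (('a \<Rightarrow> complex) \<Rightarrow> int) \<Rightarrow> (('a \<Rightarrow> complex) \<Rightarrow> int)" where
  "refl \<phi> d = d(\<phi> := d \<phi> + cf \<phi> d)"
definition nul :: "int \<Rightarrow> ('a \<Rightarrow> complex) \<Rightarrow> int" where "nul r = restrict (\<lambda>\<phi>. r * int (dg \<phi>)) IrrC"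

lemma ca_sym: "ca \<phi> \<psi> = ca \<psi> \<phi>" by (simp add: ca_def mi_sym[of \<phi>])
lemma ca_diag: "\<phi> \<in> IrrC \<Longrightarrow> ca \<phi> \<phi> = 2" by (simp add: ca_def mi_diag)
lemma ca_off: "\<phi> \<in> IrrC \<Longrightarrow> \<psi> \<in> IrrC \<Longrightarrow> \<phi> \<noteq> \<psi> \<Longrightarrow> ca \<phi> \<psi> \<le> 0" by (simp add: ca_def mi)
lemma ca_row: assumes "\<phi> \<in> IrrC" shows "(\<Sum>\<psi>\<in>IrrC. ca \<phi> \<psi> * int (dg \<psi>)) = 0"
proof -
  have "(\<Sum>\<psi>\<in>IrrC. ca \<phi> \<psi> * int (dg \<psi>)) = (\<Sum>\<psi>\<in>IrrC. (if \<psi> = \<phi> then 2 * int (dg \<phi>) else 0) - mi \<phi> \<psi> * int (dg \<psi>))"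
    by (intro sum.cong) (auto simp: ca_def algebra_simps)
  also have "\<dots> = 0" using assms finite_IrrC by (simp add: sum_subtractf sum.delta mi_row)
  finally show ?thesis .
qed

lemma Bf_sym: "Bf d e = Bf e d"
proof -
  have "Bf d e = (\<Sum>\<phi>\<in>IrrC. \<Sum>\<psi>\<in>IrrC. d \<phi> * ca \<phi> \<psi> * e \<psi>)" by (simp add: Bf_def Bv_def sum_distrib_left mult.assoc)
  also have "\<dots> = (\<Sum>\<psi>\<in>IrrC. \<Sum>\<phi>\<in>IrrC. d \<phi> * ca \<phi> \<psi> * e \<psi>)" by (rule sum.swap)
  also have "\<dots> = Bf e d" by (simp add: Bf_def Bv_def sum_distrib_left ca_sym mult_ac)
  finally show ?thesis .
qed
lemma Bv_lin: "Bv \<phi> (\<lambda>x. c * d x + e x) = c * Bv \<phi> d + Bv \<phi> e"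
  by (simp add: Bv_def algebra_simps sum.distrib sum_distrib_left)
lemma Bf_lin: "Bf (\<lambda>x. c * d x + e x) f = c * Bf d f + Bf e f"
  by (simp add: Bf_def algebra_simps sum.distrib sum_distrib_left)
lemma Bf_lin': "Bf f (\<lambda>x. c * d x + e x) = c * Bf f d + Bf f e"
  by (simp add: Bf_sym[of f] Bf_lin)
lemma Bv_cong: "(\<And>\<psi>. \<psi> \<in> IrrC \<Longrightarrow> d \<psi> = e \<psi>) \<Longrightarrow> Bv \<phi> d = Bv \<phi> e" unfolding Bv_def by (intro sum.cong) auto
definition un :: "('a \<Rightarrow> complex) \<Rightarrow> ('a \<Rightarrow> complex) \<Rightarrow> int" where "un \<phi> = (\<lambda>x. if x = \<phi> then 1 else 0)"
lemma Bv_un: "\<psi> \<in> IrrC \<Longrightarrow> Bv \<phi> (un \<psi>) = ca \<phi> \<psi>"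
  using finite_IrrC by (simp add: Bv_def un_def if_distrib[of "\<lambda>x. _ * x"] sum.delta cong: if_cong)
lemma Bf_un: "\<phi> \<in> IrrC \<Longrightarrow> Bf (un \<phi>) d = Bv \<phi> d"
  using finite_IrrC by (simp add: Bf_def un_def if_distrib[of "\<lambda>x. x * _"] sum.delta cong: if_cong)

lemma ch_inv: assumes "g \<in> carrier G" shows "ch d (inv g) = cnj (ch d g)"
  using IrrC_inv assms by (simp add: ch_def cong: sum.cong)

lemma inner_sum_left: "inner (\<lambda>g. \<Sum>x\<in>A. f x g) \<psi> = (\<Sum>x\<in>A. inner (f x) \<psi>)"
  unfolding inner_def sum_distrib_right
  by (subst sum.swap) (simp add: sum_divide_distrib)
lemma inner_sc_left: "inner (\<lambda>g. c * f g) \<psi> = c * inner f \<psi>"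
  by (simp add: inner_def sum_distrib_left mult.assoc)
lemma inner_diff_left: "inner (\<lambda>g. f g - h g) \<psi> = inner f \<psi> - inner h \<psi>"
  by (simp add: inner_def algebra_simps sum_subtractf diff_divide_distrib)

lemma inner_ch: assumes "\<psi> \<in> IrrC" shows "inner (ch d) \<psi> = of_int (d \<psi>)"
proof -
  have "inner (ch d) \<psi> = (\<Sum>\<phi>\<in>IrrC. of_int (d \<phi>) * inner \<phi> \<psi>)"
    unfolding ch_def inner_sum_left inner_sc_left ..
  also have "\<dots> = (\<Sum>\<phi>\<in>IrrC. if \<phi> = \<psi> then of_int (d \<psi>) else 0)"
    using assms by (intro sum.cong) (auto simp: IrrC_orth)
  finally show ?thesis using assms finite_IrrC by (simp add: sum.delta)
qed

lemma ch_st: assumes g: "g \<in> carrier G"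
  shows "ch d g * (2 - st g) = (\<Sum>\<phi>\<in>IrrC. of_int (Bv \<phi> d) * \<phi> g)"
proof -
  have "ch d g * st g = (\<Sum>\<psi>\<in>IrrC. of_int (d \<psi>) * (\<psi> g * st g))" by (simp add: ch_def sum_distrib_right mult.assoc)
  also have "\<dots> = (\<Sum>\<psi>\<in>IrrC. \<Sum>\<phi>\<in>IrrC. of_int (d \<psi>) * (of_int (mi \<psi> \<phi>) * \<phi> g))"
    using g by (intro sum.cong refl) (simp add: mm_expand sum_distrib_left mi cong: sum.cong)
  also have "\<dots> = (\<Sum>\<phi>\<in>IrrC. \<Sum>\<psi>\<in>IrrC. of_int (d \<psi>) * (of_int (mi \<psi> \<phi>) * \<phi> g))" by (rule sum.swap)
  also have "\<dots> = (\<Sum>\<phi>\<in>IrrC. of_int (\<Sum>\<psi>\<in>IrrC. mi \<phi> \<psi> * d \<psi>) * \<phi> g)"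
    by (simp add: sum_distrib_left sum_distrib_right mi_sym mult_ac)
  finally have 1: "ch d g * st g = (\<Sum>\<phi>\<in>IrrC. of_int (\<Sum>\<psi>\<in>IrrC. mi \<phi> \<psi> * d \<psi>) * \<phi> g)" .
  have 2: "Bv \<phi> d = 2 * d \<phi> - (\<Sum>\<psi>\<in>IrrC. mi \<phi> \<psi> * d \<psi>)" if "\<phi> \<in> IrrC" for \<phi>
  proof -
    have "Bv \<phi> d = (\<Sum>\<psi>\<in>IrrC. (if \<psi> = \<phi> then 2 * d \<phi> else 0) - mi \<phi> \<psi> * d \<psi>)"
      unfolding Bv_def by (intro sum.cong) (auto simp: ca_def algebra_simps)
    then show ?thesis using that finite_IrrC by (simp add: sum_subtractf sum.delta)
  qed
  have "(\<Sum>\<phi>\<in>IrrC. of_int (Bv \<phi> d) * \<phi> g) = (\<Sum>\<phi>\<in>IrrC. 2 * (of_int (d \<phi>) * \<phi> g) - of_int (\<Sum>\<psi>\<in>IrrC. mi \<phi> \<psi> * d \<psi>) * \<phi> g)"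
    by (intro sum.cong refl) (simp add: 2 algebra_simps)
  also have "\<dots> = 2 * ch d g - (\<Sum>\<phi>\<in>IrrC. of_int (\<Sum>\<psi>\<in>IrrC. mi \<phi> \<psi> * d \<psi>) * \<phi> g)"
    unfolding sum_subtractf sum_distrib_left[symmetric] ch_def ..
  also have "\<dots> = 2 * ch d g - ch d g * st g" by (simp only: 1)
  finally show ?thesis by (simp add: algebra_simps)
qed

text \<open>The Cartan matrix acts on virtual characters as multiplication by 2 minus the standard
  character, so evaluation at group elements diagonalises it. Since the standard character is real,
  at most 2, and less than 2 off the unit, the form is semidefinite.\<close>

lemma Bf_char: "real_of_int (Bf d d) = (\<Sum>g\<in>carrier G. (2 - Re (st g)) * (cmod (ch d g))\<^sup>2) / M"
proof -
  have "complex_of_int (Bf d d) = (\<Sum>\<phi>\<in>IrrC. of_int (d \<phi>) * inner (\<lambda>g. ch d g * (2 - st g)) \<phi>)"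
    unfolding Bf_def
  proof (simp, intro sum.cong refl)
    fix \<phi> assume p: "\<phi> \<in> IrrC"
    have "inner (\<lambda>g. ch d g * (2 - st g)) \<phi> = inner (ch (\<lambda>\<psi>. Bv \<psi> d)) \<phi>"
      by (intro inner_cong) (simp_all add: ch_st, simp add: ch_def)
    then show "of_int (d \<phi>) * of_int (Bv \<phi> d) = of_int (d \<phi>) * inner (\<lambda>g. ch d g * (2 - st g)) \<phi>"
      using inner_ch[OF p] by simp
  qed
  also have "\<dots> = (\<Sum>\<phi>\<in>IrrC. of_int (d \<phi>) * inner \<phi> (\<lambda>g. ch d g * (2 - st g)))"
    by (simp add: inner_comm[of _ "\<lambda>g. ch d g * (2 - st g)"])
  also have "\<dots> = inner (ch d) (\<lambda>g. ch d g * (2 - st g))"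
    unfolding ch_def[of d] inner_sum_left inner_sc_left ..
  also have "\<dots> = (\<Sum>g\<in>carrier G. of_real ((2 - Re (st g)) * (cmod (ch d g))\<^sup>2)) / of_nat M"
    unfolding inner_def
  proof (intro arg_cong2[of _ _ _ _ "(/)"] sum.cong refl)
    fix g assume g: "g \<in> carrier G"
    have "st g = of_real (Re (st g))" using st_real_le(1)[OF g] by (simp add: complex_eq_iff)
    then have "ch d g * (ch d (inv g) * (2 - st (inv g))) = (ch d g * cnj (ch d g)) * of_real (2 - Re (st g))"
      using g by (simp add: ch_inv st_inv)
    also have "\<dots> = of_real ((2 - Re (st g)) * (cmod (ch d g))\<^sup>2)"
      by (simp add: complex_norm_square[symmetric] mult.commute)
    finally show "ch d g * (ch d (inv g) * (2 - st (inv g))) = of_real ((2 - Re (st g)) * (cmod (ch d g))\<^sup>2)" .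
  qed
  finally have "complex_of_real (of_int (Bf d d)) = complex_of_real ((\<Sum>g\<in>carrier G. (2 - Re (st g)) * (cmod (ch d g))\<^sup>2) / M)"
    by simp
  then show ?thesis by (simp only: of_real_eq_iff)
qed

lemma Bf_nonneg: "Bf d d \<ge> 0"
proof -
  have "real_of_int (Bf d d) \<ge> 0" unfolding Bf_char
    using st_real_le by (intro divide_nonneg_nonneg sum_nonneg mult_nonneg_nonneg) auto
  then show ?thesis by simp
qed

text \<open>The factors 2 - st are positive off the unit, so a null vector has a virtual character
  supported at the unit, that is, a multiple of the regular character.\<close>

lemma Bf_zero: assumes "Bf d d = 0" "\<phi> \<in> IrrC" shows "d \<phi> = d triv * int (dg \<phi>)"
proof -
  have "(\<Sum>g\<in>carrier G. (2 - Re (st g)) * (cmod (ch d g))\<^sup>2) = 0"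
    using Bf_char[of d] assms(1) M_pos by simp
  then have z: "(2 - Re (st g)) * (cmod (ch d g))\<^sup>2 = 0" if "g \<in> carrier G" for g
    using st_real_le fin that by (subst (asm) sum_nonneg_eq_0_iff) auto
  have c0: "ch d g = 0" if "g \<in> carrier G" "g \<noteq> \<one>" for g
    using z[OF that(1)] st_real_le(3)[OF that] by simp
  have i: "inner (ch d) \<psi> = ch d \<one> * \<psi> \<one> / of_nat M" for \<psi>
  proof -
    have "inner (ch d) \<psi> = (\<Sum>g\<in>carrier G. if g = \<one> then ch d \<one> * \<psi> \<one> else 0) / of_nat M"
      unfolding inner_def using c0 by (intro arg_cong2[of _ _ _ _ "(/)"] sum.cong) auto
    then show ?thesis using fin by (simp add: sum.delta)
  qed
  have "triv \<one> = 1" by (simp add: triv_def)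
  then have t: "complex_of_int (d triv) = ch d \<one> / of_nat M"
    using i[of triv] inner_ch[OF triv_IrrC, of d] by (metis mult.right_neutral)
  have "complex_of_int (d \<phi>) = ch d \<one> / of_nat M * of_nat (dg \<phi>)"
    using i[of \<phi>] inner_ch[OF assms(2), of d] dg(1)[OF assms(2)] by simp
  then have "complex_of_int (d \<phi>) = of_int (d triv * int (dg \<phi>))" by (simp add: t)
  then show ?thesis by (simp only: of_int_eq_iff)
qed

lemma Bv_nul: "\<phi> \<in> IrrC \<Longrightarrow> Bv \<phi> (nul r) = 0"
proof -
  assume p: "\<phi> \<in> IrrC"
  have "Bv \<phi> (nul r) = r * (\<Sum>\<psi>\<in>IrrC. ca \<phi> \<psi> * int (dg \<psi>))"
    by (simp add: Bv_def nul_def sum_distrib_left mult_ac cong: sum.cong)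
  then show ?thesis by (simp add: ca_row[OF p])
qed
lemma Bf_nul: "Bf d (nul r) = 0"
  by (simp add: Bf_def Bv_nul cong: sum.cong)

text \<open>Minus the norm of Lambda_0 - d, hence invariant under the reflections; at r\<delta> it
  is 2r, so it separates the orbits of the multiples of \<delta>.\<close>

definition q2 :: "(('a \<Rightarrow> complex) \<Rightarrow> int) \<Rightarrow> int" where "q2 d = 2 * d triv - Bf d d"

lemma q2_nul: "q2 (nul r) = 2 * r"
proof -
  have "nul r triv = r" using triv_IrrC dg_triv by (simp add: nul_def)
  then show ?thesis unfolding q2_def Bf_nul by simp
qed

lemma refl_lin: "refl \<phi> d = (\<lambda>x. cf \<phi> d * un \<phi> x + d x)" by (rule ext) (simp add: refl_def un_def)

lemma q2_refl: assumes p: "\<phi> \<in> IrrC" shows "q2 (refl \<phi> d) = q2 d"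
proof -
  let ?c = "cf \<phi> d"
  have "Bf (refl \<phi> d) (refl \<phi> d) = ?c * (?c * 2 + Bv \<phi> d) + (?c * Bv \<phi> d + Bf d d)"
    unfolding refl_lin Bf_lin Bf_lin' Bf_sym[of d "un \<phi>"] Bf_un[OF p] Bv_un[OF p] ca_diag[OF p] ..
  moreover have "Bv \<phi> d = eps \<phi> - ?c" by (simp add: cf_def)
  moreover have "refl \<phi> d triv = d triv + ?c * eps \<phi>" by (auto simp: refl_def eps_def)
  ultimately show ?thesis by (simp add: q2_def algebra_simps)
qed

lemma cf_refl: assumes p: "\<phi> \<in> IrrC" shows "cf \<phi> (refl \<phi> d) = - cf \<phi> d"
proof -
  have "Bv \<phi> (refl \<phi> d) = cf \<phi> d * 2 + Bv \<phi> d" unfolding refl_lin Bv_lin by (simp add: Bv_un[OF p] ca_diag[OF p])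
  then show ?thesis by (simp add: cf_def)
qed
lemma refl_refl: assumes p: "\<phi> \<in> IrrC" shows "refl \<phi> (refl \<phi> d) = d"
  unfolding refl_def[of \<phi> "refl \<phi> d"] cf_refl[OF p] by (auto simp: refl_def)

lemma sz_refl: assumes p: "\<phi> \<in> IrrC" shows "sz (refl \<phi> d) = sz d + int (dg \<phi>) * cf \<phi> d"
proof -
  have "sz (refl \<phi> d) = (\<Sum>\<psi>\<in>IrrC. int (dg \<psi>) * d \<psi> + (if \<psi> = \<phi> then int (dg \<phi>) * cf \<phi> d else 0))"
    unfolding sz_def refl_def by (intro sum.cong) (auto simp: algebra_simps)
  then show ?thesis using p finite_IrrC by (simp add: sum.distrib sum.delta sz_def)
qed

text \<open>Lambda_0 - d has level one: \<delta> lies in the radical of the form, so only the term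
  of the trivial character remains.\<close>

lemma sum_cf: "(\<Sum>\<phi>\<in>IrrC. int (dg \<phi>) * cf \<phi> d) = 1"
proof -
  have "(\<Sum>\<phi>\<in>IrrC. int (dg \<phi>) * Bv \<phi> d) = Bf (nul 1) d"
    unfolding Bf_def by (intro sum.cong) (auto simp: nul_def)
  also have "\<dots> = 0" unfolding Bf_sym[of "nul 1" d] by (rule Bf_nul)
  finally have "(\<Sum>\<phi>\<in>IrrC. int (dg \<phi>) * cf \<phi> d) = (\<Sum>\<phi>\<in>IrrC. int (dg \<phi>) * eps \<phi>)"
    by (simp add: cf_def right_diff_distrib sum_subtractf)
  also have "\<dots> = (\<Sum>\<phi>\<in>IrrC. if \<phi> = triv then 1 else 0)"
    by (intro sum.cong) (auto simp: eps_def dg_triv)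
  finally show ?thesis using triv_IrrC finite_IrrC by (simp add: sum.delta)
qed

lemma sz_char: "of_int (sz d) = ch d \<one>"
  by (simp add: sz_def ch_def dg mult.commute cong: sum.cong)

text \<open>With t the norm of d, fixing \<open>q2\<close> gives d triv = (k + t) / 2, which
  contributes M (k + t) / 2 to the size; the part of d off \<delta> lowers the size by at most M t /
  2 plus a constant. The terms in t cancel exactly.\<close>

lemma sz_bounded: "\<exists>C. \<forall>d. q2 d = k \<longrightarrow> real_of_int (sz d) \<ge> C"
proof -
  define \<kappa> where "\<kappa> = Min ((\<lambda>g. 2 - Re (st g)) ` (carrier G - {\<one>}))"
  have ne: "carrier G - {\<one>} \<noteq> {}" using nontriv one_closed by blast
  have \<kappa>: "\<kappa> > 0" unfolding \<kappa>_def using ne fin st_real_le(3) by (subst Min_gr_iff) auto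
  have \<kappa>le: "\<kappa> \<le> 2 - Re (st g)" if "g \<in> carrier G" "g \<noteq> \<one>" for g
    unfolding \<kappa>_def using fin that by (intro Min_le) auto
  show ?thesis
  proof (intro exI[of _ "M * k / 2 - M / (2 * \<kappa>)"] allI impI)
    fix d assume q: "q2 d = k"
    \<comment> \<open>Subtracting a multiple of \<delta> removes the trivial coordinate and keeps
      the norm.\<close>
    define e where "e = (\<lambda>x. - d triv * nul 1 x + d x)"
    have etriv: "e triv = 0" by (simp add: e_def nul_def triv_IrrC dg_triv)
    have Be: "Bf e e = Bf d d" unfolding e_def Bf_lin Bf_lin' Bf_nul Bf_sym[of "nul 1" d] by simp
    have sze: "sz d = d triv * (\<Sum>\<phi>\<in>IrrC. int (dg \<phi>) * int (dg \<phi>)) + sz e"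
      unfolding sz_def e_def nul_def sum_distrib_left sum.distrib[symmetric]
      by (intro sum.cong) (auto simp: algebra_simps)
    have "complex_of_int (\<Sum>\<phi>\<in>IrrC. int (dg \<phi>) * int (dg \<phi>)) = (\<Sum>\<phi>\<in>IrrC. inner (chr (free_rep 1)) \<phi> * \<phi> \<one>)"
      by (simp add: inner_free dg cong: sum.cong)
    also have "\<dots> = of_int (int M)" using chr_expand[OF free_rep_rep one_closed, of 1] by (simp add: free_rep_chr)
    finally have M2: "(\<Sum>\<phi>\<in>IrrC. int (dg \<phi>) * int (dg \<phi>)) = int M" by (simp only: of_int_eq_iff)
    define t where "t = real_of_int (Bf d d)"
    have dt: "real_of_int (d triv) = (k + t) / 2" using q by (simp add: q2_def t_def)
    have "inner (ch e) triv = 0" using inner_ch[OF triv_IrrC, of e] etriv by simp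
    then have "(\<Sum>g\<in>carrier G. ch e g) = 0" by (simp add: inner_def triv_def cong: sum.cong)
    \<comment> \<open>Without a trivial constituent the values of the character sum to 0. This
      expresses the size through the other elements, where 2 - st is at least \<kappa>.\<close>
    then have "ch e \<one> = - (\<Sum>g\<in>carrier G - {\<one>}. ch e g)"
      using sum.remove[OF fin one_closed, of "ch e"] by (simp add: eq_neg_iff_add_eq_0)
    then have "\<bar>real_of_int (sz e)\<bar> = cmod (\<Sum>g\<in>carrier G - {\<one>}. ch e g)"
      using sz_char[of e] by (metis norm_minus_cancel norm_of_int)
    also have "\<dots> \<le> (\<Sum>g\<in>carrier G - {\<one>}. cmod (ch e g))" by (rule norm_sum)
    also have "\<dots> \<le> (\<Sum>g\<in>carrier G - {\<one>}. (2 - Re (st g)) * (cmod (ch e g))\<^sup>2 / 2 + 1 / (2 * \<kappa>))"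
    proof (rule sum_mono)
      fix g assume g: "g \<in> carrier G - {\<one>}"
      define x where "x = cmod (ch e g)"
      \<comment> \<open>The square is balanced to give x \<le> \<kappa> x^2 / 2 + 1 / (2 \<kappa>),
        so that the quadratic terms add up to no more than M t / 2.\<close>
      have "0 \<le> (\<kappa> * x - 1)\<^sup>2" by simp
      then have "2 * (\<kappa> * x) \<le> \<kappa> * (\<kappa> * x\<^sup>2) + 1" by (simp add: power2_eq_square algebra_simps)
      then have "x \<le> \<kappa> * x\<^sup>2 / 2 + 1 / (2 * \<kappa>)" using \<kappa> by (simp add: field_simps)
      also have "\<kappa> * x\<^sup>2 \<le> (2 - Re (st g)) * x\<^sup>2" using \<kappa>le g by (intro mult_right_mono) auto
      finally show "cmod (ch e g) \<le> (2 - Re (st g)) * (cmod (ch e g))\<^sup>2 / 2 + 1 / (2 * \<kappa>)" by (simp add: x_def)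
    qed
    also have "\<dots> \<le> (\<Sum>g\<in>carrier G. (2 - Re (st g)) * (cmod (ch e g))\<^sup>2 / 2 + 1 / (2 * \<kappa>))"
      using fin \<kappa> st_real_le by (intro sum_mono2) auto
    also have "\<dots> = M * t / 2 + M / (2 * \<kappa>)"
    proof -
      have "(\<Sum>g\<in>carrier G. (2 - Re (st g)) * (cmod (ch e g))\<^sup>2) = M * t"
        using Bf_char[of e] M_pos unfolding Be t_def[symmetric] by (simp add: field_simps)
      then show ?thesis unfolding sum.distrib sum_divide_distrib[symmetric] by simp
    qed
    finally have "real_of_int (sz e) \<ge> - (M * t / 2 + M / (2 * \<kappa>))" by linarith
    moreover have "real_of_int (sz d) = (k + t) / 2 * M + real_of_int (sz e)"
      unfolding sze M2 using dt by simp
    moreover have "(k + t) / 2 * M = M * k / 2 + M * t / 2" by (simp add: field_simps)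
    ultimately show "M * k / 2 - M / (2 * \<kappa>) \<le> real_of_int (sz d)" by linarith
  qed
qed

section \<open>Orbits of the affine reflections\<close>

inductive reach :: "(('a \<Rightarrow> complex) \<Rightarrow> int) \<Rightarrow> (('a \<Rightarrow> complex) \<Rightarrow> int) \<Rightarrow> bool" for d where
  start: "reach d d"
| step: "reach d e \<Longrightarrow> \<phi> \<in> IrrC \<Longrightarrow> reach d (refl \<phi> e)"

lemma reach_trans: "reach e f \<Longrightarrow> reach d e \<Longrightarrow> reach d f"
  by (induction rule: reach.induct) (auto intro: reach.intros)
lemma reach_sym: "reach d e \<Longrightarrow> reach e d"
proof (induction rule: reach.induct)
  case (step e \<phi>)
  have "reach (refl \<phi> e) e" using reach.step[OF reach.start step(2), of "refl \<phi> e"] refl_refl[OF step(2)] by simp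
  then show ?case using step(3) reach_trans by blast
qed (rule reach.start)
lemma reach_q2: "reach d e \<Longrightarrow> q2 e = q2 d"
  by (induction rule: reach.induct) (auto simp: q2_refl)
lemma reach_ext: "reach d e \<Longrightarrow> d \<in> extensional IrrC \<Longrightarrow> e \<in> extensional IrrC"
  by (induction rule: reach.induct) (auto simp: refl_def extensional_def)

text \<open>Moving the window of summation by one exchanges F a for F (a + N). It is applied to
  eigenvalue multiplicities and to their first moment, which is periodic only modulo N.\<close>

lemma shift_mod: fixes F :: "nat \<Rightarrow> int"
  assumes "\<And>j. int N dvd F (j + N) - F j"
  shows "int N dvd (\<Sum>j<N. F (j + a)) - (\<Sum>j<N. F j)"
proof (induction a)
  case (Suc a)
  have "F a + (\<Sum>j<N. F (Suc j + a)) = (\<Sum>j<N. F (j + a)) + F (a + N)"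
    using sum.lessThan_Suc_shift[of "\<lambda>j. F (j + a)" N] sum.lessThan_Suc[of "\<lambda>j. F (j + a)" N]
    by (simp add: add.commute)
  then have "(\<Sum>j<N. F (j + Suc a)) - (\<Sum>j<N. F j) = ((\<Sum>j<N. F (j + a)) - (\<Sum>j<N. F j)) + (F (a + N) - F a)"
    by (simp add: algebra_simps)
  then show ?case using Suc assms by (metis dvd_add)
qed simp

text \<open>Level-one weights in the root lattice: if all coordinates of the shifted coroot pairing vanish
  except that of a linear character \<open>\<psi>\<close>, comparing Fourier coefficients on each cyclic subgroup shows
  that \<open>\<psi>\<close> is trivial. This is the determinant of a virtual representation in disguise.\<close>

lemma linear_trivial:
  assumes p: "\<psi> \<in> IrrC" "dg \<psi> = 1"
    and e: "\<And>\<phi>. \<phi> \<in> IrrC \<Longrightarrow> Bv \<phi> d = eps \<phi> - un \<psi> \<phi>"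
  shows "\<psi> = triv"
proof -
  have chd: "ch d g * (2 - st g) = 1 - \<psi> g" if g: "g \<in> carrier G" for g
  proof -
    have "ch d g * (2 - st g) = (\<Sum>\<phi>\<in>IrrC. (if \<phi> = triv then 1 else 0) - (if \<phi> = \<psi> then \<psi> g else 0))"
      unfolding ch_st[OF g] using g by (intro sum.cong) (auto simp: e eps_def un_def triv_def)
    also have "\<dots> = 1 - \<psi> g" using p triv_IrrC finite_IrrC by (simp add: sum_subtractf sum.delta)
    finally show ?thesis .
  qed
  have "\<psi> g = 1" if g: "g \<in> carrier G" for g
  proof -
    obtain a where a: "\<And>i. st (g [^] (i::nat)) = zet ^ (i * a) + cnj zet ^ (i * a)" using st_pow[OF g] by blast
    obtain \<rho> where r: "irr \<rho>" "\<And>g. g \<in> carrier G \<Longrightarrow> \<psi> g = chr \<rho> g" using IrrC_E[OF p(1)] by metis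
    have rr: "rep \<rho>" using r by (simp add: irr_def)
    have "of_nat (\<Sum>j<M. cn \<rho> g j) = (of_nat 1 :: complex)"
      using chr_pow[OF rr g, of 0] r(2)[OF one_closed] dg(1)[OF p(1)] p(2) by simp
    then have "(\<Sum>j<M. cn \<rho> g j) = Suc 0" by (simp only: of_nat_eq_iff One_nat_def)
    then obtain k where k: "k < M" "cn \<rho> g k = Suc 0" "\<forall>b\<in>{..<M}. k \<noteq> b \<longrightarrow> cn \<rho> g b = 0"
      by (subst (asm) sum_eq_Suc0_iff) auto
    have psi: "\<psi> (g [^] i) = zet ^ (i * k)" for i :: nat
    proof -
      have "\<psi> (g [^] i) = (\<Sum>j<M. zet ^ (i * j) * of_nat (cn \<rho> g j))"
        using r(2)[of "g [^] i"] g by (simp add: chr_pow[OF rr g])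
      also have "\<dots> = (\<Sum>j<M. if j = k then zet ^ (i * k) else 0)"
        using k by (intro sum.cong) auto
      finally show ?thesis using k by (simp add: sum.delta)
    qed
    \<comment> \<open>\<open>n j\<close> is the multiplicity of the eigenvalue
      \<open>zet ^ j\<close> of g in the virtual representation d. For irreducible characters it is
      the trace of \<open>cp\<close>, hence an integer, and d combines these integrally.\<close>
    have "\<exists>n. \<forall>j. of_int (n j) = (\<Sum>i<M. cnj zet ^ (i * j) * ch d (g [^] i)) / of_nat M"
    proof -
      have n1: "\<exists>m::int. of_int m = (\<Sum>i<M. cnj zet ^ (i * j) * \<phi> (g [^] i)) / of_nat M" if ph: "\<phi> \<in> IrrC" for \<phi> j
      proof -
        obtain \<tau> where t: "irr \<tau>" "\<And>g. g \<in> carrier G \<Longrightarrow> \<phi> g = chr \<tau> g" using IrrC_E[OF ph] by metis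
        have tt: "rep \<tau>" using t by (simp add: irr_def)
        have "tr (cp \<tau> g j) = (\<Sum>i<M. cnj zet ^ (i * j) * \<phi> (g [^] i)) / of_nat M"
          using t(2) g by (simp add: cp_def tr_sum chr_def)
        then show ?thesis using cn[OF tt g, of j] by (metis of_int_of_nat_eq)
      qed
      then obtain f where f: "\<And>\<phi> j. \<phi> \<in> IrrC \<Longrightarrow> of_int (f \<phi> j) = (\<Sum>i<M. cnj zet ^ (i * j) * \<phi> (g [^] i)) / of_nat M"
        by metis
      have "of_int (\<Sum>\<phi>\<in>IrrC. d \<phi> * f \<phi> j) = (\<Sum>i<M. cnj zet ^ (i * j) * ch d (g [^] i)) / of_nat M" for j
      proof -
        have "complex_of_int (\<Sum>\<phi>\<in>IrrC. d \<phi> * f \<phi> j)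
          = (\<Sum>\<phi>\<in>IrrC. \<Sum>i<M. of_int (d \<phi>) * (cnj zet ^ (i * j) * \<phi> (g [^] i))) / of_nat M"
          by (simp add: f sum_distrib_left sum_divide_distrib cong: sum.cong)
        also have "\<dots> = (\<Sum>i<M. cnj zet ^ (i * j) * ch d (g [^] i)) / of_nat M"
          by (subst sum.swap) (simp add: ch_def sum_distrib_left mult_ac)
        finally show ?thesis .
      qed
      then show ?thesis by (intro exI[of _ "\<lambda>j. \<Sum>\<phi>\<in>IrrC. d \<phi> * f \<phi> j"]) blast
    qed
    then obtain n where n: "\<And>j. complex_of_int (n j) = (\<Sum>i<M. cnj zet ^ (i * j) * ch d (g [^] i)) / of_nat M" by blast
    \<comment> \<open>A natural number congruent to - a modulo M, so that both eigenvalues of g act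
      on the index j as shifts by naturals.\<close>
    define b where "b = a * (M - 1)"
    have ab: "a + b = a * M" using M_pos by (simp add: b_def algebra_simps)
    have zb: "cnj zet ^ (i * b) = zet ^ (i * a)" for i
    proof -
      have "i * b + i * a = M * (i * a)" using arg_cong[OF ab, of "\<lambda>x. i * x"] by (simp add: algebra_simps)
      then have "cnj zet ^ (i * b) * cnj zet ^ (i * a) = cnj zet ^ (M * (i * a))"
        by (simp only: power_add[symmetric])
      also have "\<dots> = 1" unfolding power_mult by (simp add: cnj_zet_M)
      finally have "cnj zet ^ (i * b) * (cnj zet ^ (i * a) * zet ^ (i * a)) = zet ^ (i * a)"
        by (simp add: mult.assoc[symmetric])
      then show ?thesis by (simp add: cnj_zet_pow)
    qed
    have per: "n (j + M) = n j" for j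
    proof -
      have "cnj zet ^ (i * (j + M)) = cnj zet ^ (i * j)" for i
        by (simp add: distrib_left power_add) (metis cnj_zet_M mult.commute power_mult power_one mult.right_neutral)
      then have "complex_of_int (n (j + M)) = of_int (n j)" by (simp add: n)
      then show ?thesis by simp
    qed
    have ind: "(\<Sum>i<M. cnj zet ^ (i * j) * zet ^ (i * l)) / of_nat M = (if j = l then 1 else 0)"
      if jl: "j < M" "l < M" for j l
    proof (cases "j = l")
      case True
      then show ?thesis by (simp add: cnj_zet_pow)
    next
      case False
      define w where "w = cnj zet ^ j * zet ^ l"
      have wM: "w ^ M = 1" unfolding w_def power_mult_distrib
        by (metis cnj_zet_M zet_M mult.commute power_mult power_one mult_1)
      have "w \<noteq> 1"
      proof
        assume w1: "w = 1"
        have "zet ^ l = zet ^ j * w" by (simp add: w_def mult.assoc[symmetric] cnj_zet_pow)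
        then have eq: "zet ^ l = zet ^ j" using w1 by simp
        have "M dvd (max j l - min j l)"
        proof (rule zet_eq_1)
          have "zet ^ (max j l - min j l) * zet ^ min j l = zet ^ max j l" by (simp add: power_add[symmetric])
          also have "\<dots> = zet ^ min j l" using eq by (simp add: max_def min_def)
          finally show "zet ^ (max j l - min j l) = 1" by (simp add: zet_def)
        qed
        then show False using False jl by (auto dest!: dvd_imp_le simp: max_def min_def split: if_splits)
      qed
      then have "(\<Sum>i<M. w ^ i) = 0" using root_sum[OF wM] by simp
      moreover have "cnj zet ^ (i * j) * zet ^ (i * l) = w ^ i" for i
        by (simp add: w_def power_mult_distrib power_mult[symmetric] mult.commute)
      ultimately show ?thesis using False by simp
    qed
    \<comment> \<open>The Fourier coefficients of ch d (2 - st) = 1 - \<psi> on the powers of g: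
      multiplication by st shifts the index by a and by - a.\<close>
    have rec: "2 * n j - n (j + a) - n (j + b) = (if j = 0 then 1 else 0) - (if j = k then 1 else 0)" if j: "j < M" for j
    proof -
      have "complex_of_int (2 * n j - n (j + a) - n (j + b))
        = (\<Sum>i<M. cnj zet ^ (i * j) * (ch d (g [^] i) * (2 - st (g [^] i)))) / of_nat M"
        by (simp add: n a zb distrib_left power_add algebra_simps sum_subtractf sum.distrib
            sum_distrib_left diff_divide_distrib add_divide_distrib)
      also have "\<dots> = (\<Sum>i<M. cnj zet ^ (i * j) * zet ^ (i * 0)) / of_nat M - (\<Sum>i<M. cnj zet ^ (i * j) * zet ^ (i * k)) / of_nat M"
      proof -
        have "(\<Sum>i<M. cnj zet ^ (i * j) * (ch d (g [^] i) * (2 - st (g [^] i))))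
          = (\<Sum>i<M. cnj zet ^ (i * j) * zet ^ (i * 0) - cnj zet ^ (i * j) * zet ^ (i * k))"
          unfolding chd[OF nat_pow_closed[OF g]] psi by (simp add: right_diff_distrib)
        then show ?thesis by (simp only: sum_subtractf diff_divide_distrib)
      qed
      also have "\<dots> = of_int ((if j = 0 then 1 else 0) - (if j = k then 1 else 0))"
        unfolding ind[OF j M_pos] ind[OF j k(1)] by simp
      finally show ?thesis by (simp only: of_int_eq_iff)
    qed
    define N where "N = (\<Sum>j<M. n j)"
    \<comment> \<open>The first moment is the exponent of the determinant of g. Modulo M a shift by
      c changes it by - c N, so the shifts by a and b cancel in the second difference, while its
      right-hand side has first moment - k; thus M divides k.\<close>
    define J where "J = (\<Sum>j<M. int j * n j)"
    have sh: "int M dvd (\<Sum>j<M. int j * n (j + c)) - J + int c * N" for c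
    proof -
      have 1: "int M dvd (\<Sum>j<M. int (j + c) * n (j + c)) - J" unfolding J_def
        by (rule shift_mod[of M "\<lambda>j. int j * n j"]) (simp add: per algebra_simps)
      have 2: "int M dvd (\<Sum>j<M. n (j + c)) - N" unfolding N_def
        by (rule shift_mod) (simp add: per)
      have eq: "(\<Sum>j<M. int j * n (j + c)) - J + int c * N
        = ((\<Sum>j<M. int (j + c) * n (j + c)) - J) - int c * ((\<Sum>j<M. n (j + c)) - N)"
        by (simp add: algebra_simps sum.distrib sum_distrib_left)
      show ?thesis unfolding eq by (rule dvd_diff[OF 1 dvd_mult[OF 2]])
    qed
    have "(\<Sum>j<M. int j * (2 * n j - n (j + a) - n (j + b))) = - int k"
    proof -
      have "(\<Sum>j<M. int j * (2 * n j - n (j + a) - n (j + b))) = (\<Sum>j<M. if j = k then - int k else 0)"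
        by (intro sum.cong) (auto simp: rec)
      then show ?thesis using k by (simp add: sum.delta)
    qed
    moreover have "(\<Sum>j<M. int j * (2 * n j - n (j + a) - n (j + b)))
      = - (((\<Sum>j<M. int j * n (j + a)) - J + int a * N) + ((\<Sum>j<M. int j * n (j + b)) - J + int b * N)) + int (a + b) * N"
      unfolding J_def by (simp add: algebra_simps sum.distrib sum_subtractf sum_distrib_left)
    ultimately have eq: "- int k = - (((\<Sum>j<M. int j * n (j + a)) - J + int a * N) + ((\<Sum>j<M. int j * n (j + b)) - J + int b * N)) + int (a + b) * N"
      by (simp only:)
    have "int M dvd int (a + b) * N" unfolding ab by simp
    then have "int M dvd - int k" unfolding eq
      by (intro dvd_add[OF iffD2[OF dvd_minus_iff dvd_add[OF sh sh]]])
    then have "k = 0" using k(1) by (auto dest: zdvd_imp_le)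
    then show ?thesis using psi[of 1] g by simp
  qed
  then show ?thesis by (intro IrrC_eqI[OF p(1) triv_IrrC]) (simp add: triv_def)
qed

text \<open>An element e of least size in the orbit exists by \<open>sz_bounded\<close>. Minimality
  makes every \<open>cf \<phi> e\<close> nonnegative, since a reflection changes the size by
  \<open>dg \<phi> * cf \<phi> e\<close>; as these products sum to 1, only one is nonzero, at a
  character of degree 1. By \<open>linear_trivial\<close> it is the trivial one, so e is orthogonal
  to all simple roots.\<close>

lemma reach_nul: assumes "d \<in> extensional IrrC" shows "\<exists>r. reach d (nul r)"
proof -
  obtain C where C: "\<And>e. q2 e = q2 d \<Longrightarrow> real_of_int (sz e) \<ge> C" using sz_bounded by blast
  define c where "c = \<lfloor>C\<rfloor>"
  have c: "sz e \<ge> c" if "reach d e" for e using C[OF reach_q2[OF that]] by (simp add: c_def floor_le_iff le_floor_iff)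
  obtain e where e: "reach d e" "\<And>f. reach d f \<Longrightarrow> nat (sz e - c) \<le> nat (sz f - c)"
    using ex_has_least_nat[of "reach d" d "\<lambda>e. nat (sz e - c)"] reach.start by blast
  have min: "sz e \<le> sz f" if "reach d f" for f using e(2)[OF that] c[OF that] c[OF e(1)] by linarith
  have nn: "cf \<phi> e \<ge> 0" if p: "\<phi> \<in> IrrC" for \<phi>
  proof -
    have "sz e \<le> sz e + int (dg \<phi>) * cf \<phi> e" using min[OF reach.step[OF e(1) p]] sz_refl[OF p] by simp
    then show ?thesis using dg(2)[OF p] by (simp add: zero_le_mult_iff)
  qed
  have "(\<Sum>\<phi>\<in>IrrC. nat (int (dg \<phi>) * cf \<phi> e)) = Suc 0"
  proof -
    have "int (\<Sum>\<phi>\<in>IrrC. nat (int (dg \<phi>) * cf \<phi> e)) = (\<Sum>\<phi>\<in>IrrC. int (dg \<phi>) * cf \<phi> e)"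
      unfolding of_nat_sum using nn by (intro sum.cong) auto
    then have "int (\<Sum>\<phi>\<in>IrrC. nat (int (dg \<phi>) * cf \<phi> e)) = int (Suc 0)" using sum_cf[of e] by (simp only: of_nat_Suc of_nat_0 add_0_right)
    then show ?thesis by (simp only: of_nat_eq_iff)
  qed
  then obtain \<psi> where \<psi>: "\<psi> \<in> IrrC" "nat (int (dg \<psi>) * cf \<psi> e) = Suc 0"
    "\<And>\<phi>. \<phi> \<in> IrrC \<Longrightarrow> \<psi> \<noteq> \<phi> \<Longrightarrow> nat (int (dg \<phi>) * cf \<phi> e) = 0"
    using finite_IrrC by (subst (asm) sum_eq_Suc0_iff) auto
  have "int (dg \<psi>) * cf \<psi> e = 1" using \<psi>(2) by simp
  then have d1: "dg \<psi> = 1" "cf \<psi> e = 1" using nn[OF \<psi>(1)] by (auto simp: zmult_eq_1_iff)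
  have z: "cf \<phi> e = 0" if "\<phi> \<in> IrrC" "\<psi> \<noteq> \<phi>" for \<phi>
    using \<psi>(3)[OF that] nn[OF that(1)] dg(2)[OF that(1)] by (simp add: mult_le_0_iff)
  have B: "Bv \<phi> e = eps \<phi> - un \<psi> \<phi>" if "\<phi> \<in> IrrC" for \<phi>
    using z[OF that] d1 by (cases "\<phi> = \<psi>") (auto simp: cf_def un_def)
  have "\<psi> = triv" by (rule linear_trivial[OF \<psi>(1) d1(1) B])
  then have "Bv \<phi> e = 0" if "\<phi> \<in> IrrC" for \<phi> using B[OF that] by (simp add: eps_def un_def)
  then have "Bf e e = 0" by (simp add: Bf_def)
  then have "e \<phi> = e triv * int (dg \<phi>)" if "\<phi> \<in> IrrC" for \<phi> using Bf_zero that by blast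
  then have "e = nul (e triv)"
    using reach_ext[OF e(1) assms] unfolding nul_def by (intro extensionalityI[of _ IrrC]) auto
  then show ?thesis using e(1) by metis
qed

section \<open>Roots and regular parameters\<close>

lemma sum_even_diag: "finite A \<Longrightarrow> A \<subseteq> IrrC \<Longrightarrow> even (\<Sum>\<phi>\<in>A. \<Sum>\<psi>\<in>A. d \<phi> * ca \<phi> \<psi> * d \<psi>)"
proof (induction A rule: finite_induct)
  case (insert x A)
  have "(\<Sum>\<phi>\<in>insert x A. \<Sum>\<psi>\<in>insert x A. d \<phi> * ca \<phi> \<psi> * d \<psi>)
    = d x * ca x x * d x + (\<Sum>\<psi>\<in>A. d x * ca x \<psi> * d \<psi>) + ((\<Sum>\<phi>\<in>A. d \<phi> * ca \<phi> x * d x) + (\<Sum>\<phi>\<in>A. \<Sum>\<psi>\<in>A. d \<phi> * ca \<phi> \<psi> * d \<psi>))"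
    using insert by (simp add: sum.distrib)
  moreover have "(\<Sum>\<phi>\<in>A. d \<phi> * ca \<phi> x * d x) = (\<Sum>\<psi>\<in>A. d x * ca x \<psi> * d \<psi>)"
    by (simp add: ca_sym mult_ac)
  ultimately show ?case using insert by (simp add: ca_diag)
qed simp

lemma Bf_even: "even (Bf d d)"
  using sum_even_diag[OF finite_IrrC subset_refl, of d] by (simp add: Bf_def Bv_def sum_distrib_left mult.assoc)

text \<open>Write b = u - v with u, v \<ge> 0 of disjoint support. Then \<open>Bf u v\<close> is at
  most 0, so the even nonnegative norms of u and v sum to at most 2 and one of them is 0. That part
  is a multiple of \<delta>, hence zero or of full support; in the latter case the other part would
  vanish and b would have norm 0. So b has one sign and cannot have size 0.\<close>

lemma root_sz: assumes "Bf b b = 2" shows "sz b \<noteq> 0"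
proof -
  define u where "u = (\<lambda>x. max (b x) 0)"
  define v where "v = (\<lambda>x. max (- b x) 0)"
  have uv: "b = (\<lambda>x. (-1) * v x + u x)" by (auto simp: u_def v_def fun_eq_iff)
  have disj: "u x = 0 \<or> v x = 0" for x by (auto simp: u_def v_def)
  have "Bf u v \<le> 0" unfolding Bf_def Bv_def sum_distrib_left
  proof (intro sum_nonpos)
    fix \<phi> \<psi> assume p: "\<phi> \<in> IrrC" "\<psi> \<in> IrrC"
    show "u \<phi> * (ca \<phi> \<psi> * v \<psi>) \<le> 0"
    proof (cases "\<phi> = \<psi>")
      case True
      then show ?thesis using disj[of \<phi>] by auto
    next
      case False
      have "u \<phi> \<ge> 0" "v \<psi> \<ge> 0" by (auto simp: u_def v_def)
      then show ?thesis using ca_off[OF p False] by (simp add: mult_nonneg_nonpos mult_nonpos_nonneg)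
    qed
  qed
  moreover have "2 = Bf u u + Bf v v - 2 * Bf u v"
    using assms unfolding uv Bf_lin Bf_lin' using Bf_sym[of v u] by simp
  ultimately have "Bf u u + Bf v v \<le> 2" by linarith
  then have "Bf u u = 0 \<or> Bf v v = 0" using Bf_even[of u] Bf_even[of v] Bf_nonneg[of u] Bf_nonneg[of v] by presburger
  have key: "Bf s s = 0 \<Longrightarrow> (\<And>x. s x = 0 \<or> w x = 0) \<Longrightarrow> Bf w w = 2 + 2 * Bf s w - Bf s s \<Longrightarrow> (\<And>x. s x \<ge> 0) \<Longrightarrow>
     (\<forall>\<phi>\<in>IrrC. s \<phi> = 0)" for s w
  proof -
    assume a: "Bf s s = 0" "\<And>x. s x = 0 \<or> w x = 0" "Bf w w = 2 + 2 * Bf s w - Bf s s" "\<And>x. s x \<ge> 0"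
    have s: "s \<phi> = s triv * int (dg \<phi>)" if "\<phi> \<in> IrrC" for \<phi> using Bf_zero[OF a(1) that] .
    show ?thesis
    proof (cases "s triv = 0")
      case True
      then show ?thesis using s by (metis mult_zero_left)
    next
      case False
      then have "s \<phi> \<noteq> 0" if "\<phi> \<in> IrrC" for \<phi> using s[OF that] dg(2)[OF that] by (metis mult_eq_0_iff of_nat_0_eq_iff less_irrefl)
      then have w: "w \<phi> = 0" if "\<phi> \<in> IrrC" for \<phi> using a(2) that by metis
      then have "Bf w w = 0" by (simp add: Bf_def)
      moreover have "Bf s w = 0" unfolding Bf_sym[of s] using w by (simp add: Bf_def)
      ultimately show ?thesis using a(1,3) by simp
    qed
  qed
  have sgn: "(\<forall>\<phi>\<in>IrrC. b \<phi> \<ge> 0) \<or> (\<forall>\<phi>\<in>IrrC. b \<phi> \<le> 0)"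
  proof -
    have e: "2 = Bf u u + Bf v v - 2 * Bf u v" by fact
    have un: "u x \<ge> 0" "v x \<ge> 0" for x by (auto simp: u_def v_def)
    from \<open>Bf u u = 0 \<or> Bf v v = 0\<close> show ?thesis
    proof
      assume "Bf u u = 0"
      moreover have "Bf v v = 2 + 2 * Bf u v - Bf u u" using e by linarith
      ultimately have "\<forall>\<phi>\<in>IrrC. u \<phi> = 0" using key[of u v] disj un(1) by blast
      then show ?thesis by (auto simp: u_def max_def split: if_splits)
    next
      assume "Bf v v = 0"
      moreover have "Bf u u = 2 + 2 * Bf v u - Bf v v" using e Bf_sym[of v u] by linarith
      moreover have "v x = 0 \<or> u x = 0" for x using disj[of x] by blast
      ultimately have "\<forall>\<phi>\<in>IrrC. v \<phi> = 0" using key[of v u] un(2) by blast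
      then show ?thesis by (auto simp: v_def max_def split: if_splits)
    qed
  qed
  show ?thesis
  proof
    assume z: "sz b = 0"
    have "int (dg \<phi>) * b \<phi> = 0" if p: "\<phi> \<in> IrrC" for \<phi>
      using sgn
    proof
      assume "\<forall>\<phi>\<in>IrrC. b \<phi> \<ge> 0"
      then show ?thesis using z p finite_IrrC unfolding sz_def by (subst (asm) sum_nonneg_eq_0_iff) auto
    next
      assume *: "\<forall>\<phi>\<in>IrrC. b \<phi> \<le> 0"
      have "(\<Sum>\<phi>\<in>IrrC. - (int (dg \<phi>) * b \<phi>)) = 0" using z by (simp add: sz_def sum_negf)
      then have "- (int (dg \<phi>) * b \<phi>) = 0" using * p finite_IrrC
        by (subst (asm) sum_nonneg_eq_0_iff) (auto simp: mult_nonneg_nonpos)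
      then show ?thesis by simp
    qed
    then have "b \<phi> = 0" if "\<phi> \<in> IrrC" for \<phi> using dg(2)[OF that] that by (metis mult_eq_0_iff of_nat_0_eq_iff less_irrefl)
    then have "Bf b b = 0" by (simp add: Bf_def)
    then show False using assms by simp
  qed
qed

text \<open>Vectors of norm 2 stand for the real roots; described by their norm they are visibly
  permuted by the reflections.\<close>

definition regular :: "(('a \<Rightarrow> complex) \<Rightarrow> complex) \<Rightarrow> bool" where
  "regular l \<longleftrightarrow> (\<forall>b. Bf b b = 2 \<longrightarrow> (\<Sum>\<phi>\<in>IrrC. l \<phi> * of_int (b \<phi>)) \<noteq> 0)"
text \<open>The action on parameters dual to the linear reflections of the lattice: pairing
  \<open>lrefl \<phi> l\<close> with b is pairing l with the reflected b.\<close>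

definition lrefl :: "('a \<Rightarrow> complex) \<Rightarrow> (('a \<Rightarrow> complex) \<Rightarrow> complex) \<Rightarrow> ('a \<Rightarrow> complex) \<Rightarrow> complex" where
  "lrefl \<phi> l \<psi> = l \<psi> - of_int (ca \<phi> \<psi>) * l \<phi>"

lemma regular_nz: assumes "regular l" "\<phi> \<in> IrrC" shows "l \<phi> \<noteq> 0"
proof -
  have "Bf (un \<phi>) (un \<phi>) = 2" using assms by (simp add: Bf_un Bv_un ca_diag)
  then have "(\<Sum>\<psi>\<in>IrrC. l \<psi> * of_int (un \<phi> \<psi>)) \<noteq> 0" using assms by (simp add: regular_def)
  moreover have "(\<Sum>\<psi>\<in>IrrC. l \<psi> * of_int (un \<phi> \<psi>)) = l \<phi>"
    using assms finite_IrrC by (simp add: un_def if_distrib[of "\<lambda>x. _ * of_int x"] sum.delta cong: if_cong)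
  ultimately show ?thesis by simp
qed

lemma regular_lrefl: assumes "regular l" "\<phi> \<in> IrrC" shows "regular (lrefl \<phi> l)"
  unfolding regular_def
proof (intro allI impI)
  fix b assume b: "Bf b b = 2"
  define b' where "b' = (\<lambda>x. (- Bv \<phi> b) * un \<phi> x + b x)"
  have "Bf b' b' = 2" unfolding b'_def Bf_lin Bf_lin' using assms(2) b
    by (simp add: Bf_un Bv_un ca_diag Bf_sym[of b "un \<phi>"])
  then have "(\<Sum>\<psi>\<in>IrrC. l \<psi> * of_int (b' \<psi>)) \<noteq> 0" using assms(1) by (simp add: regular_def)
  moreover have "(\<Sum>\<psi>\<in>IrrC. l \<psi> * of_int (b' \<psi>)) = (\<Sum>\<psi>\<in>IrrC. (if \<psi> = \<phi> then - (l \<phi> * of_int (Bv \<phi> b)) else 0) + l \<psi> * of_int (b \<psi>))"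
    by (intro sum.cong) (auto simp: b'_def un_def algebra_simps)
  moreover have "\<dots> = - (l \<phi> * of_int (Bv \<phi> b)) + (\<Sum>\<psi>\<in>IrrC. l \<psi> * of_int (b \<psi>))"
    using assms(2) finite_IrrC by (simp add: sum.distrib sum.delta)
  moreover have "(\<Sum>\<psi>\<in>IrrC. lrefl \<phi> l \<psi> * of_int (b \<psi>)) = - (l \<phi> * of_int (Bv \<phi> b)) + (\<Sum>\<psi>\<in>IrrC. l \<psi> * of_int (b \<psi>))"
    by (simp add: lrefl_def Bv_def algebra_simps sum_subtractf sum_distrib_left)
  ultimately show "(\<Sum>\<psi>\<in>IrrC. lrefl \<phi> l \<psi> * of_int (b \<psi>)) \<noteq> 0" by simp
qed

lemma lrefl_lrefl: assumes "\<phi> \<in> IrrC" shows "lrefl \<phi> (lrefl \<phi> l) = l"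
  by (rule ext) (simp add: lrefl_def ca_diag[OF assms] algebra_simps)

lemma regular_dg: "regular (\<lambda>\<phi>. of_nat (dg \<phi>))"
  unfolding regular_def
proof (intro allI impI)
  fix b assume "Bf b b = 2"
  then have "sz b \<noteq> 0" by (rule root_sz)
  moreover have "(\<Sum>\<phi>\<in>IrrC. of_nat (dg \<phi>) * of_int (b \<phi>)) = (of_int (sz b) :: complex)" by (simp add: sz_def)
  ultimately show "(\<Sum>\<phi>\<in>IrrC. of_nat (dg \<phi>) * of_int (b \<phi>)) \<noteq> (0 :: complex)" by simp
qed

end

section \<open>Reflection functors\<close>

lemma blk_mult2: "blk a b X * (blk c d Y * Z) = (if b = c then blk a d (X * Y) * Z else 0)"
  by (simp add: mult.assoc[symmetric] blk_mult)

context sl2_group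
begin

text \<open>An equivariant point with moment map value \<open>C\<close>; the space carrying it is the image of \<open>\<sigma> \<one>\<close>,
  the column \<open>v\<close> and the row \<open>w\<close> sit at index 0.\<close>

definition cm :: "('a \<Rightarrow> fmat) \<Rightarrow> fmat \<Rightarrow> fmat \<Rightarrow> fmat \<Rightarrow> fmat \<Rightarrow> fmat \<Rightarrow> bool" where
  "cm \<sigma> \<alpha> \<beta> v w C \<longleftrightarrow> rep \<sigma> \<and>
     \<sigma> \<one> * \<alpha> = \<alpha> \<and> \<alpha> * \<sigma> \<one> = \<alpha> \<and> \<sigma> \<one> * \<beta> = \<beta> \<and> \<beta> * \<sigma> \<one> = \<beta> \<and>
     \<sigma> \<one> * v = v \<and> v * eu 0 0 = v \<and> w * \<sigma> \<one> = w \<and> eu 0 0 * w = w \<and>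
     (\<forall>g\<in>carrier G. \<alpha> * \<sigma> g = \<sigma> g * (ga g \<star> \<alpha> + gb g \<star> \<beta>) \<and> \<beta> * \<sigma> g = \<sigma> g * (gc g \<star> \<alpha> + gd g \<star> \<beta>)
        \<and> \<sigma> g * v = v \<and> w * \<sigma> g = w) \<and>
     \<alpha> * \<beta> - \<beta> * \<alpha> + v * w = C"

text \<open>The normalisation makes the degrees \<open>dg\<close>, rather than the constant 1, the parameter of the identity.\<close>

definition cen :: "(('a \<Rightarrow> complex) \<Rightarrow> complex) \<Rightarrow> ('a \<Rightarrow> fmat) \<Rightarrow> fmat" where
  "cen l \<sigma> = (\<Sum>\<phi>\<in>IrrC. (l \<phi> / of_nat (dg \<phi>)) \<star> iso \<phi> \<sigma>)"

definition has_type :: "('a \<Rightarrow> fmat) \<Rightarrow> (('a \<Rightarrow> complex) \<Rightarrow> int) \<Rightarrow> bool" where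
  "has_type \<sigma> d \<longleftrightarrow> (\<forall>\<phi>\<in>IrrC. inner (chr \<sigma>) \<phi> = of_int (d \<phi>))"

definition CM :: "(('a \<Rightarrow> complex) \<Rightarrow> int) \<Rightarrow> (('a \<Rightarrow> complex) \<Rightarrow> complex) \<Rightarrow> bool" where
  "CM d l \<longleftrightarrow> (\<exists>\<sigma> \<alpha> \<beta> v w. cm \<sigma> \<alpha> \<beta> v w (cen l \<sigma>) \<and> has_type \<sigma> d)"

lemma move_iso: "intw \<sigma> \<tau> X \<Longrightarrow> X * iso \<phi> \<sigma> = iso \<phi> \<tau> * X"
  unfolding iso_def zf_def using intw_comm[of \<sigma> \<tau> X]
  by (simp add: sum_distrib_left sum_distrib_right cong: sum.cong)

lemma iso_add: "iso \<phi> (\<lambda>g. \<sigma> g + \<tau> g) = iso \<phi> \<sigma> + iso \<phi> \<tau>"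
  by (simp add: iso_def zf_def sc_add sum.distrib)
lemma iso_blk: "iso \<phi> (\<lambda>g. blk p q (\<sigma> g)) = blk p q (iso \<phi> \<sigma>)"
  by (simp add: iso_def zf_def blk_sum blk_sc)

text \<open>The \<chi>-part of the space, the image of \<open>e\<close>, is exchanged for another
  module. All arrows at the vertex \<chi> pass through the \<chi>-part of \<tau>, with \<iota>
  leading into \<tau> and \<pi> out of it. Since \<open>\<pi> * \<iota>\<close> is the scalar \<mu>
  \<noteq> 0 on the \<chi>-part, the image of \<iota> has the kernel of \<pi> as a complement there.
  That kernel, the image of \<kappa>, is the new \<chi>-part.\<close>

lemma reflection:
  assumes cm: "cm \<sigma> \<alpha> \<beta> v w (cen l \<sigma>)" and ty: "has_type \<sigma> d" and chi: "\<chi> \<in> IrrC" and lnz: "l \<chi> \<noteq> 0"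
  shows "CM (refl \<chi> d) (lrefl \<chi> l)"
proof -
  note [simp] = of_nat_eq_0_iff
  have rs: "rep \<sigma>" and eqv: "\<And>g. g \<in> carrier G \<Longrightarrow> \<alpha> * \<sigma> g = \<sigma> g * (ga g \<star> \<alpha> + gb g \<star> \<beta>)"
    "\<And>g. g \<in> carrier G \<Longrightarrow> \<beta> * \<sigma> g = \<sigma> g * (gc g \<star> \<alpha> + gd g \<star> \<beta>)"
    "\<And>g. g \<in> carrier G \<Longrightarrow> \<sigma> g * v = v" "\<And>g. g \<in> carrier G \<Longrightarrow> w * \<sigma> g = w"
    and mom: "\<alpha> * \<beta> - \<beta> * \<alpha> + v * w = cen l \<sigma>"
    using cm by (auto simp: cm_def)
  define E where "E = \<sigma> \<one>"
  have un: "E * \<alpha> = \<alpha>" "\<alpha> * E = \<alpha>" "E * \<beta> = \<beta>" "\<beta> * E = \<beta>" "E * v = v" "v * eu 0 0 = v" "w * E = w" "eu 0 0 * w = w"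
    using cm by (auto simp: cm_def E_def)
  have EE: "E * E = E" using rep_idem[OF rs] by (simp add: E_def)
  have dgnz: "(of_nat (dg \<chi>) :: complex) \<noteq> 0" using dg(2)[OF chi] by simp
  define \<mu> where "\<mu> = l \<chi> / of_nat (dg \<chi>)"
  have mu: "\<mu> \<noteq> 0" using lnz dgnz by (simp add: \<mu>_def)
  define f where "f = eu 0 0"
  have ff: "f * f = f" by (simp add: f_def)
  define e where "e = iso \<chi> \<sigma>"
  have ee: "e * e = e" using iso_mult[OF chi chi rs] by (simp add: e_def)
  have ie: "intw \<sigma> \<sigma> e" using iso_intw[OF chi rs] by (simp add: e_def)
  have eE: "e * E = e" "E * e = e" using ie by (auto simp: intw_def E_def)
  define \<tau> where "\<tau> = (\<lambda>g. tens \<sigma> g + blk 3 3 f)"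
  have r3: "rep (\<lambda>g. blk 3 3 f)" by (simp add: rep_def blk_mult ff)
  have rt: "rep \<tau>"
    using tens_rep[OF rs] unfolding rep_def \<tau>_def
    by (simp add: distrib_left distrib_right blk_mult ff) (simp add: tens_def algebra_simps blk_mult)
  have t1: "\<tau> \<one> = blk 1 1 E + blk 2 2 E + blk 3 3 f" by (simp add: \<tau>_def tens_one E_def)
  define \<sigma>0 where "\<sigma>0 = (\<lambda>g. blk 0 0 (\<sigma> g))"
  have r0: "rep \<sigma>0" using rs by (simp add: rep_def \<sigma>0_def blk_mult)
  \<comment> \<open>The signs here and in \<iota> are those of the moment map:
    \<open>\<pi> * \<iota>\<close> becomes
    \<open>\<alpha> * \<beta> - \<beta> * \<alpha> + v * w\<close>.\<close>
  define \<pi> where "\<pi> = blk 0 1 \<alpha> + blk 0 2 \<beta> + blk 0 3 v"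
  define \<iota> where "\<iota> = blk 1 0 \<beta> - blk 2 0 \<alpha> + blk 3 0 w"
  have sa: "\<sigma> g * \<alpha> = gd g \<star> (\<alpha> * \<sigma> g) - gb g \<star> (\<beta> * \<sigma> g)"
    and sb: "\<sigma> g * \<beta> = ga g \<star> (\<beta> * \<sigma> g) - gc g \<star> (\<alpha> * \<sigma> g)" if g: "g \<in> carrier G" for g
  proof -
    have "gd g \<star> (\<alpha> * \<sigma> g) - gb g \<star> (\<beta> * \<sigma> g) = (ga g * gd g - gb g * gc g) \<star> (\<sigma> g * \<alpha>)"
      unfolding eqv(1,2)[OF g] by (simp add: algebra_simps sc_add sc_diff sc_diff_left)
    then show "\<sigma> g * \<alpha> = gd g \<star> (\<alpha> * \<sigma> g) - gb g \<star> (\<beta> * \<sigma> g)" using det1[OF g] by simp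
    have "ga g \<star> (\<beta> * \<sigma> g) - gc g \<star> (\<alpha> * \<sigma> g) = (ga g * gd g - gb g * gc g) \<star> (\<sigma> g * \<beta>)"
      unfolding eqv(1,2)[OF g] by (simp add: algebra_simps sc_add sc_diff sc_diff_left)
    then show "\<sigma> g * \<beta> = ga g \<star> (\<beta> * \<sigma> g) - gc g \<star> (\<alpha> * \<sigma> g)" using det1[OF g] by simp
  qed
  have fw: "f * w = w" "v * f = v" using un by (auto simp: f_def)
  have ipi: "intw \<tau> \<sigma>0 \<pi>" unfolding intw_def
  proof (intro conjI ballI)
    show "\<pi> * \<tau> \<one> = \<pi>" "\<sigma>0 \<one> * \<pi> = \<pi>"
      unfolding t1 \<pi>_def \<sigma>0_def E_def[symmetric] by (simp_all add: algebra_simps blk_mult un fw)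
    fix g assume g: "g \<in> carrier G"
    show "\<sigma>0 g * \<pi> = \<pi> * \<tau> g"
      unfolding \<sigma>0_def \<pi>_def \<tau>_def tens_def
      by (simp add: algebra_simps blk_mult sa[OF g] sb[OF g] eqv(3)[OF g] fw blk_diff blk_sc)
  qed
  have iio: "intw \<sigma>0 \<tau> \<iota>" unfolding intw_def
  proof (intro conjI ballI)
    show "\<iota> * \<sigma>0 \<one> = \<iota>" "\<tau> \<one> * \<iota> = \<iota>"
      unfolding t1 \<iota>_def \<sigma>0_def E_def[symmetric] by (simp_all add: algebra_simps blk_mult un fw)
    fix g assume g: "g \<in> carrier G"
    show "\<tau> g * \<iota> = \<iota> * \<sigma>0 g"
      unfolding \<sigma>0_def \<iota>_def \<tau>_def tens_def
      by (simp add: algebra_simps blk_mult eqv[OF g] fw blk_add blk_sc sc_add)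
  qed
  have ec: "e * cen l \<sigma> = \<mu> \<star> e"
  proof -
    have "e * cen l \<sigma> = (\<Sum>\<phi>\<in>IrrC. if \<phi> = \<chi> then \<mu> \<star> e else 0)"
      unfolding cen_def sum_distrib_left
      by (intro sum.cong refl) (auto simp: e_def iso_mult[OF chi _ rs] \<mu>_def)
    then show ?thesis using chi finite_IrrC by (simp add: sum.delta)
  qed
  have ce: "cen l \<sigma> * e = \<mu> \<star> e"
  proof -
    have "cen l \<sigma> * e = (\<Sum>\<phi>\<in>IrrC. if \<phi> = \<chi> then \<mu> \<star> e else 0)"
      unfolding cen_def sum_distrib_right
      by (intro sum.cong refl) (auto simp: e_def iso_mult[OF _ chi rs] \<mu>_def)
    then show ?thesis using chi finite_IrrC by (simp add: sum.delta)
  qed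
  have pio: "\<pi> * \<iota> = blk 0 0 (cen l \<sigma>)"
    unfolding mom[symmetric] \<pi>_def \<iota>_def by (simp add: algebra_simps blk_mult blk_add blk_diff)
  define P where "P = iso \<chi> \<tau>"
  have PP: "P * P = P" using iso_mult[OF chi chi rt] by (simp add: P_def)
  have iP: "intw \<tau> \<tau> P" using iso_intw[OF chi rt] by (simp add: P_def)
  have e0: "iso \<chi> \<sigma>0 = blk 0 0 e" by (simp add: \<sigma>0_def iso_blk e_def)
  have piP: "\<pi> * P = blk 0 0 e * \<pi>" using move_iso[OF ipi, of \<chi>] by (simp add: P_def e0)
  have Pio: "P * \<iota> = \<iota> * blk 0 0 e" using move_iso[OF iio, of \<chi>] by (simp add: P_def e0)
  define Q where "Q = \<iota> * blk 0 0 e * \<pi>"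
  \<comment> \<open>Since \<open>Q * Q\<close> is \<mu> times \<open>Q\<close>, the multiple Q /
    \<mu> projects onto the image of the \<chi>-part under \<iota>, and \<kappa> onto its complement
    in the \<chi>-part of \<tau>.\<close>
  define \<kappa> where "\<kappa> = P - (1 / \<mu>) \<star> Q"
  have PQ: "P * Q = Q" unfolding Q_def by (simp add: mult.assoc[symmetric] Pio) (simp add: mult.assoc blk_mult2 ee)
  have QP: "Q * P = Q" unfolding Q_def by (simp add: mult.assoc piP blk_mult2 ee)
  have QQ: "Q * Q = \<mu> \<star> Q"
  proof -
    have "Q * Q = \<iota> * (blk 0 0 e * ((\<pi> * \<iota>) * (blk 0 0 e * \<pi>)))" unfolding Q_def by (simp add: mult.assoc)
    also have "\<dots> = \<iota> * (blk 0 0 (e * cen l \<sigma> * e) * \<pi>)" unfolding pio by (simp add: blk_mult2 mult.assoc)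
    also have "\<dots> = \<mu> \<star> Q" by (simp add: ec Q_def ee blk_sc mult.assoc)
    finally show ?thesis .
  qed
  have kk: "\<kappa> * \<kappa> = \<kappa>"
    unfolding \<kappa>_def by (simp add: algebra_simps PP PQ QP QQ sc_diff mu)
  have pk: "\<pi> * \<kappa> = 0"
  proof -
    have "\<pi> * Q = (\<pi> * \<iota>) * (blk 0 0 e * \<pi>)" by (simp add: Q_def mult.assoc)
    also have "\<dots> = \<mu> \<star> (blk 0 0 e * \<pi>)" unfolding pio by (simp add: blk_mult2 ce blk_sc)
    finally show ?thesis unfolding \<kappa>_def by (simp add: algebra_simps piP mu)
  qed
  have ki: "\<kappa> * \<iota> = 0"
  proof -
    have "Q * \<iota> = \<iota> * (blk 0 0 e * (\<pi> * \<iota>))" by (simp add: Q_def mult.assoc)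
    also have "\<dots> = \<mu> \<star> (\<iota> * blk 0 0 e)" unfolding pio by (simp add: blk_mult ec blk_sc)
    finally show ?thesis unfolding \<kappa>_def by (simp add: algebra_simps Pio mu)
  qed
  have kP: "\<kappa> * P = \<kappa>" "P * \<kappa> = \<kappa>" unfolding \<kappa>_def by (simp_all add: algebra_simps PP PQ QP)
  have iQ: "intw \<tau> \<tau> Q"
    unfolding Q_def using intw_mult[OF ipi intw_mult[OF _ iio]] iso_intw[OF chi r0] by (simp add: e0 mult.assoc)
  have ik: "intw \<tau> \<tau> \<kappa>" unfolding \<kappa>_def by (intro intw_diff intw_sc iQ iP)
  have kt: "\<tau> g * \<kappa> = \<kappa> * \<tau> g" if "g \<in> carrier G" for g using intw_comm[OF ik that] .
  have kt1: "\<kappa> * \<tau> \<one> = \<kappa>" "\<tau> \<one> * \<kappa> = \<kappa>" using ik by (auto simp: intw_def)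
  \<comment> \<open>\<kappa> lives in blocks 1 to 3, so every product meeting block 0
    vanishes.\<close>
  have k0: "\<kappa> * blk 0 q X = 0" "blk p 0 X * \<kappa> = 0" for p q X
  proof -
    have "\<kappa> * blk 0 q X = \<kappa> * (\<tau> \<one> * blk 0 q X)" by (simp add: mult.assoc[symmetric] kt1)
    then show "\<kappa> * blk 0 q X = 0" by (simp add: t1 algebra_simps blk_mult)
    have "blk p 0 X * \<kappa> = (blk p 0 X * \<tau> \<one>) * \<kappa>" by (simp add: mult.assoc kt1)
    then show "blk p 0 X * \<kappa> = 0" by (simp add: t1 algebra_simps blk_mult)
  qed
  have k0': "\<kappa> * (blk 0 q X * Y) = 0" "blk p 0 X * (\<kappa> * Y) = 0" for p q X Y
    using k0 by (simp_all add: mult.assoc[symmetric])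
  define D where "D = blk 1 1 e + blk 2 2 e"
  have iD: "intw \<tau> \<tau> D" unfolding intw_def
  proof (intro conjI ballI)
    show "D * \<tau> \<one> = D" "\<tau> \<one> * D = D" by (simp_all add: t1 D_def algebra_simps blk_mult eE)
    fix g assume "g \<in> carrier G"
    then show "\<tau> g * D = D * \<tau> g" using intw_comm[OF ie]
      by (simp add: \<tau>_def tens_def D_def algebra_simps blk_mult)
  qed
  \<comment> \<open>Here the absence of loops enters: the tensor product of the \<chi>-part with the
    plane contains no \<chi>, so \<open>P\<close> kills it and \<kappa> sees only the complement of
    \<open>e\<close> in blocks 1 and 2.\<close>
  have PD: "P * D = 0"
  proof -
    have re: "rep (\<lambda>g. e * \<sigma> g)" by (rule rep_part[OF rs ie ee])
    have "D * \<tau> g = tens (\<lambda>g. e * \<sigma> g) g" for g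
      by (simp add: D_def \<tau>_def tens_def algebra_simps blk_mult)
    then have "iso \<chi> (\<lambda>g. D * \<tau> g) = iso \<chi> (tens (\<lambda>g. e * \<sigma> g))" by (simp add: iso_def zf_def)
    then have DP: "D * P = iso \<chi> (tens (\<lambda>g. e * \<sigma> g))" by (simp add: iso_left P_def)
    have "inner (chr (tens (\<lambda>g. e * \<sigma> g))) \<chi> = inner (\<lambda>g. of_int (d \<chi>) * (\<chi> g * st g)) \<chi>"
    proof (intro inner_cong refl)
      fix g assume g: "g \<in> carrier G"
      have "chr (\<lambda>g. e * \<sigma> g) g = of_int (d \<chi>) * \<chi> g"
        using iso_tr[OF chi rs g] ty chi by (simp add: chr_def e_def has_type_def)
      then show "chr (tens (\<lambda>g. e * \<sigma> g)) g = of_int (d \<chi>) * (\<chi> g * st g)" by (simp add: chr_tens)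
    qed
    also have "\<dots> = 0" unfolding inner_sc_left using mm_no_loop[OF chi] by (simp add: mm_def)
    finally have i0: "inner (chr (tens (\<lambda>g. e * \<sigma> g))) \<chi> = 0" .
    have rte: "rep (tens (\<lambda>g. e * \<sigma> g))" by (rule tens_rep[OF re])
    have "iso \<chi> (tens (\<lambda>g. e * \<sigma> g)) * tens (\<lambda>g. e * \<sigma> g) \<one> = iso \<chi> (tens (\<lambda>g. e * \<sigma> g))"
      using iso_intw[OF chi rte] by (simp add: intw_def)
    then have "tr (iso \<chi> (tens (\<lambda>g. e * \<sigma> g))) = 0" using iso_tr[OF chi rte one_closed] i0 by simp
    then have "iso \<chi> (tens (\<lambda>g. e * \<sigma> g)) = 0" using tr_idem_0 iso_mult[OF chi chi rte] by simp
    then have "D * P = 0" using DP by simp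
    moreover have "D * P = P * D" using move_iso[OF iD, of \<chi>] by (simp add: P_def)
    ultimately show ?thesis by simp
  qed
  have DP: "D * P = 0" using PD move_iso[OF iD, of \<chi>] by (simp add: P_def)
  have kD: "\<kappa> * D = 0" using kP PD by (metis mult.assoc mult_zero_right)
  have Dk: "D * \<kappa> = 0" using kP DP by (metis mult.assoc mult_zero_left)
  define F where "F = E - e"
  have FF: "F * F = F" by (simp add: F_def algebra_simps EE eE ee)
  have FF': "F * (F * X) = F * X" for X using FF by (metis mult.assoc)
  define T where "T = blk 1 1 F + blk 2 2 F + blk 3 3 f"
  have Tt: "T = \<tau> \<one> - D" by (simp add: T_def t1 D_def F_def blk_diff)
  have kT: "\<kappa> * T = \<kappa>" "T * \<kappa> = \<kappa>" by (simp_all add: Tt algebra_simps kt1 kD Dk)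
  have Fs: "F * \<sigma> g = \<sigma> g * F" if "g \<in> carrier G" for g
    using intw_comm[OF ie that] rs that by (simp add: F_def algebra_simps E_def rep_one)
  \<comment> \<open>The other isotypic parts stay in block 0, while the \<chi>-part is replaced by
    the image of \<kappa>; the two do not overlap.\<close>
  define \<sigma>N where "\<sigma>N = (\<lambda>g. blk 0 0 (F * \<sigma> g) + \<kappa> * \<tau> g)"
  have kblk: "\<kappa> * \<tau> g * blk 0 q X = 0" "blk p 0 X * (\<kappa> * \<tau> g) = 0" if "g \<in> carrier G" for g p q X
    using kt[OF that] by (simp_all add: mult.assoc[symmetric] k0) (metis kt[OF that] k0(1) mult.assoc mult_zero_right)
  have rN: "rep \<sigma>N" unfolding rep_def
  proof (intro ballI)
    fix x y assume xy: "x \<in> carrier G" "y \<in> carrier G"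
    have "\<kappa> * \<tau> x * (\<kappa> * \<tau> y) = \<kappa> * \<tau> (x \<otimes> y)"
      using kt[OF xy(1)] kk rep_mult[OF rt xy] by (metis mult.assoc)
    moreover have "F * \<sigma> x * (F * \<sigma> y) = F * \<sigma> (x \<otimes> y)"
      using Fs[OF xy(1)] FF rep_mult[OF rs xy] by (metis mult.assoc)
    ultimately show "\<sigma>N (x \<otimes> y) = \<sigma>N x * \<sigma>N y"
      unfolding \<sigma>N_def distrib_left distrib_right by (simp add: blk_mult kblk xy)
  qed
  have FE: "F * E = F" "E * F = F" by (simp_all add: F_def algebra_simps EE eE)
  have N1: "\<sigma>N \<one> = blk 0 0 F + \<kappa>" by (simp add: \<sigma>N_def kt1 E_def[symmetric] FE)
  \<comment> \<open>Arrows into the new part end with the projection \<kappa>, arrows out of it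
    start with \<kappa>. Putting the whole factor - \<mu> on the incoming arrows gives the new part
    the moment map value - \<mu>.\<close>
  define \<alpha>' where "\<alpha>' = blk 0 0 (F * \<alpha> * F) - \<mu> \<star> (\<kappa> * blk 1 0 F) - blk 0 2 F * \<kappa>"
  define \<beta>' where "\<beta>' = blk 0 0 (F * \<beta> * F) - \<mu> \<star> (\<kappa> * blk 2 0 F) + blk 0 1 F * \<kappa>"
  define v' where "v' = blk 0 0 (F * v) - \<mu> \<star> (\<kappa> * blk 3 0 f)"
  define w' where "w' = blk 0 0 (w * F) + blk 0 3 f * \<kappa>"
  note ks = k0 k0' blk_mult blk_mult2 FF FF'
  have kk': "\<kappa> * (\<kappa> * X) = \<kappa> * X" for X using kk by (metis mult.assoc)
  have ab: "\<alpha>' * \<beta>' = blk 0 0 (F * (\<alpha> * (F * (\<beta> * F)))) + blk 0 1 (F * (\<alpha> * F)) * \<kappa> - \<mu> \<star> (\<kappa> * blk 1 0 (F * (\<beta> * F)))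
      - \<mu> \<star> (\<kappa> * (blk 1 1 F * \<kappa>)) + \<mu> \<star> (blk 0 2 F * (\<kappa> * blk 2 0 F))"
    unfolding \<alpha>'_def \<beta>'_def by (simp add: algebra_simps ks kk kk')
  have ba: "\<beta>' * \<alpha>' = blk 0 0 (F * (\<beta> * (F * (\<alpha> * F)))) - blk 0 2 (F * (\<beta> * F)) * \<kappa> - \<mu> \<star> (\<kappa> * blk 2 0 (F * (\<alpha> * F)))
      + \<mu> \<star> (\<kappa> * (blk 2 2 F * \<kappa>)) - \<mu> \<star> (blk 0 1 F * (\<kappa> * blk 1 0 F))"
    unfolding \<alpha>'_def \<beta>'_def by (simp add: algebra_simps ks kk kk')
  have vw: "v' * w' = blk 0 0 (F * (v * (w * F))) + blk 0 3 (F * v) * \<kappa> - \<mu> \<star> (\<kappa> * blk 3 0 (w * F)) - \<mu> \<star> (\<kappa> * (blk 3 3 f * \<kappa>))"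
  proof -
    have "F * (v * f) = F * v" "f * (w * F) = w * F" using fw by (simp_all add: mult.assoc[symmetric])
    then show ?thesis unfolding v'_def w'_def by (simp add: algebra_simps ks ff)
  qed
  \<comment> \<open>Components of the moment map between old and new part cancel: out of the new
    part because \<open>\<pi> * \<kappa> = 0\<close>, and into it (\<open>from0\<close>) because
    \<open>\<kappa> * \<iota> = 0\<close>.\<close>
  have to0: "blk 0 1 (F * (\<alpha> * F)) * \<kappa> + blk 0 2 (F * (\<beta> * F)) * \<kappa> + blk 0 3 (F * v) * \<kappa> = 0"
  proof -
    have "blk 0 0 F * (\<pi> * T) = blk 0 1 (F * (\<alpha> * F)) + blk 0 2 (F * (\<beta> * F)) + blk 0 3 (F * v)"
      by (simp add: \<pi>_def T_def algebra_simps blk_mult fw)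
    then have "blk 0 1 (F * (\<alpha> * F)) * \<kappa> + blk 0 2 (F * (\<beta> * F)) * \<kappa> + blk 0 3 (F * v) * \<kappa>
      = blk 0 0 F * (\<pi> * T) * \<kappa>" by (simp add: distrib_right)
    also have "\<dots> = 0" by (simp add: mult.assoc kT pk)
    finally show ?thesis .
  qed
  have from0: "\<kappa> * blk 1 0 (F * (\<beta> * F)) - \<kappa> * blk 2 0 (F * (\<alpha> * F)) + \<kappa> * blk 3 0 (w * F) = 0"
  proof -
    have "T * \<iota> * blk 0 0 F = blk 1 0 (F * (\<beta> * F)) - blk 2 0 (F * (\<alpha> * F)) + blk 3 0 (w * F)"
    proof -
      have "f * (w * F) = w * F" using fw by (simp add: mult.assoc[symmetric])
      then show ?thesis by (simp add: \<iota>_def T_def algebra_simps blk_mult)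
    qed
    then have "\<kappa> * blk 1 0 (F * (\<beta> * F)) - \<kappa> * blk 2 0 (F * (\<alpha> * F)) + \<kappa> * blk 3 0 (w * F)
      = \<kappa> * (T * \<iota> * blk 0 0 F)" by (simp add: distrib_left right_diff_distrib)
    also have "\<dots> = 0" by (metis kT(1) ki mult.assoc mult_zero_left)
    finally show ?thesis .
  qed
  have KK: "\<kappa> * (blk 1 1 F * \<kappa>) + \<kappa> * (blk 2 2 F * \<kappa>) + \<kappa> * (blk 3 3 f * \<kappa>) = \<kappa>"
  proof -
    have "\<kappa> * (blk 1 1 F * \<kappa>) + \<kappa> * (blk 2 2 F * \<kappa>) + \<kappa> * (blk 3 3 f * \<kappa>) = \<kappa> * (T * \<kappa>)"
      by (simp add: T_def algebra_simps)
    then show ?thesis by (simp add: kT kk)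
  qed
  \<comment> \<open>Contracting the two tensor blocks of a group element against \<open>F\<close>
    yields the trace of its plane matrix; for \<open>P\<close> this multiplies the coefficients of
    the idempotent of \<chi> by the standard character.\<close>
  define h where "h = (\<lambda>g. \<chi> \<one> / of_nat M * \<chi> (inv g) * st g)"
  have trP: "blk 0 1 F * (P * blk 1 0 F) + blk 0 2 F * (P * blk 2 0 F) = blk 0 0 (F * (zf h \<sigma> * F))"
  proof -
    have "blk 0 1 F * (\<tau> g * blk 1 0 F) + blk 0 2 F * (\<tau> g * blk 2 0 F) = st g \<star> blk 0 0 (F * (\<sigma> g * F))" for g
      by (simp add: \<tau>_def tens_def algebra_simps blk_mult st_def sc_add_left)
    then have "(\<Sum>g\<in>carrier G. (\<chi> \<one> / of_nat M * \<chi> (inv g)) \<star> (blk 0 1 F * (\<tau> g * blk 1 0 F) + blk 0 2 F * (\<tau> g * blk 2 0 F)))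
       = blk 0 0 (F * (zf h \<sigma> * F))"
      by (simp add: zf_def h_def blk_sum blk_sc sum_distrib_left sum_distrib_right)
    then show ?thesis
      by (simp add: P_def iso_def zf_def sum_distrib_left sum_distrib_right sc_add sum.distrib)
  qed
  have tku: "blk 0 1 F * (\<kappa> * blk 1 0 F) + blk 0 2 F * (\<kappa> * blk 2 0 F)
     = blk 0 0 (F * (zf h \<sigma> * F)) - (1 / \<mu>) \<star> blk 0 0 (F * (\<beta> * (e * (\<alpha> * F)))) + (1 / \<mu>) \<star> blk 0 0 (F * (\<alpha> * (e * (\<beta> * F))))"
  proof -
    have "blk 0 1 F * (Q * blk 1 0 F) = blk 0 0 (F * (\<beta> * (e * (\<alpha> * F))))"
      by (simp add: Q_def \<iota>_def \<pi>_def algebra_simps blk_mult blk_mult2)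
    moreover have "blk 0 2 F * (Q * blk 2 0 F) = - blk 0 0 (F * (\<alpha> * (e * (\<beta> * F))))"
      by (simp add: Q_def \<iota>_def \<pi>_def algebra_simps blk_mult blk_mult2)
    ultimately show ?thesis unfolding trP[symmetric] \<kappa>_def
      by (simp add: left_diff_distrib right_diff_distrib)
  qed
  \<comment> \<open>For \<phi> \<noteq> \<chi> the coefficient of \<open>iso \<phi> \<sigma>\<close>
    in \<mu> times \<open>zf h \<sigma>\<close> is
    \<open>l \<chi> * mi \<chi> \<phi> / dg \<phi>\<close>, which is exactly the change of parameter
    under \<open>lrefl \<chi>\<close>.\<close>
  have Fcen: "F * (cen l \<sigma> * F) = (\<Sum>\<phi>\<in>IrrC - {\<chi>}. (l \<phi> / of_nat (dg \<phi>)) \<star> iso \<phi> \<sigma>)"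
    and Fz: "F * (zf h \<sigma> * F) = (\<Sum>\<phi>\<in>IrrC - {\<chi>}. (of_nat (dg \<chi>) * of_int (mi \<chi> \<phi>) / of_nat (dg \<phi>)) \<star> iso \<phi> \<sigma>)"
  proof -
    have Fi: "F * (iso \<phi> \<sigma> * F) = (if \<phi> = \<chi> then 0 else iso \<phi> \<sigma>)" if p: "\<phi> \<in> IrrC" for \<phi>
    proof -
      have 1: "iso \<phi> \<sigma> * E = iso \<phi> \<sigma>" "E * iso \<phi> \<sigma> = iso \<phi> \<sigma>"
        using iso_intw[OF p rs] by (auto simp: intw_def E_def)
      show ?thesis
      proof (cases "\<phi> = \<chi>")
        case True
        then have "iso \<phi> \<sigma> = e" by (simp add: e_def)
        then show ?thesis using True by (simp add: F_def right_diff_distrib eE ee)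
      next
        case False
        have z: "iso \<phi> \<sigma> * e = 0" "e * iso \<phi> \<sigma> = 0"
          using iso_mult[OF p chi rs] iso_mult[OF chi p rs] False by (simp_all add: e_def)
        have "iso \<phi> \<sigma> * F = iso \<phi> \<sigma>" "F * iso \<phi> \<sigma> = iso \<phi> \<sigma>"
          by (simp_all only: F_def right_diff_distrib left_diff_distrib 1 z diff_0_right)
        then show ?thesis using False by (simp only: if_False)
      qed
    qed
    have gen: "F * ((\<Sum>\<phi>\<in>IrrC. c \<phi> \<star> iso \<phi> \<sigma>) * F) = (\<Sum>\<phi>\<in>IrrC - {\<chi>}. c \<phi> \<star> iso \<phi> \<sigma>)" for c
    proof -
      have "F * ((\<Sum>\<phi>\<in>IrrC. c \<phi> \<star> iso \<phi> \<sigma>) * F) = (\<Sum>\<phi>\<in>IrrC. c \<phi> \<star> (if \<phi> = \<chi> then 0 else iso \<phi> \<sigma>))"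
        unfolding sum_distrib_left sum_distrib_right by (intro sum.cong refl) (simp add: Fi)
      also have "\<dots> = (\<Sum>\<phi>\<in>IrrC - {\<chi>}. c \<phi> \<star> (if \<phi> = \<chi> then 0 else iso \<phi> \<sigma>))"
        using chi by (simp add: sum.remove[OF finite_IrrC chi])
      also have "\<dots> = (\<Sum>\<phi>\<in>IrrC - {\<chi>}. c \<phi> \<star> iso \<phi> \<sigma>)" by (intro sum.cong) auto
      finally show ?thesis .
    qed
    show "F * (cen l \<sigma> * F) = (\<Sum>\<phi>\<in>IrrC - {\<chi>}. (l \<phi> / of_nat (dg \<phi>)) \<star> iso \<phi> \<sigma>)"
      unfolding cen_def by (rule gen)
    have hc: "class_fun h" unfolding h_def
      by (rule class_mult[OF class_scale[OF class_inv[OF IrrC_class[OF chi]]] st_class])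
    have "(\<Sum>g\<in>carrier G. h g * \<phi> g) / \<phi> \<one> = of_nat (dg \<chi>) * of_int (mi \<chi> \<phi>) / of_nat (dg \<phi>)" if p: "\<phi> \<in> IrrC" for \<phi>
    proof -
      have "(\<Sum>g\<in>carrier G. h g * \<phi> g) = \<chi> \<one> * mm \<phi> \<chi>"
        unfolding mm_def inner_def h_def by (simp add: sum_distrib_left sum_divide_distrib mult_ac)
      then show ?thesis using dg(1)[OF p] dg(1)[OF chi] mi(1)[OF p chi] mi_sym[of \<chi> \<phi>] by simp
    qed
    then have "zf h \<sigma> = (\<Sum>\<phi>\<in>IrrC. (of_nat (dg \<chi>) * of_int (mi \<chi> \<phi>) / of_nat (dg \<phi>)) \<star> iso \<phi> \<sigma>)"
      unfolding zf_expand[OF hc rs] by (intro sum.cong) auto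
    then show "F * (zf h \<sigma> * F) = (\<Sum>\<phi>\<in>IrrC - {\<chi>}. (of_nat (dg \<chi>) * of_int (mi \<chi> \<phi>) / of_nat (dg \<phi>)) \<star> iso \<phi> \<sigma>)"
      by (simp only: gen)
  qed
  have mom': "\<alpha>' * \<beta>' - \<beta>' * \<alpha>' + v' * w'
     = blk 0 0 (F * (cen l \<sigma> * F) + \<mu> \<star> (F * (zf h \<sigma> * F))) - \<mu> \<star> \<kappa>"
  proof -
    \<comment> \<open>Replacing the inner \<open>F\<close> by \<open>E - e\<close> isolates the
      paths through the old \<chi>-part; they are cancelled by the terms of \<open>tku\<close> that
      come from \<open>Q\<close>.\<close>
    have Fe: "F * (\<alpha> * (F * (\<beta> * F))) = F * (\<alpha> * (\<beta> * F)) - F * (\<alpha> * (e * (\<beta> * F)))"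
      "F * (\<beta> * (F * (\<alpha> * F))) = F * (\<beta> * (\<alpha> * F)) - F * (\<beta> * (e * (\<alpha> * F)))"
    proof -
      have "F * (\<beta> * Y) = \<beta> * Y - e * (\<beta> * Y)" "F * (\<alpha> * Y) = \<alpha> * Y - e * (\<alpha> * Y)" for Y
        using un by (simp_all add: F_def left_diff_distrib mult.assoc[symmetric])
      then have "\<alpha> * (F * (\<beta> * F)) = \<alpha> * (\<beta> * F) - \<alpha> * (e * (\<beta> * F))"
        "\<beta> * (F * (\<alpha> * F)) = \<beta> * (\<alpha> * F) - \<beta> * (e * (\<alpha> * F))" by (metis right_diff_distrib)+
      then show "F * (\<alpha> * (F * (\<beta> * F))) = F * (\<alpha> * (\<beta> * F)) - F * (\<alpha> * (e * (\<beta> * F)))"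
        "F * (\<beta> * (F * (\<alpha> * F))) = F * (\<beta> * (\<alpha> * F)) - F * (\<beta> * (e * (\<alpha> * F)))" by (metis right_diff_distrib)+
    qed
    let ?A = "F * (\<alpha> * (e * (\<beta> * F)))" and ?B = "F * (\<beta> * (e * (\<alpha> * F)))"
    have "\<alpha>' * \<beta>' - \<beta>' * \<alpha>' + v' * w' =
       blk 0 0 (F * (\<alpha> * (\<beta> * F)) - F * (\<beta> * (\<alpha> * F)) + F * (v * (w * F))) - blk 0 0 ?A + blk 0 0 ?B
       + (blk 0 1 (F * (\<alpha> * F)) * \<kappa> + blk 0 2 (F * (\<beta> * F)) * \<kappa> + blk 0 3 (F * v) * \<kappa>)
       - \<mu> \<star> (\<kappa> * blk 1 0 (F * (\<beta> * F)) - \<kappa> * blk 2 0 (F * (\<alpha> * F)) + \<kappa> * blk 3 0 (w * F))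
       - \<mu> \<star> (\<kappa> * (blk 1 1 F * \<kappa>) + \<kappa> * (blk 2 2 F * \<kappa>) + \<kappa> * (blk 3 3 f * \<kappa>))
       + \<mu> \<star> (blk 0 1 F * (\<kappa> * blk 1 0 F) + blk 0 2 F * (\<kappa> * blk 2 0 F))"
      unfolding ab ba vw Fe by (simp add: blk_add blk_diff sc_add sc_diff)
    also have "\<dots> = blk 0 0 (F * (\<alpha> * (\<beta> * F)) - F * (\<beta> * (\<alpha> * F)) + F * (v * (w * F))) - blk 0 0 ?A + blk 0 0 ?B
       - \<mu> \<star> \<kappa> + \<mu> \<star> (blk 0 0 (F * (zf h \<sigma> * F)) - (1 / \<mu>) \<star> blk 0 0 ?B + (1 / \<mu>) \<star> blk 0 0 ?A)"
      unfolding to0 from0 KK tku by simp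
    also have "\<dots> = blk 0 0 (F * (\<alpha> * (\<beta> * F)) - F * (\<beta> * (\<alpha> * F)) + F * (v * (w * F)) + \<mu> \<star> (F * (zf h \<sigma> * F))) - \<mu> \<star> \<kappa>"
      using mu by (simp add: sc_add sc_diff blk_add blk_sc)
    also have "F * (\<alpha> * (\<beta> * F)) - F * (\<beta> * (\<alpha> * F)) + F * (v * (w * F)) = F * (cen l \<sigma> * F)"
      unfolding mom[symmetric] by (simp add: algebra_simps)
    finally show ?thesis .
  qed
  have isoN: "iso \<phi> \<sigma>N = (if \<phi> = \<chi> then \<kappa> else blk 0 0 (iso \<phi> \<sigma>))" if p: "\<phi> \<in> IrrC" for \<phi>
  proof -
    have "iso \<phi> \<sigma>N = blk 0 0 (F * iso \<phi> \<sigma>) + \<kappa> * iso \<phi> \<tau>"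
      by (simp add: \<sigma>N_def iso_add iso_left iso_blk)
    moreover have "F * iso \<phi> \<sigma> = (if \<phi> = \<chi> then 0 else iso \<phi> \<sigma>)"
    proof (cases "\<phi> = \<chi>")
      case True
      then have "iso \<phi> \<sigma> = e" by (simp add: e_def)
      then show ?thesis using True by (simp add: F_def left_diff_distrib eE ee)
    next
      case False
      then have "e * iso \<phi> \<sigma> = 0" using iso_mult[OF chi p rs] by (simp add: e_def)
      moreover have "E * iso \<phi> \<sigma> = iso \<phi> \<sigma>" using iso_intw[OF p rs] by (simp add: intw_def E_def)
      ultimately show ?thesis using False by (simp add: F_def left_diff_distrib)
    qed
    moreover have "\<kappa> * iso \<phi> \<tau> = (if \<phi> = \<chi> then \<kappa> else 0)"
    proof -
      have "\<kappa> * iso \<phi> \<tau> = \<kappa> * (P * iso \<phi> \<tau>)" by (simp add: mult.assoc[symmetric] kP)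
      then show ?thesis using iso_mult[OF chi p rt] kP by (auto simp: P_def)
    qed
    ultimately show ?thesis by simp
  qed
  have cenN: "cen (lrefl \<chi> l) \<sigma>N = blk 0 0 (F * (cen l \<sigma> * F) + \<mu> \<star> (F * (zf h \<sigma> * F))) - \<mu> \<star> \<kappa>"
  proof -
    have "cen (lrefl \<chi> l) \<sigma>N = (lrefl \<chi> l \<chi> / of_nat (dg \<chi>)) \<star> \<kappa>
        + (\<Sum>\<phi>\<in>IrrC - {\<chi>}. (lrefl \<chi> l \<phi> / of_nat (dg \<phi>)) \<star> blk 0 0 (iso \<phi> \<sigma>))"
      unfolding cen_def sum.remove[OF finite_IrrC chi] by (auto simp: isoN chi intro!: sum.cong)
    also have "lrefl \<chi> l \<chi> / of_nat (dg \<chi>) = - \<mu>" by (simp add: lrefl_def ca_diag[OF chi] \<mu>_def)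
    also have "(\<Sum>\<phi>\<in>IrrC - {\<chi>}. (lrefl \<chi> l \<phi> / of_nat (dg \<phi>)) \<star> blk 0 0 (iso \<phi> \<sigma>))
      = blk 0 0 (F * (cen l \<sigma> * F) + \<mu> \<star> (F * (zf h \<sigma> * F)))"
      unfolding Fcen Fz sc_sum sum.distrib[symmetric] blk_sum
    proof (intro sum.cong refl)
      fix \<phi> assume p: "\<phi> \<in> IrrC - {\<chi>}"
      have "lrefl \<chi> l \<phi> / of_nat (dg \<phi>) = l \<phi> / of_nat (dg \<phi>) + \<mu> * (of_nat (dg \<chi>) * of_int (mi \<chi> \<phi>) / of_nat (dg \<phi>))"
      proof -
        have "\<chi> \<noteq> \<phi>" using p by auto
        then show ?thesis using dgnz by (simp add: lrefl_def ca_def \<mu>_def add_divide_distrib)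
      qed
      then show "(lrefl \<chi> l \<phi> / of_nat (dg \<phi>)) \<star> blk 0 0 (iso \<phi> \<sigma>)
        = blk 0 0 ((l \<phi> / of_nat (dg \<phi>)) \<star> iso \<phi> \<sigma> + \<mu> \<star> (of_nat (dg \<chi>) * of_int (mi \<chi> \<phi>) / of_nat (dg \<phi>)) \<star> iso \<phi> \<sigma>)"
        by (simp add: blk_add blk_sc sc_add_left)
    qed
    finally show ?thesis by simp
  qed
  have eN: "\<alpha>' * \<sigma>N g = \<sigma>N g * (ga g \<star> \<alpha>' + gb g \<star> \<beta>') \<and> \<beta>' * \<sigma>N g = \<sigma>N g * (gc g \<star> \<alpha>' + gd g \<star> \<beta>')
      \<and> \<sigma>N g * v' = v' \<and> w' * \<sigma>N g = w'" if g: "g \<in> carrier G" for g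
  proof -
    define S where "S = \<sigma> g"
    have FS: "F * S = S * F" using Fs[OF g] by (simp add: S_def)
    have FS': "F * (S * X) = S * (F * X)" for X using FS by (metis mult.assoc)
    define t where "t = \<tau> g"
    have tk: "t * \<kappa> = \<kappa> * t" using kt[OF g] by (simp add: t_def)
    have tk': "t * (\<kappa> * X) = \<kappa> * (t * X)" for X using tk by (metis mult.assoc)
    have tb: "t * blk 1 0 F = gd g \<star> blk 1 0 (S * F) - gb g \<star> blk 2 0 (S * F)"
      "t * blk 2 0 F = ga g \<star> blk 2 0 (S * F) - gc g \<star> blk 1 0 (S * F)" "t * blk 3 0 f = blk 3 0 f"
      by (simp_all add: t_def \<tau>_def tens_def S_def algebra_simps blk_mult ff)
    have bt: "blk 0 1 F * t = gd g \<star> blk 0 1 (S * F) - gc g \<star> blk 0 2 (S * F)"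
      "blk 0 2 F * t = ga g \<star> blk 0 2 (S * F) - gb g \<star> blk 0 1 (S * F)" "blk 0 3 f * t = blk 0 3 f"
      using FS by (simp_all add: t_def \<tau>_def tens_def S_def algebra_simps blk_mult ff)
    have bt': "blk 0 1 F * (t * X) = gd g \<star> (blk 0 1 (S * F) * X) - gc g \<star> (blk 0 2 (S * F) * X)"
      "blk 0 2 F * (t * X) = ga g \<star> (blk 0 2 (S * F) * X) - gb g \<star> (blk 0 1 (S * F) * X)"
      "blk 0 3 f * (t * X) = blk 0 3 f * X" for X
      unfolding mult.assoc[symmetric] bt by (simp_all only: left_diff_distrib sc_mult_left)
    have kt0: "\<kappa> * (t * (blk 0 q X * Y)) = 0" "\<kappa> * (t * blk 0 q X) = 0" "blk p 0 X * (\<kappa> * (t * Y)) = 0" "blk p 0 X * (\<kappa> * t) = 0"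
      "blk p 0 X * (t * \<kappa>) = 0" for p q X Y
      using kblk[OF g] by (simp_all add: t_def mult.assoc[symmetric] k0 kt[OF g])
    have SN: "\<sigma>N g = blk 0 0 (S * F) + \<kappa> * t" by (simp add: \<sigma>N_def S_def t_def Fs[OF g])
    have sab: "\<alpha> * (S * F) = ga g \<star> (S * (\<alpha> * F)) + gb g \<star> (S * (\<beta> * F))"
      "\<beta> * (S * F) = gc g \<star> (S * (\<alpha> * F)) + gd g \<star> (S * (\<beta> * F))"
      using eqv(1,2)[OF g] by (simp_all add: S_def mult.assoc[symmetric] distrib_right distrib_left)
    have Sv: "S * v = v" "w * S = w" using eqv(3,4)[OF g] by (auto simp: S_def)
    have Sv': "S * (F * v) = F * v" "w * (S * F) = w * F" "w * (F * (S * X)) = w * (F * X)" for X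
      using FS' [of v] Sv by (simp, simp add: mult.assoc[symmetric] Sv, metis FS Sv(2) mult.assoc)
    have d1: "ga g * gd g - gb g * gc g = 1" by (rule det1[OF g])
    \<comment> \<open>The determinant relation as a rewrite rule for scalar multiples, oriented so
      that products of diagonal entries are eliminated.\<close>
    have dd: "(ga g * gd g) \<star> X = X + (gb g * gc g) \<star> X" for X
      using d1 by (metis diff_eq_eq sc_add_left sc_one)
    have dd': "(c * (ga g * gd g)) \<star> X = c \<star> X + (c * (gb g * gc g)) \<star> X" for c X
      using dd[of X] by (metis sc_add sc_sc)
    have a: "\<alpha>' * \<sigma>N g = blk 0 0 (F * (\<alpha> * (S * F))) - \<mu> \<star> (\<kappa> * blk 1 0 (S * F)) - blk 0 2 F * (\<kappa> * t)"
      unfolding \<alpha>'_def SN by (simp add: algebra_simps ks kt0 kk' FS' FS)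
    have b: "\<beta>' * \<sigma>N g = blk 0 0 (F * (\<beta> * (S * F))) - \<mu> \<star> (\<kappa> * blk 2 0 (S * F)) + blk 0 1 F * (\<kappa> * t)"
      unfolding \<beta>'_def SN by (simp add: algebra_simps ks kt0 kk' FS' FS)
    have na: "\<sigma>N g * \<alpha>' = blk 0 0 (S * (F * (\<alpha> * F))) - \<mu> \<star> (\<kappa> * (t * blk 1 0 F)) - blk 0 2 (S * F) * \<kappa>"
      unfolding \<alpha>'_def SN by (simp add: algebra_simps ks kt0 kk' tk')
    have nb: "\<sigma>N g * \<beta>' = blk 0 0 (S * (F * (\<beta> * F))) - \<mu> \<star> (\<kappa> * (t * blk 2 0 F)) + blk 0 1 (S * F) * \<kappa>"
      unfolding \<beta>'_def SN by (simp add: algebra_simps ks kt0 kk' tk')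
    have 1: "\<alpha>' * \<sigma>N g = \<sigma>N g * (ga g \<star> \<alpha>' + gb g \<star> \<beta>')"
      unfolding distrib_left sc_mult_right a na nb tk[symmetric] bt' tb sab
      by (simp add: algebra_simps blk_add blk_sc sc_add sc_diff FS' dd dd')
    have 2: "\<beta>' * \<sigma>N g = \<sigma>N g * (gc g \<star> \<alpha>' + gd g \<star> \<beta>')"
      unfolding distrib_left sc_mult_right b na nb tk[symmetric] bt' tb sab
      by (simp add: algebra_simps blk_add blk_sc sc_add sc_diff FS' dd dd')
    have 3: "\<sigma>N g * v' = v'"
      unfolding v'_def SN by (simp add: algebra_simps ks kt0 kk' tk' tb Sv')
    have 4: "w' * \<sigma>N g = w'"
    proof -
      have "w' * \<sigma>N g = blk 0 0 (w * F) + blk 0 3 f * (\<kappa> * t)"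
        unfolding w'_def SN by (simp add: algebra_simps ks kt0 kk' Sv' FS FS')
      then show ?thesis unfolding tk[symmetric] bt' w'_def .
    qed
    from 1 2 3 4 show ?thesis by simp
  qed
  have cmN: "cm \<sigma>N \<alpha>' \<beta>' v' w' (cen (lrefl \<chi> l) \<sigma>N)"
    unfolding cm_def
  proof (intro conjI)
    have f0: "eu 0 0 = blk 0 0 f" by (simp add: f_def eu00_blk)
    show "rep \<sigma>N" by (rule rN)
    show "\<sigma>N \<one> * \<alpha>' = \<alpha>'" "\<alpha>' * \<sigma>N \<one> = \<alpha>'" "\<sigma>N \<one> * \<beta>' = \<beta>'" "\<beta>' * \<sigma>N \<one> = \<beta>'"
      unfolding N1 \<alpha>'_def \<beta>'_def by (simp_all add: algebra_simps ks kk kk')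
    show "\<sigma>N \<one> * v' = v'" "w' * \<sigma>N \<one> = w'" using eN[OF one_closed] by auto
    show "v' * eu 0 0 = v'" unfolding f0 v'_def by (simp add: algebra_simps ks ff fw)
    show "eu 0 0 * w' = w'"
    proof -
      have "f * (w * F) = w * F" using fw by (simp add: mult.assoc[symmetric])
      then show ?thesis unfolding f0 w'_def by (simp add: algebra_simps ks ff)
    qed
    show "\<forall>g\<in>carrier G. \<alpha>' * \<sigma>N g = \<sigma>N g * (ga g \<star> \<alpha>' + gb g \<star> \<beta>') \<and> \<beta>' * \<sigma>N g = \<sigma>N g * (gc g \<star> \<alpha>' + gd g \<star> \<beta>')
      \<and> \<sigma>N g * v' = v' \<and> w' * \<sigma>N g = w'" using eN by blast
    show "\<alpha>' * \<beta>' - \<beta>' * \<alpha>' + v' * w' = cen (lrefl \<chi> l) \<sigma>N" unfolding mom' cenN ..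
  qed
  \<comment> \<open>The multiplicity of \<chi> drops twice by \<open>d \<chi>\<close>: once for the
    removed part \<open>e\<close>, once for the image of \<iota> split off from the \<chi>-part of
    \<tau>.\<close>
  have chrN: "chr \<sigma>N g = chr \<sigma> g - 2 * of_int (d \<chi>) * \<chi> g + inner (chr \<tau>) \<chi> * \<chi> g" if g: "g \<in> carrier G" for g
  proof -
    have ts: "tr (e * \<sigma> g) = of_int (d \<chi>) * \<chi> g"
      using iso_tr[OF chi rs g] ty chi by (simp add: e_def has_type_def)
    have "tr (Q * \<tau> g) = tr (\<iota> * (blk 0 0 e * (\<sigma>0 g * \<pi>)))" unfolding Q_def
      using intw_comm[OF ipi g] by (simp add: mult.assoc)
    also have "\<dots> = tr (blk 0 0 e * (\<sigma>0 g * (\<pi> * \<iota>)))" unfolding tr_comm[of \<iota>] by (simp add: mult.assoc)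
    also have "\<dots> = tr (e * (\<sigma> g * cen l \<sigma>))" unfolding pio \<sigma>0_def by (simp add: blk_mult tr_blk)
    also have "\<dots> = tr (\<sigma> g * (cen l \<sigma> * e))" by (simp add: tr_comm[of e] mult.assoc)
    also have "\<dots> = \<mu> * tr (e * \<sigma> g)" by (simp add: ce tr_comm[of e])
    finally have "tr (Q * \<tau> g) = \<mu> * (of_int (d \<chi>) * \<chi> g)" by (simp add: ts)
    moreover have "tr (P * \<tau> g) = inner (chr \<tau>) \<chi> * \<chi> g" unfolding P_def by (rule iso_tr[OF chi rt g])
    ultimately have "tr (\<kappa> * \<tau> g) = inner (chr \<tau>) \<chi> * \<chi> g - of_int (d \<chi>) * \<chi> g"
      using mu by (simp add: \<kappa>_def left_diff_distrib tr_diff)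
    moreover have "tr (F * \<sigma> g) = chr \<sigma> g - of_int (d \<chi>) * \<chi> g"
      using ts rs g by (simp add: F_def left_diff_distrib tr_diff E_def rep_one chr_def)
    ultimately show ?thesis by (simp add: chr_def \<sigma>N_def tr_add tr_blk)
  qed
  have innt: "inner (chr \<tau>) \<chi> = of_int ((\<Sum>\<psi>\<in>IrrC. mi \<chi> \<psi> * d \<psi>) + eps \<chi>)"
  proof -
    have "chr \<tau> g = (\<Sum>\<psi>\<in>IrrC. of_int (d \<psi>) * (\<psi> g * st g)) - (- 1) * triv g" if g: "g \<in> carrier G" for g
    proof -
      have "chr \<tau> g = chr \<sigma> g * st g + 1" using chr_tens[of \<sigma> g] by (simp add: \<tau>_def chr_def tr_add tr_blk f_def)
      also have "chr \<sigma> g = (\<Sum>\<psi>\<in>IrrC. of_int (d \<psi>) * \<psi> g)" using chr_expand[OF rs g] ty by (simp add: has_type_def cong: sum.cong)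
      finally show ?thesis using g by (simp add: sum_distrib_right mult.assoc triv_def)
    qed
    then have "inner (chr \<tau>) \<chi> = inner (\<lambda>g. (\<Sum>\<psi>\<in>IrrC. of_int (d \<psi>) * (\<psi> g * st g)) - (- 1) * triv g) \<chi>"
      by (intro inner_cong) auto
    also have "\<dots> = (\<Sum>\<psi>\<in>IrrC. of_int (d \<psi>) * mm \<psi> \<chi>) + of_int (eps \<chi>)"
      unfolding inner_diff_left inner_sum_left inner_sc_left mm_def[symmetric]
      using IrrC_orth[OF triv_IrrC chi] by (auto simp: eps_def)
    also have "(\<Sum>\<psi>\<in>IrrC. of_int (d \<psi>) * mm \<psi> \<chi>) = of_int (\<Sum>\<psi>\<in>IrrC. mi \<chi> \<psi> * d \<psi>)"
      unfolding of_int_sum by (intro sum.cong refl) (simp add: mi(1)[OF _ chi, symmetric] mi_sym[of \<chi>])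
    finally show ?thesis by simp
  qed
  have tyN: "has_type \<sigma>N (refl \<chi> d)" unfolding has_type_def
  proof
    fix \<phi> assume p: "\<phi> \<in> IrrC"
    define c where "c = inner (chr \<tau>) \<chi> - 2 * of_int (d \<chi>)"
    have "inner (chr \<sigma>N) \<phi> = inner (\<lambda>g. chr \<sigma> g - (- c) * \<chi> g) \<phi>"
      by (intro inner_cong) (auto simp: chrN c_def algebra_simps)
    also have "\<dots> = of_int (d \<phi>) + c * (if \<chi> = \<phi> then 1 else 0)"
      unfolding inner_diff_left inner_sc_left using ty p IrrC_orth[OF chi p] by (simp add: has_type_def)
    finally have i: "inner (chr \<sigma>N) \<phi> = of_int (d \<phi>) + c * (if \<chi> = \<phi> then 1 else 0)" .
    have "Bv \<chi> d = 2 * d \<chi> - (\<Sum>\<psi>\<in>IrrC. mi \<chi> \<psi> * d \<psi>)"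
    proof -
      have "Bv \<chi> d = (\<Sum>\<psi>\<in>IrrC. (if \<psi> = \<chi> then 2 * d \<chi> else 0) - mi \<chi> \<psi> * d \<psi>)"
        unfolding Bv_def by (intro sum.cong) (auto simp: ca_def algebra_simps)
      then show ?thesis using chi finite_IrrC by (simp add: sum_subtractf sum.delta)
    qed
    then have "c = of_int (cf \<chi> d)" unfolding c_def innt cf_def by simp
    then show "inner (chr \<sigma>N) \<phi> = of_int (refl \<chi> d \<phi>)" using i by (simp add: refl_def)
  qed
  show ?thesis unfolding CM_def using cmN tyN by blast
qed

end

section \<open>Deforming the moment map value\<close>

context sl2_group
begin

section \<open>Equivariant pairs and the differential of the moment map\<close>

definition eqp :: "('a \<Rightarrow> fmat) \<Rightarrow> fmat \<Rightarrow> fmat \<Rightarrow> bool" where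
  "eqp \<sigma> X Y \<longleftrightarrow> (\<forall>g\<in>carrier G. X * \<sigma> g = \<sigma> g * (ga g \<star> X + gb g \<star> Y) \<and> Y * \<sigma> g = \<sigma> g * (gc g \<star> X + gd g \<star> Y))"

lemma eqpD: assumes "eqp \<sigma> X Y" "g \<in> carrier G"
  shows "X * \<sigma> g = ga g \<star> (\<sigma> g * X) + gb g \<star> (\<sigma> g * Y)" "Y * \<sigma> g = gc g \<star> (\<sigma> g * X) + gd g \<star> (\<sigma> g * Y)"
  using assms by (auto simp: eqp_def distrib_left)

lemma eqp_add: "eqp \<sigma> X Y \<Longrightarrow> eqp \<sigma> X' Y' \<Longrightarrow> eqp \<sigma> (X + X') (Y + Y')"
  by (simp add: eqp_def algebra_simps sc_add)
lemma eqp_sc: "eqp \<sigma> X Y \<Longrightarrow> eqp \<sigma> (c \<star> X) (c \<star> Y)"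
  by (simp add: eqp_def algebra_simps sc_add)
lemma eqp_zero: "eqp \<sigma> 0 0" by (simp add: eqp_def)
lemma eqp_sum: "(\<And>x. x \<in> A \<Longrightarrow> eqp \<sigma> (X x) (Y x)) \<Longrightarrow> eqp \<sigma> (\<Sum>x\<in>A. X x) (\<Sum>x\<in>A. Y x)"
  by (induction A rule: infinite_finite_induct) (auto simp: eqp_zero intro: eqp_add)
lemma eqp_conj: assumes "eqp \<sigma> X Y" "\<And>g. g \<in> carrier G \<Longrightarrow> A * \<sigma> g = \<sigma> g * A" "\<And>g. g \<in> carrier G \<Longrightarrow> B * \<sigma> g = \<sigma> g * B"
  shows "eqp \<sigma> (A * X * B) (A * Y * B)"
  unfolding eqp_def
proof
  fix g assume g: "g \<in> carrier G"
  have "A * X * B * \<sigma> g = A * (X * \<sigma> g) * B" "A * Y * B * \<sigma> g = A * (Y * \<sigma> g) * B"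
    using assms(3)[OF g] by (simp_all add: mult.assoc)
  then show "A * X * B * \<sigma> g = \<sigma> g * (ga g \<star> (A * X * B) + gb g \<star> (A * Y * B))
    \<and> A * Y * B * \<sigma> g = \<sigma> g * (gc g \<star> (A * X * B) + gd g \<star> (A * Y * B))"
    unfolding eqpD[OF assms(1) g] using assms(2)[OF g]
    by (simp add: distrib_left distrib_right) (simp add: mult.assoc[symmetric])
qed

text \<open>The commutator of a pair that transforms like the coordinates of the plane is scaled by
  the determinant, which is 1.\<close>

lemma eqp_comm: assumes "eqp \<sigma> X Y" "g \<in> carrier G"
  shows "(X * Y - Y * X) * \<sigma> g = \<sigma> g * (X * Y - Y * X)"
proof -
  have xy: "X * (Y * \<sigma> g) = gc g \<star> ((X * \<sigma> g) * X) + gd g \<star> ((X * \<sigma> g) * Y)"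
    unfolding eqpD(2)[OF assms] by (simp add: distrib_left mult.assoc)
  have yx: "Y * (X * \<sigma> g) = ga g \<star> ((Y * \<sigma> g) * X) + gb g \<star> ((Y * \<sigma> g) * Y)"
    unfolding eqpD(1)[OF assms] by (simp add: distrib_left mult.assoc)
  have "(X * Y - Y * X) * \<sigma> g = X * (Y * \<sigma> g) - Y * (X * \<sigma> g)" by (simp add: algebra_simps)
  also have "\<dots> = gc g \<star> ((X * \<sigma> g) * X) + gd g \<star> ((X * \<sigma> g) * Y) - (ga g \<star> ((Y * \<sigma> g) * X) + gb g \<star> ((Y * \<sigma> g) * Y))"
    by (simp only: xy yx)
  also have "\<dots> = (ga g * gd g - gb g * gc g) \<star> (\<sigma> g * (X * Y - Y * X))"
    unfolding eqpD[OF assms] by (simp add: algebra_simps sc_add sc_diff sc_diff_left sc_add_left)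
  finally show ?thesis using det1[OF assms(2)] by simp
qed

text \<open>The differential of the moment map in the directions (X, Y, W) that leave
  \<open>v\<close> alone; these are already enough for surjectivity.\<close>

definition Lop :: "fmat \<Rightarrow> fmat \<Rightarrow> fmat \<Rightarrow> fmat \<Rightarrow> fmat \<Rightarrow> fmat \<Rightarrow> fmat" where
  "Lop \<alpha> \<beta> v X Y W = X * \<beta> - \<beta> * X + (\<alpha> * Y - Y * \<alpha>) + v * W"

lemma Lop_sum: "Lop \<alpha> \<beta> v (\<Sum>x\<in>S. X x) (\<Sum>x\<in>S. Y x) (\<Sum>x\<in>S. W x) = (\<Sum>x\<in>S. Lop \<alpha> \<beta> v (X x) (Y x) (W x))"
  by (simp add: Lop_def sum_distrib_left sum_distrib_right sum.distrib sum_subtractf)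
lemma Lop_sc: "Lop \<alpha> \<beta> v (c \<star> X) (c \<star> Y) (c \<star> W) = c \<star> Lop \<alpha> \<beta> v X Y W"
  by (simp add: Lop_def sc_add sc_diff)

lemma tr_eu_left: "tr (eu j i * A) = ent A i j"
proof -
  have "tr (eu j i * A) = tr (eu j j * (eu j i * A))" by (simp add: mult.assoc[symmetric])
  also have "\<dots> = tr (eu j i * A * eu j j)" by (rule tr_comm)
  also have "\<dots> = ent A i j" by (simp add: eu_sandwich)
  finally show ?thesis .
qed

text \<open>Under the trace pairing the annihilator of the image consists of the matrices that
  commute with \<alpha> and \<beta> and kill \<open>v\<close>; assumption \<open>H\<close> leaves
  only zero.\<close>

lemma Lop_surj:
  assumes b: "bd \<alpha> N" "bd \<beta> N" "v * eu 0 0 = v" "idm N * v = v"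
    and H: "\<And>Z. bd Z N \<Longrightarrow> Z * \<alpha> = \<alpha> * Z \<Longrightarrow> Z * \<beta> = \<beta> * Z \<Longrightarrow> Z * v = 0 \<Longrightarrow> Z = 0"
    and pq: "p < N" "q < N"
  shows "\<exists>X Y W. bd X N \<and> bd Y N \<and> eu 0 0 * W = W \<and> W * idm N = W \<and> Lop \<alpha> \<beta> v X Y W = eu p q"
proof -
  let ?I = "idm N"
  let ?J = "{..<N} \<times> {..<N}"
  define f where "f X Y W = Lop \<alpha> \<beta> v (?I * X * ?I) (?I * Y * ?I) (eu 0 0 * W * ?I)" for X Y W
  have fadd: "f X Y W + f X' Y' W' = f (X + X') (Y + Y') (W + W')" for X Y W X' Y' W'
    by (simp add: f_def Lop_def algebra_simps)
  have fsc: "c \<star> f X Y W = f (c \<star> X) (c \<star> Y) (c \<star> W)" for c X Y W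
    by (simp add: f_def Lop_def sc_add sc_diff)
  define S where "S = {s. \<exists>X Y W. s = (\<lambda>ij. ent (f X Y W) (fst ij) (snd ij))}"
  have "\<exists>s\<in>S. \<forall>ij\<in>?J. s ij = ent (eu p q) (fst ij) (snd ij)"
  proof (rule functionals_separate)
    show "finite ?J" "S \<noteq> {}" by (auto simp: S_def)
    show "(\<lambda>j. s j + t j) \<in> S" if "s \<in> S" "t \<in> S" for s t
      using that unfolding S_def
      by clarsimp (metis (no_types, lifting) ent_add fadd)
    show "(\<lambda>j. c * s j) \<in> S" if "s \<in> S" for c s
      using that unfolding S_def
      by clarsimp (metis (no_types, lifting) ent_sc fsc)
    fix z :: "nat \<times> nat \<Rightarrow> complex" assume z: "\<And>s. s \<in> S \<Longrightarrow> (\<Sum>j\<in>?J. z j * s j) = 0"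
    \<comment> \<open>The functional with coefficients \<open>z\<close> is A \<mapsto> tr (Z A),
      hence the transposed indices.\<close>
    define Z where "Z = (\<Sum>ij\<in>?J. z ij \<star> eu (snd ij) (fst ij))"
    have bZ: "bd Z N" unfolding Z_def by (intro bd_sum bd_sc bd_eu) auto
    have trZ: "tr (Z * A) = (\<Sum>ij\<in>?J. z ij * ent A (fst ij) (snd ij))" for A
      by (simp add: Z_def sum_distrib_right tr_sum tr_eu_left)
    have t0: "tr (Z * f X Y W) = 0" for X Y W
      unfolding trZ by (rule z) (auto simp: S_def)
    note bi = idm_left[OF b(1)] idm_right[OF b(1)] idm_left[OF b(2)] idm_right[OF b(2)] idm_left[OF bZ] idm_right[OF bZ] b(4)
    have bi': "?I * (\<alpha> * A) = \<alpha> * A" "?I * (\<beta> * A) = \<beta> * A" "?I * (Z * A) = Z * A" "?I * (v * A) = v * A" for A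
      using bi by (simp_all add: mult.assoc[symmetric])
    have "\<beta> * Z - Z * \<beta> = 0"
    proof (rule fmat_eqI)
      fix i j
      have "tr (Z * f (eu j i) 0 0) = tr (Z * (?I * eu j i * ?I) * \<beta>) - tr (Z * \<beta> * (?I * eu j i * ?I))"
        by (simp add: f_def Lop_def algebra_simps tr_diff)
      also have "tr (Z * (?I * eu j i * ?I) * \<beta>) = tr ((Z * ?I) * (eu j i * (?I * \<beta>)))" by (simp add: mult.assoc)
      also have "\<dots> = tr (eu j i * (\<beta> * Z))" unfolding bi by (simp add: tr_comm[of Z] mult.assoc)
      also have "tr (Z * \<beta> * (?I * eu j i * ?I)) = tr ((Z * (\<beta> * ?I)) * (eu j i * ?I))" by (simp add: mult.assoc)
      also have "\<dots> = tr (eu j i * (?I * (Z * \<beta>)))" unfolding bi tr_comm[of "Z * \<beta>"] by (simp add: mult.assoc)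
      also have "\<dots> = tr (eu j i * (Z * \<beta>))" unfolding bi' ..
      finally show "ent (\<beta> * Z - Z * \<beta>) i j = ent 0 i j" using t0[of "eu j i" 0 0] by (simp add: tr_eu_left)
    qed
    moreover have "Z * \<alpha> - \<alpha> * Z = 0"
    proof (rule fmat_eqI)
      fix i j
      have "tr (Z * f 0 (eu j i) 0) = tr (Z * \<alpha> * (?I * eu j i * ?I)) - tr (Z * (?I * eu j i * ?I) * \<alpha>)"
        by (simp add: f_def Lop_def algebra_simps tr_diff)
      also have "tr (Z * (?I * eu j i * ?I) * \<alpha>) = tr ((Z * ?I) * (eu j i * (?I * \<alpha>)))" by (simp add: mult.assoc)
      also have "\<dots> = tr (eu j i * (\<alpha> * Z))" unfolding bi by (simp add: tr_comm[of Z] mult.assoc)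
      also have "tr (Z * \<alpha> * (?I * eu j i * ?I)) = tr ((Z * (\<alpha> * ?I)) * (eu j i * ?I))" by (simp add: mult.assoc)
      also have "\<dots> = tr (eu j i * (?I * (Z * \<alpha>)))" unfolding bi tr_comm[of "Z * \<alpha>"] by (simp add: mult.assoc)
      also have "\<dots> = tr (eu j i * (Z * \<alpha>))" unfolding bi' ..
      finally show "ent (Z * \<alpha> - \<alpha> * Z) i j = ent 0 i j" using t0[of 0 "eu j i" 0] by (simp add: tr_eu_left)
    qed
    moreover have "Z * v = 0"
    proof (rule fmat_eqI)
      fix i j
      have "tr (Z * f 0 0 (eu j i)) = tr (Z * (v * eu 0 0) * (eu j i * ?I))" by (simp add: f_def Lop_def mult.assoc del: eu_eu)
      also have "\<dots> = tr (eu j i * (?I * (Z * v)))" unfolding b(3) tr_comm[of "Z * v"] by (simp add: mult.assoc)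
      also have "\<dots> = ent (Z * v) i j" unfolding bi' by (rule tr_eu_left)
      finally show "ent (Z * v) i j = ent 0 i j" using t0[of 0 0 "eu j i"] by simp
    qed
    ultimately have Z0: "Z = 0" using H[OF bZ] by (metis eq_iff_diff_eq_0)
    show "\<forall>j\<in>?J. z j = 0"
    proof
      fix ij assume ij: "ij \<in> ?J"
      have "tr (Z * eu (fst ij) (snd ij)) = (\<Sum>kl\<in>?J. if kl = ij then z ij else 0)"
        unfolding trZ by (intro sum.cong) (auto simp: ent_eu)
      then show "z ij = 0" using Z0 ij by (simp add: sum.delta)
    qed
  qed
  then obtain X Y W where XY: "\<forall>ij\<in>?J. ent (f X Y W) (fst ij) (snd ij) = ent (eu p q) (fst ij) (snd ij)"
    unfolding S_def by blast
  have XYW: "ent (f X Y W) i j = ent (eu p q) i j" if "i < N" "j < N" for i j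
    using bspec[OF XY, of "(i, j)"] that by simp
  have bIX: "bd (?I * X * ?I) N" for X unfolding bd_idm_iff by (simp add: mult.assoc[symmetric]) (simp add: mult.assoc)
  have bf: "bd (f X Y W) N"
  proof -
    have bV: "bd (v * (eu 0 0 * W * ?I)) N" unfolding bd_idm_iff
      using b(4) by (simp add: mult.assoc[symmetric]) (simp add: mult.assoc)
    show ?thesis unfolding f_def Lop_def
      by (rule bd_add[OF bd_add[OF bd_diff[OF bd_mult[OF bIX b(2)] bd_mult[OF b(2) bIX]]
        bd_diff[OF bd_mult[OF b(1) bIX] bd_mult[OF bIX b(1)]]] bV])
  qed
  have "f X Y W = eu p q"
  proof (rule fmat_eqI)
    fix i j
    show "ent (f X Y W) i j = ent (eu p q) i j"
      using XYW[of i j] bdD[OF bf, of i j] bdD[OF bd_eu[OF pq], of i j] by (cases "i < N \<and> j < N") auto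
  qed
  moreover have "eu 0 0 * (eu 0 0 * W * ?I) = eu 0 0 * W * ?I" "eu 0 0 * W * ?I * ?I = eu 0 0 * W * ?I"
    by (simp_all add: mult.assoc[symmetric]) (simp_all add: mult.assoc)
  ultimately show ?thesis using bIX unfolding f_def by blast
qed

text \<open>The differential of the moment map is onto at such a point, so the moment map hits every small
  multiple of \<open>C\<close>; it is homogeneous of degree 2, hence hits \<open>C\<close> itself.\<close>

lemma deform:
  assumes cm: "cm \<sigma> \<alpha> \<beta> v w 0" and one: "\<sigma> \<one> = idm N"
    and H: "\<And>Z. bd Z N \<Longrightarrow> Z * \<alpha> = \<alpha> * Z \<Longrightarrow> Z * \<beta> = \<beta> * Z \<Longrightarrow> Z * v = 0 \<Longrightarrow> Z = 0"
    and C: "intw \<sigma> \<sigma> C"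
  shows "\<exists>\<alpha>' \<beta>' v' w'. cm \<sigma> \<alpha>' \<beta>' v' w' C"
proof -
  let ?I = "idm N"
  let ?J = "{..<N} \<times> {..<N}"
  have rs: "rep \<sigma>" and un: "?I * \<alpha> = \<alpha>" "\<alpha> * ?I = \<alpha>" "?I * \<beta> = \<beta>" "\<beta> * ?I = \<beta>" "?I * v = v" "v * eu 0 0 = v"
    "w * ?I = w" "eu 0 0 * w = w" and eqv: "eqp \<sigma> \<alpha> \<beta>" "\<And>g. g \<in> carrier G \<Longrightarrow> \<sigma> g * v = v" "\<And>g. g \<in> carrier G \<Longrightarrow> w * \<sigma> g = w"
    and mom: "\<alpha> * \<beta> - \<beta> * \<alpha> + v * w = 0"
    using cm by (auto simp: cm_def one eqp_def)
  have bab: "bd \<alpha> N" "bd \<beta> N" using un by (auto simp: bd_idm_iff)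
  have bC: "bd C N" using C by (auto simp: intw_def one bd_idm_iff)
  have bs: "bd (\<sigma> g) N" if "g \<in> carrier G" for g using rep_one[OF rs that] by (simp add: bd_idm_iff one)
  \<comment> \<open>Preimages of the matrix units under the differential. Averaging then makes each
    of them equivariant, at the price of averaging the matrix unit as well
    (\<open>LA\<close>).\<close>
  have "\<forall>pq\<in>?J. \<exists>XYW. bd (fst XYW) N \<and> bd (fst (snd XYW)) N \<and> eu 0 0 * snd (snd XYW) = snd (snd XYW)
     \<and> snd (snd XYW) * ?I = snd (snd XYW) \<and> Lop \<alpha> \<beta> v (fst XYW) (fst (snd XYW)) (snd (snd XYW)) = eu (fst pq) (snd pq)"
  proof
    fix pq assume "pq \<in> ?J"
    then have "fst pq < N" "snd pq < N" by auto
    from Lop_surj[OF bab un(6,5) H this]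
    obtain X Y W where "bd X N \<and> bd Y N \<and> eu 0 0 * W = W \<and> W * idm N = W \<and> Lop \<alpha> \<beta> v X Y W = eu (fst pq) (snd pq)"
      by blast
    then show "\<exists>XYW. bd (fst XYW) N \<and> bd (fst (snd XYW)) N \<and> eu 0 0 * snd (snd XYW) = snd (snd XYW)
     \<and> snd (snd XYW) * ?I = snd (snd XYW) \<and> Lop \<alpha> \<beta> v (fst XYW) (fst (snd XYW)) (snd (snd XYW)) = eu (fst pq) (snd pq)"
      by (intro exI[of _ "(X, Y, W)"]) simp
  qed
  then obtain R where R: "\<And>pq. pq \<in> ?J \<Longrightarrow> bd (fst (R pq)) N" "\<And>pq. pq \<in> ?J \<Longrightarrow> bd (fst (snd (R pq))) N"
    "\<And>pq. pq \<in> ?J \<Longrightarrow> eu 0 0 * snd (snd (R pq)) = snd (snd (R pq))" "\<And>pq. pq \<in> ?J \<Longrightarrow> snd (snd (R pq)) * ?I = snd (snd (R pq))"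
    "\<And>pq. pq \<in> ?J \<Longrightarrow> Lop \<alpha> \<beta> v (fst (R pq)) (fst (snd (R pq))) (snd (snd (R pq))) = eu (fst pq) (snd pq)"
    by metis
  define X where "X pq = fst (R pq)" for pq
  define Y where "Y pq = fst (snd (R pq))" for pq
  define W where "W pq = snd (snd (R pq))" for pq
  define cj where "cj A g = \<sigma> (inv g) * A * \<sigma> g" for A g
  \<comment> \<open>With \<open>B\<close> below, the average of (X, Y) under simultaneous
    conjugation and the inverse plane matrix, whose entries are gd, - gb, - gc, ga because the
    determinant is 1.\<close>
  define A where "A pq = (1 / of_nat M) \<star> (\<Sum>g\<in>carrier G. gd g \<star> cj (X pq) g - gb g \<star> cj (Y pq) g)" for pq
  define B where "B pq = (1 / of_nat M) \<star> (\<Sum>g\<in>carrier G. ga g \<star> cj (Y pq) g - gc g \<star> cj (X pq) g)" for pq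
  define V where "V pq = (1 / of_nat M) \<star> (\<Sum>g\<in>carrier G. W pq * \<sigma> g)" for pq
  have cjm: "cj Z g * \<sigma> h = \<sigma> h * cj Z (g \<otimes> h)" if "g \<in> carrier G" "h \<in> carrier G" for Z g h
  proof -
    have "\<sigma> h * cj Z (g \<otimes> h) = (\<sigma> h * \<sigma> (inv (g \<otimes> h))) * Z * \<sigma> (g \<otimes> h)" by (simp add: cj_def mult.assoc)
    also have "\<sigma> h * \<sigma> (inv (g \<otimes> h)) = \<sigma> (inv g)" using that by (simp add: rep_mult[OF rs] inv_mult_group m_assoc[symmetric])
    finally show ?thesis using that by (simp add: cj_def rep_mult[OF rs, symmetric] mult.assoc)
  qed
  have eAB: "eqp \<sigma> (A pq) (B pq)" for pq unfolding eqp_def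
  proof (intro ballI conjI)
    fix h assume h: "h \<in> carrier G"
    define x where "x g = cj (X pq) g" for g
    define y where "y g = cj (Y pq) g" for g
    have sa: "(\<Sum>g\<in>carrier G. gd g \<star> x g - gb g \<star> y g) = (\<Sum>g\<in>carrier G. gd (g \<otimes> h) \<star> x (g \<otimes> h) - gb (g \<otimes> h) \<star> y (g \<otimes> h))"
      by (rule sum_rshift[OF h, symmetric, of "\<lambda>g. gd g \<star> x g - gb g \<star> y g"])
    have sb: "(\<Sum>g\<in>carrier G. ga g \<star> y g - gc g \<star> x g) = (\<Sum>g\<in>carrier G. ga (g \<otimes> h) \<star> y (g \<otimes> h) - gc (g \<otimes> h) \<star> x (g \<otimes> h))"
      by (rule sum_rshift[OF h, symmetric, of "\<lambda>g. ga g \<star> y g - gc g \<star> x g"])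
    have d: "ga h * gd h - gb h * gc h = 1" by (rule det1[OF h])
    have c1: "ga h * gd (g \<otimes> h) - gb h * gc (g \<otimes> h) = gd g" "gb h * ga (g \<otimes> h) - ga h * gb (g \<otimes> h) = - gb g"
      "gd h * ga (g \<otimes> h) - gc h * gb (g \<otimes> h) = ga g" "gc h * gd (g \<otimes> h) - gd h * gc (g \<otimes> h) = - gc g" if g: "g \<in> carrier G" for g
    proof -
      have "ga h * gd (g \<otimes> h) - gb h * gc (g \<otimes> h) = gd g * (ga h * gd h - gb h * gc h)"
        using g h by (simp add: m algebra_simps)
      then show "ga h * gd (g \<otimes> h) - gb h * gc (g \<otimes> h) = gd g" by (simp add: d)
      have "gb h * ga (g \<otimes> h) - ga h * gb (g \<otimes> h) = - gb g * (ga h * gd h - gb h * gc h)"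
        using g h by (simp add: m algebra_simps)
      then show "gb h * ga (g \<otimes> h) - ga h * gb (g \<otimes> h) = - gb g" by (simp add: d)
      have "gd h * ga (g \<otimes> h) - gc h * gb (g \<otimes> h) = ga g * (ga h * gd h - gb h * gc h)"
        using g h by (simp add: m algebra_simps)
      then show "gd h * ga (g \<otimes> h) - gc h * gb (g \<otimes> h) = ga g" by (simp add: d)
      have "gc h * gd (g \<otimes> h) - gd h * gc (g \<otimes> h) = - gc g * (ga h * gd h - gb h * gc h)"
        using g h by (simp add: m algebra_simps)
      then show "gc h * gd (g \<otimes> h) - gd h * gc (g \<otimes> h) = - gc g" by (simp add: d)
    qed
    have "ga h \<star> A pq + gb h \<star> B pq = (1 / of_nat M) \<star> (\<Sum>g\<in>carrier G. ga h \<star> (gd (g \<otimes> h) \<star> x (g \<otimes> h) - gb (g \<otimes> h) \<star> y (g \<otimes> h)) + gb h \<star> (ga (g \<otimes> h) \<star> y (g \<otimes> h) - gc (g \<otimes> h) \<star> x (g \<otimes> h)))"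
      unfolding A_def B_def x_def[symmetric] y_def[symmetric] sa sb
      by (simp add: sc_sum sum.distrib sc_add mult.commute[of _ "1 / _"])
    also have "\<dots> = (1 / of_nat M) \<star> (\<Sum>g\<in>carrier G. gd g \<star> x (g \<otimes> h) - gb g \<star> y (g \<otimes> h))"
    proof (intro arg_cong[of _ _ "\<lambda>z. _ \<star> z"] sum.cong refl)
      fix g assume g: "g \<in> carrier G"
      have "ga h \<star> (gd (g \<otimes> h) \<star> x (g \<otimes> h) - gb (g \<otimes> h) \<star> y (g \<otimes> h)) + gb h \<star> (ga (g \<otimes> h) \<star> y (g \<otimes> h) - gc (g \<otimes> h) \<star> x (g \<otimes> h))
        = (ga h * gd (g \<otimes> h) - gb h * gc (g \<otimes> h)) \<star> x (g \<otimes> h) + (gb h * ga (g \<otimes> h) - ga h * gb (g \<otimes> h)) \<star> y (g \<otimes> h)"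
        by (simp add: sc_diff sc_diff_left)
      then show "ga h \<star> (gd (g \<otimes> h) \<star> x (g \<otimes> h) - gb (g \<otimes> h) \<star> y (g \<otimes> h)) + gb h \<star> (ga (g \<otimes> h) \<star> y (g \<otimes> h) - gc (g \<otimes> h) \<star> x (g \<otimes> h))
        = gd g \<star> x (g \<otimes> h) - gb g \<star> y (g \<otimes> h)" by (simp add: c1[OF g])
    qed
    finally have "\<sigma> h * (ga h \<star> A pq + gb h \<star> B pq) = (1 / of_nat M) \<star> (\<Sum>g\<in>carrier G. gd g \<star> (x g * \<sigma> h) - gb g \<star> (y g * \<sigma> h))"
      using h by (simp add: sum_distrib_left right_diff_distrib x_def y_def cjm cong: sum.cong)
    then show "A pq * \<sigma> h = \<sigma> h * (ga h \<star> A pq + gb h \<star> B pq)"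
      unfolding A_def[of pq] x_def y_def by (simp add: sum_distrib_right left_diff_distrib)
    have "gc h \<star> A pq + gd h \<star> B pq = (1 / of_nat M) \<star> (\<Sum>g\<in>carrier G. gc h \<star> (gd (g \<otimes> h) \<star> x (g \<otimes> h) - gb (g \<otimes> h) \<star> y (g \<otimes> h)) + gd h \<star> (ga (g \<otimes> h) \<star> y (g \<otimes> h) - gc (g \<otimes> h) \<star> x (g \<otimes> h)))"
      unfolding A_def B_def x_def[symmetric] y_def[symmetric] sa sb
      by (simp add: sc_sum sum.distrib sc_add mult.commute[of _ "1 / _"])
    also have "\<dots> = (1 / of_nat M) \<star> (\<Sum>g\<in>carrier G. ga g \<star> y (g \<otimes> h) - gc g \<star> x (g \<otimes> h))"
    proof (intro arg_cong[of _ _ "\<lambda>z. _ \<star> z"] sum.cong refl)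
      fix g assume g: "g \<in> carrier G"
      have "gc h \<star> (gd (g \<otimes> h) \<star> x (g \<otimes> h) - gb (g \<otimes> h) \<star> y (g \<otimes> h)) + gd h \<star> (ga (g \<otimes> h) \<star> y (g \<otimes> h) - gc (g \<otimes> h) \<star> x (g \<otimes> h))
        = (gc h * gd (g \<otimes> h) - gd h * gc (g \<otimes> h)) \<star> x (g \<otimes> h) + (gd h * ga (g \<otimes> h) - gc h * gb (g \<otimes> h)) \<star> y (g \<otimes> h)"
        by (simp add: sc_diff sc_diff_left)
      then show "gc h \<star> (gd (g \<otimes> h) \<star> x (g \<otimes> h) - gb (g \<otimes> h) \<star> y (g \<otimes> h)) + gd h \<star> (ga (g \<otimes> h) \<star> y (g \<otimes> h) - gc (g \<otimes> h) \<star> x (g \<otimes> h))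
        = ga g \<star> y (g \<otimes> h) - gc g \<star> x (g \<otimes> h)" by (simp add: c1[OF g])
    qed
    finally have "\<sigma> h * (gc h \<star> A pq + gd h \<star> B pq) = (1 / of_nat M) \<star> (\<Sum>g\<in>carrier G. ga g \<star> (y g * \<sigma> h) - gc g \<star> (x g * \<sigma> h))"
      using h by (simp add: sum_distrib_left right_diff_distrib x_def y_def cjm cong: sum.cong)
    then show "B pq * \<sigma> h = \<sigma> h * (gc h \<star> A pq + gd h \<star> B pq)"
      unfolding B_def[of pq] x_def y_def by (simp add: sum_distrib_right left_diff_distrib)
  qed
  have eV: "V pq * \<sigma> h = V pq" if h: "h \<in> carrier G" for pq h
  proof -
    have "V pq * \<sigma> h = (1 / of_nat M) \<star> (\<Sum>g\<in>carrier G. W pq * \<sigma> (g \<otimes> h))"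
      using h by (simp add: V_def sum_distrib_right mult.assoc rep_mult[OF rs] cong: sum.cong)
    also have "(\<Sum>g\<in>carrier G. W pq * \<sigma> (g \<otimes> h)) = (\<Sum>g\<in>carrier G. W pq * \<sigma> g)"
      by (rule sum_rshift[OF h, of "\<lambda>g. W pq * \<sigma> g"])
    finally show ?thesis by (simp add: V_def)
  qed
  have bcj: "bd (cj Z g) N" if "bd Z N" "g \<in> carrier G" for Z g
    unfolding cj_def using that bs by (intro bd_mult) auto
  have bAB: "bd (A pq) N" "bd (B pq) N" if "pq \<in> ?J" for pq
    unfolding A_def B_def using that R(1,2) by (auto intro!: bd_sc bd_sum bd_diff bcj simp: X_def Y_def)
  have uV: "eu 0 0 * V pq = V pq" "V pq * ?I = V pq" if "pq \<in> ?J" for pq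
  proof -
    show "eu 0 0 * V pq = V pq" using R(3)[OF that]
      by (simp add: V_def W_def sum_distrib_left mult.assoc[symmetric])
    show "V pq * ?I = V pq" using eV[OF one_closed] by (simp add: one)
  qed
  have LA: "Lop \<alpha> \<beta> v (A pq) (B pq) (V pq) = (1 / of_nat M) \<star> (\<Sum>g\<in>carrier G. cj (eu (fst pq) (snd pq)) g)" if pq: "pq \<in> ?J" for pq
  proof -
    have t: "(gd g \<star> cj (X pq) g - gb g \<star> cj (Y pq) g) * \<beta> - \<beta> * (gd g \<star> cj (X pq) g - gb g \<star> cj (Y pq) g)
      + (\<alpha> * (ga g \<star> cj (Y pq) g - gc g \<star> cj (X pq) g) - (ga g \<star> cj (Y pq) g - gc g \<star> cj (X pq) g) * \<alpha>) + v * (W pq * \<sigma> g)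
      = cj (eu (fst pq) (snd pq)) g" if g: "g \<in> carrier G" for g
    proof -
      have Xm: "\<sigma> (inv g) * (X pq * (\<beta> * \<sigma> g)) = gc g \<star> (cj (X pq) g * \<alpha>) + gd g \<star> (cj (X pq) g * \<beta>)"
        "\<sigma> (inv g) * (Y pq * (\<alpha> * \<sigma> g)) = ga g \<star> (cj (Y pq) g * \<alpha>) + gb g \<star> (cj (Y pq) g * \<beta>)"
        unfolding eqpD[OF eqv(1) g] by (simp_all add: cj_def distrib_left mult.assoc)
      have s: "\<sigma> (inv g) * \<alpha> = (ga g \<star> \<alpha> + gb g \<star> \<beta>) * \<sigma> (inv g)" "\<sigma> (inv g) * \<beta> = (gc g \<star> \<alpha> + gd g \<star> \<beta>) * \<sigma> (inv g)"
      proof -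
        have i: "inv g \<in> carrier G" using g by simp
        have "(ga g \<star> \<alpha> + gb g \<star> \<beta>) * \<sigma> (inv g) = (ga g * gd g - gb g * gc g) \<star> (\<sigma> (inv g) * \<alpha>)"
          by (simp add: distrib_right eqpD[OF eqv(1) i] inv_entries[OF g] sc_add sc_diff sc_diff_left algebra_simps)
        then show "\<sigma> (inv g) * \<alpha> = (ga g \<star> \<alpha> + gb g \<star> \<beta>) * \<sigma> (inv g)" by (simp add: det1[OF g])
        have "(gc g \<star> \<alpha> + gd g \<star> \<beta>) * \<sigma> (inv g) = (ga g * gd g - gb g * gc g) \<star> (\<sigma> (inv g) * \<beta>)"
          by (simp add: distrib_right eqpD[OF eqv(1) i] inv_entries[OF g] sc_add sc_diff sc_diff_left algebra_simps)
        then show "\<sigma> (inv g) * \<beta> = (gc g \<star> \<alpha> + gd g \<star> \<beta>) * \<sigma> (inv g)" by (simp add: det1[OF g])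
      qed
      have mX: "\<sigma> (inv g) * (\<beta> * (X pq * \<sigma> g)) = gc g \<star> (\<alpha> * cj (X pq) g) + gd g \<star> (\<beta> * cj (X pq) g)"
        "\<sigma> (inv g) * (\<alpha> * (Y pq * \<sigma> g)) = ga g \<star> (\<alpha> * cj (Y pq) g) + gb g \<star> (\<beta> * cj (Y pq) g)"
        unfolding mult.assoc[symmetric] s by (simp_all add: cj_def distrib_right mult.assoc)
      have vv: "\<sigma> (inv g) * (v * (W pq * \<sigma> g)) = v * (W pq * \<sigma> g)"
        using eqv(2)[of "inv g"] g by (simp add: mult.assoc[symmetric])
      have "cj (eu (fst pq) (snd pq)) g = \<sigma> (inv g) * Lop \<alpha> \<beta> v (X pq) (Y pq) (W pq) * \<sigma> g"
        using R(5)[OF pq] by (simp add: cj_def X_def Y_def W_def)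
      also have "\<dots> = \<sigma> (inv g) * (X pq * (\<beta> * \<sigma> g)) - \<sigma> (inv g) * (\<beta> * (X pq * \<sigma> g))
        + (\<sigma> (inv g) * (\<alpha> * (Y pq * \<sigma> g)) - \<sigma> (inv g) * (Y pq * (\<alpha> * \<sigma> g))) + \<sigma> (inv g) * (v * (W pq * \<sigma> g))"
        by (simp add: Lop_def algebra_simps)
      finally show ?thesis unfolding Xm mX vv by (simp add: algebra_simps)
    qed
    show ?thesis unfolding A_def B_def V_def Lop_sc Lop_sum
      by (intro arg_cong[of _ _ "\<lambda>z. _ \<star> z"] sum.cong refl) (simp only: Lop_def t)
  qed
  \<comment> \<open>The unknowns h are the entries of the matrix \<open>hC\<close>. Moving in the
    direction (hA, hB, hV) changes the moment map by its differential, to be \<open>hC\<close>, plus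
    [hA, hB]. Asking for the value \<epsilon> C gives hC = \<epsilon> C - [hA, hB], a quadratic
    fixed-point equation.\<close>
  have "\<exists>e h. (e::real) > 0 \<and> (\<forall>ij\<in>?J. h ij = of_real e * ent C (fst ij) (snd ij)
     + (\<Sum>kl\<in>?J. \<Sum>pq\<in>?J. - ent (A kl * B pq - B pq * A kl) (fst ij) (snd ij) * h kl * h pq))"
    by (rule quadratic_solution) simp
  then obtain \<epsilon> :: real and h where eps: "\<epsilon> > 0" and h: "\<And>i j. i < N \<Longrightarrow> j < N \<Longrightarrow> h (i, j) = of_real \<epsilon> * ent C i j
     + (\<Sum>kl\<in>?J. \<Sum>pq\<in>?J. - ent (A kl * B pq - B pq * A kl) i j * h kl * h pq)"
    by auto
  define hA where "hA = (\<Sum>pq\<in>?J. h pq \<star> A pq)"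
  define hB where "hB = (\<Sum>pq\<in>?J. h pq \<star> B pq)"
  define hV where "hV = (\<Sum>pq\<in>?J. h pq \<star> V pq)"
  define hC where "hC = (\<Sum>pq\<in>?J. h pq \<star> eu (fst pq) (snd pq))"
  have bh: "bd hA N" "bd hB N" "bd hC N"
    unfolding hA_def hB_def hC_def by (auto intro!: bd_sum bd_sc bAB bd_eu)
  have ehC: "ent hC i j = h (i, j)" if "i < N" "j < N" for i j
  proof -
    have "ent hC i j = (\<Sum>pq\<in>?J. if pq = (i, j) then h (i, j) else 0)"
      unfolding hC_def ent_sum by (intro sum.cong) (auto simp: ent_eu)
    then show ?thesis using that by (simp add: sum.delta)
  qed
  have hCeq: "hC = of_real \<epsilon> \<star> C - (hA * hB - hB * hA)"
  proof (rule fmat_eqI)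
    fix i j
    have r: "hA * hB - hB * hA = (\<Sum>kl\<in>?J. \<Sum>pq\<in>?J. (h kl * h pq) \<star> (A kl * B pq - B pq * A kl))"
    proof -
      have "hA * hB = (\<Sum>kl\<in>?J. \<Sum>pq\<in>?J. (h kl * h pq) \<star> (A kl * B pq))"
        by (simp add: hA_def hB_def sum_product mult.commute)
      moreover have "hB * hA = (\<Sum>kl\<in>?J. \<Sum>pq\<in>?J. (h kl * h pq) \<star> (B pq * A kl))"
        by (simp add: hA_def hB_def sum_product) (rule sum.swap)
      ultimately show ?thesis by (simp add: sum_subtractf sc_diff)
    qed
    show "ent hC i j = ent (of_real \<epsilon> \<star> C - (hA * hB - hB * hA)) i j"
    proof (cases "i < N \<and> j < N")
      case True
      have neg: "(\<Sum>kl\<in>?J. \<Sum>pq\<in>?J. - ee kl pq * h kl * h pq) = - (\<Sum>kl\<in>?J. \<Sum>pq\<in>?J. (h kl * h pq) * ee kl pq)" for ee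
        unfolding sum_negf[symmetric] by (intro sum.cong refl) (simp add: mult_ac)
      have "ent (hA * hB - hB * hA) i j = (\<Sum>kl\<in>?J. \<Sum>pq\<in>?J. (h kl * h pq) * ent (A kl * B pq - B pq * A kl) i j)"
        unfolding r ent_sum ent_sc ..
      then have "(\<Sum>kl\<in>?J. \<Sum>pq\<in>?J. - ent (A kl * B pq - B pq * A kl) i j * h kl * h pq) = - ent (hA * hB - hB * hA) i j"
        by (simp only: neg)
      then show ?thesis using True h[of i j] by (simp only: ehC) simp
    next
      case False
      then show ?thesis using bdD[OF bh(3), of i j] bdD[OF bC, of i j] bdD[OF bd_diff[OF bd_mult[OF bh(1,2)] bd_mult[OF bh(2,1)]], of i j]
        by auto
    qed
  qed
  have eh: "eqp \<sigma> hA hB" unfolding hA_def hB_def by (intro eqp_sum eqp_sc eAB)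
  have hVs: "hV * \<sigma> g = hV" if "g \<in> carrier G" for g
    using eV[OF that] by (simp add: hV_def sum_distrib_right)
  \<comment> \<open>\<open>C\<close> and the commutator are equivariant, so the fixed-point equation
    makes \<open>hC\<close> equivariant. Averaging then leaves it unchanged, and the differential
    indeed returns \<open>hC\<close>.\<close>
  have hCs: "hC * \<sigma> g = \<sigma> g * hC" if g: "g \<in> carrier G" for g
    unfolding hCeq left_diff_distrib right_diff_distrib[of "\<sigma> g" "of_real \<epsilon> \<star> C"]
    using eqp_comm[OF eh g] intw_comm[OF C g] by (simp add: left_diff_distrib right_diff_distrib)
  have "Lop \<alpha> \<beta> v hA hB hV = (\<Sum>pq\<in>?J. h pq \<star> Lop \<alpha> \<beta> v (A pq) (B pq) (V pq))"
    unfolding hA_def hB_def hV_def Lop_sum Lop_sc ..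
  also have "\<dots> = (\<Sum>pq\<in>?J. h pq \<star> (1 / of_nat M) \<star> (\<Sum>g\<in>carrier G. cj (eu (fst pq) (snd pq)) g))"
    by (intro sum.cong refl) (simp only: LA)
  also have "\<dots> = (1 / of_nat M) \<star> (\<Sum>g\<in>carrier G. cj hC g)"
    unfolding hC_def cj_def sum_distrib_left sum_distrib_right sc_sum
    by (subst sum.swap) (simp add: mult.commute)
  also have "\<dots> = hC"
  proof -
    have "cj hC g = hC" if g: "g \<in> carrier G" for g
    proof -
      have "cj hC g = \<sigma> (inv g) * \<sigma> g * hC" using hCs[OF g] by (simp add: cj_def mult.assoc)
      then show ?thesis using g idm_left[OF bh(3)] by (simp add: rep_inv[OF rs] one)
    qed
    then show ?thesis by (simp add: sum_const_sc cong: sum.cong)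
  qed
  finally have Lh: "Lop \<alpha> \<beta> v hA hB hV = hC" .
  \<comment> \<open>Scaling the whole point by s multiplies the moment map by s^2 = 1 /
    \<epsilon>.\<close>
  define s where "s = 1 / csqrt (of_real \<epsilon>)"
  have ss: "s * s * of_real \<epsilon> = 1"
  proof -
    have "csqrt (of_real \<epsilon>) * csqrt (of_real \<epsilon>) = of_real \<epsilon>" by (metis power2_csqrt power2_eq_square)
    then show ?thesis using eps by (simp add: s_def)
  qed
  have "cm \<sigma> (s \<star> (\<alpha> + hA)) (s \<star> (\<beta> + hB)) (s \<star> v) (s \<star> (w + hV)) C"
    unfolding cm_def
  proof (intro conjI)
    show "rep \<sigma>" by (rule rs)
    have e0: "eu 0 0 * hV = hV" "hV * ?I = hV" unfolding hV_def sum_distrib_left sum_distrib_right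
      by (intro sum.cong refl, simp add: uV)+
    show "\<sigma> \<one> * (s \<star> (\<alpha> + hA)) = s \<star> (\<alpha> + hA)" "s \<star> (\<alpha> + hA) * \<sigma> \<one> = s \<star> (\<alpha> + hA)"
      "\<sigma> \<one> * (s \<star> (\<beta> + hB)) = s \<star> (\<beta> + hB)" "s \<star> (\<beta> + hB) * \<sigma> \<one> = s \<star> (\<beta> + hB)"
      "\<sigma> \<one> * (s \<star> v) = s \<star> v" "s \<star> v * eu 0 0 = s \<star> v" "s \<star> (w + hV) * \<sigma> \<one> = s \<star> (w + hV)" "eu 0 0 * (s \<star> (w + hV)) = s \<star> (w + hV)"
      unfolding one by (simp_all add: distrib_left distrib_right un idm_left[OF bh(1)] idm_left[OF bh(2)] idm_right[OF bh(1)] idm_right[OF bh(2)] e0)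
    show "\<forall>g\<in>carrier G. s \<star> (\<alpha> + hA) * \<sigma> g = \<sigma> g * (ga g \<star> s \<star> (\<alpha> + hA) + gb g \<star> s \<star> (\<beta> + hB)) \<and>
       s \<star> (\<beta> + hB) * \<sigma> g = \<sigma> g * (gc g \<star> s \<star> (\<alpha> + hA) + gd g \<star> s \<star> (\<beta> + hB)) \<and>
       \<sigma> g * (s \<star> v) = s \<star> v \<and> s \<star> (w + hV) * \<sigma> g = s \<star> (w + hV)"
      using eqp_sc[OF eqp_add[OF eqv(1) eh], of s] eqv(2,3) hVs unfolding eqp_def by (simp add: distrib_right)
    have "\<alpha> * \<beta> - \<beta> * \<alpha> + v * w + Lop \<alpha> \<beta> v hA hB hV + (hA * hB - hB * hA) = of_real \<epsilon> \<star> C"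
      unfolding Lh mom hCeq by simp
    then have "(\<alpha> + hA) * (\<beta> + hB) - (\<beta> + hB) * (\<alpha> + hA) + v * (w + hV) = of_real \<epsilon> \<star> C"
      by (simp add: Lop_def algebra_simps)
    then have ssC: "(s * s) \<star> ((\<alpha> + hA) * (\<beta> + hB) - (\<beta> + hB) * (\<alpha> + hA) + v * (w + hV)) = C"
      using ss by simp
    have gen: "s \<star> a * (s \<star> b) - s \<star> b * (s \<star> a) + s \<star> x * (s \<star> y) = (s * s) \<star> (a * b - b * a + x * y)" for a b x y
      by (simp add: sc_add sc_diff)
    show "s \<star> (\<alpha> + hA) * (s \<star> (\<beta> + hB)) - s \<star> (\<beta> + hB) * (s \<star> (\<alpha> + hA)) + s \<star> v * (s \<star> (w + hV)) = C"
      unfolding gen by (rule ssC)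
  qed
  then show ?thesis by blast
qed

lemma cen_intw: assumes "rep \<sigma>" shows "intw \<sigma> \<sigma> (cen l \<sigma>)"
  unfolding cen_def by (intro intw_sum intw_sc iso_intw assms)

text \<open>The trace of such an element is s + 1/s \<ge> 2, and only the unit attains 2. Hence no
  other element moves (1, 0) to a positive multiple of itself, which keeps the orbits in
  \<open>CM_nul\<close> free and disjoint.\<close>

lemma scalar_entries: assumes u: "u \<in> carrier G" and "ga u = of_real s" "gc u = 0" "s > 0" shows "u = \<one>"
proof (rule ccontr)
  assume "u \<noteq> \<one>"
  then have lt: "Re (st u) < 2" using st_real_le(3)[OF u] by simp
  have "of_real s * gd u = 1" using det1[OF u] assms by simp
  then have "gd u = of_real (1 / s)" using assms(4) by (simp add: field_simps)
  then have "Re (st u) = s + 1 / s" using assms(2) by (simp add: st_def)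
  moreover have "s + 1 / s \<ge> 2"
  proof -
    have "0 \<le> (s - 1)\<^sup>2 / s" using assms(4) by simp
    also have "\<dots> = s + 1 / s - 2" using assms(4) by (simp add: power2_eq_square field_simps)
    finally show ?thesis by simp
  qed
  ultimately show False using lt by simp
qed

text \<open>The free orbits of the points \<open>(1, 0)\<close>, ..., \<open>(r, 0)\<close> of the plane form a point with
  moment map value 0, which is then deformed.\<close>

lemma CM_nul: "CM (nul (int r)) l"
proof -
  define \<Omega> where "\<Omega> = {..<r} \<times> carrier G"
  have fO: "finite \<Omega>" using fin by (simp add: \<Omega>_def)
  define en where "en = free_enc r"
  have en: "en x = en y \<longleftrightarrow> x = y" if "x \<in> \<Omega>" "y \<in> \<Omega>" for x y
    using free_enc_inj that unfolding en_def \<Omega>_def by blast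
  have en_less: "en x < r * M" if "x \<in> \<Omega>" for x using free_enc_less that unfolding en_def \<Omega>_def by blast
  have en_ex: "\<exists>x\<in>\<Omega>. en x = i" if "i < r * M" for i
    using free_enc[of r] that unfolding en_def \<Omega>_def bij_betw_def by (metis image_iff lessThan_iff)
  define ac where "ac g x = (fst x, g \<otimes> snd x)" for g :: 'a and x :: "nat \<times> 'a"
  have acO: "ac g x \<in> \<Omega>" if "g \<in> carrier G" "x \<in> \<Omega>" for g x using that by (auto simp: ac_def \<Omega>_def)
  \<comment> \<open>x = (i, h) stands for the image of the point (i + 1, 0) under h; the shift by 1
    avoids the origin, which is a fixed point.\<close>
  define px where "px x = of_nat (fst x + 1) * ga (snd x)" for x :: "nat \<times> 'a"
  define py where "py x = of_nat (fst x + 1) * gc (snd x)" for x :: "nat \<times> 'a"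
  define dia where "dia p = (\<Sum>x\<in>\<Omega>. p x \<star> eu (en x) (en x))" for p :: "nat \<times> 'a \<Rightarrow> complex"
  define v where "v = (\<Sum>x\<in>\<Omega>. eu (en x) 0)"
  let ?\<sigma> = "free_rep r"
  have dl: "dia p * eu (en x) j = p x \<star> eu (en x) j" if "x \<in> \<Omega>" for p x j
  proof -
    have "dia p * eu (en x) j = (\<Sum>y\<in>\<Omega>. if y = x then p x \<star> eu (en x) j else 0)"
      unfolding dia_def sum_distrib_right using that by (intro sum.cong) (auto simp: en)
    then show ?thesis using that fO by (simp add: sum.delta)
  qed
  have dr: "eu j (en x) * dia p = p x \<star> eu j (en x)" if "x \<in> \<Omega>" for p x j
  proof -
    have "eu j (en x) * dia p = (\<Sum>y\<in>\<Omega>. if y = x then p x \<star> eu j (en x) else 0)"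
      unfolding dia_def sum_distrib_left using that by (intro sum.cong) (auto simp: en)
    then show ?thesis using that fO by (simp add: sum.delta)
  qed
  have dd: "dia p * dia q = dia (\<lambda>x. p x * q x)" for p q
    unfolding dia_def[of q] dia_def[of "\<lambda>x. p x * q x"] sum_distrib_left by (intro sum.cong) (auto simp: dl mult.commute)
  have fr: "?\<sigma> g * eu (en x) j = eu (en (ac g x)) j" if "g \<in> carrier G" "x \<in> \<Omega>" for g x j
    using free_rep_eu that unfolding en_def ac_def \<Omega>_def by blast
  have ds: "dia p * ?\<sigma> g = ?\<sigma> g * dia (\<lambda>x. p (ac g x))" if g: "g \<in> carrier G" for p g
  proof -
    have "dia p * ?\<sigma> g = (\<Sum>x\<in>\<Omega>. dia p * eu (en (ac g x)) (en x))"
      unfolding free_rep_def sum_distrib_left en_def ac_def \<Omega>_def ..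
    also have "\<dots> = (\<Sum>x\<in>\<Omega>. p (ac g x) \<star> eu (en (ac g x)) (en x))"
      by (intro sum.cong refl) (simp add: dl acO g)
    also have "\<dots> = ?\<sigma> g * dia (\<lambda>x. p (ac g x))"
      unfolding dia_def sum_distrib_left by (intro sum.cong refl) (simp add: fr g)
    finally show ?thesis .
  qed
  have dlin: "c \<star> dia p + c' \<star> dia q = dia (\<lambda>x. c * p x + c' * q x)" for c c' p q
    unfolding dia_def sc_sum sum.distrib[symmetric] by (intro sum.cong refl) (simp add: sc_add_left)
  have dcong: "(\<And>x. x \<in> \<Omega> \<Longrightarrow> p x = q x) \<Longrightarrow> dia p = dia q" for p q
    unfolding dia_def by (intro sum.cong) auto
  have s1: "?\<sigma> \<one> = idm (r * M)" by (rule free_rep_one)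
  have b: "bd (dia p) (r * M)" for p unfolding dia_def by (intro bd_sum bd_sc bd_eu en_less)
  have v1: "idm (r * M) * v = v" unfolding v_def sum_distrib_left using en_less by (intro sum.cong refl) (simp add: idm_eu)
  have sv: "?\<sigma> g * v = v" if g: "g \<in> carrier G" for g
  proof -
    have "?\<sigma> g * v = (\<Sum>x\<in>\<Omega>. eu (en (ac g x)) 0)"
      unfolding v_def sum_distrib_left by (intro sum.cong refl) (simp add: fr g)
    also have "\<dots> = (\<Sum>x\<in>\<Omega>. eu (en x) 0)"
      by (rule sum.reindex_bij_witness[of _ "ac (inv g)" "ac g"])
        (use g in \<open>auto simp: ac_def \<Omega>_def m_assoc[symmetric]\<close>)
    finally show ?thesis by (simp add: v_def)
  qed
  have cm0: "cm ?\<sigma> (dia px) (dia py) v 0 0"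
    unfolding cm_def
  proof (intro conjI ballI)
    show "rep ?\<sigma>" by (rule free_rep_rep)
    show "?\<sigma> \<one> * dia px = dia px" "dia px * ?\<sigma> \<one> = dia px" "?\<sigma> \<one> * dia py = dia py" "dia py * ?\<sigma> \<one> = dia py" "?\<sigma> \<one> * v = v"
      unfolding s1 by (simp_all add: idm_left[OF b] idm_right[OF b] v1)
    show "v * eu 0 0 = v" by (simp add: v_def sum_distrib_right)
    fix g assume g: "g \<in> carrier G"
    show "dia px * ?\<sigma> g = ?\<sigma> g * (ga g \<star> dia px + gb g \<star> dia py)" "dia py * ?\<sigma> g = ?\<sigma> g * (gc g \<star> dia px + gd g \<star> dia py)"
      unfolding ds[OF g] dlin
      by (intro arg_cong[of _ _ "\<lambda>z. _ * z"] dcong,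
          use g in \<open>auto simp: px_def py_def ac_def \<Omega>_def m algebra_simps\<close>)+
    show "?\<sigma> g * v = v" by (rule sv[OF g])
  qed (simp_all add: dd mult.commute)
  have dist: "x = y" if x: "x \<in> \<Omega>" and y: "y \<in> \<Omega>" and e: "px x = px y" "py x = py y" for x y
  proof -
    obtain i h where xi: "x = (i, h)" "i < r" "h \<in> carrier G" using x by (auto simp: \<Omega>_def)
    obtain j k where yj: "y = (j, k)" "j < r" "k \<in> carrier G" using y by (auto simp: \<Omega>_def)
    define a where "a = (of_nat (i + 1) :: complex)"
    define c where "c = (of_nat (j + 1) :: complex)"
    have ac0: "a \<noteq> 0" "c \<noteq> 0" unfolding a_def c_def by (metis Suc_eq_plus1 of_nat_neq_0)+
    have e1: "a * ga h = c * ga k" "a * gc h = c * gc k"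
      using e xi yj by (simp_all add: px_def py_def a_def c_def)
    define u where "u = inv k \<otimes> h"
    have u: "u \<in> carrier G" using xi yj by (simp add: u_def)
    have "a * ga u = gd k * (a * ga h) - gb k * (a * gc h)"
      using xi yj by (simp add: u_def m inv_entries algebra_simps)
    also have "\<dots> = c * (ga k * gd k - gb k * gc k)" unfolding e1 by (simp add: algebra_simps)
    finally have au: "a * ga u = c" using det1[OF yj(3)] by simp
    have "a * gc u = ga k * (a * gc h) - gc k * (a * ga h)"
      using xi yj by (simp add: u_def m inv_entries algebra_simps)
    also have "\<dots> = 0" unfolding e1 by simp
    finally have cu: "gc u = 0" using ac0 by simp
    have "ga u = c / a" using au ac0 by (simp add: field_simps)
    also have "\<dots> = of_real (real (j + 1) / real (i + 1))" by (simp add: a_def c_def)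
    finally have "u = \<one>" using cu by (intro scalar_entries[OF u, of "real (j + 1) / real (i + 1)"]) auto
    then have "c = a" using au one_closed by (simp add: one)
    then have "i = j" unfolding a_def c_def by (simp only: of_nat_eq_iff)
    moreover have "h = k"
      using \<open>u = \<one>\<close> xi yj unfolding u_def by (metis inv_closed inv_inv inv_unique' inv_equality inv_comm)
    ultimately show ?thesis using xi yj by simp
  qed
  \<comment> \<open>The points are distinct, so a matrix commuting with both coordinate matrices is
    diagonal; \<open>v\<close> is the constant function 1, so killing it makes the diagonal
    zero.\<close>
  have H: "Z = 0" if bZ: "bd Z (r * M)" and Z: "Z * dia px = dia px * Z" "Z * dia py = dia py * Z" "Z * v = 0" for Z
  proof -
    have com: "ent Z (en x) (en y) * p y = p x * ent Z (en x) (en y)"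
      if xy: "x \<in> \<Omega>" "y \<in> \<Omega>" and zp: "Z * dia p = dia p * Z" for x y p
    proof -
      have "eu 0 (en x) * (Z * dia p) * eu (en y) 0 = eu 0 (en x) * Z * (dia p * eu (en y) 0)" by (simp add: mult.assoc)
      then have 1: "eu 0 (en x) * (Z * dia p) * eu (en y) 0 = (ent Z (en x) (en y) * p y) \<star> eu 0 0"
        by (simp add: dl[OF xy(2)] eu_sandwich mult.commute)
      have "eu 0 (en x) * (dia p * Z) * eu (en y) 0 = (eu 0 (en x) * dia p) * Z * eu (en y) 0" by (simp add: mult.assoc)
      then have 2: "eu 0 (en x) * (dia p * Z) * eu (en y) 0 = (p x * ent Z (en x) (en y)) \<star> eu 0 0"
        by (simp add: dr[OF xy(1)] eu_sandwich)
      have "(ent Z (en x) (en y) * p y) \<star> eu 0 0 = (p x * ent Z (en x) (en y)) \<star> eu 0 0" using 1 2 zp by simp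
      then show ?thesis by (metis ent_eu ent_sc mult.right_neutral)
    qed
    have off: "ent Z (en x) (en y) = 0" if xy: "x \<in> \<Omega>" "y \<in> \<Omega>" "x \<noteq> y" for x y
    proof (rule ccontr)
      assume "ent Z (en x) (en y) \<noteq> 0"
      then have "px x = px y" "py x = py y" using com[OF xy(1,2) Z(1)] com[OF xy(1,2) Z(2)] by auto
      then show False using dist[OF xy(1,2)] xy(3) by blast
    qed
    have diag: "ent Z (en x) (en x) = 0" if x: "x \<in> \<Omega>" for x
    proof -
      have "0 = eu 0 (en x) * (Z * v)" using Z by simp
      also have "\<dots> = (\<Sum>y\<in>\<Omega>. ent Z (en x) (en y) \<star> eu 0 0)"
        unfolding v_def sum_distrib_left by (simp add: eu_sandwich')
      also have "\<dots> = (\<Sum>y\<in>\<Omega>. if y = x then ent Z (en x) (en x) \<star> eu 0 0 else 0)"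
        using off[OF x] by (intro sum.cong refl) auto
      also have "\<dots> = ent Z (en x) (en x) \<star> eu 0 0" using x fO by (simp add: sum.delta)
      finally show ?thesis by (metis ent_eu ent_sc ent_zero mult.right_neutral)
    qed
    show "Z = 0"
    proof (rule fmat_eqI)
      fix i j
      show "ent Z i j = ent 0 i j"
      proof (cases "i < r * M \<and> j < r * M")
        case True
        obtain x where x: "x \<in> \<Omega>" "en x = i" using en_ex True by meson
        obtain y where y: "y \<in> \<Omega>" "en y = j" using en_ex True by meson
        have "ent Z (en x) (en y) = 0"
          using diag[OF x(1)] off[OF x(1) y(1)] by metis
        then show ?thesis using x y by simp
      qed (use bdD[OF bZ, of i j] in auto)
    qed
  qed
  obtain \<alpha>' \<beta>' v' w' where "cm ?\<sigma> \<alpha>' \<beta>' v' w' (cen l ?\<sigma>)"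
    using deform[OF cm0 s1 H cen_intw[OF free_rep_rep]] by blast
  moreover have "has_type ?\<sigma> (nul (int r))"
    unfolding has_type_def by (simp add: inner_free nul_def dg)
  ultimately show ?thesis unfolding CM_def by blast
qed

section \<open>Transport along an orbit\<close>

lemma CM_refl_ex: assumes "regular l" "CM d l" "\<phi> \<in> IrrC" shows "CM (refl \<phi> d) (lrefl \<phi> l)"
proof -
  obtain \<sigma> \<alpha> \<beta> v w where "cm \<sigma> \<alpha> \<beta> v w (cen l \<sigma>)" "has_type \<sigma> d" using assms(2) unfolding CM_def by blast
  then show ?thesis by (rule reflection) (use assms regular_nz in auto)
qed

text \<open>The parameter at the end of the path need not be recorded: for r < 0 the negative
  multiplicities exclude solutions for every parameter.\<close>

lemma reach_ex: "reach d e \<Longrightarrow> \<exists>l. regular l \<and> CM d l \<Longrightarrow> \<exists>l. regular l \<and> CM e l"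
proof (induction rule: reach.induct)
  case (step e \<phi>)
  then show ?case using CM_refl_ex regular_lrefl by metis
qed

text \<open>Quantifying over all regular parameters absorbs their change: to obtain l at the
  reflected type, the induction hypothesis is used at \<open>lrefl \<phi> l\<close>.\<close>

lemma reach_all: "reach d e \<Longrightarrow> (\<And>l. regular l \<Longrightarrow> CM d l) \<Longrightarrow> regular l \<Longrightarrow> CM e l"
proof (induction arbitrary: l rule: reach.induct)
  case (step e \<phi>)
  have "CM (refl \<phi> e) (lrefl \<phi> (lrefl \<phi> l))"
    using step CM_refl_ex[OF regular_lrefl[OF step(5) step(2)] _ step(2)] regular_lrefl by blast
  then show ?case by (simp add: lrefl_lrefl[OF step(2)])
qed

lemma CM_iff: assumes "reach (nul r) d" shows "CM d (\<lambda>\<phi>. of_nat (dg \<phi>)) \<longleftrightarrow> r \<ge> 0"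
proof
  assume "CM d (\<lambda>\<phi>. of_nat (dg \<phi>))"
  then obtain l where "CM (nul r) l" using reach_ex[OF reach_sym[OF assms]] regular_dg by blast
  then obtain \<sigma> where s: "rep \<sigma>" "has_type \<sigma> (nul r)" unfolding CM_def cm_def by blast
  obtain k where "inner (chr \<sigma>) triv = of_nat k" using inner_nat[OF triv_IrrC s(1)] by blast
  then have "complex_of_int (nul r triv) = of_int (int k)" using s(2) triv_IrrC by (simp add: has_type_def)
  then have "nul r triv = int k" by (simp only: of_int_eq_iff)
  then show "r \<ge> 0" by (simp add: nul_def triv_IrrC dg_triv)
next
  assume "r \<ge> 0"
  then obtain k where k: "r = int k" by (metis nonneg_int_cases)
  show "CM d (\<lambda>\<phi>. of_nat (dg \<phi>))"
    using reach_all[OF assms _ regular_dg] CM_nul unfolding k by blast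
qed

lemma cen_dg: "rep \<sigma> \<Longrightarrow> cen (\<lambda>\<phi>. of_nat (dg \<phi>)) \<sigma> = \<sigma> \<one>"
  unfolding cen_def iso_sum[symmetric] 
proof (intro sum.cong refl)
  fix \<phi> assume "\<phi> \<in> IrrC"
  then have "(of_nat (dg \<phi>) :: complex) \<noteq> 0" using dg(2)[of \<phi>] by simp
  then show "(of_nat (dg \<phi>) / of_nat (dg \<phi>)) \<star> iso \<phi> \<sigma> = iso \<phi> \<sigma>" by simp
qed

end

section \<open>The graded degeneration\<close>

definition wact :: "fmat \<Rightarrow> fmat \<Rightarrow> bool list \<Rightarrow> fmat \<Rightarrow> fmat" where
  "wact \<alpha> \<beta> u X = foldr (\<lambda>b X. (if b then \<alpha> else \<beta>) * X) u X"

lemma wact_Nil[simp]: "wact \<alpha> \<beta> [] X = X" by (simp add: wact_def)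
lemma wact_Cons[simp]: "wact \<alpha> \<beta> (b # u) X = (if b then \<alpha> else \<beta>) * wact \<alpha> \<beta> u X" by (simp add: wact_def)
lemma wact_snoc: "wact \<alpha> \<beta> (u @ [b]) X = wact \<alpha> \<beta> u ((if b then \<alpha> else \<beta>) * X)" by (simp add: wact_def)
lemma wact_right: "wact \<alpha> \<beta> u (X * Y) = wact \<alpha> \<beta> u X * Y"
  by (induction u) (simp_all add: mult.assoc)
lemma wact_add: "wact \<alpha> \<beta> u (X + Y) = wact \<alpha> \<beta> u X + wact \<alpha> \<beta> u Y"
  by (induction u) (simp_all add: distrib_left)

text \<open>Generation by words applied to \<open>v\<close>, stated dually: no nonzero row on the
  space kills all words. Spans are thereby avoided.\<close>

definition cyclic :: "fmat \<Rightarrow> fmat \<Rightarrow> fmat \<Rightarrow> fmat \<Rightarrow> bool" where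
  "cyclic E \<alpha> \<beta> v \<longleftrightarrow> (\<forall>y. y * E = y \<longrightarrow> (\<forall>u. y * wact \<alpha> \<beta> u v = 0) \<longrightarrow> y = 0)"

context sl2_group
begin

text \<open>One step of the filtration by word length: \<open>Q\<close> projects onto a complement of the image of \<open>P\<close>
  in the span of the images of \<open>P\<close>, \<open>\<alpha> P\<close> and \<open>\<beta> P\<close>.\<close>

definition grow :: "('a \<Rightarrow> fmat) \<Rightarrow> fmat \<Rightarrow> fmat \<Rightarrow> fmat \<Rightarrow> fmat \<Rightarrow> bool" where
  "grow \<sigma> \<alpha> \<beta> P Q \<longleftrightarrow> intw \<sigma> \<sigma> Q \<and> Q * Q = Q \<and> Q * P = 0 \<and> P * Q = 0 \<and>
     Q * ((\<sigma> \<one> - P) * \<alpha> * P) = (\<sigma> \<one> - P) * \<alpha> * P \<and> Q * ((\<sigma> \<one> - P) * \<beta> * P) = (\<sigma> \<one> - P) * \<beta> * P \<and>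
     (\<exists>S S'. Q = (\<sigma> \<one> - P) * \<alpha> * P * S + (\<sigma> \<one> - P) * \<beta> * P * S')"

text \<open>The components of \<alpha> and \<beta> leading out of \<open>P\<close> form one
  equivariant map \<open>T\<close> from the tensor product with the plane; with an equivariant
  quasi-inverse \<open>S\<close>, the product \<open>T * S\<close> projects onto its image. The
  factor \<open>F\<close> on the right makes the projector vanish on the image of
  \<open>P\<close>.\<close>

lemma grow_exists:
  assumes rs: "rep \<sigma>" and un: "\<sigma> \<one> * \<alpha> = \<alpha>" "\<alpha> * \<sigma> \<one> = \<alpha>" "\<sigma> \<one> * \<beta> = \<beta>" "\<beta> * \<sigma> \<one> = \<beta>"
    and eqv: "eqp \<sigma> \<alpha> \<beta>" and P: "intw \<sigma> \<sigma> P" "P * P = P"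
  shows "\<exists>Q. grow \<sigma> \<alpha> \<beta> P Q"
proof -
  define E where "E = \<sigma> \<one>"
  have EE: "E * E = E" using rep_idem[OF rs] by (simp add: E_def)
  have EP: "E * P = P" "P * E = P" using P by (auto simp: intw_def E_def)
  define F where "F = E - P"
  have FF: "F * F = F" and FP: "F * P = 0" "P * F = 0" by (simp_all add: F_def algebra_simps EE EP P)
  have Fs: "F * \<sigma> g = \<sigma> g * F" "P * \<sigma> g = \<sigma> g * P" if "g \<in> carrier G" for g
    using intw_comm[OF P(1) that] rs that by (simp_all add: F_def algebra_simps E_def rep_one)
  define A where "A = F * \<alpha> * P"
  define B where "B = F * \<beta> * P"
  have eAB: "eqp \<sigma> A B" unfolding A_def B_def by (rule eqp_conj[OF eqv Fs])
  have FE: "F * E = F" "E * F = F" by (simp_all add: F_def algebra_simps EE EP)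
  have AE: "E * A = A" "A * E = A" "E * B = B" "B * E = B"
    by (simp_all add: A_def B_def mult.assoc EP) (simp_all add: mult.assoc[symmetric] FE)
  have FA: "F * A = A" "F * B = B" by (simp_all add: A_def B_def mult.assoc[symmetric] FF)
  define \<sigma>0 where "\<sigma>0 = (\<lambda>g. blk 0 0 (\<sigma> g))"
  have r0: "rep \<sigma>0" using rs by (simp add: rep_def \<sigma>0_def blk_mult)
  have rt: "rep (tens \<sigma>)" by (rule tens_rep[OF rs])
  define T where "T = blk 0 1 A + blk 0 2 B"
  have sa: "\<sigma> g * A = gd g \<star> (A * \<sigma> g) - gb g \<star> (B * \<sigma> g)"
    and sb: "\<sigma> g * B = ga g \<star> (B * \<sigma> g) - gc g \<star> (A * \<sigma> g)" if g: "g \<in> carrier G" for g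
  proof -
    have "gd g \<star> (A * \<sigma> g) - gb g \<star> (B * \<sigma> g) = (ga g * gd g - gb g * gc g) \<star> (\<sigma> g * A)"
      unfolding eqpD[OF eAB g] by (simp add: sc_add sc_diff_left algebra_simps)
    then show "\<sigma> g * A = gd g \<star> (A * \<sigma> g) - gb g \<star> (B * \<sigma> g)" using det1[OF g] by simp
    have "ga g \<star> (B * \<sigma> g) - gc g \<star> (A * \<sigma> g) = (ga g * gd g - gb g * gc g) \<star> (\<sigma> g * B)"
      unfolding eqpD[OF eAB g] by (simp add: sc_add sc_diff_left algebra_simps)
    then show "\<sigma> g * B = ga g \<star> (B * \<sigma> g) - gc g \<star> (A * \<sigma> g)" using det1[OF g] by simp
  qed
  have iT: "intw (tens \<sigma>) \<sigma>0 T" unfolding intw_def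
  proof (intro conjI ballI)
    show "T * tens \<sigma> \<one> = T" "\<sigma>0 \<one> * T = T"
      unfolding tens_one T_def \<sigma>0_def E_def[symmetric] by (simp_all add: algebra_simps blk_mult AE)
    fix g assume g: "g \<in> carrier G"
    show "\<sigma>0 g * T = T * tens \<sigma> g"
      unfolding \<sigma>0_def T_def tens_def
      by (simp add: algebra_simps blk_mult sa[OF g] sb[OF g] blk_diff blk_sc)
  qed
  obtain S where S: "intw \<sigma>0 (tens \<sigma>) S" "T * S * T = T" using quasi_intw[OF rt r0 iT] by blast
  define S1 where "S1 = E * ublk 1 0 S * E"
  define S2 where "S2 = E * ublk 2 0 S * E"
  have "S = tens \<sigma> \<one> * S * \<sigma>0 \<one>" using S by (simp add: intw_def mult.assoc)
  then have SS: "S = blk 1 0 S1 + blk 2 0 S2"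
    by (simp add: tens_one \<sigma>0_def distrib_right blk_ublk S1_def S2_def E_def)
  define R where "R = A * S1 + B * S2"
  have TS: "T * S = blk 0 0 R" by (simp add: T_def SS R_def algebra_simps blk_mult blk_add)
  have iR: "intw \<sigma> \<sigma> R"
  proof -
    have "intw \<sigma>0 \<sigma>0 (blk 0 0 R)" using intw_mult[OF S(1) iT] by (simp add: TS)
    then show ?thesis unfolding intw_def \<sigma>0_def by (auto simp: blk_mult dest: blk_inj)
  qed
  have RA: "R * A = A" "R * B = B"
  proof -
    have e: "blk 0 1 (R * A) + blk 0 2 (R * B) = blk 0 1 A + blk 0 2 B"
      using S(2) unfolding TS by (simp add: T_def distrib_left blk_mult)
    have u: "ublk 0 1 (blk 0 1 X + blk 0 2 Y) = X" "ublk 0 2 (blk 0 1 X + blk 0 2 Y) = Y" for X Y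
      by (rule fmat_eqI, simp add: ent_ublk ent_blk)+
    show "R * A = A" "R * B = B" using arg_cong[OF e, of "ublk 0 1"] arg_cong[OF e, of "ublk 0 2"] by (simp_all only: u)
  qed
  have RR: "R * R = R"
    by (subst (2 3) R_def) (simp add: distrib_left mult.assoc[symmetric] RA)
  have FR: "F * R = R" by (simp add: R_def distrib_left mult.assoc[symmetric] FA)
  have RE: "R * E = R" "E * R = R" using iR by (auto simp: intw_def E_def)
  define Q where "Q = R * F"
  have iF: "intw \<sigma> \<sigma> F" using Fs FE by (auto simp: intw_def E_def)
  have "grow \<sigma> \<alpha> \<beta> P Q" unfolding grow_def E_def[symmetric] F_def[symmetric] A_def[symmetric] B_def[symmetric]
  proof (intro conjI exI)
    show "intw \<sigma> \<sigma> Q" unfolding Q_def by (rule intw_mult[OF iF iR])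
    show "Q * Q = Q" unfolding Q_def by (metis FF FR RR mult.assoc)
    show "Q * P = 0" unfolding Q_def by (simp add: mult.assoc FP)
    show "P * Q = 0" unfolding Q_def by (metis FP(2) FR mult.assoc mult_zero_left)
    show "Q * A = A" "Q * B = B" unfolding Q_def by (simp_all add: mult.assoc FA RA)
    show "Q = A * (S1 * F) + B * (S2 * F)" unfolding Q_def R_def by (simp add: distrib_right mult.assoc)
  qed
  then show ?thesis by blast
qed

text \<open>\<open>P k\<close> projects onto the span of the words of length at most k applied to
  \<open>v\<close>, \<open>Q k\<close> onto the complement added in step k. Only the components of
  \<alpha> and \<beta> of degree 1 are kept. Their commutator has degree 2, where neither the
  identity, of degree 0, nor \<open>v * w\<close>, with image in degree 0, has a component; so it is
  0 and \<open>w\<close> is replaced by 0.\<close>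

lemma graded:
  assumes cm: "cm \<sigma> \<alpha> \<beta> v w (\<sigma> \<one>)"
  shows "\<exists>\<alpha>' \<beta>'. cm \<sigma> \<alpha>' \<beta>' v 0 0 \<and> cyclic (\<sigma> \<one>) \<alpha>' \<beta>' v"
proof -
  define E where "E = \<sigma> \<one>"
  have rs: "rep \<sigma>" and un: "E * \<alpha> = \<alpha>" "\<alpha> * E = \<alpha>" "E * \<beta> = \<beta>" "\<beta> * E = \<beta>" "E * v = v" "v * eu 0 0 = v"
    "w * E = w" "eu 0 0 * w = w" and eqv: "eqp \<sigma> \<alpha> \<beta>" "\<And>g. g \<in> carrier G \<Longrightarrow> \<sigma> g * v = v"
    and mom: "\<alpha> * \<beta> - \<beta> * \<alpha> + v * w = E"
    using cm by (auto simp: cm_def eqp_def E_def)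
  have EE: "E * E = E" using rep_idem[OF rs] by (simp add: E_def)
  define tv where "tv = (\<lambda>g :: 'a. eu 0 0)"
  have rv: "rep tv" by (simp add: rep_def tv_def)
  have iv: "intw tv \<sigma> v" using eqv(2) un by (auto simp: intw_def tv_def E_def)
  obtain S where S: "intw \<sigma> tv S" "v * S * v = v" using quasi_intw[OF rv rs iv] by blast
  define P0 where "P0 = v * S"
  have P0: "intw \<sigma> \<sigma> P0" "P0 * P0 = P0" "P0 * v = v"
    using intw_mult[OF S(1) iv] S(2) unfolding P0_def by (simp, metis mult.assoc, simp)
  define nx where "nx P = (SOME Q. grow \<sigma> \<alpha> \<beta> P Q)" for P
  define P where "P k = ((\<lambda>P. P + nx P) ^^ k) P0" for k
  define Q where "Q k = (if k = 0 then P0 else nx (P (k - 1)))" for k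
  have P_0: "P 0 = P0" and P_Suc: "P (Suc k) = P k + Q (Suc k)" for k by (simp_all add: P_def Q_def)
  have Q_0: "Q 0 = P0" by (simp add: Q_def)
  have grw: "grow \<sigma> \<alpha> \<beta> (P k) (Q (Suc k))" if "intw \<sigma> \<sigma> (P k)" "P k * P k = P k" for k
    using someI_ex[OF grow_exists[OF rs un(1-4)[unfolded E_def] eqv(1) that]] by (simp add: Q_def nx_def)
  have Pk: "intw \<sigma> \<sigma> (P k) \<and> P k * P k = P k" for k
  proof (induction k)
    case (Suc k)
    then have g: "intw \<sigma> \<sigma> (Q (Suc k))" "Q (Suc k) * Q (Suc k) = Q (Suc k)" "Q (Suc k) * P k = 0" "P k * Q (Suc k) = 0"
      using grw[of k] unfolding grow_def by simp_all
    show ?case unfolding P_Suc using Suc g by (simp add: intw_add distrib_left distrib_right)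
  qed (simp add: P_0 P0)
  have gr: "grow \<sigma> \<alpha> \<beta> (P k) (Q (Suc k))" for k using grw Pk by blast
  have iQ: "intw \<sigma> \<sigma> (Q k)" and QQ: "Q k * Q k = Q k" for k
    using gr P0 by (cases k; simp add: Q_0 grow_def)+
  have EP: "E * P k = P k" "P k * E = P k" for k using Pk[of k] by (auto simp: intw_def E_def)
  have EQ: "E * Q k = Q k" "Q k * E = Q k" for k using iQ[of k] by (auto simp: intw_def E_def)
  have PQ1: "P k * Q (Suc k) = 0" "Q (Suc k) * P k = 0" for k using gr[of k] by (auto simp: grow_def)
  have PP: "P k * P (k + j) = P k \<and> P (k + j) * P k = P k" for k j
  proof (induction j)
    case (Suc j)
    have "P k * Q (Suc (k + j)) = (P k * P (k + j)) * Q (Suc (k + j))" using Suc by simp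
    then have 1: "P k * Q (Suc (k + j)) = 0" by (simp only: mult.assoc PQ1 mult_zero_right)
    have "Q (Suc (k + j)) * P k = Q (Suc (k + j)) * (P (k + j) * P k)" using Suc by simp
    then have 2: "Q (Suc (k + j)) * P k = 0" by (simp only: mult.assoc[symmetric] PQ1 mult_zero_left)
    show ?case using Suc 1 2 by (simp add: P_Suc distrib_left distrib_right)
  qed (simp add: Pk)
  have PQ0: "P k * Q (Suc (k + j)) = 0" "Q (Suc (k + j)) * P k = 0" for k j
  proof -
    have "P k * Q (Suc (k + j)) = (P k * P (k + j)) * Q (Suc (k + j))" using PP[of k j] by simp
    then show "P k * Q (Suc (k + j)) = 0" by (simp only: mult.assoc PQ1 mult_zero_right)
    have "Q (Suc (k + j)) * P k = Q (Suc (k + j)) * (P (k + j) * P k)" using PP[of k j] by simp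
    then show "Q (Suc (k + j)) * P k = 0" by (simp only: mult.assoc[symmetric] PQ1 mult_zero_left)
  qed
  have PQs: "P k * Q k = Q k" "Q k * P k = Q k" for k
  proof -
    have "P k * Q k = Q k \<and> Q k * P k = Q k"
    proof (cases k)
      case (Suc j)
      then show ?thesis by (simp add: P_Suc distrib_left distrib_right PQ1 QQ)
    qed (simp add: P_0 Q_0 P0)
    then show "P k * Q k = Q k" "Q k * P k = Q k" by auto
  qed
  have QQ0: "Q i * Q j = 0" if "i \<noteq> j" for i j
  proof (cases "i < j")
    case True
    then obtain l where l: "j = Suc (i + l)" unfolding less_iff_Suc_add by blast
    have "Q i * Q j = Q i * (P i * Q j)" by (simp add: mult.assoc[symmetric] PQs)
    then show ?thesis by (simp add: l PQ0)
  next
    case False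
    then have "j < i" using that by simp
    then obtain l where l: "i = Suc (j + l)" unfolding less_iff_Suc_add by blast
    have "Q i * Q j = Q i * P j * Q j" by (simp add: mult.assoc PQs)
    then show ?thesis by (simp add: l PQ0)
  qed
  have ap: "\<alpha> * P k = P (Suc k) * \<alpha> * P k" "\<beta> * P k = P (Suc k) * \<beta> * P k" for k
  proof -
    have g: "Q (Suc k) * ((E - P k) * \<alpha> * P k) = (E - P k) * \<alpha> * P k" "Q (Suc k) * ((E - P k) * \<beta> * P k) = (E - P k) * \<beta> * P k"
      using gr[of k] by (auto simp: grow_def E_def)
    have "Q (Suc k) * (E - P k) = Q (Suc k)" by (simp add: right_diff_distrib EQ PQ1)
    then have "Q (Suc k) * \<alpha> * P k = (E - P k) * \<alpha> * P k" "Q (Suc k) * \<beta> * P k = (E - P k) * \<beta> * P k"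
      using g by (simp_all add: mult.assoc[symmetric])
    then show "\<alpha> * P k = P (Suc k) * \<alpha> * P k" "\<beta> * P k = P (Suc k) * \<beta> * P k"
      by (simp_all add: P_Suc distrib_right left_diff_distrib un)
  qed
  have trP: "\<exists>m. tr (Q k) = of_nat m" for k by (rule tr_idem[OF QQ])
  \<comment> \<open>Each nonzero step raises the trace of \<open>P k\<close> by at least 1, while
    that trace is bounded by the trace of \<open>E\<close>.\<close>
  have "\<exists>K. Q (Suc K) = 0"
  proof (rule ccontr)
    assume "\<not> (\<exists>K. Q (Suc K) = 0)"
    then have nz: "Q (Suc K) \<noteq> 0" for K by blast
    have ge: "\<exists>m\<ge>k. tr (P k) = of_nat m" for k
    proof (induction k)
      case 0
      then show ?case using tr_idem[of "P 0"] Pk by auto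
    next
      case (Suc k)
      then obtain m where m: "m \<ge> k" "tr (P k) = of_nat m" by blast
      obtain l where l: "tr (Q (Suc k)) = of_nat l" using trP by blast
      have "l \<noteq> 0"
      proof
        assume "l = 0"
        then have "tr (Q (Suc k)) = 0" using l by simp
        then show False using tr_idem_0[OF QQ] nz by blast
      qed
      then show ?case using m l by (intro exI[of _ "m + l"]) (auto simp: P_Suc tr_add)
    qed
    obtain n where n: "tr E = of_nat n" using tr_idem[OF EE] by blast
    obtain m where m: "m \<ge> Suc n" "tr (P (Suc n)) = of_nat m" using ge by blast
    have "(E - P (Suc n)) * (E - P (Suc n)) = E - P (Suc n)" using Pk[of "Suc n"] by (simp add: algebra_simps EE EP)
    then obtain l where "tr (E - P (Suc n)) = of_nat l" using tr_idem by blast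
    then have "of_nat n = (of_nat (m + l) :: complex)" using n m by (simp add: tr_diff algebra_simps)
    then have "n = m + l" by (simp only: of_nat_eq_iff)
    then show False using m by simp
  qed
  then obtain K where K: "Q (Suc K) = 0" by blast
  have PK: "P (Suc K) = P K" using K by (simp add: P_Suc)
  have Qz: "Q (Suc (K + j)) = 0 \<and> P (K + j) = P K" for j
  proof (induction j)
    case (Suc j)
    then have "P (K + Suc j) = P K" by (simp add: P_Suc)
    moreover have "Q (Suc (K + Suc j)) = nx (P (K + Suc j))" by (simp add: Q_def)
    moreover have "nx (P K) = Q (Suc K)" by (simp add: Q_def)
    ultimately show ?case using K by simp
  qed (use K in simp)
  have Qbig: "Q k = 0" if "k > K" for k
  proof -
    from that obtain l where "k = Suc (K + l)" unfolding less_iff_Suc_add by blast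
    then show ?thesis using Qz by simp
  qed
  have vP: "P K * v = v"
  proof -
    have "P K * P0 = P0" using PP[of 0 K] by (simp add: P_0)
    then show ?thesis using P0(3) by (metis mult.assoc)
  qed
  \<comment> \<open>Modulo the stable image of \<open>P K\<close> the vector \<open>v\<close>
    disappears, so on the quotient, realised by \<open>R\<close>, the relation says that the
    identity is a commutator. Taking traces gives tr R = 0.\<close>
  have PKE: "P K = E"
  proof -
    define R where "R = E - P K"
    have RR: "R * R = R" using Pk[of K] by (simp add: R_def algebra_simps EE EP)
    have Ra: "R * \<alpha> = R * \<alpha> * R" "R * \<beta> = R * \<beta> * R"
    proof -
      have RP: "R * P K = 0" using Pk[of K] by (simp add: R_def left_diff_distrib EP)
      have "R * \<alpha> * P K = R * (P K * \<alpha> * P K)" "R * \<beta> * P K = R * (P K * \<beta> * P K)"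
        using ap[of K] PK by (simp_all add: mult.assoc)
      then have "R * \<alpha> * P K = 0" "R * \<beta> * P K = 0" using RP by (simp_all add: mult.assoc[symmetric])
      then show "R * \<alpha> = R * \<alpha> * R" "R * \<beta> = R * \<beta> * R" by (simp_all add: R_def[of] right_diff_distrib mult.assoc un)
    qed
    have Rv: "R * v = 0" by (simp add: R_def left_diff_distrib un vP)
    have RE: "R * E = R" by (simp add: R_def left_diff_distrib EE EP)
    have "R = R * (\<alpha> * \<beta> - \<beta> * \<alpha> + v * w) * R" unfolding mom by (simp add: RE RR)
    also have "\<dots> = (R * \<alpha>) * \<beta> * R - (R * \<beta>) * \<alpha> * R" by (simp add: algebra_simps) (simp add: mult.assoc[symmetric] Rv)
    also have "\<dots> = (R * \<alpha> * R) * (R * \<beta> * R) - (R * \<beta> * R) * (R * \<alpha> * R)"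
    proof -
      have "(R * \<alpha>) * \<beta> * R = R * \<alpha> * R * \<beta> * R" "(R * \<beta>) * \<alpha> * R = R * \<beta> * R * \<alpha> * R" using Ra by simp_all
      moreover have "(R * \<alpha> * R) * (R * \<beta> * R) = R * \<alpha> * (R * R) * \<beta> * R" "(R * \<beta> * R) * (R * \<alpha> * R) = R * \<beta> * (R * R) * \<alpha> * R"
        by (simp_all add: mult.assoc)
      ultimately show ?thesis by (simp add: RR)
    qed
    finally have "R = (R * \<alpha> * R) * (R * \<beta> * R) - (R * \<beta> * R) * (R * \<alpha> * R)" .
    then have "tr R = tr ((R * \<alpha> * R) * (R * \<beta> * R)) - tr ((R * \<beta> * R) * (R * \<alpha> * R))" by (metis tr_diff)
    also have "\<dots> = 0" by (simp add: tr_comm[of "R * \<alpha> * R"])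
    finally have "R = 0" by (rule tr_idem_0[OF RR])
    then show ?thesis by (simp add: R_def)
  qed
  have sumQ: "P k = (\<Sum>j\<le>k. Q j)" for k
    by (induction k) (simp_all add: P_0 Q_0 P_Suc)
  define \<alpha>' where "\<alpha>' = (\<Sum>k\<le>K. Q (Suc k) * \<alpha> * Q k)"
  define \<beta>' where "\<beta>' = (\<Sum>k\<le>K. Q (Suc k) * \<beta> * Q k)"
  have gQ: "(\<Sum>j\<le>K. Q (Suc j) * \<gamma> * Q j) * Q k = Q (Suc k) * \<gamma> * Q k" for k \<gamma>
  proof (cases "k \<le> K")
    case True
    have "(\<Sum>j\<le>K. Q (Suc j) * \<gamma> * Q j) * Q k = (\<Sum>j\<le>K. if j = k then Q (Suc k) * \<gamma> * Q k else 0)"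
      unfolding sum_distrib_right by (intro sum.cong) (auto simp: mult.assoc QQ QQ0)
    then show ?thesis using True by (simp add: sum.delta)
  next
    case False
    then show ?thesis using Qbig by simp
  qed
  have aQ: "\<alpha>' * Q k = Q (Suc k) * \<alpha> * Q k" "\<beta>' * Q k = Q (Suc k) * \<beta> * Q k" for k
    unfolding \<alpha>'_def \<beta>'_def by (rule gQ)+
  \<comment> \<open>\<gamma> maps the image of \<open>P k\<close> into that of
    \<open>P (Suc k)\<close>, which \<open>Q (Suc (Suc k))\<close> kills; hence adding
    \<open>P k\<close> on the right changes nothing.\<close>
  have two: "Q (Suc (Suc k)) * \<gamma> * Q (Suc k) = Q (Suc (Suc k)) * \<gamma> * P (Suc k)"
    if "\<gamma> * P k = P (Suc k) * \<gamma> * P k" for \<gamma> k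
  proof -
    have "Q (Suc (Suc k)) * \<gamma> * P k = Q (Suc (Suc k)) * (P (Suc k) * \<gamma> * P k)" using that by (simp add: mult.assoc)
    also have "\<dots> = 0" by (simp add: mult.assoc[symmetric] PQ1)
    finally show ?thesis by (simp add: P_Suc distrib_left)
  qed
  have comQ: "(\<alpha>' * \<beta>' - \<beta>' * \<alpha>') * Q k = 0" for k
  proof -
    have h: "Q (Suc (Suc k)) * \<gamma> * Q (Suc k) * \<delta> * Q k = Q (Suc (Suc k)) * \<gamma> * \<delta> * Q k"
      if "\<gamma> * P k = P (Suc k) * \<gamma> * P k" "\<delta> * P k = P (Suc k) * \<delta> * P k" for \<gamma> \<delta>
    proof -
      have "P (Suc k) * (\<delta> * Q k) = P (Suc k) * (\<delta> * P k) * Q k" by (simp add: mult.assoc PQs)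
      also have "\<dots> = \<delta> * P k * Q k" using that(2) by (simp add: mult.assoc)
      finally have "P (Suc k) * (\<delta> * Q k) = \<delta> * Q k" by (simp add: mult.assoc PQs)
      moreover have "Q (Suc (Suc k)) * \<gamma> * Q (Suc k) * \<delta> * Q k = Q (Suc (Suc k)) * \<gamma> * (P (Suc k) * (\<delta> * Q k))"
        using two[OF that(1)] by (simp add: mult.assoc)
      ultimately show ?thesis by (simp add: mult.assoc)
    qed
    have "\<alpha>' * \<beta>' * Q k = Q (Suc (Suc k)) * \<alpha> * Q (Suc k) * \<beta> * Q k"
      by (simp add: mult.assoc aQ) (simp add: mult.assoc[symmetric] aQ)
    moreover have "\<beta>' * \<alpha>' * Q k = Q (Suc (Suc k)) * \<beta> * Q (Suc k) * \<alpha> * Q k"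
      by (simp add: mult.assoc aQ) (simp add: mult.assoc[symmetric] aQ)
    ultimately have "(\<alpha>' * \<beta>' - \<beta>' * \<alpha>') * Q k = Q (Suc (Suc k)) * (\<alpha> * \<beta> - \<beta> * \<alpha>) * Q k"
      using h[OF ap(1,2)] h[OF ap(2,1)] by (simp add: left_diff_distrib right_diff_distrib mult.assoc)
    also have "\<alpha> * \<beta> - \<beta> * \<alpha> = E - v * w" using mom by (simp add: eq_diff_eq)
    also have "Q (Suc (Suc k)) * (E - v * w) * Q k = Q (Suc (Suc k)) * Q k - (Q (Suc (Suc k)) * v) * w * Q k"
      by (simp add: left_diff_distrib right_diff_distrib mult.assoc EQ)
    also have "Q (Suc (Suc k)) * v = 0"
    proof -
      have "Q (Suc (Suc k)) * v = Q (Suc (Suc k)) * Q 0 * v" by (simp add: mult.assoc Q_0 P0)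
      then show ?thesis by (simp add: QQ0)
    qed
    finally show ?thesis by (simp add: QQ0)
  qed
  have com: "\<alpha>' * \<beta>' - \<beta>' * \<alpha>' = 0"
  proof -
    have E': "E * \<alpha>' = \<alpha>'" "\<alpha>' * E = \<alpha>'" "E * \<beta>' = \<beta>'" "\<beta>' * E = \<beta>'"
      unfolding \<alpha>'_def \<beta>'_def sum_distrib_left sum_distrib_right by (simp_all add: mult.assoc EQ) (simp_all add: mult.assoc[symmetric] EQ)
    have "\<alpha>' * \<beta>' - \<beta>' * \<alpha>' = (\<alpha>' * \<beta>' - \<beta>' * \<alpha>') * P K" unfolding PKE by (simp add: left_diff_distrib mult.assoc E')
    also have "\<dots> = 0" unfolding sumQ sum_distrib_left by (simp add: comQ)
    finally show ?thesis .
  qed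
  have E': "E * \<alpha>' = \<alpha>'" "\<alpha>' * E = \<alpha>'" "E * \<beta>' = \<beta>'" "\<beta>' * E = \<beta>'"
    unfolding \<alpha>'_def \<beta>'_def sum_distrib_left sum_distrib_right by (simp_all add: mult.assoc EQ) (simp_all add: mult.assoc[symmetric] EQ)
  have eqv': "eqp \<sigma> \<alpha>' \<beta>'" unfolding \<alpha>'_def \<beta>'_def
    by (intro eqp_sum eqp_conj[OF eqv(1)]) (use intw_comm[OF iQ] in simp_all)
  have cm': "cm \<sigma> \<alpha>' \<beta>' v 0 0" unfolding cm_def E_def[symmetric]
    using rs E' un eqv' eqv(2) com by (auto simp: eqp_def)
  have "cyclic E \<alpha>' \<beta>' v" unfolding cyclic_def
  proof (intro allI impI)
    fix y assume y: "y * E = y" and z: "\<forall>u. y * wact \<alpha>' \<beta>' u v = 0"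
    \<comment> \<open>Degree k + 1 is spanned by the images of degree k under
      \<open>\<alpha>'\<close> and \<open>\<beta>'\<close>. Descending one degree lengthens the word
      by a letter on the right, so the induction is for all words at once.\<close>
    have "y * wact \<alpha>' \<beta>' u (Q k) = 0" for u k
    proof (induction k arbitrary: u)
      case 0
      have "y * wact \<alpha>' \<beta>' u (Q 0) = (y * wact \<alpha>' \<beta>' u v) * S"
        by (simp add: Q_0 P0_def wact_right mult.assoc)
      then show ?case using z by simp
    next
      case (Suc k)
      obtain S1 S2 where Qk: "Q (Suc k) = (E - P k) * \<alpha> * P k * S1 + (E - P k) * \<beta> * P k * S2"
        using gr[of k] unfolding grow_def E_def by blast
      have red: "(E - P k) * \<gamma> * P k = Q (Suc k) * \<gamma> * Q k"
        if 1: "\<gamma> * P k = P (Suc k) * \<gamma> * P k" and 2: "\<And>j. \<gamma> * P j = P (Suc j) * \<gamma> * P j" and 3: "E * \<gamma> = \<gamma>" for \<gamma>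
      proof -
        have "(E - P k) * \<gamma> * P k = \<gamma> * P k - P k * \<gamma> * P k" by (simp add: left_diff_distrib 3)
        also have "\<dots> = Q (Suc k) * \<gamma> * P k" by (subst 1) (simp add: P_Suc distrib_right)
        also have "\<dots> = Q (Suc k) * \<gamma> * Q k"
        proof (cases k)
          case 0
          then show ?thesis by (simp add: P_0 Q_0)
        next
          case (Suc j)
          then show ?thesis using two[OF 2] by simp
        qed
        finally show ?thesis .
      qed
      have "(E - P k) * \<alpha> * P k = \<alpha>' * Q k" "(E - P k) * \<beta> * P k = \<beta>' * Q k"
        unfolding aQ using red[of \<alpha>] red[of \<beta>] ap un by auto
      then have Qk': "Q (Suc k) = (\<alpha>' * Q k) * S1 + (\<beta>' * Q k) * S2" using Qk by simp
      have "y * wact \<alpha>' \<beta>' u (Q (Suc k)) = (y * wact \<alpha>' \<beta>' (u @ [True]) (Q k)) * S1 + (y * wact \<alpha>' \<beta>' (u @ [False]) (Q k)) * S2"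
        unfolding Qk' wact_add wact_snoc wact_right[of _ _ _ _ S1] wact_right[of _ _ _ _ S2] by (simp only: distrib_left mult.assoc if_True if_False)
      then show ?case using Suc by simp
    qed
    then have "y * Q k = 0" for k using wact_Nil by metis
    then have "y * P K = 0" unfolding sumQ sum_distrib_left by simp
    then show "y = 0" using y PKE by simp
  qed
  then show ?thesis using cm' unfolding E_def by blast
qed

end

text \<open>Words are chosen greedily, together with a left inverse \<open>B\<close> of the matrix
  of chosen columns. While m < N the projector onto their span has trace m and is not the identity,
  so some nonzero row \<open>y\<close> kills them; by cyclicity there is a word that
  \<open>y\<close> does not kill, and it becomes the next column.\<close>

lemma cyclic_basis:
  assumes cyc: "cyclic (idm N) \<alpha> \<beta> v" and v0: "v * eu 0 0 = v"
  shows "\<exists>us B. length us = N \<and> B * (\<Sum>i<N. wact \<alpha> \<beta> (us ! i) v * eu 0 i) = idm N \<and> idm N * B = B"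
proof -
  define col where "col us = (\<Sum>i<length us. wact \<alpha> \<beta> (us ! i) v * eu 0 i)" for us
  have col_app: "col (us @ [u]) = col us + wact \<alpha> \<beta> u v * eu 0 (length us)" for us u
    by (simp add: col_def nth_append)
  have colr: "col us * idm (length us) = col us" for us
    unfolding col_def sum_distrib_right by (intro sum.cong refl) (simp add: mult.assoc eu_idm)
  have step: "\<exists>us B. length us = m \<and> B * col us = idm m \<and> idm m * B = B \<and> B * idm N = B" if "m \<le> N" for m
    using that
  proof (induction m)
    case 0
    show ?case by (intro exI[of _ "[]"] exI[of _ 0]) simp
  next
    case (Suc m)
    then obtain us B where B: "length us = m" "B * col us = idm m" "idm m * B = B" "B * idm N = B" by auto
    define P where "P = idm N * col us * B"
    have PP: "P * P = P"
    proof -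
      have "P * P = idm N * col us * (B * idm N) * col us * B" by (simp add: P_def mult.assoc)
      also have "\<dots> = idm N * col us * (B * col us) * B" by (simp add: B mult.assoc)
      finally show ?thesis using B by (simp add: P_def mult.assoc)
    qed
    have "tr P = tr (B * (idm N * col us))" unfolding P_def by (rule tr_comm)
    also have "\<dots> = of_nat m" using B by (simp add: mult.assoc[symmetric])
    finally have trP: "tr P = of_nat m" .
    have PN: "P * idm N = P" "idm N * P = P" using B by (simp_all add: P_def mult.assoc) (simp add: mult.assoc[symmetric])
    have "P \<noteq> idm N"
    proof
      assume "P = idm N"
      then have "of_nat m = (of_nat N :: complex)" using trP by simp
      then show False using Suc.prems by simp
    qed
    then have "idm N - P \<noteq> 0" by simp
    then obtain i j where "ent (idm N - P) i j \<noteq> 0" using zero_or_entry by blast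
    then have y0: "eu m i * (idm N - P) \<noteq> 0" using ent_eu_mult[of m i "idm N - P" m j] by (metis ent_zero)
    define y where "y = eu m i * (idm N - P)"
    have yN: "y * idm N = y" by (simp add: y_def mult.assoc left_diff_distrib PN)
    have yc: "y * (idm N * col us) = 0"
    proof -
      have "P * (idm N * col us) = idm N * col us * (B * idm N) * col us" by (simp add: P_def mult.assoc)
      also have "\<dots> = idm N * col us * (B * col us)" by (simp add: B mult.assoc)
      also have "\<dots> = idm N * col us" using colr[of us] B by (simp add: mult.assoc)
      finally show ?thesis by (simp add: y_def mult.assoc left_diff_distrib) (simp add: mult.assoc[symmetric])
    qed
    then have yc': "y * col us = 0" using yN by (simp add: mult.assoc[symmetric])
    obtain u where u: "y * wact \<alpha> \<beta> u v \<noteq> 0" using cyc yN y0 unfolding cyclic_def y_def by blast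
    define x where "x = wact \<alpha> \<beta> u v"
    have x0: "x * eu 0 0 = x" unfolding x_def using v0 by (metis wact_right)
    have "y = eu m m * y" by (simp add: y_def mult.assoc[symmetric])
    then have "y * x = eu m m * (y * x) * eu 0 0" using x0 by (metis mult.assoc)
    then obtain c where c: "y * x = c \<star> eu m 0" by (metis eu_sandwich)
    have cnz: "c \<noteq> 0" using u c by (auto simp: x_def)
    define y1 where "y1 = (1 / c) \<star> y"
    have y1: "y1 * x = eu m 0" "y1 * col us = 0" "y1 * idm N = y1" "idm (Suc m) * y1 = y1"
      using c cnz yc' yN by (simp_all add: y1_def) (simp add: y_def mult.assoc[symmetric] idm_eu)
    \<comment> \<open>\<open>y1\<close> is scaled to serve as the new last row; the correction by
      \<open>B * x\<close> makes the old rows vanish on the new column.\<close>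
    define B' where "B' = B - B * x * eu 0 m * y1 + y1"
    have colu: "col (us @ [u]) = col us + x * eu 0 m" using col_app B by (simp add: x_def)
    have y1c: "y1 * (x * eu 0 m) = eu m m" using y1 by (simp add: mult.assoc[symmetric])
    have "B' * col (us @ [u]) = idm (Suc m)"
      unfolding colu B'_def by (simp add: algebra_simps y1 y1c B idm_Suc)
    moreover have "idm (Suc m) * B' = B'"
    proof -
      have "idm (Suc m) * B = idm (Suc m) * idm m * B" by (simp only: mult.assoc B(3))
      also have "idm (Suc m) * idm m = idm m" by (rule idm_left[OF bd_mono[OF bd_idm]]) simp
      finally have "idm (Suc m) * B = B" by (simp only: B(3))
      then show ?thesis unfolding B'_def by (simp add: distrib_left right_diff_distrib y1 mult.assoc[symmetric])
    qed
    moreover have "B' * idm N = B'" unfolding B'_def by (simp add: distrib_right left_diff_distrib y1 B mult.assoc)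
    ultimately show ?case using B(1) by (intro exI[of _ "us @ [u]"] exI[of _ B']) simp
  qed
  then obtain us B where "length us = N" "B * col us = idm N" "idm N * B = B" by blast
  then show ?thesis unfolding col_def by blast
qed

section \<open>Matrix representations\<close>

lemma GL_simps: "x \<otimes>\<^bsub>GL n\<^esub> y = x * y" "\<one>\<^bsub>GL n\<^esub> = 1\<^sub>m n"
  by (simp_all add: GL_def units_of_def ring_mat_def)
lemma GL_carrier: "carrier (GL n) = {A \<in> carrier_mat n n. \<exists>B\<in>carrier_mat n n. B * A = 1\<^sub>m n \<and> A * B = 1\<^sub>m n}"
  by (auto simp: GL_def units_of_def Units_def ring_mat_def)
lemma GL_group: "group (GL n)"
proof -
  interpret R: ring "ring_mat TYPE(complex) n ()" by (rule ring_mat)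
  show ?thesis unfolding GL_def by (rule R.units_group)
qed
lemma GL_D: "A \<in> carrier (GL n) \<Longrightarrow> A \<in> carrier_mat n n" by (simp add: GL_carrier)
lemma GL_I: "A \<in> carrier_mat n n \<Longrightarrow> B \<in> carrier_mat n n \<Longrightarrow> B * A = 1\<^sub>m n \<Longrightarrow> A * B = 1\<^sub>m n \<Longrightarrow> A \<in> carrier (GL n)"
  by (auto simp: GL_carrier)
lemma GL_inv: assumes "g \<in> carrier (GL n)"
  shows "inv\<^bsub>GL n\<^esub> g \<in> carrier (GL n)" "inv\<^bsub>GL n\<^esub> g \<in> carrier_mat n n" "inv\<^bsub>GL n\<^esub> g * g = 1\<^sub>m n" "g * inv\<^bsub>GL n\<^esub> g = 1\<^sub>m n"
  using group.inv_closed[OF GL_group assms] group.l_inv[OF GL_group assms] group.r_inv[OF GL_group assms]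
  by (auto simp: GL_simps GL_D)

lemma mult_entries_2:
  assumes "A \<in> carrier_mat 2 2" "B \<in> carrier_mat 2 2" "i < 2" "j < 2"
  shows "(A * B) $$ (i, j) = A $$ (i, 0) * B $$ (0, j) + A $$ (i, 1) * B $$ (1, j)"
  using assms by (simp add: scalar_prod_def numeral_2_eq_2)
lemma det_entries_2: assumes "(A :: complex mat) \<in> carrier_mat 2 2"
  shows "det A = A $$ (0, 0) * A $$ (1, 1) - A $$ (0, 1) * A $$ (1, 0)"
proof -
  have m: "mat_delete A i 0 \<in> carrier_mat 1 1" for i using mat_delete_carrier[of A 2 2] assms by (auto simp: mat_delete_def)
  have "det A = (\<Sum>i<2. A $$ (i, 0) * cofactor A i 0)" by (rule laplace_expansion_column[OF assms]) simp
  also have "\<dots> = A $$ (0, 0) * A $$ (1, 1) - A $$ (0, 1) * A $$ (1, 0)"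
    using assms by (simp add: numeral_2_eq_2 cofactor_def det_single[OF m]) (simp add: mat_delete_def)
  finally show ?thesis .
qed

lemma SL_subgroup: assumes "subgroup H (SL n)" shows "subgroup H (GL n)"
proof -
  let ?K = "{A \<in> carrier (GL n). det A = 1}"
  interpret GL: group "GL n" by (rule GL_group)
  have det_inv: "det (inv\<^bsub>GL n\<^esub> x) = 1" if "x \<in> ?K" for x
  proof -
    from that have x: "x \<in> carrier (GL n)" "det x = 1" by auto
    have "det (inv\<^bsub>GL n\<^esub> x) * det x = 1"
      unfolding det_mult[OF GL_inv(2)[OF x(1)] GL_D[OF x(1)], symmetric] GL_inv(3)[OF x(1)] by (rule det_one)
    then show ?thesis using x by simp
  qed
  have K: "subgroup ?K (GL n)"
  proof (rule GL.subgroupI)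
    show "?K \<noteq> {}" using GL.one_closed by (auto simp: GL_simps intro!: exI[of _ "1\<^sub>m n"])
    show "inv\<^bsub>GL n\<^esub> x \<in> ?K" if "x \<in> ?K" for x using det_inv[OF that] that by simp
    fix x y assume "x \<in> ?K" "y \<in> ?K"
    then have xy: "x \<in> carrier (GL n)" "y \<in> carrier (GL n)" "det x = 1" "det y = 1" by auto
    have "det (x * y) = 1" using det_mult[OF GL_D[OF xy(1)] GL_D[OF xy(2)]] xy by simp
    then show "x \<otimes>\<^bsub>GL n\<^esub> y \<in> ?K" using GL.m_closed[OF xy(1,2)] by (simp add: GL_simps)
  qed auto
  show ?thesis by (rule GL.incl_subgroup[OF K]) (use assms in \<open>simp add: SL_def\<close>)
qed

text \<open>The parameters of the interpretation below are kept as constants: the simplifier would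
  rewrite the index \<open>1\<close> inside abstractions to \<open>Suc 0\<close>.\<close>

definition "m11 g = g $$ (0, 0)"
definition "m12 g = g $$ (0, 1)"
definition "m21 g = g $$ (1, 0)"
definition "m22 g = g $$ (1, 1)"

locale mckay =
  fixes \<Gamma> :: "complex mat set"
  assumes sub: "subgroup \<Gamma> (SL 2)" and fin\<Gamma>: "finite \<Gamma>" and nt: "\<Gamma> \<noteq> {1\<^sub>m 2}"
begin

abbreviation GG :: "complex mat monoid" where "GG \<equiv> (GL 2)\<lparr>carrier := \<Gamma>\<rparr>"

lemma sub_GL: "subgroup \<Gamma> (GL 2)" by (rule SL_subgroup[OF sub])
lemma \<Gamma>_GL: "g \<in> \<Gamma> \<Longrightarrow> g \<in> carrier (GL 2)" using subgroup.subset[OF sub_GL] by blast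
lemma \<Gamma>_mat: "g \<in> \<Gamma> \<Longrightarrow> g \<in> carrier_mat 2 2" using \<Gamma>_GL GL_D by blast
lemma \<Gamma>_det: "g \<in> \<Gamma> \<Longrightarrow> det g = 1" using subgroup.subset[OF sub] by (auto simp: SL_def)
lemma GG_simps: "x \<otimes>\<^bsub>GG\<^esub> y = x * y" "\<one>\<^bsub>GG\<^esub> = 1\<^sub>m 2" "carrier GG = \<Gamma>"
  by (simp_all add: GL_simps)
lemma GG_group: "group GG"
  using group.subgroup_imp_group[OF GL_group sub_GL] .
lemma GG_inv: "g \<in> \<Gamma> \<Longrightarrow> inv\<^bsub>GG\<^esub> g = inv\<^bsub>GL 2\<^esub> g"
  by (rule group.m_inv_consistent[OF GL_group sub_GL])

lemma sl2: "sl2_group GG m11 m12 m21 m22"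
proof -
  interpret group GG by (rule GG_group)
  have "sl2_group GG (\<lambda>g. g $$ (0, 0)) (\<lambda>g. g $$ (0, 1)) (\<lambda>g. g $$ (1, 0)) (\<lambda>g. g $$ (1, 1))"
  proof
    show "finite (carrier GG)" using fin\<Gamma> by simp
    fix x y assume "x \<in> carrier GG" "y \<in> carrier GG"
    then have xy: "x \<in> carrier_mat 2 2" "y \<in> carrier_mat 2 2" using \<Gamma>_mat by auto
    show "(x \<otimes>\<^bsub>GG\<^esub> y) $$ (0, 0) = x $$ (0, 0) * y $$ (0, 0) + x $$ (0, 1) * y $$ (1, 0)"
      "(x \<otimes>\<^bsub>GG\<^esub> y) $$ (0, 1) = x $$ (0, 0) * y $$ (0, 1) + x $$ (0, 1) * y $$ (1, 1)"
      "(x \<otimes>\<^bsub>GG\<^esub> y) $$ (1, 0) = x $$ (1, 0) * y $$ (0, 0) + x $$ (1, 1) * y $$ (1, 0)"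
      "(x \<otimes>\<^bsub>GG\<^esub> y) $$ (1, 1) = x $$ (1, 0) * y $$ (0, 1) + x $$ (1, 1) * y $$ (1, 1)"
      unfolding GG_simps by (rule mult_entries_2[OF xy]; simp)+
  next
    fix x assume x: "x \<in> carrier GG"
    then show "x $$ (0, 0) * x $$ (1, 1) - x $$ (0, 1) * x $$ (1, 0) = 1"
      using det_entries_2[OF \<Gamma>_mat, of x] \<Gamma>_det[of x] by simp
    assume e: "x $$ (0, 0) = 1" "x $$ (0, 1) = 0" "x $$ (1, 0) = 0" "x $$ (1, 1) = 1"
    show "x = \<one>\<^bsub>GG\<^esub>" unfolding GG_simps
    proof (rule eq_matI)
      fix i j :: nat assume "i < dim_row (1\<^sub>m 2 :: complex mat)" "j < dim_col (1\<^sub>m 2 :: complex mat)"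
      then have "(i = 0 \<or> i = 1) \<and> (j = 0 \<or> j = 1)" by auto
      then show "x $$ (i, j) = 1\<^sub>m 2 $$ (i, j)" using e by auto
    qed (use \<Gamma>_mat[of x] x in auto)
  next
    show "\<one>\<^bsub>GG\<^esub> $$ (0, 0) = 1" "\<one>\<^bsub>GG\<^esub> $$ (0, 1) = 0" "\<one>\<^bsub>GG\<^esub> $$ (1, 0) = 0" "\<one>\<^bsub>GG\<^esub> $$ (1, 1) = 1"
      by (simp_all add: GG_simps)
    show "carrier GG \<noteq> {\<one>\<^bsub>GG\<^esub>}" using nt by (simp add: GG_simps)
  qed
  then show ?thesis unfolding m11_def[abs_def] m12_def[abs_def] m21_def[abs_def] m22_def[abs_def] .
qed

sublocale sl2_group GG m11 m12 m21 m22
  by (rule sl2)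

lemma one_\<Gamma>: "1\<^sub>m 2 \<in> \<Gamma>" using one_closed by (simp add: GG_simps)

lemma reps_D: assumes "\<rho> \<in> reps \<Gamma> k" "g \<in> \<Gamma>"
  shows "\<rho> g \<in> carrier (GL k)" "\<rho> g \<in> carrier_mat k k" "h \<in> \<Gamma> \<Longrightarrow> \<rho> (g * h) = \<rho> g * \<rho> h"
proof -
  show 1: "\<rho> g \<in> carrier (GL k)" using assms unfolding reps_def hom_def by auto
  then show "\<rho> g \<in> carrier_mat k k" by (rule GL_D)
  show "h \<in> \<Gamma> \<Longrightarrow> \<rho> (g * h) = \<rho> g * \<rho> h" using assms unfolding reps_def hom_def by (auto simp: GL_simps)
qed
lemma reps_one: assumes "\<rho> \<in> reps \<Gamma> k" shows "\<rho> (1\<^sub>m 2) = 1\<^sub>m k"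
  using hom_one[OF assms[unfolded reps_def] GG_group GL_group] by (simp add: GL_simps)

lemma reps_rep: assumes "\<rho> \<in> reps \<Gamma> k"
  shows "rep (\<lambda>g. fm (\<rho> g))" "fm (\<rho> (1\<^sub>m 2)) = idm k" "g \<in> \<Gamma> \<Longrightarrow> chr (\<lambda>g. fm (\<rho> g)) g = mat_trace (\<rho> g)"
  "g \<in> \<Gamma> \<Longrightarrow> character \<Gamma> \<rho> g = chr (\<lambda>g. fm (\<rho> g)) g"
proof -
  show "rep (\<lambda>g. fm (\<rho> g))" unfolding rep_def
    using reps_D(3)[OF assms] fm_mult[OF reps_D(2)[OF assms] reps_D(2)[OF assms]] by (simp add: GL_simps)
  show "fm (\<rho> (1\<^sub>m 2)) = idm k" by (simp add: reps_one[OF assms] fm_one)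
  show "chr (\<lambda>g. fm (\<rho> g)) g = mat_trace (\<rho> g)" if "g \<in> \<Gamma>" for g
    using tr_fm[OF reps_D(2)[OF assms that]] by (simp add: chr_def)
  then show "g \<in> \<Gamma> \<Longrightarrow> character \<Gamma> \<rho> g = chr (\<lambda>g. fm (\<rho> g)) g" by (simp add: character_def)
qed

lemma rep_bd_one: assumes "rep \<sigma>" "\<sigma> (1\<^sub>m 2) = idm k" "g \<in> \<Gamma>" shows "idm k * \<sigma> g = \<sigma> g" "\<sigma> g * idm k = \<sigma> g"
  using rep_one[OF assms(1), of g] assms by (auto simp: GL_simps)

lemma rep_reps: assumes "rep \<sigma>" "\<sigma> (1\<^sub>m 2) = idm k"
  shows "(\<lambda>g. mf k k (\<sigma> g)) \<in> reps \<Gamma> k" "g \<in> \<Gamma> \<Longrightarrow> fm (mf k k (\<sigma> g)) = \<sigma> g"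
    "g \<in> \<Gamma> \<Longrightarrow> character \<Gamma> (\<lambda>g. mf k k (\<sigma> g)) g = chr \<sigma> g"
proof -
  note b = rep_bd_one[OF assms]
  show fm: "fm (mf k k (\<sigma> g)) = \<sigma> g" if "g \<in> \<Gamma>" for g using b[OF that] by (simp add: fm_mf)
  have mult: "mf k k (\<sigma> x) * mf k k (\<sigma> y) = mf k k (\<sigma> (x * y))" if "x \<in> \<Gamma>" "y \<in> \<Gamma>" for x y
    using mf_mult[OF b(1)[OF that(2)], of k k "\<sigma> x"] rep_mult[OF assms(1), of x y] that by (simp add: GL_simps)
  have one: "mf k k (\<sigma> (1\<^sub>m 2)) = 1\<^sub>m k" using mf_fm[of "1\<^sub>m k" k k] assms(2) by (simp add: fm_one)
  have "mf k k (\<sigma> x) \<in> carrier (GL k)" if x: "x \<in> \<Gamma>" for x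
  proof -
    have i: "inv\<^bsub>GG\<^esub> x \<in> \<Gamma>" "inv\<^bsub>GG\<^esub> x * x = 1\<^sub>m 2" "x * inv\<^bsub>GG\<^esub> x = 1\<^sub>m 2"
      using inv_closed[of x] l_inv[of x] r_inv[of x] x by (auto simp: GL_simps)
    show ?thesis using mult[OF i(1) x] mult[OF x i(1)] by (intro GL_I[of _ _ "mf k k (\<sigma> (inv\<^bsub>GG\<^esub> x))"]) (simp_all add: i one)
  qed
  then show r: "(\<lambda>g. mf k k (\<sigma> g)) \<in> reps \<Gamma> k" using mult by (auto simp: reps_def hom_def GL_simps)
  show "character \<Gamma> (\<lambda>g. mf k k (\<sigma> g)) g = chr \<sigma> g" if g: "g \<in> \<Gamma>" for g
    using reps_rep(4)[OF r g] fm[OF g] by (simp add: chr_def)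
qed

text \<open>Splitting the idempotent of the unit conjugates a representation to one on a full
  coordinate space, from which invertible matrices can be read off.\<close>

lemma rep_split: assumes "rep \<sigma>"
  shows "\<exists>m A B. B * A = idm m \<and> A * B = \<sigma> (1\<^sub>m 2) \<and> A * idm m = A \<and> idm m * B = B \<and>
    rep (\<lambda>g. B * \<sigma> g * A) \<and> B * \<sigma> (1\<^sub>m 2) * A = idm m \<and> (\<forall>g\<in>\<Gamma>. chr (\<lambda>g. B * \<sigma> g * A) g = chr \<sigma> g)"
proof -
  have o: "\<sigma> (1\<^sub>m 2) * \<sigma> (1\<^sub>m 2) = \<sigma> (1\<^sub>m 2)" using rep_idem[OF assms] by (simp add: GL_simps)
  obtain m A B where AB: "A * B = \<sigma> (1\<^sub>m 2)" "B * A = idm m" "A * idm m = A" "idm m * B = B"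
    using idempotent_split[OF o] by blast
  have r1: "\<sigma> g * (A * (B * Y)) = \<sigma> g * Y" if "g \<in> \<Gamma>" for g Y
    using rep_one(2)[OF assms, of g] that by (simp add: mult.assoc[symmetric] GL_simps) (simp add: mult.assoc AB(1))
  have "rep (\<lambda>g. B * \<sigma> g * A)"
    using rep_mult[OF assms] by (auto simp: rep_def GL_simps mult.assoc r1) (simp add: mult.assoc[symmetric])
  moreover have "B * \<sigma> (1\<^sub>m 2) * A = idm m" 
  proof -
    have "B * (A * B) * A = (B * A) * (B * A)" by (simp only: mult.assoc)
    then show ?thesis unfolding AB by (simp add: AB(1) idm_left[OF bd_idm])
  qed
  moreover have "chr (\<lambda>g. B * \<sigma> g * A) g = chr \<sigma> g" if g: "g \<in> \<Gamma>" for g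
  proof -
    have "tr (B * \<sigma> g * A) = tr (\<sigma> g * (A * B))" using tr_comm[of B "\<sigma> g * A"] by (simp add: mult.assoc)
    then show ?thesis using rep_one(2)[OF assms, of g] g by (simp add: chr_def AB(1) GL_simps)
  qed
  ultimately show ?thesis using AB by blast
qed

end

section \<open>Invariant subspaces and equivariant idempotents\<close>

lemma mat_vec_eqI:
  assumes A: "(A :: complex mat) \<in> carrier_mat n m" and B: "B \<in> carrier_mat n m"
    and e: "\<And>v. v \<in> carrier_vec m \<Longrightarrow> A *\<^sub>v v = B *\<^sub>v v"
  shows "A = B"
proof (rule eq_matI)
  fix i j assume "i < dim_row B" "j < dim_col B"
  then have ij: "i < n" "j < m" using B by auto
  have "(A *\<^sub>v unit_vec m j) $ i = (B *\<^sub>v unit_vec m j) $ i" using e[of "unit_vec m j"] by simp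
  then show "A $$ (i, j) = B $$ (i, j)" using ij A B by simp
qed (use A B in auto)

lemma module_vec_subspace_iff:
  "VectorSpace.subspace class_ring W (module_vec TYPE(complex) k) \<longleftrightarrow>
    W \<subseteq> carrier_vec k \<and> 0\<^sub>v k \<in> W \<and> (\<forall>v\<in>W. \<forall>w\<in>W. v + w \<in> W) \<and> (\<forall>c. \<forall>v\<in>W. c \<cdot>\<^sub>v v \<in> W)"
  using vec_vs[of k] vec_module[of k]
  by (auto simp: VectorSpace.subspace_def submodule_def module_vec_simps class_ring_simps)

definition fcol :: "nat \<Rightarrow> fmat \<Rightarrow> nat \<Rightarrow> complex vec" where
  "fcol k T j = vec k (\<lambda>i. ent T i j)"

lemma fcol_carrier[simp]: "fcol k T j \<in> carrier_vec k" by (simp add: fcol_def)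
lemma fcol_add: "fcol k (S + T) j = fcol k S j + fcol k T j"
  by (rule eq_vecI) (auto simp: fcol_def)
lemma fcol_sc: "fcol k (c \<star> T) j = c \<cdot>\<^sub>v fcol k T j"
  by (rule eq_vecI) (auto simp: fcol_def)
lemma fcol_mult: assumes "\<rho> \<in> carrier_mat k k" "idm k * T = T"
  shows "fcol k (fm \<rho> * T) j = \<rho> *\<^sub>v fcol k T j"
proof (rule eq_vecI)
  fix i assume "i < dim_vec (\<rho> *\<^sub>v fcol k T j)"
  then have i: "i < k" using assms by simp
  have "ent (fm \<rho> * T) i j = (\<Sum>l<k. ent (fm \<rho>) i l * ent T l j)"
    by (rule ent_mult[OF bd_fm[OF assms(1)]])
  then show "fcol k (fm \<rho> * T) j $ i = (\<rho> *\<^sub>v fcol k T j) $ i"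
    using i assms(1) by (auto simp: fcol_def scalar_prod_def ent_fm lessThan_atLeast0 intro!: sum.cong)
qed (use assms in \<open>auto simp: fcol_def\<close>)

text \<open>A subspace W enters the ring as the matrices with columns in W, which are closed under
  multiplication on the right by \<open>cols_in_right\<close>.\<close>

definition cols_in :: "nat \<Rightarrow> complex vec set \<Rightarrow> fmat \<Rightarrow> bool" where
  "cols_in k W T \<longleftrightarrow> idm k * T = T \<and> (\<forall>j. fcol k T j \<in> W)"

definition colm :: "complex vec \<Rightarrow> fmat" where
  "colm w = (\<Sum>i<dim_vec w. (w $ i) \<star> eu i 0)"

lemma ent_colm: "ent (colm w) i j = (if i < dim_vec w \<and> j = 0 then w $ i else 0)"
proof -
  have "ent (colm w) i j = (\<Sum>l<dim_vec w. if l = i then (if j = 0 then w $ i else 0) else 0)"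
    unfolding colm_def by (simp add: ent_eu if_distrib) (intro sum.cong, auto)
  then show ?thesis by (simp add: sum.delta)
qed

lemma idm_colm: "w \<in> carrier_vec k \<Longrightarrow> idm k * colm w = colm w"
  by (rule fmat_eqI) (auto simp: ent_idm_mult ent_colm)
lemma fcol_colm: "w \<in> carrier_vec k \<Longrightarrow> fcol k (colm w) j = (if j = 0 then w else 0\<^sub>v k)"
  by (rule eq_vecI) (auto simp: fcol_def ent_colm)

lemma cols_in_right:
  assumes W: "0\<^sub>v k \<in> W" "\<And>v w. v \<in> W \<Longrightarrow> w \<in> W \<Longrightarrow> v + w \<in> W" "\<And>c v. v \<in> W \<Longrightarrow> c \<cdot>\<^sub>v v \<in> W"
    and T: "cols_in k W T"
  shows "cols_in k W (T * S)"
proof -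
  obtain N where N: "bd T N" using bd_ex by blast
  have "fcol k (T * S) j \<in> W" for j
  proof -
    have "vec k (\<lambda>i. \<Sum>l<n. ent T i l * ent S l j) \<in> W" for n
    proof (induction n)
      case 0
      have "vec k (\<lambda>i. \<Sum>l<0. ent T i l * ent S l j) = 0\<^sub>v k" by auto
      then show ?case using W(1) by simp
    next
      case (Suc n)
      have "vec k (\<lambda>i. \<Sum>l<Suc n. ent T i l * ent S l j)
        = vec k (\<lambda>i. \<Sum>l<n. ent T i l * ent S l j) + ent S n j \<cdot>\<^sub>v fcol k T n"
        by (rule eq_vecI) (auto simp: fcol_def)
      then show ?case using W(2)[OF Suc W(3)] T by (auto simp: cols_in_def)
    qed
    moreover have "fcol k (T * S) j = vec k (\<lambda>i. \<Sum>l<N. ent T i l * ent S l j)"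
      by (simp add: fcol_def ent_mult[OF N])
    ultimately show ?thesis by simp
  qed
  then show ?thesis using T by (simp add: cols_in_def mult.assoc[symmetric])
qed

text \<open>Take an idempotent with columns in W of maximal trace, which exists because traces are
  at most k. If it failed to fix some T, the remainder \<open>u\<close> would produce an orthogonal
  idempotent \<open>e\<close>, and \<open>P + e\<close> would have larger trace.\<close>

lemma subspace_projector:
  assumes W: "0\<^sub>v k \<in> W" "\<And>v w. v \<in> W \<Longrightarrow> w \<in> W \<Longrightarrow> v + w \<in> W" "\<And>c v. v \<in> W \<Longrightarrow> c \<cdot>\<^sub>v v \<in> W"
  obtains P where "cols_in k W P" "P * idm k = P" "\<And>T. cols_in k W T \<Longrightarrow> P * T = T"
proof -
  define S where "S = {m. \<exists>P. cols_in k W P \<and> P * idm k = P \<and> P * P = P \<and> tr P = of_nat m}"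
  have le: "m \<le> k" if "m \<in> S" for m
  proof -
    obtain P where P: "idm k * P = P" "P * idm k = P" "P * P = P" "tr P = of_nat m"
      using \<open>m \<in> S\<close> by (auto simp: S_def cols_in_def)
    then obtain m' where "m' \<le> k" "tr P = of_nat m'" using tr_idem_le[OF P(3)] by (auto simp: bd_idm_iff)
    then show ?thesis using P(4) by simp
  qed
  have fz: "fcol k 0 j = 0\<^sub>v k" for j by (rule eq_vecI) (auto simp: fcol_def)
  have "cols_in k W 0" using W(1) by (simp add: cols_in_def fz)
  then have "0 \<in> S" by (auto simp: S_def intro!: exI[of _ 0])
  moreover have finS: "finite S" using le by (intro finite_subset[of S "{..k}"]) auto
  ultimately obtain M where M: "M \<in> S" "M = Max S" using Max_in[of S] by blast
  then obtain P where P: "cols_in k W P" "P * idm k = P" "P * P = P" "tr P = of_nat M" by (auto simp: S_def)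
  have "P * T = T" if T: "cols_in k W T" for T
  proof (rule ccontr)
    assume ne: "P * T \<noteq> T"
    define u where "u = T + P * ((-1) \<star> T)"
    have u: "u = T - P * T" by (rule fmat_eqI) (simp add: u_def)
    have cadd: "cols_in k W (X + Y)" if "cols_in k W X" "cols_in k W Y" for X Y
      using that W(2) by (simp add: cols_in_def fcol_add distrib_left)
    have cu: "cols_in k W u" unfolding u_def by (intro cadd T cols_in_right W P(1)) auto
    have Pu: "P * u = 0" by (simp add: u right_diff_distrib mult.assoc[symmetric] P(3))
    obtain s where s: "u * s * u = u" using quasi_inverse by blast
    \<comment> \<open>The factor \<open>idm k - P\<close> makes \<open>e\<close> vanish on the image
      of \<open>P\<close>; the leading \<open>u\<close> puts the image of \<open>e\<close> where
      \<open>P\<close> vanishes.\<close>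
    define e where "e = u * (s * (idm k - P))"
    have ku: "idm k * u = u" using cu by (simp add: cols_in_def)
    have eu': "e * u = u" using s by (simp add: e_def mult.assoc left_diff_distrib Pu ku right_diff_distrib)
    have ee: "e * e = e" using eu' by (simp add: e_def mult.assoc[symmetric])
    have Pk: "idm k * P = P" using P(1) by (simp add: cols_in_def)
    have eP: "e * P = 0" by (simp add: e_def mult.assoc left_diff_distrib Pk P(3))
    have Pe: "P * e = 0" by (simp add: e_def mult.assoc[symmetric] Pu)
    have ek: "e * idm k = e" by (simp add: e_def mult.assoc left_diff_distrib P(2) idm_left[OF bd_idm])
    have ce: "cols_in k W e" unfolding e_def by (intro cols_in_right W cu) auto
    obtain l where l: "tr e = of_nat l" using tr_idem[OF ee] by blast
    have "u \<noteq> 0" using ne u by auto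
    then have "e \<noteq> 0" using eu' by auto
    then have l0: "l \<noteq> 0" using tr_idem_0[OF ee] l by auto
    have "M + l \<in> S" unfolding S_def mem_Collect_eq
      by (intro exI[of _ "P + e"] conjI cadd P(1) ce)
        (simp_all add: distrib_left distrib_right P ek ee eP Pe tr_add l)
    then have "M + l \<le> M" unfolding M(2) using finS by (rule Max_ge[rotated])
    then show False using l0 by simp
  qed
  then show ?thesis using that P by blast
qed

context mckay
begin

text \<open>Averaging a projector onto the invariant subspace W gives an equivariant projector onto
  W, which irreducibility in the sense of idempotents forces to be 0 or the unit.\<close>

lemma irr_invariant:
  assumes r: "\<rho> \<in> reps \<Gamma> k" and i: "irr (\<lambda>g. fm (\<rho> g))"
    and W: "W \<subseteq> carrier_vec k" "0\<^sub>v k \<in> W" "\<And>v w. v \<in> W \<Longrightarrow> w \<in> W \<Longrightarrow> v + w \<in> W" "\<And>c v. v \<in> W \<Longrightarrow> c \<cdot>\<^sub>v v \<in> W"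
    and inv: "\<And>g v. g \<in> \<Gamma> \<Longrightarrow> v \<in> W \<Longrightarrow> \<rho> g *\<^sub>v v \<in> W"
  shows "W = {0\<^sub>v k} \<or> W = carrier_vec k"
proof -
  let ?\<sigma> = "\<lambda>g. fm (\<rho> g)"
  have rep: "rep ?\<sigma>" and s1: "fm (\<rho> (1\<^sub>m 2)) = idm k" using reps_rep[OF r] by auto
  obtain P where P: "cols_in k W P" "P * idm k = P" "\<And>T. cols_in k W T \<Longrightarrow> P * T = T"
    using subspace_projector[OF W(2-4)] by blast
  have cl: "cols_in k W (?\<sigma> g * T)" if "g \<in> \<Gamma>" "cols_in k W T" for g T
    using that inv fcol_mult[OF reps_D(2)[OF r that(1)]] rep_bd_one[OF rep s1 that(1)]
    by (simp add: cols_in_def mult.assoc[symmetric])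
  have ci: "inv\<^bsub>GG\<^esub> g \<in> \<Gamma>" if "g \<in> \<Gamma>" for g using inv_closed[of g] that by simp
  have csum: "cols_in k W (\<Sum>g\<in>A. f g)" if "\<And>g. g \<in> A \<Longrightarrow> cols_in k W (f g)" "finite A" for A and f :: "complex mat \<Rightarrow> fmat"
    using that(2,1)
  proof (induction A)
    case empty
    have "fcol k 0 j = 0\<^sub>v k" for j by (rule eq_vecI) (auto simp: fcol_def)
    then show ?case using W(2) by (simp add: cols_in_def)
  next
    case (insert x F)
    then show ?case using W(3) by (simp add: cols_in_def fcol_add distrib_left)
  qed
  define E where "E = avg ?\<sigma> ?\<sigma> P"
  have cE: "cols_in k W E"
  proof -
    have "cols_in k W (\<Sum>g\<in>\<Gamma>. ?\<sigma> g * P * ?\<sigma> (inv\<^bsub>GG\<^esub> g))"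
      by (rule csum[OF _ fin\<Gamma>]) (intro cols_in_right W(2-4) cl P(1))
    then have "cols_in k W (c \<star> (\<Sum>g\<in>\<Gamma>. ?\<sigma> g * P * ?\<sigma> (inv\<^bsub>GG\<^esub> g)))" for c
      using W(4) by (simp add: cols_in_def fcol_sc)
    then show ?thesis by (simp add: E_def avg_def)
  qed
  have iE: "intw ?\<sigma> ?\<sigma> E" unfolding E_def by (rule avg_intw[OF rep rep])
  have ET: "E * T = T" if T: "cols_in k W T" for T
  proof -
    have "?\<sigma> g * P * ?\<sigma> (inv\<^bsub>GG\<^esub> g) * T = T" if g: "g \<in> \<Gamma>" for g
    proof -
      have "?\<sigma> g * P * ?\<sigma> (inv\<^bsub>GG\<^esub> g) * T = ?\<sigma> g * (P * (?\<sigma> (inv\<^bsub>GG\<^esub> g) * T))" by (simp add: mult.assoc)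
      also have "\<dots> = ?\<sigma> g * ?\<sigma> (inv\<^bsub>GG\<^esub> g) * T" using P(3)[OF cl[OF ci[OF g] T]] by (simp add: mult.assoc)
      also have "\<dots> = T" using rep_inv(2)[OF rep, of g] g T s1 by (simp add: GL_simps cols_in_def)
      finally show ?thesis .
    qed
    then have "(\<Sum>g\<in>carrier GG. ?\<sigma> g * P * ?\<sigma> (inv\<^bsub>GG\<^esub> g)) * T = of_nat (card (carrier GG)) \<star> T"
      unfolding sum_distrib_right sum_const_sc[symmetric] by (intro sum.cong) auto
    then show ?thesis using M_nz by (simp add: E_def avg_def)
  qed
  have "E * E = E" using ET[OF cE] .
  then have "E = 0 \<or> E = idm k" using i iE s1 unfolding irr_def by (auto simp: GL_simps)
  then show ?thesis
  proof
    assume E0: "E = 0"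
    have "w = 0\<^sub>v k" if w: "w \<in> W" for w
    proof -
      have wc: "w \<in> carrier_vec k" using w W(1) by blast
      have "cols_in k W (colm w)" using wc w W(2) by (simp add: cols_in_def idm_colm fcol_colm)
      then have "colm w = 0" using ET E0 by (metis mult_zero_left)
      then have z: "ent (colm w) i 0 = 0" for i by simp
      have "w $ i = 0" if "i < k" for i using z[of i] wc that by (simp add: ent_colm)
      then show ?thesis using wc by (intro eq_vecI) auto
    qed
    then show ?thesis using W(2) by blast
  next
    assume E1: "E = idm k"
    have "w \<in> W" if w: "w \<in> carrier_vec k" for w
    proof -
      have "cols_in k W (E * colm w)" by (intro cols_in_right W(2-4) cE)
      then have "fcol k (colm w) 0 \<in> W" using idm_colm[OF w] by (simp add: cols_in_def E1)
      then show ?thesis using fcol_colm[OF w] by simp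
    qed
    then show ?thesis using W(1) by blast
  qed
qed

text \<open>One direction is \<open>irr_invariant\<close>; for the other, the fixed vectors of an
  equivariant idempotent form an invariant subspace.\<close>

lemma irreducible_rep_iff: assumes r: "\<rho> \<in> reps \<Gamma> k"
  shows "irreducible_rep \<Gamma> k \<rho> \<longleftrightarrow> irr (\<lambda>g. fm (\<rho> g))"
proof
  let ?\<sigma> = "\<lambda>g. fm (\<rho> g)"
  have rep: "rep ?\<sigma>" and s1: "fm (\<rho> (1\<^sub>m 2)) = idm k" using reps_rep[OF r] by auto
  {
    assume ir: "irr ?\<sigma>"
    have "k > 0"
    proof (rule ccontr)
      assume "\<not> k > 0"
      then have "idm k = 0" by (simp add: fmat_eqI ent_idm)
      then show False using ir s1 by (simp add: irr_def GL_simps)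
    qed
    moreover have "W = {0\<^sub>v k} \<or> W = carrier_vec k"
      if "VectorSpace.subspace class_ring W (module_vec TYPE(complex) k)" "\<forall>g\<in>\<Gamma>. \<forall>v\<in>W. \<rho> g *\<^sub>v v \<in> W" for W
      using that by (intro irr_invariant[OF r ir]) (auto simp: module_vec_subspace_iff)
    ultimately show "irreducible_rep \<Gamma> k \<rho>" unfolding irreducible_rep_def using r by blast
  }
  assume ir: "irreducible_rep \<Gamma> k \<rho>"
  then have k: "k > 0" by (simp add: irreducible_rep_def)
  have "idm k \<noteq> 0"
  proof
    assume "idm k = 0"
    then have "ent (idm k) 0 0 = 0" by simp
    then show False using k by (simp add: ent_idm)
  qed
  moreover have "E = 0 \<or> E = idm k" if E: "intw ?\<sigma> ?\<sigma> E" "E * E = E" for E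
  proof -
    define e where "e = mf k k E"
    have Ek: "idm k * E = E" "E * idm k = E" using E(1) s1 by (auto simp: intw_def GL_simps)
    have fe: "fm e = E" by (simp add: e_def fm_mf Ek)
    have ec: "e \<in> carrier_mat k k" by (simp add: e_def)
    have ee: "e * e = e" using mf_mult[OF Ek(1), of k k E] E(2) by (simp add: e_def)
    define W where "W = {v \<in> carrier_vec k. e *\<^sub>v v = v}"
    have "VectorSpace.subspace class_ring W (module_vec TYPE(complex) k)" unfolding module_vec_subspace_iff
      using ec by (auto simp: W_def mult_add_distrib_mat_vec mult_mat_vec)
    moreover have "\<rho> g *\<^sub>v v \<in> W" if g: "g \<in> \<Gamma>" and v: "v \<in> W" for g v
    proof -
      note rg = reps_D(2)[OF r g]
      have "fm (e * \<rho> g) = fm (\<rho> g * e)"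
        using intw_comm[OF E(1), of g] g by (simp add: fm_mult[OF ec rg] fm_mult[OF rg ec] fe)
      then have "e * \<rho> g = \<rho> g * e" using fm_inj[of "e * \<rho> g" k k "\<rho> g * e"] ec rg by auto
      then have "e *\<^sub>v (\<rho> g *\<^sub>v v) = \<rho> g *\<^sub>v (e *\<^sub>v v)"
        using v ec rg by (simp add: W_def assoc_mult_mat_vec[symmetric, of _ k k _ k])
      then show ?thesis using v rg by (auto simp: W_def)
    qed
    ultimately have "W = {0\<^sub>v k} \<or> W = carrier_vec k" using ir unfolding irreducible_rep_def by blast
    then show ?thesis
    proof
      assume W0: "W = {0\<^sub>v k}"
      have "e = 0\<^sub>m k k"
      proof (rule mat_vec_eqI[OF ec])
        fix v :: "complex vec" assume v: "v \<in> carrier_vec k"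
        have "e *\<^sub>v v \<in> W" using v ec ee by (simp add: W_def assoc_mult_mat_vec[symmetric, of _ k k _ k])
        then show "e *\<^sub>v v = 0\<^sub>m k k *\<^sub>v v" using W0 v by (auto intro!: eq_vecI)
      qed simp
      moreover have "fm (0\<^sub>m k k) = 0" by (rule fmat_eqI) (auto simp: ent_fm)
      ultimately show ?thesis using fe by simp
    next
      assume W1: "W = carrier_vec k"
      have "e = 1\<^sub>m k"
      proof (rule mat_vec_eqI[OF ec])
        fix v :: "complex vec" assume v: "v \<in> carrier_vec k"
        then have "v \<in> W" using W1 by simp
        then show "e *\<^sub>v v = 1\<^sub>m k *\<^sub>v v" by (simp add: W_def)
      qed simp
      then show ?thesis using fe by (simp add: fm_one)
    qed
  qed
  ultimately show "irr ?\<sigma>" using rep s1 by (auto simp: irr_def GL_simps)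
qed

text \<open>An equivariant idempotent \<open>E\<close> of the compressed representation gives
  \<open>A * E * B\<close> for the original one, so irreducibility survives
  \<open>rep_split\<close>.\<close>

lemma irr_irreducible: assumes "irr \<sigma>"
  shows "\<exists>k \<rho>. irreducible_rep \<Gamma> k \<rho> \<and> (\<forall>g\<in>\<Gamma>. character \<Gamma> \<rho> g = chr \<sigma> g)"
proof -
  have rs: "rep \<sigma>" using assms by (simp add: irr_def)
  obtain m A B where s: "B * A = idm m" "A * B = \<sigma> (1\<^sub>m 2)" "A * idm m = A" "idm m * B = B"
    "rep (\<lambda>g. B * \<sigma> g * A)" "B * \<sigma> (1\<^sub>m 2) * A = idm m" "\<forall>g\<in>\<Gamma>. chr (\<lambda>g. B * \<sigma> g * A) g = chr \<sigma> g"
    using rep_split[OF rs] by metis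
  let ?\<tau> = "\<lambda>g. B * \<sigma> g * A"
  let ?\<rho> = "\<lambda>g. mf m m (?\<tau> g)"
  have r: "?\<rho> \<in> reps \<Gamma> m" and fr: "\<And>g. g \<in> \<Gamma> \<Longrightarrow> fm (?\<rho> g) = ?\<tau> g" and cr: "\<And>g. g \<in> \<Gamma> \<Longrightarrow> character \<Gamma> ?\<rho> g = chr ?\<tau> g"
    using rep_reps[OF s(5,6)] by auto
  have BAX: "B * (A * X) = idm m * X" "A * (B * X) = \<sigma> (1\<^sub>m 2) * X" for X by (simp_all add: mult.assoc[symmetric] s(1,2))
  have o: "\<sigma> (1\<^sub>m 2) * \<sigma> g = \<sigma> g" "\<sigma> g * \<sigma> (1\<^sub>m 2) = \<sigma> g" if "g \<in> \<Gamma>" for g using rep_one[OF rs, of g] that by (simp_all add: GL_simps)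
  have oX: "\<sigma> g * (\<sigma> (1\<^sub>m 2) * X) = \<sigma> g * X" if "g \<in> \<Gamma>" for g X using o(2)[OF that] by (simp add: mult.assoc[symmetric])
  have oA: "\<sigma> (1\<^sub>m 2) * A = A" "B * \<sigma> (1\<^sub>m 2) = B"
    using s(1,3,4) by (simp_all add: s(2)[symmetric] mult.assoc) (simp add: mult.assoc[symmetric] s(1,4))
  have "irr (\<lambda>g. fm (?\<rho> g))" unfolding irr_def
  proof (intro conjI allI impI)
    show "rep (\<lambda>g. fm (?\<rho> g))" using reps_rep(1)[OF r] .
    have f1: "fm (?\<rho> (\<one>\<^bsub>GG\<^esub>)) = idm m" using fr[OF one_\<Gamma>] s(6) by (simp add: GL_simps)
    show "fm (?\<rho> (\<one>\<^bsub>GG\<^esub>)) \<noteq> 0"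
    proof
      assume "fm (?\<rho> (\<one>\<^bsub>GG\<^esub>)) = 0"
      then have "idm m = 0" using f1 by simp
      then have "A = 0" using s(3) by (metis mult_zero_right)
      then have "\<sigma> (1\<^sub>m 2) = 0" using s(2) by (metis mult_zero_left)
      then show False using assms by (simp add: irr_def GL_simps)
    qed
    fix E assume E: "intw (\<lambda>g. fm (?\<rho> g)) (\<lambda>g. fm (?\<rho> g)) E \<and> E * E = E"
    have Em: "E * idm m = E" "idm m * E = E" using E f1 by (auto simp: intw_def)
    have Ec: "?\<tau> g * E = E * ?\<tau> g" if "g \<in> \<Gamma>" for g using E fr[OF that] that by (auto simp: intw_def)
    have EmX: "E * (idm m * X) = E * X" for X using Em by (simp add: mult.assoc[symmetric])
    have "intw \<sigma> \<sigma> (A * E * B)" unfolding intw_def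
    proof (intro conjI ballI)
      show "A * E * B * \<sigma> \<one>\<^bsub>GG\<^esub> = A * E * B" "\<sigma> \<one>\<^bsub>GG\<^esub> * (A * E * B) = A * E * B"
        using oA by (simp_all add: GL_simps mult.assoc) (simp add: mult.assoc[symmetric] oA)
      fix g assume "g \<in> carrier GG"
      then have g: "g \<in> \<Gamma>" by simp
      have "A * (?\<tau> g * E) * B = A * (E * ?\<tau> g) * B" using Ec[OF g] by simp
      then show "\<sigma> g * (A * E * B) = A * E * B * \<sigma> g"
        by (simp add: mult.assoc BAX s(2) o[OF g]) (simp add: mult.assoc[symmetric] o[OF g])
    qed
    moreover have "(A * E * B) * (A * E * B) = A * E * B"
      using E by (simp add: mult.assoc BAX EmX) (simp add: mult.assoc[symmetric])
    ultimately have "A * E * B = 0 \<or> A * E * B = \<sigma> (1\<^sub>m 2)" using assms by (simp add: irr_def GL_simps)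
    moreover have "B * (A * E * B) * A = E" by (simp add: mult.assoc BAX s(1) Em)
    ultimately have "E = 0 \<or> E = B * \<sigma> (1\<^sub>m 2) * A" by (metis mult_zero_left mult_zero_right)
    then show "E = 0 \<or> E = fm (?\<rho> \<one>\<^bsub>GG\<^esub>)" unfolding f1 s(6) .
  qed
  then show ?thesis using irreducible_rep_iff[OF r] cr s(7) by (intro exI[of _ m] exI[of _ ?\<rho>]) auto
qed

lemma Irr_eq: "Irr \<Gamma> = IrrC"
proof
  show "Irr \<Gamma> \<subseteq> IrrC"
  proof
    fix \<phi> assume "\<phi> \<in> Irr \<Gamma>"
    then obtain k \<rho> where r: "irreducible_rep \<Gamma> k \<rho>" "\<phi> = character \<Gamma> \<rho>" by (auto simp: Irr_def)
    then have rr: "\<rho> \<in> reps \<Gamma> k" by (simp add: irreducible_rep_def)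
    have "irr (\<lambda>g. fm (\<rho> g))" using irreducible_rep_iff[OF rr] r by simp
    moreover have "\<phi> = restrict (chr (\<lambda>g. fm (\<rho> g))) (carrier GG)"
      using reps_rep(3)[OF rr] by (auto simp: r(2) character_def intro!: restrict_ext)
    ultimately show "\<phi> \<in> IrrC" unfolding IrrC_def by blast
  qed
  show "IrrC \<subseteq> Irr \<Gamma>"
  proof
    fix \<phi> assume "\<phi> \<in> IrrC"
    then obtain \<sigma> where s: "irr \<sigma>" "\<phi> = restrict (chr \<sigma>) (carrier GG)" by (auto simp: IrrC_def)
    obtain k \<rho> where "irreducible_rep \<Gamma> k \<rho>" "\<forall>g\<in>\<Gamma>. character \<Gamma> \<rho> g = chr \<sigma> g" using irr_irreducible[OF s(1)] by blast
    moreover from this have "\<phi> = character \<Gamma> \<rho>" by (intro ext) (auto simp: s(2) character_def)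
    ultimately show "\<phi> \<in> Irr \<Gamma>" unfolding Irr_def by blast
  qed
qed

lemma char_degree_eq: assumes "\<phi> \<in> IrrC" shows "char_degree \<Gamma> \<phi> = dg \<phi>"
proof -
  have d: "k = dg \<phi>" if "irreducible_rep \<Gamma> k \<rho>" "character \<Gamma> \<rho> = \<phi>" for k \<rho>
  proof -
    have rr: "\<rho> \<in> reps \<Gamma> k" using that by (simp add: irreducible_rep_def)
    have "\<phi> (1\<^sub>m 2) = of_nat k" using reps_rep(4)[OF rr one_\<Gamma>] reps_rep(2)[OF rr] that(2) by (simp add: chr_def tr_idm)
    then have "of_nat (dg \<phi>) = (of_nat k :: complex)" using dg(1)[OF assms] by (simp add: GL_simps)
    then show ?thesis by simp
  qed
  obtain k \<rho> where k: "irreducible_rep \<Gamma> k \<rho>" "character \<Gamma> \<rho> = \<phi>" using assms unfolding Irr_eq[symmetric] Irr_def by blast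
  show ?thesis unfolding char_degree_def
    by (rule the_equality) (use d k in blast)+
qed

end

section \<open>Weights\<close>

context mckay
begin

lemma triv_char_eq: "triv_char \<Gamma> = triv" by (simp add: triv_char_def triv_def)

lemma std_char_eq: "g \<in> \<Gamma> \<Longrightarrow> std_char \<Gamma> g = st g"
  using \<Gamma>_mat[of g] by (simp add: std_char_def character_def st_def mat_trace_def numeral_2_eq_2 m11_def m22_def)

lemma char_inner_eq: assumes "\<psi> \<in> IrrC" shows "char_inner \<Gamma> \<phi> \<psi> = inner \<phi> \<psi>"
  using inner_cnj[OF assms] by (simp add: char_inner_def)

lemma mckay_mult_eq: assumes "\<chi> \<in> IrrC" "\<xi> \<in> IrrC" shows "mckay_mult \<Gamma> \<chi> \<xi> = mi \<chi> \<xi>"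
proof -
  have "char_inner \<Gamma> (\<lambda>g\<in>\<Gamma>. \<chi> g * std_char \<Gamma> g) \<xi> = mm \<chi> \<xi>"
    unfolding char_inner_eq[OF assms(2)] mm_def by (rule inner_cong) (simp_all add: std_char_eq)
  then have "char_inner \<Gamma> (\<lambda>g\<in>\<Gamma>. \<chi> g * std_char \<Gamma> g) \<xi> = of_int (mi \<chi> \<xi>)" using mi(1)[OF assms] by simp
  then show ?thesis unfolding mckay_mult_def by (simp only: of_int_eq_iff the_eq_trivial)
qed

lemma root_lattice_eq: "root_lattice \<Gamma> = extensional IrrC"
  by (auto simp: root_lattice_def Irr_eq PiE_def)

lemma lattice_size_eq: "lattice_size \<Gamma> d = sz d"
  unfolding lattice_size_def sz_def Irr_eq by (intro sum.cong) (simp_all add: char_degree_eq)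

lemma null_root_multiple_eq: "null_root_multiple \<Gamma> r = nul r"
  unfolding null_root_multiple_def nul_def Irr_eq by (intro restrict_ext) (simp add: char_degree_eq)

lemma nul_ext: "nul r \<in> extensional IrrC" by (simp add: nul_def)

lemma simple_reflection_eq: assumes "\<chi> \<in> IrrC" "d \<in> extensional IrrC"
  shows "simple_reflection \<Gamma> \<chi> d = refl \<chi> d"
proof -
  have "Bv \<chi> d = (\<Sum>\<psi>\<in>IrrC. (if \<psi> = \<chi> then 2 * d \<chi> else 0) - mi \<chi> \<psi> * d \<psi>)"
    unfolding Bv_def ca_def by (intro sum.cong) (auto simp: left_diff_distrib)
  then have "Bv \<chi> d = 2 * d \<chi> - (\<Sum>\<psi>\<in>IrrC. mi \<chi> \<psi> * d \<psi>)"
    using assms finite_IrrC by (simp add: sum_subtractf sum.delta)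
  moreover have "(\<Sum>\<xi>\<in>Irr \<Gamma>. mckay_mult \<Gamma> \<chi> \<xi> * d \<xi>) = (\<Sum>\<psi>\<in>IrrC. mi \<chi> \<psi> * d \<psi>)"
    unfolding Irr_eq by (intro sum.cong) (simp_all add: mckay_mult_eq assms)
  ultimately have "(\<Sum>\<xi>\<in>Irr \<Gamma>. mckay_mult \<Gamma> \<chi> \<xi> * d \<xi>) - d \<chi> + eps \<chi> = d \<chi> + cf \<chi> d" by (simp add: cf_def)
  moreover have "simple_reflection \<Gamma> \<chi> d = d(\<chi> := (\<Sum>\<xi>\<in>Irr \<Gamma>. mckay_mult \<Gamma> \<chi> \<xi> * d \<xi>) - d \<chi> + eps \<chi>)"
    using assms(2) unfolding simple_reflection_def root_lattice_eq eps_def triv_char_eq by (simp only: restrict_apply')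
  ultimately show ?thesis by (simp only: refl_def)
qed

lemma refl_ext: "\<chi> \<in> IrrC \<Longrightarrow> d \<in> extensional IrrC \<Longrightarrow> refl \<chi> d \<in> extensional IrrC"
  by (auto simp: refl_def extensional_def)

lemma simple_reflection_Bij: assumes "\<chi> \<in> IrrC"
  shows "simple_reflection \<Gamma> \<chi> \<in> Bij (root_lattice \<Gamma>)"
proof -
  have "bij_betw (simple_reflection \<Gamma> \<chi>) (root_lattice \<Gamma>) (root_lattice \<Gamma>)"
    by (rule bij_betwI[where g = "simple_reflection \<Gamma> \<chi>"])
      (auto simp: root_lattice_eq simple_reflection_eq[OF assms] refl_ext[OF assms] refl_refl[OF assms])
  moreover have "simple_reflection \<Gamma> \<chi> \<in> extensional (root_lattice \<Gamma>)" by (simp add: simple_reflection_def)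
  ultimately show ?thesis by (simp add: Bij_def)
qed

abbreviation "BG \<equiv> BijGroup (root_lattice \<Gamma>)"

lemma simple_reflection_invol: assumes "\<chi> \<in> IrrC"
  shows "inv\<^bsub>BG\<^esub> (simple_reflection \<Gamma> \<chi>) = simple_reflection \<Gamma> \<chi>"
proof (rule group.inv_equality[OF group_BijGroup])
  have "compose (root_lattice \<Gamma>) (simple_reflection \<Gamma> \<chi>) (simple_reflection \<Gamma> \<chi>) = (\<lambda>x\<in>root_lattice \<Gamma>. x)"
    by (rule ext) (auto simp: compose_def root_lattice_eq simple_reflection_eq[OF assms] refl_ext[OF assms] refl_refl[OF assms])
  then show "simple_reflection \<Gamma> \<chi> \<otimes>\<^bsub>BG\<^esub> simple_reflection \<Gamma> \<chi> = \<one>\<^bsub>BG\<^esub>"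
    using simple_reflection_Bij[OF assms] by (simp add: BijGroup_def)
qed (use simple_reflection_Bij[OF assms] in \<open>auto simp: BijGroup_def\<close>)

lemma weyl_group_reach: assumes "w \<in> affine_weyl_group \<Gamma>"
  shows "w \<in> Bij (root_lattice \<Gamma>) \<and> (\<forall>d \<in> extensional IrrC. reach d (w d))"
  using assms unfolding affine_weyl_group_def
proof (induction rule: generate.induct)
  case one
  have one: "\<one>\<^bsub>BG\<^esub> = (\<lambda>x\<in>root_lattice \<Gamma>. x)" by (simp add: BijGroup_def)
  show ?case unfolding one
  proof (intro conjI ballI)
    show "(\<lambda>x\<in>root_lattice \<Gamma>. x) \<in> Bij (root_lattice \<Gamma>)" by (rule id_Bij)
    show "reach d ((\<lambda>x\<in>root_lattice \<Gamma>. x) d)" if "d \<in> extensional IrrC" for d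
      using that by (simp add: root_lattice_eq reach.start)
  qed
next
  case (incl h)
  then obtain \<chi> where c: "\<chi> \<in> IrrC" "h = simple_reflection \<Gamma> \<chi>" by (auto simp: Irr_eq)
  then show ?case using simple_reflection_Bij[OF c(1)] by (auto simp: simple_reflection_eq intro: reach.intros)
next
  case (inv h)
  then obtain \<chi> where c: "\<chi> \<in> IrrC" "h = simple_reflection \<Gamma> \<chi>" by (auto simp: Irr_eq)
  then show ?case using simple_reflection_Bij[OF c(1)]
    by (auto simp: simple_reflection_invol simple_reflection_eq intro: reach.intros)
next
  case (eng h1 h2)
  have eq: "h1 \<otimes>\<^bsub>BG\<^esub> h2 = compose (root_lattice \<Gamma>) h1 h2" using eng by (simp add: BijGroup_def)
  have "reach d (h1 (h2 d))" if d: "d \<in> extensional IrrC" for d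
  proof -
    have "reach d (h2 d)" using eng d by simp
    moreover have "h2 d \<in> extensional IrrC" using reach_ext[OF \<open>reach d (h2 d)\<close> d] .
    ultimately show ?thesis using eng reach_trans by blast
  qed
  moreover have "compose (root_lattice \<Gamma>) h1 h2 \<in> Bij (root_lattice \<Gamma>)" using compose_Bij eng by blast
  ultimately show ?case unfolding eq by (simp add: root_lattice_eq compose_eq)
qed

lemma weyl_orbit_iff: assumes d: "d \<in> extensional IrrC"
  shows "e \<in> weyl_orbit \<Gamma> d \<longleftrightarrow> reach d e"
proof
  assume "e \<in> weyl_orbit \<Gamma> d"
  then show "reach d e" using weyl_group_reach d by (auto simp: weyl_orbit_def)
next
  assume "reach d e"
  then show "e \<in> weyl_orbit \<Gamma> d"
  proof (induction rule: reach.induct)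
    case start
    have "\<one>\<^bsub>BG\<^esub> \<in> affine_weyl_group \<Gamma>" unfolding affine_weyl_group_def by (rule generate.one)
    moreover have "d = \<one>\<^bsub>BG\<^esub> d" using d by (simp add: BijGroup_def root_lattice_eq)
    ultimately show ?case unfolding weyl_orbit_def image_iff by blast
  next
    case (step e \<phi>)
    then obtain w where w: "w \<in> affine_weyl_group \<Gamma>" "e = w d" by (auto simp: weyl_orbit_def)
    have s: "simple_reflection \<Gamma> \<phi> \<in> affine_weyl_group \<Gamma>" unfolding affine_weyl_group_def
      using step by (intro generate.incl) (simp add: Irr_eq)
    have "simple_reflection \<Gamma> \<phi> \<otimes>\<^bsub>BG\<^esub> w \<in> affine_weyl_group \<Gamma>"
      using s w(1) unfolding affine_weyl_group_def by (rule generate.eng)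
    moreover have "refl \<phi> e = (simple_reflection \<Gamma> \<phi> \<otimes>\<^bsub>BG\<^esub> w) d"
    proof -
      have "(simple_reflection \<Gamma> \<phi> \<otimes>\<^bsub>BG\<^esub> w) d = simple_reflection \<Gamma> \<phi> (w d)"
        using weyl_group_reach[OF w(1)] simple_reflection_Bij[OF step(2)] d by (simp add: BijGroup_def compose_def root_lattice_eq)
      then show ?thesis using simple_reflection_eq[OF step(2)] reach_ext[OF step(1) d] w(2) by simp
    qed
    ultimately show ?case unfolding weyl_orbit_def image_iff by blast
  qed
qed

text \<open>This makes the description in \<open>wt\<close> a proper one: \<open>reach_nul\<close>
  gives existence, and r is unique because \<open>q2\<close> equals 2r along the orbit.\<close>

lemma wt_ex: assumes d: "d \<in> extensional IrrC" shows "reach (nul (wt \<Gamma> d)) d"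
proof -
  obtain r where "reach d (nul r)" using reach_nul[OF d] by blast
  then have r: "reach (nul r) d" by (rule reach_sym)
  have u: "r' = r" if "reach (nul r') d" for r' using reach_q2[OF that] reach_q2[OF r] by (simp add: q2_nul)
  have "wt \<Gamma> d = r" unfolding wt_def null_root_multiple_eq weyl_orbit_iff[OF nul_ext] using r u by blast
  then show ?thesis using r by simp
qed

lemma CM_wt: assumes "d \<in> extensional IrrC" shows "CM d (\<lambda>\<phi>. of_nat (dg \<phi>)) \<longleftrightarrow> wt \<Gamma> d \<ge> 0"
  by (rule CM_iff[OF wt_ex[OF assms]])

lemma type_of_character:
  assumes "rep \<sigma>" "\<And>g. g \<in> \<Gamma> \<Longrightarrow> chr \<sigma> g = (\<Sum>\<chi>\<in>IrrC. of_int (d \<chi>) * \<chi> g)"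
  shows "has_type \<sigma> d"
  unfolding has_type_def
proof
  fix \<phi> assume p: "\<phi> \<in> IrrC"
  have "inner (chr \<sigma>) \<phi> = inner (ch d) \<phi>" by (rule inner_cong) (simp_all add: assms(2) ch_def)
  then show "inner (chr \<sigma>) \<phi> = of_int (d \<phi>)" using inner_ch[OF p] by simp
qed

lemma character_of_type:
  assumes "rep \<sigma>" "has_type \<sigma> d" "g \<in> \<Gamma>"
  shows "chr \<sigma> g = (\<Sum>\<chi>\<in>IrrC. of_int (d \<chi>) * \<chi> g)"
  using chr_expand[OF assms(1), of g] assms by (simp add: has_type_def cong: sum.cong)

lemma type_size: assumes "rep \<sigma>" "has_type \<sigma> d" "\<sigma> (1\<^sub>m 2) = idm k" shows "sz d = int k"
proof -
  have "of_int (sz d) = chr \<sigma> (1\<^sub>m 2)"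
    using sz_char[of d] character_of_type[OF assms(1,2) one_\<Gamma>] by (simp add: ch_def GL_simps)
  also have "\<dots> = of_int (int k)" by (simp add: chr_def assms(3) tr_idm)
  finally show ?thesis by (simp only: of_int_eq_iff)
qed

end

section \<open>Semistability\<close>

lemma poly_sum: "(\<And>i. i \<in> A \<Longrightarrow> f i \<in> poly_functions n) \<Longrightarrow> (\<lambda>x. \<Sum>i\<in>A. f i x) \<in> poly_functions n"
proof (induction A rule: infinite_finite_induct)
  case (insert a A)
  then show ?case using poly_functions.add[of "f a" n "\<lambda>x. \<Sum>i\<in>A. f i x"] by simp
qed (simp_all add: poly_functions.const)

lemma poly_prod: "(\<And>i. i \<in> A \<Longrightarrow> f i \<in> poly_functions n) \<Longrightarrow> (\<lambda>x. \<Prod>i\<in>A. f i x) \<in> poly_functions n"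
proof (induction A rule: infinite_finite_induct)
  case (insert a A)
  then show ?case using poly_functions.mult[of "f a" n "\<lambda>x. \<Prod>i\<in>A. f i x"] by simp
qed (simp_all add: poly_functions.const)

lemma poly_det: assumes "\<And>i j. i < n \<Longrightarrow> j < n \<Longrightarrow> f i j \<in> poly_functions n"
  shows "(\<lambda>x. det (mat n n (\<lambda>(i, j). f i j x))) \<in> poly_functions n"
proof -
  have "det (mat n n (\<lambda>(i, j). f i j x)) = (\<Sum>p\<in>{p. p permutes {0..<n}}. signof p * (\<Prod>i\<in>{0..<n}. f i (p i) x))" for x
  proof -
    have "(\<Prod>i\<in>{0..<n}. mat n n (\<lambda>(i, j). f i j x) $$ (i, p i)) = (\<Prod>i\<in>{0..<n}. f i (p i) x)"
      if "p permutes {0..<n}" for p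
      using permutes_in_image[OF that] by (intro prod.cong) auto
    then show ?thesis using det_def'[of "mat n n (\<lambda>(i, j). f i j x)" n] by simp
  qed
  moreover have "(\<lambda>x. \<Sum>p\<in>{p. p permutes {0..<n}}. signof p * (\<Prod>i\<in>{0..<n}. f i (p i) x)) \<in> poly_functions n"
    using permutes_in_image
    by (intro poly_sum poly_functions.mult poly_functions.const poly_prod assms) fastforce+
  ultimately show ?thesis by simp
qed

lemma poly_isCont:
  assumes "f \<in> poly_functions n"
    and "\<And>i j. i < n \<Longrightarrow> j < n \<Longrightarrow> isCont (\<lambda>s. A s $$ (i, j)) z"
    and "\<And>i j. i < n \<Longrightarrow> j < n \<Longrightarrow> isCont (\<lambda>s. B s $$ (i, j)) z"
    and "\<And>i. i < n \<Longrightarrow> isCont (\<lambda>s. V s $$ (i, 0)) z" and "\<And>j. j < n \<Longrightarrow> isCont (\<lambda>s. W s $$ (0, j)) z"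
  shows "isCont (\<lambda>s. f (A s, B s, V s, W s)) (z :: complex)"
  using assms(1) by (induction rule: poly_functions.induct) (use assms(2-5) in auto)

lemma GL_inv_eq: assumes "g \<in> carrier_mat n n" "h \<in> carrier_mat n n" "g * h = 1\<^sub>m n" "h * g = 1\<^sub>m n"
  shows "g \<in> carrier (GL n)" "inv\<^bsub>GL n\<^esub> g = h"
proof -
  show g: "g \<in> carrier (GL n)" by (rule GL_I[OF assms(1,2,4,3)])
  have h: "h \<in> carrier (GL n)" by (rule GL_I[OF assms(2,1,3,4)])
  show "inv\<^bsub>GL n\<^esub> g = h" by (rule group.inv_equality[OF GL_group _ g h]) (simp add: GL_simps assms)
qed

text \<open>The kernel of \<open>Z\<close> is stable under \<open>\<alpha>\<close> and \<open>\<beta>\<close> and contains the image of \<open>v1\<close>. Scaling a complement of it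
  by \<open>1 / s\<close> moves the point along a curve with a limit for \<open>s \<longlonglongrightarrow> 0\<close>, where every semi-invariant
  of positive weight is forced to vanish.\<close>

lemma semistable_centralizer:
  assumes x: "(\<alpha>, \<beta>, v1, v2) \<in> jordan_space n" and ss: "semistable n 1 (\<alpha>, \<beta>, v1, v2)"
    and Z: "bd Z n" "Z * fm \<alpha> = fm \<alpha> * Z" "Z * fm \<beta> = fm \<beta> * Z" "Z * fm v1 = 0"
  shows "Z = 0"
proof (rule ccontr)
  assume Z0: "Z \<noteq> 0"
  have c: "\<alpha> \<in> carrier_mat n n" "\<beta> \<in> carrier_mat n n" "v1 \<in> carrier_mat n 1" "v2 \<in> carrier_mat 1 n"
    using x by (auto simp: jordan_space_def)
  obtain m k f where mk: "m \<ge> (1::nat)" "of_int k = of_nat m * (1::rat)" and si: "semi_invariant n k f" and f0: "f (\<alpha>, \<beta>, v1, v2) \<noteq> 0"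
    using ss unfolding semistable_def by blast
  have "of_int k = (of_int (int m) :: rat)" using mk by simp
  then have k: "k = int m" by (simp only: of_int_eq_iff)
  have fp: "f \<in> poly_functions n"
    and fi: "\<And>g y. g \<in> carrier (GL n) \<Longrightarrow> y \<in> jordan_space n \<Longrightarrow> f (gl_act n g y) = (det g powi k) * f y"
    using si by (auto simp: semi_invariant_def)
  obtain S' where S': "Z * S' * Z = Z" using quasi_inverse by blast
  have ZI: "idm n * Z = Z" "Z * idm n = Z" using Z(1) by (auto simp: bd_idm_iff)
  define S where "S = idm n * S' * idm n"
  have S: "Z * S * Z = Z"
  proof -
    have "Z * S * Z = (Z * idm n) * S' * (idm n * Z)" by (simp add: S_def mult.assoc)
    then show ?thesis using S' by (simp add: ZI)
  qed
  \<comment> \<open>\<open>Q\<close> has the same kernel as \<open>Z\<close>, so \<open>P\<close>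
    projects onto that kernel, which is stable under \<alpha> and \<beta> because \<open>Z\<close>
    commutes with them.\<close>
  define Q where "Q = S * Z"
  define P where "P = idm n - Q"
  have II: "idm n * idm n = idm n" by (simp add: idm_left[OF bd_idm])
  have IS: "idm n * S = S" by (simp add: S_def mult.assoc[symmetric] II)
  have IQ: "idm n * Q = Q" "Q * idm n = Q" by (simp_all add: Q_def mult.assoc ZI) (simp add: mult.assoc[symmetric] IS)
  have QQ: "Q * Q = Q" using S by (simp add: Q_def mult.assoc)
  have PQ: "P * Q = 0" "Q * P = 0" "P * P = P" by (simp_all add: P_def left_diff_distrib right_diff_distrib QQ IQ II)
  have IP: "idm n * P = P" "P * idm n = P" by (simp_all add: P_def left_diff_distrib right_diff_distrib IQ II)
  have Q0: "Q \<noteq> 0" using S Z0 by (metis Q_def mult.assoc mult_zero_right)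
  have ZP: "Z * P = 0" using S by (simp add: P_def Q_def right_diff_distrib ZI mult.assoc)
  have QaP: "Q * fm \<alpha> * P = 0" "Q * fm \<beta> * P = 0"
  proof -
    have "Q * fm \<alpha> * P = S * (Z * fm \<alpha>) * P" "Q * fm \<beta> * P = S * (Z * fm \<beta>) * P" by (simp_all add: Q_def mult.assoc)
    then show "Q * fm \<alpha> * P = 0" "Q * fm \<beta> * P = 0" unfolding Z(2,3) by (simp_all add: mult.assoc ZP)
  qed
  have Qv: "Q * fm v1 = 0" by (simp add: Q_def mult.assoc Z(4))
  have Iv: "idm n * fm v1 = fm v1" by (rule fm_idm_left[OF c(3)])
  \<comment> \<open>The conjugate of a by P + Q / s. Its remaining component Q a P / s is absent
    because the kernel of \<open>Z\<close> is stable, so the curve extends to s = 0.\<close>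
  define cur where "cur a s = P * a * P + Q * a * Q + s \<star> (P * a * Q)" for a and s :: complex
  define A where "A s = mf n n (cur (fm \<alpha>) s)" for s
  define B where "B s = mf n n (cur (fm \<beta>) s)" for s
  define W where "W s = mf 1 n (fm v2 * P + s \<star> (fm v2 * Q))" for s
  define h where "h s = mf n n (P + s \<star> Q)" for s
  have fh: "fm (h s) = P + s \<star> Q" for s by (simp add: h_def fm_mf distrib_left distrib_right IP IQ)
  have hc: "h s \<in> carrier_mat n n" for s by (simp add: h_def)
  have hh: "h s * h (1 / s) = 1\<^sub>m n" if "s \<noteq> 0" for s
  proof -
    have "h s * h (1 / s) = mf n n ((P + s \<star> Q) * (P + (1 / s) \<star> Q))"
      unfolding h_def by (rule mf_mult[symmetric]) (simp add: distrib_left IP IQ)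
    also have "(P + s \<star> Q) * (P + (1 / s) \<star> Q) = idm n" using that by (simp add: distrib_left distrib_right PQ QQ) (simp add: P_def)
    finally show ?thesis using mf_fm[of "1\<^sub>m n" n n] by (simp add: fm_one)
  qed
  have key: "f (\<alpha>, \<beta>, v1, v2) = det (h s) ^ m * f (A s, B s, v1, W s)" if s: "s \<noteq> 0" for s
  proof -
    define g where "g = h (1 / s)"
    have gc: "g \<in> carrier_mat n n" by (simp add: g_def hc)
    have gh: "g * h s = 1\<^sub>m n" "h s * g = 1\<^sub>m n" using hh[of "1 / s"] hh[of s] s by (simp_all add: g_def)
    note gG = GL_inv_eq[OF gc hc gh]
    have cc: "g * a * h s = mf n n (cur (fm a) s)" if a: "a \<in> carrier_mat n n" and qp: "Q * fm a * P = 0" for a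
    proof (rule fm_inj)
      show "g * a * h s \<in> carrier_mat n n" using gc a hc by (metis mult_carrier_mat)
      have "fm (g * a * h s) = fm g * fm a * fm (h s)"
        using fm_mult[OF mult_carrier_mat[OF gc a] hc, of s] fm_mult[OF gc a] by simp
      also have "\<dots> = cur (fm a) s" using s qp
        by (simp add: g_def fh cur_def distrib_left distrib_right mult.assoc sc_add add.commute)
      also have "\<dots> = fm (mf n n (cur (fm a) s))"
        by (simp add: fm_mf cur_def distrib_left distrib_right mult.assoc IP IQ) (simp add: mult.assoc[symmetric] IP IQ)
      finally show "fm (g * a * h s) = fm (mf n n (cur (fm a) s))" .
    qed simp
    have gv: "g * v1 = v1"
    proof (rule fm_inj)
      show "g * v1 \<in> carrier_mat n 1" using gc c(3) by simp
      have "fm (g * v1) = (P + (1 / s) \<star> Q) * fm v1" using fm_mult[OF gc c(3)] by (simp add: g_def fh)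
      also have "\<dots> = P * fm v1" by (simp add: distrib_right Qv)
      also have "\<dots> = fm v1" by (simp add: P_def left_diff_distrib Qv Iv)
      finally show "fm (g * v1) = fm v1" .
    qed (rule c(3))
    have vh: "v2 * h s = W s"
    proof (rule fm_inj)
      show "v2 * h s \<in> carrier_mat 1 n" using c(4) hc by simp
      show "fm (v2 * h s) = fm (W s)" using fm_idm_left[OF c(4)]
        by (simp add: fm_mult[OF c(4) hc] fh W_def fm_mf distrib_left distrib_right mult.assoc IP IQ) (simp add: mult.assoc[symmetric])
    qed (simp add: W_def)
    have "f (A s, B s, v1, W s) = det g ^ m * f (\<alpha>, \<beta>, v1, v2)"
      using fi[OF gG(1) x] by (simp add: gG(2) cc[OF c(1) QaP(1)] cc[OF c(2) QaP(2)] gv vh A_def B_def k)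
    moreover have "det (h s) * det g = 1" using det_mult[OF hc gc, of s] gh(2) by simp
    ultimately show ?thesis by (simp add: power_mult_distrib[symmetric] mult.assoc[symmetric])
  qed
  \<comment> \<open>By \<open>key\<close> this function is constant off 0, and it is continuous at
    0. There the determinant factor vanishes, since \<open>Q\<close> is nonzero and h 0 is
    \<open>P\<close>; as m \<ge> 1, so does F.\<close>
  define F where "F s = det (h s) ^ m * f (A s, B s, v1, W s)" for s
  have "isCont (\<lambda>s. f (A s, B s, v1, W s)) 0"
    by (rule poly_isCont[OF fp]) (auto simp: A_def B_def W_def mf_def cur_def intro!: continuous_intros)
  moreover have "isCont (\<lambda>s. det (h s)) 0"
  proof -
    have "isCont (\<lambda>s. h s $$ (i, p i)) 0" if "p permutes {0..<n}" "i < n" for p i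
      using permutes_in_image[OF that(1), of i] that(2) by (auto simp: h_def mf_def intro!: continuous_intros)
    then show ?thesis unfolding det_def'[OF hc] by (intro continuous_intros) simp_all
  qed
  ultimately have F: "isCont F 0" unfolding F_def[abs_def] by (intro continuous_intros)
  have "F \<midarrow>0\<rightarrow> f (\<alpha>, \<beta>, v1, v2)"
    using key by (intro tendsto_eventually) (auto simp: eventually_at_filter F_def)
  then have "F 0 = f (\<alpha>, \<beta>, v1, v2)" using F by (metis LIM_unique isCont_def)
  moreover have "det (h 0) = 0"
  proof (rule ccontr)
    assume "det (h 0) \<noteq> 0"
    then have "h 0 \<in> Units (ring_mat TYPE(complex) n ())" by (rule det_non_zero_imp_unit[OF hc])
    then obtain y where y: "y \<in> carrier_mat n n" "y * h 0 = 1\<^sub>m n" by (auto simp: Units_def ring_mat_def)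
    have "fm y * P = idm n" using fm_mult[OF y(1) hc, of 0] y(2) fh[of 0] by (simp add: fm_one)
    then have "Q = fm y * P * Q" using IQ by simp
    then show False using Q0 by (simp add: mult.assoc PQ)
  qed
  ultimately show False using f0 mk(1) by (simp add: F_def zero_power)
qed

section \<open>Determinants of words as semi-invariants\<close>

primrec word_entry :: "nat \<Rightarrow> bool list \<Rightarrow> nat \<Rightarrow> jordan_point \<Rightarrow> complex" where
  "word_entry n [] = (\<lambda>i (\<alpha>, \<beta>, v1, v2). v1 $$ (i, 0))"
| "word_entry n (c # u) = (\<lambda>i x. \<Sum>l<n. (case x of (\<alpha>, \<beta>, v1, v2) \<Rightarrow> if c then \<alpha> $$ (i, l) else \<beta> $$ (i, l)) * word_entry n u l x)"

lemma poly_word: "i < n \<Longrightarrow> word_entry n u i \<in> poly_functions n"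
proof (induction u arbitrary: i)
  case Nil
  then show ?case using poly_functions.coord_v1 by simp
next
  case (Cons c u)
  have ent: "(\<lambda>x. case x of (\<alpha>, \<beta>, v1, v2) \<Rightarrow> if c then \<alpha> $$ (i, l) else \<beta> $$ (i, l)) \<in> poly_functions n" if "l < n" for l
    using poly_functions.coord_alpha[OF Cons.prems that] poly_functions.coord_beta[OF Cons.prems that] by (cases c) (simp_all only: if_True if_False)
  then show ?case unfolding word_entry.simps
    by (intro poly_sum poly_functions.mult Cons.IH ent) simp_all
qed

lemma word_entry_wact:
  assumes "(\<alpha>, \<beta>, v1, v2) \<in> jordan_space n" "i < n"
  shows "word_entry n u i (\<alpha>, \<beta>, v1, v2) = ent (wact (fm \<alpha>) (fm \<beta>) u (fm v1)) i 0"
  using assms(2)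
proof (induction u arbitrary: i)
  case Nil
  then show ?case using assms(1) by (auto simp: jordan_space_def ent_fm)
next
  case (Cons c u)
  have c: "\<alpha> \<in> carrier_mat n n" "\<beta> \<in> carrier_mat n n" using assms(1) by (auto simp: jordan_space_def)
  have "bd (if c then fm \<alpha> else fm \<beta>) n" using c by (simp add: bd_fm)
  then have "ent (wact (fm \<alpha>) (fm \<beta>) (c # u) (fm v1)) i 0
    = (\<Sum>l<n. ent (if c then fm \<alpha> else fm \<beta>) i l * ent (wact (fm \<alpha>) (fm \<beta>) u (fm v1)) l 0)"
    unfolding wact_Cons by (rule ent_mult)
  then show ?case using Cons c by (auto simp: ent_fm intro!: sum.cong)
qed

definition words_mat :: "nat \<Rightarrow> bool list list \<Rightarrow> fmat \<Rightarrow> fmat \<Rightarrow> fmat \<Rightarrow> fmat" where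
  "words_mat n us \<alpha> \<beta> v = (\<Sum>j<n. wact \<alpha> \<beta> (us ! j) v * eu 0 j)"

text \<open>A semi-invariant of weight 1, because the action of g multiplies every word applied to
  \<open>v1\<close> by g. Entries go through \<open>word_entry\<close> to make polynomiality
  visible.\<close>

definition words_det :: "nat \<Rightarrow> bool list list \<Rightarrow> jordan_point \<Rightarrow> complex" where
  "words_det n us x = det (mat n n (\<lambda>(i, j). word_entry n (us ! j) i x))"

lemma ent_words_mat: "j < n \<Longrightarrow> ent (words_mat n us \<alpha> \<beta> v) i j = ent (wact \<alpha> \<beta> (us ! j) v) i 0"
proof -
  assume j: "j < n"
  have "ent (words_mat n us \<alpha> \<beta> v) i j = (\<Sum>l<n. if l = j then ent (wact \<alpha> \<beta> (us ! j) v) i 0 else 0)"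
    unfolding words_mat_def by (auto simp: ent_mult_eu intro!: sum.cong)
  then show ?thesis using j by (simp add: sum.delta)
qed

lemma words_det_eq: assumes "(\<alpha>, \<beta>, v1, v2) \<in> jordan_space n"
  shows "words_det n us (\<alpha>, \<beta>, v1, v2) = det (mf n n (words_mat n us (fm \<alpha>) (fm \<beta>) (fm v1)))"
  unfolding words_det_def mf_def
  by (intro arg_cong[of _ _ det] eq_matI) (auto simp: ent_words_mat word_entry_wact[OF assms])

lemma wact_conj: assumes "h * g = idm n" "idm n * \<alpha> = \<alpha>" "idm n * \<beta> = \<beta>" "idm n * v = v"
  shows "wact (g * \<alpha> * h) (g * \<beta> * h) u (g * v) = g * wact \<alpha> \<beta> u v \<and> idm n * wact \<alpha> \<beta> u v = wact \<alpha> \<beta> u v"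
proof (induction u)
  case (Cons c u)
  have "h * (g * X) = idm n * X" for X by (simp add: mult.assoc[symmetric] assms(1))
  moreover have "idm n * (\<alpha> * X) = \<alpha> * X" "idm n * (\<beta> * X) = \<beta> * X" for X by (simp_all add: mult.assoc[symmetric] assms)
  ultimately show ?case using Cons by (simp add: mult.assoc)
qed (simp add: assms)

lemma words_det_semi_invariant: "semi_invariant n 1 (words_det n us)"
  unfolding semi_invariant_def
proof (intro conjI ballI)
  show "words_det n us \<in> poly_functions n" unfolding words_det_def[abs_def] by (intro poly_det poly_word)
  fix g y assume g: "g \<in> carrier (GL n)" and y: "y \<in> jordan_space n"
  obtain \<alpha> \<beta> v1 v2 where ye: "y = (\<alpha>, \<beta>, v1, v2)" by (cases y) auto
  have c: "\<alpha> \<in> carrier_mat n n" "\<beta> \<in> carrier_mat n n" "v1 \<in> carrier_mat n 1" "v2 \<in> carrier_mat 1 n"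
    using y by (auto simp: jordan_space_def ye)
  define h where "h = inv\<^bsub>GL n\<^esub> g"
  have gc: "g \<in> carrier_mat n n" by (rule GL_D[OF g])
  have hc: "h \<in> carrier_mat n n" and hg: "h * g = 1\<^sub>m n" using GL_inv[OF g] by (auto simp: h_def)
  have fhg: "fm h * fm g = idm n" using fm_mult[OF hc gc] hg by (simp add: fm_one)
  have gy: "gl_act n g y = (g * \<alpha> * h, g * \<beta> * h, g * v1, v2 * h)" by (simp add: ye h_def)
  have js: "(g * \<alpha> * h, g * \<beta> * h, g * v1, v2 * h) \<in> jordan_space n" using c gc hc by (simp add: jordan_space_def)
  have fa: "fm (g * a * h) = fm g * fm a * fm h" if "a \<in> carrier_mat n n" for a
    using fm_mult[OF mult_carrier_mat[OF gc that] hc] fm_mult[OF gc that] by simp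
  have w: "wact (fm (g * \<alpha> * h)) (fm (g * \<beta> * h)) u (fm (g * v1)) = fm g * wact (fm \<alpha>) (fm \<beta>) u (fm v1)"
    "idm n * wact (fm \<alpha>) (fm \<beta>) u (fm v1) = wact (fm \<alpha>) (fm \<beta>) u (fm v1)" for u
    using wact_conj[OF fhg fm_idm_left[OF c(1)] fm_idm_left[OF c(2)] fm_idm_left[OF c(3)], of u]
    by (simp_all add: fa c fm_mult[OF gc c(3)])
  let ?c = "words_mat n us (fm \<alpha>) (fm \<beta>) (fm v1)"
  have "idm n * ?c = ?c" unfolding words_mat_def sum_distrib_left by (simp add: mult.assoc[symmetric] w(2))
  moreover have "words_mat n us (fm (g * \<alpha> * h)) (fm (g * \<beta> * h)) (fm (g * v1)) = fm g * ?c"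
    unfolding words_mat_def sum_distrib_left w(1) by (simp add: mult.assoc)
  ultimately have "words_det n us (gl_act n g y) = det (mf n n (fm g) * mf n n ?c)"
    unfolding gy words_det_eq[OF js] by (simp add: mf_mult)
  also have "\<dots> = det g * words_det n us y"
    using det_mult[OF gc mf_carrier[of n n ?c]] words_det_eq[of \<alpha> \<beta> v1 v2 n us] y ye mf_fm[OF gc] by simp
  finally show "words_det n us (gl_act n g y) = det g powi 1 * words_det n us y" by simp
qed

lemma cyclic_semistable:
  assumes x: "(\<alpha>, \<beta>, v1, v2) \<in> jordan_space n" and cyc: "cyclic (idm n) (fm \<alpha>) (fm \<beta>) (fm v1)"
  shows "semistable n 1 (\<alpha>, \<beta>, v1, v2)"
proof -
  have "v1 \<in> carrier_mat n 1" using x by (simp add: jordan_space_def)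
  then have "fm v1 * idm 1 = fm v1" by (rule fm_idm_right)
  then have v: "fm v1 * eu 0 0 = fm v1" by (simp add: idm_Suc)
  have id0: "idm n * wact (fm \<alpha>) (fm \<beta>) u (fm v1) = wact (fm \<alpha>) (fm \<beta>) u (fm v1)" for u
    using wact_conj[of "idm n" "idm n" n "fm \<alpha>" "fm \<beta>" "fm v1" u] x
    by (simp add: idm_left[OF bd_idm] fm_idm_left[of _ n n] fm_idm_left[of _ n 1] jordan_space_def)
  obtain us B where B: "B * words_mat n us (fm \<alpha>) (fm \<beta>) (fm v1) = idm n"
    using cyclic_basis[OF cyc v] unfolding words_mat_def by blast
  let ?c = "words_mat n us (fm \<alpha>) (fm \<beta>) (fm v1)"
  have "idm n * ?c = ?c" unfolding words_mat_def sum_distrib_left by (simp add: mult.assoc[symmetric] id0)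
  then have "mf n n B * mf n n ?c = mf n n (idm n)" using mf_mult[of n ?c n n B] B by simp
  also have "\<dots> = 1\<^sub>m n" using mf_fm[of "1\<^sub>m n" n n] by (simp add: fm_one)
  finally have "det (mf n n B) * det (mf n n ?c) = 1" using det_mult[of "mf n n B" n "mf n n ?c"] by simp
  then have "words_det n us (\<alpha>, \<beta>, v1, v2) \<noteq> 0" unfolding words_det_eq[OF x] by auto
  then show ?thesis unfolding semistable_def using words_det_semi_invariant
    by (intro exI[of _ "1::nat"] exI[of _ "1::int"] exI[of _ "words_det n us"]) auto
qed

lemma semistable_zero: "semistable n 0 x"
  unfolding semistable_def semi_invariant_def
  by (intro exI[of _ "1::nat"] exI[of _ "0::int"] exI[of _ "\<lambda>_. 1"]) (auto intro: poly_functions.const)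

section \<open>The index sets\<close>

context mckay
begin

text \<open>Multiplying by \<open>\<sigma> g\<close> cancels the two inverses in the definition of
  the index sets, the one inside \<sigma> and the one in \<open>gl_act\<close>, and leaves the
  clauses of \<open>cm\<close>.\<close>

lemma equivariant_iff:
  assumes r: "\<sigma> \<in> reps \<Gamma> n" and x: "(\<alpha>, \<beta>, v1, v2) \<in> jordan_space n" and g: "g \<in> \<Gamma>"
  shows "plane_act g (\<alpha>, \<beta>, v1, v2) = gl_act n (\<sigma> (inv\<^bsub>GL 2\<^esub> g)) (\<alpha>, \<beta>, v1, v2) \<longleftrightarrow>
    fm \<alpha> * fm (\<sigma> g) = fm (\<sigma> g) * (m11 g \<star> fm \<alpha> + m12 g \<star> fm \<beta>) \<and>
    fm \<beta> * fm (\<sigma> g) = fm (\<sigma> g) * (m21 g \<star> fm \<alpha> + m22 g \<star> fm \<beta>) \<and>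
    fm (\<sigma> g) * fm v1 = fm v1 \<and> fm v2 * fm (\<sigma> g) = fm v2"
proof -
  have c: "\<alpha> \<in> carrier_mat n n" "\<beta> \<in> carrier_mat n n" "v1 \<in> carrier_mat n 1" "v2 \<in> carrier_mat 1 n"
    using x by (auto simp: jordan_space_def)
  define i where "i = inv\<^bsub>GL 2\<^esub> g"
  have i: "i \<in> \<Gamma>" "i * g = 1\<^sub>m 2" "g * i = 1\<^sub>m 2"
    using inv_closed[of g] GG_inv[OF g] GL_inv[OF \<Gamma>_GL[OF g]] g by (auto simp: i_def)
  have sc: "\<sigma> g \<in> carrier_mat n n" "\<sigma> i \<in> carrier_mat n n" using reps_D[OF r] g i(1) by auto
  have si: "\<sigma> i * \<sigma> g = 1\<^sub>m n" "\<sigma> g * \<sigma> i = 1\<^sub>m n"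
    using reps_D(3)[OF r i(1) g] reps_D(3)[OF r g i(1)] reps_one[OF r] i by auto
  have inv: "inv\<^bsub>GL n\<^esub> (\<sigma> i) = \<sigma> g" by (rule GL_inv_eq(2)[OF sc(2,1) si])
  let ?s = "fm (\<sigma> g)" and ?t = "fm (\<sigma> i)"
  have st: "?t * ?s = idm n" "?s * ?t = idm n" using fm_mult[OF sc(2,1)] fm_mult[OF sc] si by (simp_all add: fm_one)
  have conj: "p = \<sigma> i * a * \<sigma> g \<longleftrightarrow> fm a * ?s = ?s * fm p" if "a \<in> carrier_mat n n" "p \<in> carrier_mat n n" for a p
  proof -
    have f: "fm (\<sigma> i * a * \<sigma> g) = ?t * fm a * ?s"
      using fm_mult[OF mult_carrier_mat[OF sc(2) that(1)] sc(1)] fm_mult[OF sc(2) that(1)] by simp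
    have "p = \<sigma> i * a * \<sigma> g \<longleftrightarrow> fm p = ?t * fm a * ?s"
    proof
      assume "fm p = ?t * fm a * ?s"
      then show "p = \<sigma> i * a * \<sigma> g" using fm_inj[OF that(2), of "\<sigma> i * a * \<sigma> g"] f that sc by simp
    qed (simp add: f)
    also have "\<dots> \<longleftrightarrow> fm a * ?s = ?s * fm p"
    proof
      assume "fm p = ?t * fm a * ?s"
      then have "?s * fm p = (?s * ?t) * fm a * ?s" by (simp add: mult.assoc)
      then show "fm a * ?s = ?s * fm p" using fm_idm_left[OF that(1)] by (simp add: st)
    next
      assume "fm a * ?s = ?s * fm p"
      then have "?t * fm a * ?s = (?t * ?s) * fm p" by (simp add: mult.assoc)
      then show "fm p = ?t * fm a * ?s" using fm_idm_left[OF that(2)] by (simp add: st)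
    qed
    finally show ?thesis .
  qed
  have v: "v1 = \<sigma> i * v1 \<longleftrightarrow> ?s * fm v1 = fm v1"
  proof
    assume "v1 = \<sigma> i * v1"
    then have "fm v1 = ?t * fm v1" using fm_mult[OF sc(2) c(3)] by simp
    then have "?s * fm v1 = (?s * ?t) * fm v1" by (simp add: mult.assoc)
    then show "?s * fm v1 = fm v1" using fm_idm_left[OF c(3)] by (simp add: st)
  next
    assume "?s * fm v1 = fm v1"
    then have "?t * fm v1 = (?t * ?s) * fm v1" by (simp add: mult.assoc)
    then have "fm v1 = fm (\<sigma> i * v1)" using fm_idm_left[OF c(3)] fm_mult[OF sc(2) c(3)] by (simp add: st)
    then show "v1 = \<sigma> i * v1" using fm_inj[OF c(3), of "\<sigma> i * v1"] sc(2) c(3) by simp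
  qed
  have w: "v2 = v2 * \<sigma> g \<longleftrightarrow> fm v2 * ?s = fm v2"
  proof
    assume "v2 = v2 * \<sigma> g"
    then show "fm v2 * ?s = fm v2" using fm_mult[OF c(4) sc(1)] by simp
  next
    assume "fm v2 * ?s = fm v2"
    then show "v2 = v2 * \<sigma> g" using fm_inj[OF c(4), of "v2 * \<sigma> g"] fm_mult[OF c(4) sc(1)] sc(1) c(4) by simp
  qed
  have pc: "a \<cdot>\<^sub>m \<alpha> + b \<cdot>\<^sub>m \<beta> \<in> carrier_mat n n" and pf: "fm (a \<cdot>\<^sub>m \<alpha> + b \<cdot>\<^sub>m \<beta>) = a \<star> fm \<alpha> + b \<star> fm \<beta>" for a b
    using c by (simp_all add: fm_add[of _ n n] fm_smult)
  show ?thesis unfolding i_def[symmetric] plane_act.simps gl_act.simps inv prod.inject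
      conj[OF c(1) pc] conj[OF c(2) pc] v w pf m11_def m12_def m21_def m22_def ..
qed

lemma jordan_cm:
  assumes r: "\<sigma> \<in> reps \<Gamma> n" and x: "(\<alpha>, \<beta>, v1, v2) \<in> jordan_space n"
  shows "moment_map (\<alpha>, \<beta>, v1, v2) = l \<cdot>\<^sub>m 1\<^sub>m n \<and>
      (\<forall>g\<in>\<Gamma>. plane_act g (\<alpha>, \<beta>, v1, v2) = gl_act n (\<sigma> (inv\<^bsub>GL 2\<^esub> g)) (\<alpha>, \<beta>, v1, v2))
    \<longleftrightarrow> cm (\<lambda>g. fm (\<sigma> g)) (fm \<alpha>) (fm \<beta>) (fm v1) (fm v2) (l \<star> idm n)"
proof -
  have c: "\<alpha> \<in> carrier_mat n n" "\<beta> \<in> carrier_mat n n" "v1 \<in> carrier_mat n 1" "v2 \<in> carrier_mat 1 n"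
    using x by (auto simp: jordan_space_def)
  have e0: "eu 0 0 = idm 1" by (simp add: idm_Suc)
  have mc: "moment_map (\<alpha>, \<beta>, v1, v2) \<in> carrier_mat n n" using c by (simp add: minus_carrier_mat)
  have "fm (moment_map (\<alpha>, \<beta>, v1, v2)) = fm \<alpha> * fm \<beta> - fm \<beta> * fm \<alpha> + fm v1 * fm v2"
  proof -
    have "fm (moment_map (\<alpha>, \<beta>, v1, v2)) = fm (\<alpha> * \<beta> - \<beta> * \<alpha>) + fm (v1 * v2)"
      unfolding moment_map.simps by (rule fm_add[of _ n n]) (use c in \<open>auto simp: minus_carrier_mat\<close>)
    also have "fm (\<alpha> * \<beta> - \<beta> * \<alpha>) = fm (\<alpha> * \<beta>) - fm (\<beta> * \<alpha>)" by (rule fm_minus[of _ n n]) (use c in auto)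
    finally show ?thesis by (simp add: fm_mult[OF c(1,2)] fm_mult[OF c(2,1)] fm_mult[OF c(3,4)])
  qed
  then have mom: "moment_map (\<alpha>, \<beta>, v1, v2) = l \<cdot>\<^sub>m 1\<^sub>m n \<longleftrightarrow> fm \<alpha> * fm \<beta> - fm \<beta> * fm \<alpha> + fm v1 * fm v2 = l \<star> idm n"
    using fm_inj[OF mc, of "l \<cdot>\<^sub>m 1\<^sub>m n"] by (auto simp: fm_smult fm_one)
  have eqv: "(\<forall>g\<in>\<Gamma>. plane_act g (\<alpha>, \<beta>, v1, v2) = gl_act n (\<sigma> (inv\<^bsub>GL 2\<^esub> g)) (\<alpha>, \<beta>, v1, v2)) \<longleftrightarrow>
    (\<forall>g\<in>\<Gamma>. fm \<alpha> * fm (\<sigma> g) = fm (\<sigma> g) * (m11 g \<star> fm \<alpha> + m12 g \<star> fm \<beta>) \<and>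
      fm \<beta> * fm (\<sigma> g) = fm (\<sigma> g) * (m21 g \<star> fm \<alpha> + m22 g \<star> fm \<beta>) \<and>
      fm (\<sigma> g) * fm v1 = fm v1 \<and> fm v2 * fm (\<sigma> g) = fm v2)"
    by (intro ball_cong refl equivariant_iff r x)
  note one = reps_rep(2)[OF r]
  show ?thesis
    using reps_rep(1)[OF r] fm_idm_left[OF c(1)] fm_idm_right[OF c(1)] fm_idm_left[OF c(2)] fm_idm_right[OF c(2)]
      fm_idm_left[OF c(3)] fm_idm_right[OF c(3)] fm_idm_left[OF c(4)] fm_idm_right[OF c(4)]
    unfolding cm_def e0 mom eqv GG_simps one
    by - (rule iffI; elim conjE; intro conjI; assumption)
qed

lemma cm_transport:
  assumes cm: "cm \<sigma> \<alpha> \<beta> v w C" and AB: "B * A = idm m" "A * B = \<sigma> (1\<^sub>m 2)" "A * idm m = A" "idm m * B = B"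
    and r: "rep (\<lambda>g. B * \<sigma> g * A)" "B * \<sigma> (1\<^sub>m 2) * A = idm m"
  shows "cm (\<lambda>g. B * \<sigma> g * A) (B * \<alpha> * A) (B * \<beta> * A) (B * v) (w * A) (B * C * A)"
proof -
  have rs: "rep \<sigma>" and un: "\<sigma> (1\<^sub>m 2) * \<alpha> = \<alpha>" "\<alpha> * \<sigma> (1\<^sub>m 2) = \<alpha>" "\<sigma> (1\<^sub>m 2) * \<beta> = \<beta>" "\<beta> * \<sigma> (1\<^sub>m 2) = \<beta>"
    "\<sigma> (1\<^sub>m 2) * v = v" "v * eu 0 0 = v" "w * \<sigma> (1\<^sub>m 2) = w" "eu 0 0 * w = w"
    and eqv: "\<And>g. g \<in> \<Gamma> \<Longrightarrow> \<alpha> * \<sigma> g = \<sigma> g * (m11 g \<star> \<alpha> + m12 g \<star> \<beta>)" "\<And>g. g \<in> \<Gamma> \<Longrightarrow> \<beta> * \<sigma> g = \<sigma> g * (m21 g \<star> \<alpha> + m22 g \<star> \<beta>)"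
    "\<And>g. g \<in> \<Gamma> \<Longrightarrow> \<sigma> g * v = v" "\<And>g. g \<in> \<Gamma> \<Longrightarrow> w * \<sigma> g = w"
    and C: "C = \<alpha> * \<beta> - \<beta> * \<alpha> + v * w"
    using cm by (auto simp: cm_def GL_simps)
  have AX: "A * (B * X) = \<sigma> (1\<^sub>m 2) * X" "B * (A * X) = idm m * X" "idm m * (B * X) = B * X" "A * (idm m * X) = A * X" for X
    by (simp_all add: mult.assoc[symmetric] AB)
  have uX: "\<sigma> (1\<^sub>m 2) * (\<alpha> * X) = \<alpha> * X" "\<alpha> * (\<sigma> (1\<^sub>m 2) * X) = \<alpha> * X" "\<sigma> (1\<^sub>m 2) * (\<beta> * X) = \<beta> * X" "\<beta> * (\<sigma> (1\<^sub>m 2) * X) = \<beta> * X"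
    "\<sigma> (1\<^sub>m 2) * (v * X) = v * X" "w * (\<sigma> (1\<^sub>m 2) * X) = w * X" "v * (eu 0 0 * X) = v * X" "eu 0 0 * (w * X) = w * X" for X
    by (simp_all add: mult.assoc[symmetric] un)
  have oX: "\<sigma> g * (\<sigma> (1\<^sub>m 2) * X) = \<sigma> g * X" "\<sigma> (1\<^sub>m 2) * (\<sigma> g * X) = \<sigma> g * X" if "g \<in> \<Gamma>" for g X
    using rep_one[OF rs, of g] that by (simp_all add: GL_simps mult.assoc[symmetric])
  have e1: "\<alpha> * (\<sigma> g * X) = m11 g \<star> (\<sigma> g * (\<alpha> * X)) + m12 g \<star> (\<sigma> g * (\<beta> * X))"
    "\<beta> * (\<sigma> g * X) = m21 g \<star> (\<sigma> g * (\<alpha> * X)) + m22 g \<star> (\<sigma> g * (\<beta> * X))" if "g \<in> \<Gamma>" for g X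
    using eqv(1,2)[OF that] by (simp_all add: mult.assoc[symmetric]) (simp_all add: distrib_left distrib_right mult.assoc)
  have e2: "\<sigma> g * (v * X) = v * X" "w * (\<sigma> g * X) = w * X" if "g \<in> \<Gamma>" for g X
    using eqv(3,4)[OF that] by (simp_all add: mult.assoc[symmetric])
  show ?thesis unfolding cm_def GG_simps
    using r
    by (auto simp: mult.assoc AX uX un oX e1 e2 eqv(3,4) AB C distrib_left distrib_right left_diff_distrib right_diff_distrib)
qed

lemma cm_point:
  assumes cm: "cm \<sigma> \<alpha> \<beta> v w (l \<star> idm n)" and s1: "\<sigma> (1\<^sub>m 2) = idm n" and ty: "has_type \<sigma> d"
  obtains \<rho> a b v1 v2 where "\<rho> \<in> reps_of_type \<Gamma> n d" "(a, b, v1, v2) \<in> jordan_space n" "fm a = \<alpha>" "fm b = \<beta>" "fm v1 = v" "fm v2 = w"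
    "moment_map (a, b, v1, v2) = l \<cdot>\<^sub>m 1\<^sub>m n"
    "\<forall>g\<in>\<Gamma>. plane_act g (a, b, v1, v2) = gl_act n (\<rho> (inv\<^bsub>GL 2\<^esub> g)) (a, b, v1, v2)"
proof -
  let ?\<rho> = "\<lambda>g. mf n n (\<sigma> g)"
  have rs: "rep \<sigma>" using cm by (simp add: cm_def)
  note r = rep_reps[OF rs s1]
  have ty': "?\<rho> \<in> reps_of_type \<Gamma> n d" unfolding reps_of_type_def
    using r(1,3) character_of_type[OF rs ty] by (simp add: Irr_eq)
  have x: "(mf n n \<alpha>, mf n n \<beta>, mf n 1 v, mf 1 n w) \<in> jordan_space n" by (simp add: jordan_space_def)
  have f: "fm (mf n n \<alpha>) = \<alpha>" "fm (mf n n \<beta>) = \<beta>" "fm (mf n 1 v) = v" "fm (mf 1 n w) = w"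
    using cm by (simp_all add: fm_mf cm_def s1 GL_simps idm_Suc)
  have "cm (\<lambda>g. fm (?\<rho> g)) \<alpha> \<beta> v w (l \<star> idm n)"
    using cm reps_rep(1)[OF r(1)] r(2) r(2)[OF one_\<Gamma>] by (simp add: cm_def GL_simps)
  then show ?thesis using jordan_cm[OF r(1) x, of l] f that[OF ty' x f] by simp
qed

lemma index_cm:
  assumes d: "d \<in> index_set \<Gamma> n \<theta> l"
  obtains \<sigma> a b v1 v2 where "has_type (\<lambda>g. fm (\<sigma> g)) d" "\<sigma> \<in> reps \<Gamma> n" "(a, b, v1, v2) \<in> jordan_space n" "semistable n \<theta> (a, b, v1, v2)"
    "cm (\<lambda>g. fm (\<sigma> g)) (fm a) (fm b) (fm v1) (fm v2) (l \<star> idm n)"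
proof -
  obtain \<sigma> x where s: "\<sigma> \<in> reps_of_type \<Gamma> n d" "x \<in> semistable_fibre n \<theta> l"
    "\<forall>g\<in>\<Gamma>. plane_act g x = gl_act n (\<sigma> (inv\<^bsub>GL 2\<^esub> g)) x"
    using d by (auto simp: index_set_def)
  obtain a b v1 v2 where x: "x = (a, b, v1, v2)" by (cases x) auto
  have r: "\<sigma> \<in> reps \<Gamma> n" using s(1) by (simp add: reps_of_type_def)
  have js: "(a, b, v1, v2) \<in> jordan_space n" "moment_map (a, b, v1, v2) = l \<cdot>\<^sub>m 1\<^sub>m n" "semistable n \<theta> (a, b, v1, v2)"
    using s(2) by (auto simp: semistable_fibre_def x)
  have "has_type (\<lambda>g. fm (\<sigma> g)) d"
    by (rule type_of_character[OF reps_rep(1)[OF r]])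
      (use s(1) reps_rep(4)[OF r] in \<open>simp add: reps_of_type_def Irr_eq\<close>)
  moreover have "cm (\<lambda>g. fm (\<sigma> g)) (fm a) (fm b) (fm v1) (fm v2) (l \<star> idm n)"
    using jordan_cm[OF r js(1), of l] js(2) s(3) unfolding x by blast
  ultimately show ?thesis using that r js by blast
qed

lemma index_setI:
  assumes "d \<in> root_lattice_pos \<Gamma>" "lattice_size \<Gamma> d = int n"
    and "cm \<sigma> \<alpha> \<beta> v w (l \<star> idm n)" and "\<sigma> (1\<^sub>m 2) = idm n" and "has_type \<sigma> d"
    and ss: "\<And>a b v1 v2. (a, b, v1, v2) \<in> jordan_space n \<Longrightarrow> fm a = \<alpha> \<Longrightarrow> fm b = \<beta> \<Longrightarrow> fm v1 = v \<Longrightarrow> semistable n \<theta> (a, b, v1, v2)"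
  shows "d \<in> index_set \<Gamma> n \<theta> l"
proof -
  obtain \<rho> a b v1 v2 where p: "\<rho> \<in> reps_of_type \<Gamma> n d" "(a, b, v1, v2) \<in> jordan_space n" "fm a = \<alpha>" "fm b = \<beta>" "fm v1 = v" "fm v2 = w"
    "moment_map (a, b, v1, v2) = l \<cdot>\<^sub>m 1\<^sub>m n"
    "\<forall>g\<in>\<Gamma>. plane_act g (a, b, v1, v2) = gl_act n (\<rho> (inv\<^bsub>GL 2\<^esub> g)) (a, b, v1, v2)"
    by (rule cm_point[OF assms(3-5)])
  have "(a, b, v1, v2) \<in> semistable_fibre n \<theta> l" unfolding semistable_fibre_def using p(2,7) ss[OF p(2-5)] by blast
  then show ?thesis unfolding index_set_def using assms(1,2) p(1,8) by blast
qed

text \<open>In \<open>CM\<close> the space is the image of an arbitrary idempotent; compressing by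
  \<open>rep_split\<close> gives a full coordinate space, whose dimension the size of d identifies
  as n.\<close>

lemma CM_unit: assumes "CM d (\<lambda>\<phi>. of_nat (dg \<phi>))" "sz d = int n"
  shows "\<exists>\<sigma> \<alpha> \<beta> v w. cm \<sigma> \<alpha> \<beta> v w (idm n) \<and> \<sigma> (1\<^sub>m 2) = idm n \<and> has_type \<sigma> d"
proof -
  obtain \<sigma> \<alpha> \<beta> v w where c: "cm \<sigma> \<alpha> \<beta> v w (cen (\<lambda>\<phi>. of_nat (dg \<phi>)) \<sigma>)" "has_type \<sigma> d"
    using assms(1) unfolding CM_def by blast
  have rs: "rep \<sigma>" using c(1) by (simp add: cm_def)
  then have c': "cm \<sigma> \<alpha> \<beta> v w (\<sigma> (1\<^sub>m 2))" using c(1) cen_dg by (simp add: GL_simps)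
  obtain m A B where s: "B * A = idm m" "A * B = \<sigma> (1\<^sub>m 2)" "A * idm m = A" "idm m * B = B"
    "rep (\<lambda>g. B * \<sigma> g * A)" "B * \<sigma> (1\<^sub>m 2) * A = idm m" "\<forall>g\<in>\<Gamma>. chr (\<lambda>g. B * \<sigma> g * A) g = chr \<sigma> g"
    using rep_split[OF rs] by metis
  have t: "has_type (\<lambda>g. B * \<sigma> g * A) d"
    by (rule type_of_character[OF s(5)]) (use s(7) character_of_type[OF rs c(2)] in simp)
  have "m = n" using type_size[OF s(5) t s(6)] assms(2) by simp
  moreover have "cm (\<lambda>g. B * \<sigma> g * A) (B * \<alpha> * A) (B * \<beta> * A) (B * v) (w * A) (B * \<sigma> (1\<^sub>m 2) * A)"
    by (rule cm_transport[OF c' s(1-6)])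
  ultimately show ?thesis using s(6) t
    by (intro exI[of _ "\<lambda>g. B * \<sigma> g * A"] exI[of _ "B * \<alpha> * A"] exI[of _ "B * \<beta> * A"] exI[of _ "B * v"] exI[of _ "w * A"]) simp
qed

lemma index_sets:
  "index_set \<Gamma> n 1 0 = {d \<in> root_lattice_pos \<Gamma>. lattice_size \<Gamma> d = int n \<and> wt \<Gamma> d \<ge> 0}"
  "index_set \<Gamma> n 0 1 = {d \<in> root_lattice_pos \<Gamma>. lattice_size \<Gamma> d = int n \<and> wt \<Gamma> d \<ge> 0}"
proof -
  have ext: "d \<in> extensional IrrC" if "d \<in> root_lattice_pos \<Gamma>" for d
    using that by (auto simp: root_lattice_pos_def Irr_eq PiE_def)
  have one: "cen (\<lambda>\<phi>. of_nat (dg \<phi>)) (\<lambda>g. fm (\<sigma> g)) = idm n" if "\<sigma> \<in> reps \<Gamma> n" for \<sigma>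
    using cen_dg[OF reps_rep(1)[OF that]] reps_rep(2)[OF that] by (simp add: GL_simps)
  have wt: "wt \<Gamma> d \<ge> 0" if d: "d \<in> root_lattice_pos \<Gamma>" and c: "cm (\<lambda>g. fm (\<sigma> g)) \<alpha> \<beta> v w (idm n)"
    and t: "has_type (\<lambda>g. fm (\<sigma> g)) d" and r: "\<sigma> \<in> reps \<Gamma> n" for d \<sigma> \<alpha> \<beta> v w
    using c t one[OF r] CM_wt[OF ext[OF d]] unfolding CM_def by metis
  have i1: "d \<in> index_set \<Gamma> n 1 0 \<and> d \<in> index_set \<Gamma> n 0 1"
    if d: "d \<in> root_lattice_pos \<Gamma>" "lattice_size \<Gamma> d = int n" "wt \<Gamma> d \<ge> 0" for d
  proof -
    obtain \<sigma> \<alpha> \<beta> v w where s: "cm \<sigma> \<alpha> \<beta> v w (idm n)" "\<sigma> (1\<^sub>m 2) = idm n" "has_type \<sigma> d"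
      using CM_unit[of d n] CM_wt[OF ext[OF d(1)]] d(2,3) by (auto simp: lattice_size_eq)
    have s': "cm \<sigma> \<alpha> \<beta> v w (1 \<star> idm n)" using s(1) by simp
    have "cm \<sigma> \<alpha> \<beta> v w (\<sigma> \<one>\<^bsub>GG\<^esub>)" using s(1,2) by (simp add: GL_simps)
    \<comment> \<open>The degeneration keeps \<sigma>, hence the type d.\<close>
    then obtain \<alpha>' \<beta>' where g: "cm \<sigma> \<alpha>' \<beta>' v 0 0" "cyclic (idm n) \<alpha>' \<beta>' v"
      using graded[of \<sigma> \<alpha> \<beta> v w] s(2) by (auto simp: GL_simps)
    have g': "cm \<sigma> \<alpha>' \<beta>' v 0 (0 \<star> idm n)" using g(1) by simp
    have "d \<in> index_set \<Gamma> n 1 0"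
      by (rule index_setI[OF d(1,2) g' s(2,3)]) (use g(2) in \<open>auto intro!: cyclic_semistable\<close>)
    moreover have "d \<in> index_set \<Gamma> n 0 1"
      by (rule index_setI[OF d(1,2) s' s(2,3)]) (rule semistable_zero)
    ultimately show ?thesis by blast
  qed
  have i2: "wt \<Gamma> d \<ge> 0" if d: "d \<in> index_set \<Gamma> n 0 1" for d
  proof -
    obtain \<sigma> a b v1 v2 where p: "has_type (\<lambda>g. fm (\<sigma> g)) d" "\<sigma> \<in> reps \<Gamma> n"
      "cm (\<lambda>g. fm (\<sigma> g)) (fm a) (fm b) (fm v1) (fm v2) (1 \<star> idm n)"
      by (rule index_cm[OF d])
    have "d \<in> root_lattice_pos \<Gamma>" using d by (simp add: index_set_def)
    then show ?thesis using wt[OF _ _ p(1,2)] p(3) by simp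
  qed
  have i3: "wt \<Gamma> d \<ge> 0" if d: "d \<in> index_set \<Gamma> n 1 0" for d
  proof -
    obtain \<sigma> a b v1 v2 where p: "has_type (\<lambda>g. fm (\<sigma> g)) d" "\<sigma> \<in> reps \<Gamma> n"
      "(a, b, v1, v2) \<in> jordan_space n" "semistable n 1 (a, b, v1, v2)"
      "cm (\<lambda>g. fm (\<sigma> g)) (fm a) (fm b) (fm v1) (fm v2) (0 \<star> idm n)"
      by (rule index_cm[OF d])
    have c: "cm (\<lambda>g. fm (\<sigma> g)) (fm a) (fm b) (fm v1) (fm v2) 0" using p(5) by simp
    have o: "fm (\<sigma> \<one>\<^bsub>GG\<^esub>) = idm n" using reps_rep(2)[OF p(2)] by (simp add: GL_simps)
    \<comment> \<open>\<open>semistable_centralizer\<close> supplies the condition under which the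
      differential of the moment map is onto.\<close>
    have "\<exists>\<alpha>' \<beta>' v' w'. cm (\<lambda>g. fm (\<sigma> g)) \<alpha>' \<beta>' v' w' (idm n)"
      by (rule deform[OF c o semistable_centralizer[OF p(3,4)]])
        (use intw_one[OF reps_rep(1)[OF p(2)]] o in auto)
    moreover have "d \<in> root_lattice_pos \<Gamma>" using d by (simp add: index_set_def)
    ultimately show ?thesis using wt[OF _ _ p(1,2)] by blast
  qed
  have p: "d \<in> root_lattice_pos \<Gamma> \<and> lattice_size \<Gamma> d = int n" if "d \<in> index_set \<Gamma> n \<theta> l" for d \<theta> l
    using that by (simp add: index_set_def)
  show "index_set \<Gamma> n 1 0 = {d \<in> root_lattice_pos \<Gamma>. lattice_size \<Gamma> d = int n \<and> wt \<Gamma> d \<ge> 0}"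
    using i1 i3 p by blast
  show "index_set \<Gamma> n 0 1 = {d \<in> root_lattice_pos \<Gamma>. lattice_size \<Gamma> d = int n \<and> wt \<Gamma> d \<ge> 0}"
    using i1 i2 p by blast
qed

end

theorem theorem2:
  fixes \<Gamma> :: "complex mat set" and n :: nat
  assumes "subgroup \<Gamma> (SL 2)" and "finite \<Gamma>" and "\<Gamma> \<noteq> {1\<^sub>m 2}" and "n \<ge> 1"
  shows "index_set \<Gamma> n 1 0 = index_set \<Gamma> n 0 1 \<and>
         index_set \<Gamma> n 0 1 = {d \<in> root_lattice_pos \<Gamma>. lattice_size \<Gamma> d = int n \<and> wt \<Gamma> d \<ge> 0}"
proof -
  interpret mckay \<Gamma> by (rule mckay.intro[OF assms(1-3)])
  show ?thesis using index_sets by simp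
qed

end
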